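(* The modular curve attached to $\Gamma(2)\cap\Gamma_1(7)$ has function field \[ \mathcal A_0(\Gamma(2)\cap\Gamma_1(7))=\mathbf C(\upsilon,g_1,g_2)=\mathbf C(g_1,g_2), \] and, with $Z_1=g_1$, $Z_2=g_2$, the plane model \[ (Z_1+Z_2)(Z_1+Z_2+2)Z_1^2Z_2^2+2(Z_1+Z_2+1)(Z_1+Z_2+2)Z_1Z_2-(Z_1+Z_2)^2(Z_1+Z_2+1)^2=0. \] It has genus $4$.
   Context: For a congruence subgroup $G\subset\mathrm{SL}_2(\mathbf Z)$, $\mathcal A_0(G)$ denotes the field of modular functions for $G$ over $\mathbf C$, i.e. the function field of the associated compact modular curve. For $k=1,2,3$ put $a_k(\tau)=\sum_{n\in\mathbf Z}(-1)^{n+k+1}q^{(14n+7-2k)^2/56}$, where $q^r=e^{2\pi i r\tau}$, and $\upsilon=a_2^2a_3/a_1^3$, $\phi_1=-a_3/a_2$, $\phi_2=-a_2/a_1$. One has $\mathcal A_0(\Gamma_1(7))=\mathbf C(\upsilon)$. Put $g_1(\tau)=\phi_1(\tau)^2/\phi_1(2\tau)$ and $g_2(\tau)=\phi_1(\tau)\phi_1(\tau/2)\phi_1(2\tau)-\phi_1(2\tau)/\phi_2(\tau)$; these are two of the three roots of $T^3+T^2-\frac{\upsilon^2-1}{\upsilon}T+\frac{(\upsilon-1)^2}{\upsilon}$. *)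

theory Defs
  imports
    "HOL-Complex_Analysis.Complex_Analysis"
    "HOL-Computational_Algebra.Computational_Algebra"
    "HOL-Number_Theory.Cong"
    "HOL.Hull"
begin

section \<open>The field of meromorphic functions on the upper half-plane\<close>

definition uhp :: "complex set" where
  "uhp = {\<tau>. Im \<tau> > 0}"

lemma open_uhp: "open uhp"
  unfolding uhp_def by (rule open_halfspace_Im_gt)

lemma connected_uhp: "connected uhp"
  unfolding uhp_def by (intro convex_connected convex_halfspace_Im_gt)

lemma uhp_nonempty: "uhp \<noteq> {}"
proof -
  have "\<i> \<in> uhp" by (simp add: uhp_def)
  thus ?thesis by blast
qed

text \<open>
  Meromorphic functions are total functions in HOL, with arbitrary values at the poles. Two of
  them are therefore identified if they agree away from a discrete set.
\<close>
definition mero_eq :: "(complex \<Rightarrow> complex) \<Rightarrow> (complex \<Rightarrow> complex) \<Rightarrow> bool" where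
  "mero_eq f g \<longleftrightarrow> f meromorphic_on uhp \<and> g meromorphic_on uhp \<and> (\<forall>\<^sub>\<approx>\<tau>\<in>uhp. f \<tau> = g \<tau>)"

quotient_type mero = "complex \<Rightarrow> complex" / partial: mero_eq
proof (rule part_equivpI)
  show "\<exists>f. mero_eq f f"
    by (rule exI[of _ "\<lambda>_. 0"]) (auto simp: mero_eq_def)
  show "symp mero_eq"
    by (auto intro!: sympI simp: mero_eq_def eq_commute)
  show "transp mero_eq"
    unfolding mero_eq_def by (intro transpI conjI) (auto elim!: eventually_rev_mp)
qed

instantiation mero :: field
begin

lift_definition zero_mero :: mero is "\<lambda>_. 0"
  by (auto simp: mero_eq_def)

lift_definition one_mero :: mero is "\<lambda>_. 1"
  by (auto simp: mero_eq_def)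

lift_definition plus_mero :: "mero \<Rightarrow> mero \<Rightarrow> mero" is "\<lambda>f g \<tau>. f \<tau> + g \<tau>"
  by (auto simp: mero_eq_def intro!: meromorphic_intros elim: eventually_elim2)

lift_definition uminus_mero :: "mero \<Rightarrow> mero" is "\<lambda>f \<tau>. - f \<tau>"
  by (auto simp: mero_eq_def intro!: meromorphic_intros elim: eventually_mono)

lift_definition minus_mero :: "mero \<Rightarrow> mero \<Rightarrow> mero" is "\<lambda>f g \<tau>. f \<tau> - g \<tau>"
  by (auto simp: mero_eq_def intro!: meromorphic_intros elim: eventually_elim2)

lift_definition times_mero :: "mero \<Rightarrow> mero \<Rightarrow> mero" is "\<lambda>f g \<tau>. f \<tau> * g \<tau>"
  by (auto simp: mero_eq_def intro!: meromorphic_intros elim: eventually_elim2)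

lift_definition inverse_mero :: "mero \<Rightarrow> mero" is "\<lambda>f \<tau>. inverse (f \<tau>)"
  by (auto simp: mero_eq_def intro!: meromorphic_intros elim: eventually_mono)

lift_definition divide_mero :: "mero \<Rightarrow> mero \<Rightarrow> mero" is "\<lambda>f g \<tau>. f \<tau> / g \<tau>"
  by (auto simp: mero_eq_def intro!: meromorphic_intros elim: eventually_elim2)

instance
proof
  fix a b c :: mero
  show "a * b * c = a * (b * c)"
    by transfer (auto simp: mero_eq_def mult.assoc intro!: meromorphic_intros)
  show "a * b = b * a"
    by transfer (auto simp: mero_eq_def mult.commute intro!: meromorphic_intros)
  show "1 * a = a"
    by transfer (auto simp: mero_eq_def)
  show "a + b + c = a + (b + c)"
    by transfer (auto simp: mero_eq_def add.assoc intro!: meromorphic_intros)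
  show "a + b = b + a"
    by transfer (auto simp: mero_eq_def add.commute intro!: meromorphic_intros)
  show "0 + a = a"
    by transfer (auto simp: mero_eq_def)
  show "- a + a = 0"
    by transfer (auto simp: mero_eq_def)
  show "a - b = a + - b"
    by transfer (auto simp: mero_eq_def intro!: meromorphic_intros)
  show "(a + b) * c = a * c + b * c"
    by transfer (auto simp: mero_eq_def ring_distribs intro!: meromorphic_intros)
  show "(0 :: mero) \<noteq> 1"
    by transfer (use uhp_nonempty in \<open>auto simp: mero_eq_def trivial_limit_def [symmetric]\<close>)
  show "a \<noteq> 0 \<Longrightarrow> inverse a * a = 1"
  proof transfer
    fix f assume f: "mero_eq f f" and nz: "\<not> mero_eq f (\<lambda>_. 0)"
    have mero: "f meromorphic_on uhp"
      using f by (simp add: mero_eq_def)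
    have "(\<forall>\<^sub>\<approx>\<tau>\<in>uhp. f \<tau> = 0) \<or> (\<forall>\<^sub>\<approx>\<tau>\<in>uhp. f \<tau> \<noteq> 0)"
      by (rule meromorphic_imp_constant_or_avoid[OF mero open_uhp connected_uhp])
    with nz mero have "\<forall>\<^sub>\<approx>\<tau>\<in>uhp. f \<tau> \<noteq> 0"
      by (auto simp: mero_eq_def)
    hence "\<forall>\<^sub>\<approx>\<tau>\<in>uhp. inverse (f \<tau>) * f \<tau> = 1"
      by eventually_elim simp
    with mero show "mero_eq (\<lambda>\<tau>. inverse (f \<tau>) * f \<tau>) (\<lambda>_. 1)"
      by (auto simp: mero_eq_def intro!: meromorphic_intros)
  qed
  show "a div b = a * inverse b"
    by transfer (auto simp: mero_eq_def field_simps intro!: meromorphic_intros)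
  show "inverse (0 :: mero) = 0"
    by transfer (auto simp: mero_eq_def)
qed

end

text \<open>The class of a function; only meaningful for functions that are meromorphic on \<^const>\<open>uhp\<close>.\<close>
definition mero_of :: "(complex \<Rightarrow> complex) \<Rightarrow> mero" where
  "mero_of f = (if f meromorphic_on uhp then abs_mero f else 0)"

lift_definition mero_const :: "complex \<Rightarrow> mero" is "\<lambda>c _. c"
  by (auto simp: mero_eq_def)

lemma mero_const_add: "mero_const (a + b) = mero_const a + mero_const b"
  by transfer (auto simp: mero_eq_def)

lemma mero_const_mult: "mero_const (a * b) = mero_const a * mero_const b"
  by transfer (auto simp: mero_eq_def)

lemma mero_const_1: "mero_const 1 = 1"
  by transfer (auto simp: mero_eq_def)

definition mero_scale :: "complex \<Rightarrow> mero \<Rightarrow> mero" where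
  "mero_scale c f = mero_const c * f"

interpretation mero: vector_space mero_scale
  by unfold_locales
     (auto simp: mero_scale_def mero_const_add mero_const_mult mero_const_1 algebra_simps)


section \<open>Modular functions\<close>

definition SL2Z :: "(int^2^2) set" where
  "SL2Z = {A. det A = 1}"

definition Gamma_principal :: "int \<Rightarrow> (int^2^2) set" where
  "Gamma_principal N = {A \<in> SL2Z. [A$1$1 = 1] (mod N) \<and> [A$1$2 = 0] (mod N) \<and>
                        [A$2$1 = 0] (mod N) \<and> [A$2$2 = 1] (mod N)}"

definition Gamma1 :: "int \<Rightarrow> (int^2^2) set" where
  "Gamma1 N = {A \<in> SL2Z. [A$1$1 = 1] (mod N) \<and> [A$2$1 = 0] (mod N) \<and> [A$2$2 = 1] (mod N)}"

definition moebius :: "int^2^2 \<Rightarrow> complex \<Rightarrow> complex" where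
  "moebius A \<tau> = (of_int (A$1$1) * \<tau> + of_int (A$1$2)) / (of_int (A$2$1) * \<tau> + of_int (A$2$2))"

text \<open>
  \<open>f\<close> is meromorphic at the cusp \<open>\<infinity>\<close> if, for \<open>Im \<tau>\<close> large, it is a function of
  $q^{1/N} = e^{2 \pi i \tau / N}$ that extends meromorphically to $q^{1/N} = 0$.
\<close>
definition meromorphic_at_infinity_cusp :: "(complex \<Rightarrow> complex) \<Rightarrow> bool" where
  "meromorphic_at_infinity_cusp f \<longleftrightarrow>
     (\<exists>N::nat. N > 0 \<and> (\<exists>h. h meromorphic_on {0} \<and>
        (\<exists>y>0. \<forall>\<^sub>\<approx>\<tau>\<in>{\<tau>. Im \<tau> > y}. f \<tau> = h (exp (2 * pi * \<i> * \<tau> / of_nat N)))))"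

definition modular_function :: "(int^2^2) set \<Rightarrow> (complex \<Rightarrow> complex) \<Rightarrow> bool" where
  "modular_function G f \<longleftrightarrow>
     f meromorphic_on uhp \<and>
     (\<forall>A\<in>G. \<forall>\<^sub>\<approx>\<tau>\<in>uhp. f (moebius A \<tau>) = f \<tau>) \<and>
     (\<forall>A\<in>SL2Z. meromorphic_at_infinity_cusp (\<lambda>\<tau>. f (moebius A \<tau>)))"

definition A0 :: "(int^2^2) set \<Rightarrow> mero set" where
  "A0 G = mero_of ` {f. modular_function G f}"


section \<open>Subfields, plane models and the genus\<close>

definition C_subfield :: "mero set \<Rightarrow> bool" where
  "C_subfield F \<longleftrightarrow>
     range mero_const \<subseteq> F \<and>
     (\<forall>x\<in>F. \<forall>y\<in>F. x + y \<in> F \<and> x * y \<in> F) \<and>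
     (\<forall>x\<in>F. - x \<in> F \<and> inverse x \<in> F)"

definition C_adjoin :: "mero set \<Rightarrow> mero set" where
  "C_adjoin S = C_subfield hull S"

text \<open>Polynomials over \<open>\<complex>\<close> in two variables are elements of \<open>\<complex>[Z\<^sub>1][Z\<^sub>2]\<close>.\<close>
definition Z1 :: "complex poly poly" where
  "Z1 = [:[:0, 1:]:]"

definition Z2 :: "complex poly poly" where
  "Z2 = [:0, 1:]"

definition eval2 :: "complex poly poly \<Rightarrow> mero \<Rightarrow> mero \<Rightarrow> mero" where
  "eval2 p x y = poly (map_poly (\<lambda>r. poly (map_poly mero_const r) x) p) y"

text \<open>
  \<open>p(Z\<^sub>1, Z\<^sub>2) = 0\<close> is a plane model of the curve with function field \<open>F\<close>, the coordinate
  functions being \<open>Z\<^sub>1 = x\<close> and \<open>Z\<^sub>2 = y\<close>: the map \<open>(x, y)\<close> is birational onto the irreducible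
  plane curve \<open>p = 0\<close>.
\<close>
definition plane_model :: "mero set \<Rightarrow> mero \<Rightarrow> mero \<Rightarrow> complex poly poly \<Rightarrow> bool" where
  "plane_model F x y p \<longleftrightarrow> F = C_adjoin {x, y} \<and> irreducible p \<and> eval2 p x y = 0"

text \<open>
  The genus of a function field \<open>F\<close> in one variable over \<open>\<complex>\<close> is
  $\max_D (\deg D - \ell(D) + 1)$, where \<open>D\<close> runs over the divisors of \<open>F\<close>. A place, that is, a
  point of the smooth projective model, is represented by its valuation ring.
  Since \<open>\<complex>\<close> is algebraically closed, every place has degree one.
\<close>
definition places :: "mero set \<Rightarrow> mero set set" where
  "places F = {R. range mero_const \<subset> R \<and> R \<subset> F \<and>
                  (\<forall>x\<in>R. \<forall>y\<in>R. x + y \<in> R \<and> x - y \<in> R \<and> x * y \<in> R) \<and>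
                  (\<forall>x\<in>F. x \<in> R \<or> inverse x \<in> R)}"

definition place_units :: "mero set \<Rightarrow> mero set" where
  "place_units R = {x \<in> R. x \<noteq> 0 \<and> inverse x \<in> R}"

definition uniformizer :: "mero set \<Rightarrow> mero \<Rightarrow> bool" where
  "uniformizer R t \<longleftrightarrow> R - place_units R = (\<lambda>x. t * x) ` R"

definition place_ord :: "mero set \<Rightarrow> mero \<Rightarrow> int" where
  "place_ord R x = (THE n. \<exists>t u. uniformizer R t \<and> u \<in> place_units R \<and> x = t powi n * u)"

definition divisors :: "mero set \<Rightarrow> (mero set \<Rightarrow> int) set" where
  "divisors F = {D. finite {R. D R \<noteq> 0} \<and> {R. D R \<noteq> 0} \<subseteq> places F}"

definition div_degree :: "(mero set \<Rightarrow> int) \<Rightarrow> int" where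
  "div_degree D = (\<Sum>R | D R \<noteq> 0. D R)"

definition RR_space :: "mero set \<Rightarrow> (mero set \<Rightarrow> int) \<Rightarrow> mero set" where
  "RR_space F D = {x \<in> F. x = 0 \<or> (\<forall>R\<in>places F. place_ord R x \<ge> - D R)}"

definition RR_dim :: "mero set \<Rightarrow> (mero set \<Rightarrow> int) \<Rightarrow> nat" where
  "RR_dim F D = mero.dim (RR_space F D)"

definition has_genus :: "mero set \<Rightarrow> nat \<Rightarrow> bool" where
  "has_genus F g \<longleftrightarrow>
     (\<exists>D\<in>divisors F. div_degree D - int (RR_dim F D) + 1 = int g) \<and>
     (\<forall>D\<in>divisors F. div_degree D - int (RR_dim F D) + 1 \<le> int g)"


section \<open>The generating functions\<close>

definition theta_a :: "nat \<Rightarrow> complex \<Rightarrow> complex" where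
  "theta_a k \<tau> = (\<Sum>\<^sub>\<infinity>n::int. (-1) powi (n + int k + 1) *
                     exp (2 * pi * \<i> * (of_int ((14 * n + 7 - 2 * int k)\<^sup>2) / 56) * \<tau>))"

definition upsilon_fun :: "complex \<Rightarrow> complex" where
  "upsilon_fun \<tau> = (theta_a 2 \<tau>)\<^sup>2 * theta_a 3 \<tau> / (theta_a 1 \<tau>) ^ 3"

definition phi1 :: "complex \<Rightarrow> complex" where
  "phi1 \<tau> = - theta_a 3 \<tau> / theta_a 2 \<tau>"

definition phi2 :: "complex \<Rightarrow> complex" where
  "phi2 \<tau> = - theta_a 2 \<tau> / theta_a 1 \<tau>"

definition g1_fun :: "complex \<Rightarrow> complex" where
  "g1_fun \<tau> = (phi1 \<tau>)\<^sup>2 / phi1 (2 * \<tau>)"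

definition g2_fun :: "complex \<Rightarrow> complex" where
  "g2_fun \<tau> = phi1 \<tau> * phi1 (\<tau> / 2) * phi1 (2 * \<tau>) - phi1 (2 * \<tau>) / phi2 \<tau>"

definition upsilon :: mero where
  "upsilon = mero_of upsilon_fun"

definition g1 :: mero where
  "g1 = mero_of g1_fun"

definition g2 :: mero where
  "g2 = mero_of g2_fun"

end

theory Submission
  imports Defs
begin

text \<open>
  The theta series are products of Klein forms, whose transformation behaviour makes \<open>upsilon\<close>, \<open>g1\<close>
  and the third root \<open>g0 = -1 - g1 - g2\<close> of the cubic modular; three-term theta relations give the cubic.
  Since \<open>upsilon\<close> is holomorphic on the upper half-plane with a single simple pole at the cusps of
  \<open>Gamma1 7\<close>, it generates the modular functions for that group. A combination of \<open>g1\<close> and \<open>g0\<close>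
  separates the cosets of the smaller group, so Lagrange interpolation yields its function field, and
  eliminating \<open>upsilon\<close> from the cubic gives the plane model.

  For the genus, the Lagrange resolvent of the cubic shows that the function field is \<open>\<complex>(u, v)\<close> with
  a relation bilinear in \<open>u\<^sup>3\<close> and \<open>v\<^sup>3\<close>. Moving one of its total ramification points to infinity turns it into
  \<open>y\<^sup>3 = f(x) g(x)\<^sup>2\<close> with \<open>f g\<close> squarefree, \<open>deg f = 3\<close>, \<open>deg g = 2\<close>. With \<open>w = y\<^sup>2 / g(x)\<close>, the functions
  regular away from infinity are the \<open>\<complex>[x]\<close>-combinations of \<open>1, y, w\<close>, which have pole orders \<open>0, 7, 8\<close> there while
  \<open>x\<close> has pole order \<open>3\<close>; the gaps are \<open>1, 2, 4, 5\<close>.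
\<close>

section \<open>Theta functions\<close>

subsection \<open>Infinite q-products\<close>

text \<open>The root \<open>g0\<close> stands in for \<open>g2\<close> because \<open>g1\<close> and
  \<open>g0\<close> are single quotients of Klein forms, attached to the two-division points (0,
  1/2) and (1/2, 0), so invariance and orders at the cusps can be read off from the parameters.
  \<open>g2\<close> is a difference of two products and comes back through the product of the roots.
  The constants in the theta transformations are never evaluated: two functions of z with the same
  quasi-periods and compatible zeros are proportional, and the factor, which depends on tau alone,
  cancels in quotients with equally many theta factors above and below. The definition of the genus
  quantifies over all divisors, so a lower bound for l(D) is needed for every D. It comes from
  Riemann's argument as soon as enough functions with poles only over x = infinity are known;
  counting degrees there rests on the inequality that the ramification indices over one point sum to
  at most n. Equality is attained at D = 6 P with P the place at infinity: the pole orders up to 6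
  are 0, 3, 6, so l(D) = 3 and 6 - 3 + 1 = 4.\<close>

definition qpoch :: "complex => complex => complex" where
 "qpoch x p = (\<Prod>n. 1 - x * p ^ n)"

lemma convergent_prod_qpoch:
 fixes p :: complex
 assumes "norm p < 1"
 shows "convergent_prod (%n. 1 - x * p ^ n)"
proof -
 have "summable (%n. norm x * norm p ^ n)" using assms by (intro summable_mult summable_geometric) auto
 hence "summable (%n. norm ((1 - x * p ^ n) - 1))" by (simp add: norm_mult norm_power del: summable_cmult_iff)
 thus ?thesis by (intro abs_convergent_prod_imp_convergent_prod summable_imp_abs_convergent_prod)
qed

lemma qpoch_LIMSEQ:
 assumes "norm p < 1"
 shows "(%N. \<Prod>n<N. 1 - x * p ^ n) \<longlonglongrightarrow> qpoch x p"
proof -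
 have "(%N. PROD n<=N. 1 - x * p ^ n) \<longlonglongrightarrow> qpoch x p"
  unfolding qpoch_def by (rule convergent_prod_LIMSEQ[OF convergent_prod_qpoch[OF assms]])
 hence "(%N. \<Prod>n<Suc N. 1 - x * p ^ n) \<longlonglongrightarrow> qpoch x p" by (simp only: lessThan_Suc_atMost)
 thus ?thesis by (rule LIMSEQ_imp_Suc)
qed

lemma qpoch_rec:
 assumes "norm p < 1"
 shows "qpoch x p = (1 - x) * qpoch (x * p) p"
proof (rule LIMSEQ_unique)
 show "(%N. \<Prod>n<Suc N. 1 - x * p ^ n) \<longlonglongrightarrow> qpoch x p" using qpoch_LIMSEQ[OF assms, of x] by (rule LIMSEQ_Suc)
 have "(\<Prod>n<Suc N. 1 - x * p ^ n) = (1 - x) * (\<Prod>n<N. 1 - x * p * p ^ n)" for N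
  by (subst prod.lessThan_Suc_shift) (simp add: mult.assoc)
 thus "(%N. \<Prod>n<Suc N. 1 - x * p ^ n) \<longlonglongrightarrow> (1 - x) * qpoch (x * p) p"
  using tendsto_mult[OF tendsto_const qpoch_LIMSEQ[OF assms, of "x * p"]] by simp
qed

lemma qpoch_nonzero:
 assumes "norm p < 1" "!!n. x * p ^ n ~= 1"
 shows "qpoch x p ~= 0" unfolding qpoch_def
 by (rule prodinf_nonzero[OF convergent_prod_qpoch]) (use assms in \<open>auto simp: eq_diff_eq\<close>)

text \<open>The factors pair up as (1 - x p^n)(1 + x p^n) = 1 - x^2 p^(2n). This is what doubling
  tau and z does to a theta product.\<close>

lemma qpoch_square:
 assumes "norm p < 1"
 shows "qpoch (x\<^sup>2) (p\<^sup>2) = qpoch x p * qpoch (- x) p"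
proof (rule LIMSEQ_unique)
 have p2: "norm (p\<^sup>2) < 1" using assms by (simp add: norm_power power_less_one_iff)
 show "(%N. \<Prod>n<N. 1 - x\<^sup>2 * (p\<^sup>2) ^ n) \<longlonglongrightarrow> qpoch (x\<^sup>2) (p\<^sup>2)"
  by (rule qpoch_LIMSEQ[OF p2])
 have "(1 - x * p ^ n) * (1 - - x * p ^ n) = 1 - x\<^sup>2 * (p\<^sup>2) ^ n" for n
  by (simp add: algebra_simps power2_eq_square power_mult_distrib)
 hence "(\<Prod>n<N. 1 - x * p ^ n) * (\<Prod>n<N. 1 - - x * p ^ n) = (\<Prod>n<N. 1 - x\<^sup>2 * (p\<^sup>2) ^ n)" for N
  by (simp only: prod.distrib[symmetric])
 thus "(%N. \<Prod>n<N. 1 - x\<^sup>2 * (p\<^sup>2) ^ n) \<longlonglongrightarrow> qpoch x p * qpoch (- x) p"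
  using tendsto_mult[OF qpoch_LIMSEQ[OF assms, of x] qpoch_LIMSEQ[OF assms, of "- x"]] by simp
qed

text \<open>Even and odd exponents are separated in the partial products of even length. This is
  what relates the nomes of tau and 2 tau at a fixed z.\<close>

lemma qpoch_even_odd:
 assumes "norm p < 1"
 shows "qpoch x p = qpoch x (p\<^sup>2) * qpoch (x * p) (p\<^sup>2)"
proof (rule LIMSEQ_unique)
 have p2: "norm (p\<^sup>2) < 1" using assms by (simp add: norm_power power_less_one_iff)
 have "strict_mono (%N::nat. 2 * N)" by (auto simp: strict_mono_def)
 from LIMSEQ_subseq_LIMSEQ[OF qpoch_LIMSEQ[OF assms, of x] this]
 show "(%N. \<Prod>n<2*N. 1 - x * p ^ n) \<longlonglongrightarrow> qpoch x p" by (simp add: o_def)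
 have "(\<Prod>n<2*N. 1 - x * p ^ n) = (\<Prod>n<N. 1 - x * (p\<^sup>2) ^ n) * (\<Prod>n<N. 1 - x * p * (p\<^sup>2) ^ n)" for N
  by (induction N) (simp_all add: power_mult[symmetric] mult.assoc mult.left_commute)
 thus "(%N. \<Prod>n<2*N. 1 - x * p ^ n) \<longlonglongrightarrow> qpoch x (p\<^sup>2) * qpoch (x * p) (p\<^sup>2)"
  using tendsto_mult[OF qpoch_LIMSEQ[OF p2, of x] qpoch_LIMSEQ[OF p2, of "x * p"]] by simp
qed

text \<open>The bound tends to 0 together with x, which settles limits at the cusp, where both x and
  p depend on tau.\<close>

lemma norm_qpoch_minus_1_le:
 assumes "norm p < 1"
 shows "norm (qpoch x p - 1) <= exp (norm x / (1 - norm p)) - 1"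
proof (rule tendsto_upperbound)
 show "(%N. norm ((\<Prod>n<N. 1 - x * p ^ n) - 1)) \<longlonglongrightarrow> norm (qpoch x p - 1)"
  by (intro tendsto_intros qpoch_LIMSEQ assms)
 have "norm ((\<Prod>n<N. 1 - x * p ^ n) - 1) <= exp (norm x / (1 - norm p)) - 1" for N proof -
  have "norm ((\<Prod>n<N. 1 + (- x * p ^ n)) - 1) <= (\<Prod>n<N. 1 + norm (- x * p ^ n)) - 1" by (rule norm_prod_minus1_le_prod_minus1)
  also have "(\<Prod>n<N. 1 + norm (- x * p ^ n)) <= exp (\<Sum>n<N. norm (- x * p ^ n))" by (rule prod_le_exp_sum) auto
  also have "(\<Sum>n<N. norm (- x * p ^ n)) <= (\<Sum>n. norm x * norm p ^ n)" using assms by (simp add: norm_mult norm_power)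
    (intro sum_le_suminf summable_mult summable_geometric; simp)
  also have "... = norm x / (1 - norm p)" using assms by (subst suminf_mult) (auto simp: suminf_geometric summable_geometric divide_simps)
  finally show ?thesis by simp
 qed
 thus "\<forall>\<^sub>F N in sequentially. norm ((\<Prod>n<N. 1 - x * p ^ n) - 1) <= exp (norm x / (1 - norm p)) - 1" by simp
qed simp

lemma tendsto_qpoch_1:
 assumes "(f \<longlongrightarrow> 0) F" "(g \<longlongrightarrow> 0) F"
 shows "((%t. qpoch (f t) (g t)) \<longlongrightarrow> 1) F"
proof -
 have "((%t. qpoch (f t) (g t) - 1) \<longlongrightarrow> 0) F" proof (rule Lim_null_comparison)
  have "\<forall>\<^sub>F t in F. norm (g t) < 1" using tendstoD[OF assms(2), of 1] by simp
  thus "\<forall>\<^sub>F t in F. norm (qpoch (f t) (g t) - 1) <= exp (norm (f t) / (1 - norm (g t))) - 1"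
   by eventually_elim (rule norm_qpoch_minus_1_le)
  have "((%t. exp (norm (f t) / (1 - norm (g t))) - 1) \<longlongrightarrow> exp (norm (0::complex) / (1 - norm (0::complex))) - 1) F"
   by (intro tendsto_intros assms) auto
  thus "((%t. exp (norm (f t) / (1 - norm (g t))) - 1) \<longlongrightarrow> 0) F" by simp
 qed
 thus ?thesis by (simp add: LIM_zero_iff)
qed

text \<open>On a closed ball inside S compactness gives |f| <= M and |g| <= r < 1, so the partial
  products converge uniformly by comparison with M r^n.\<close>

lemma holomorphic_on_qpoch [holomorphic_intros]:
 assumes "open S" "f holomorphic_on S" "g holomorphic_on S" "!!t. t : S ==> norm (g t) < 1"
 shows "(%t. qpoch (f t) (g t)) holomorphic_on S"
proof (rule holomorphic_uniform_sequence[OF \<open>open S\<close>])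
 show "(%t. \<Prod>n<N. 1 - f t * g t ^ n) holomorphic_on S" for N by (intro holomorphic_intros assms)
next
 fix x assume "x : S"
 then obtain d where d: "d > 0" "cball x d <= S" using \<open>open S\<close> open_contains_cball by blast
 let ?K = "cball x d"
 have contf: "continuous_on ?K f" and contg: "continuous_on ?K g"
  by (rule continuous_on_subset[OF holomorphic_on_imp_continuous_on[OF assms(2)] d(2)],
    rule continuous_on_subset[OF holomorphic_on_imp_continuous_on[OF assms(3)] d(2)])
 have "compact (f ` ?K)" by (intro compact_continuous_image contf) auto
 from compact_imp_bounded[OF this] obtain M where "ALL y:f ` ?K. norm y <= M" by (auto simp: bounded_iff)
 hence M: "norm (f t) <= M" if "t : ?K" for t using that by blast
 have "compact ((%t. norm (g t)) ` ?K)" by (intro compact_continuous_image continuous_intros contg) auto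
 moreover have "(%t. norm (g t)) ` ?K ~= {}" using d by auto
 ultimately obtain t0 where t0: "t0 : ?K" "!!t. t : ?K ==> norm (g t) <= norm (g t0)"
  using compact_attains_sup[of "(%t. norm (g t)) ` ?K"] by auto
 define r where "r = norm (g t0)"
 have r: "0 <= r" "r < 1" using assms(4)[of t0] t0(1) d(2) by (auto simp: r_def)
 have M0: "M >= 0" using M[OF t0(1)] norm_ge_zero[of "f t0"] by linarith
 have "uniformly_convergent_on ?K (%N t. \<Sum>n<N. norm (- f t * g t ^ n))" proof (rule Weierstrass_m_test')
  fix n t assume t: "t : ?K"
  show "norm (norm (- f t * g t ^ n)) <= M * r ^ n" using M[OF t] t0(2)[OF t] M0 r
   by (auto simp: norm_mult norm_power r_def intro!: mult_mono power_mono)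
 qed (use r in \<open>intro summable_mult summable_geometric; simp\<close>)
 hence "uniformly_convergent_on ?K (%N t. \<Prod>n<N. 1 + (- f t * g t ^ n))"
  by (rule uniformly_convergent_on_prod[rotated 2]) (auto intro!: continuous_intros contf contg)
 hence "uniform_limit ?K (%N t. \<Prod>n<N. 1 - f t * g t ^ n)
     (%t. lim (%N. \<Prod>n<N. 1 - f t * g t ^ n)) sequentially" by (simp add: uniformly_convergent_uniform_limit_iff)
 also have "?this \<longleftrightarrow> uniform_limit ?K (%N t. \<Prod>n<N. 1 - f t * g t ^ n)
     (%t. qpoch (f t) (g t)) sequentially" proof (rule uniform_limit_cong')
  fix t assume "t : ?K"
  hence "norm (g t) < 1" using d assms by blast
  thus "lim (%N. \<Prod>n<N. 1 - f t * g t ^ n) = qpoch (f t) (g t)" by (intro limI qpoch_LIMSEQ)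
 qed auto
 finally show "\<exists>d>0. cball x d <= S & uniform_limit (cball x d) (%N t. \<Prod>n<N. 1 - f t * g t ^ n)
     (%t. qpoch (f t) (g t)) sequentially" using d by blast
qed

subsection \<open>A Liouville theorem for quotients of theta functions\<close>

text \<open>At a zero a of G both functions are divisible by z - a. The difference quotients
  \<open>F1\<close> and \<open>G1\<close> are holomorphic and \<open>G1\<close> does not vanish at
  a, so F / G extends there with the value given by l'Hospital's rule.\<close>

lemma holomorphic_quotient_simple_zeros:
 assumes "open S" "F holomorphic_on S" "G holomorphic_on S"
  and zero: "!!z. z : S ==> G z = 0 ==> F z = 0 & deriv G z ~= 0"
 shows "(%z. if G z = 0 then deriv F z / deriv G z else F z / G z) holomorphic_on S"
  (is "?H holomorphic_on S") unfolding holomorphic_on_open[OF \<open>open S\<close>]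
proof (intro ballI)
 fix a assume a: "a : S"
 have "EX T H1. open T & a : T & T <= S & H1 holomorphic_on T & (ALL z:T. ?H z = H1 z)" proof (cases "G a = 0")
  case False
  define T where "T = S \<inter> G -` (-{0})"
  have "open T" unfolding T_def using assms(1,3) by (intro continuous_open_preimage holomorphic_on_imp_continuous_on) auto
  moreover have "(%z. F z / G z) holomorphic_on T"
   by (rule holomorphic_on_divide) (use assms in \<open>auto simp: T_def intro: holomorphic_on_subset\<close>)
  ultimately show ?thesis using a False by (intro exI[of _ T] exI[of _ "%z. F z / G z"]) (auto simp: T_def)
 next
  case True
  define F1 where "F1 = (%z. if z = a then deriv F a else (F z - F a) / (z - a))"
  define G1 where "G1 = (%z. if z = a then deriv G a else (G z - G a) / (z - a))"
  have hol: "F1 holomorphic_on S" "G1 holomorphic_on S" unfolding F1_def G1_def by (intro pole_lemma_open assms)+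
  define T where "T = S \<inter> G1 -` (-{0})"
  have "open T" unfolding T_def using assms(1) hol by (intro continuous_open_preimage holomorphic_on_imp_continuous_on) auto
  moreover have "(%z. F1 z / G1 z) holomorphic_on T"
   by (rule holomorphic_on_divide) (use hol in \<open>auto simp: T_def intro: holomorphic_on_subset\<close>)
  moreover have "a : T" using a zero[OF a True] by (auto simp: T_def G1_def)
  moreover have "?H z = F1 z / G1 z" if "z : T" for z using that True zero[OF a True] by (auto simp: T_def F1_def G1_def)
  ultimately show ?thesis by (intro exI[of _ T] exI[of _ "%z. F1 z / G1 z"]) (auto simp: T_def)
 qed
 then obtain T H1 where T: "open T" "a : T" "T <= S" "H1 holomorphic_on T" "!!z. z : T ==> ?H z = H1 z" by blast
 have "?H holomorphic_on T" by (rule holomorphic_transform[OF T(4)]) (simp add: T(5))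
 thus "EX f'. (?H has_field_derivative f') (at a)" using T holomorphic_on_open by blast
qed

lemma lattice_reduce:
 assumes "t : uhp"
 obtains m n :: int where "EX x y. 0 <= x & x <= 1 & 0 <= y & y <= 1 \<and>
  z + of_int m + of_int n * t = complex_of_real x + complex_of_real y * t"
proof -
 have im: "Im t > 0" using assms by (simp add: uhp_def)
 define v where "v = Im z / Im t"
 define u where "u = Re z - v * Re t"
 have z: "z = complex_of_real u + complex_of_real v * t" using im by (auto simp: complex_eq_iff u_def v_def)
 have fr: "0 <= frac r & frac r <= 1" for r :: real using frac_lt_1[of r] by auto
 show ?thesis by (rule that[of "- \<lfloor>u\<rfloor>" "- \<lfloor>v\<rfloor>"], rule exI[of _ "frac u"], rule exI[of _ "frac v"])
   (use fr in \<open>auto simp: z frac_def algebra_simps\<close>)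
qed

lemma doubly_periodic_int:
 fixes H :: "complex => complex"
 assumes "!!z. H (z + 1) = H z" "!!z. H (z + t) = H z"
 shows "H (z + of_int m + of_int n * t) = H z"
proof -
 have per: "h (z + of_int k * w) = h z" if "!!z. h (z + w) = h z"
  for h :: "complex => complex" and w z k proof (induction k rule: int_induct[where k = 0])
  case (step1 i)
  thus ?case using that[of "z + of_int i * w"] by (simp add: algebra_simps)
 next
  case (step2 i)
  thus ?case using that[of "z + of_int (i - 1) * w"] by (simp add: algebra_simps)
 qed auto
 show ?thesis using per[of H t "z + of_int m" n] per[of H 1 z m] assms by simp
qed

lemma doubly_periodic_entire_const:
 assumes "t : uhp" "H holomorphic_on UNIV" "!!z. H (z + 1) = H z" "!!z. H (z + t) = H z"
 shows "EX c. ALL z. H z = c"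
proof -
 define K where "K = (%(x, y). complex_of_real x + complex_of_real y * t) ` ({0..1} \<times> {0..1})"
 have "compact K" unfolding K_def by (intro compact_continuous_image compact_Times)
   (auto intro!: continuous_intros simp: case_prod_beta)
 have "H z : H ` K" for z proof -
  obtain m n :: int and x y where "0 <= x" "x <= 1" "0 <= y" "y <= 1"
   "z + of_int m + of_int n * t = complex_of_real x + complex_of_real y * t" using lattice_reduce[OF assms(1), of z] by metis
  moreover have "H (z + of_int m + of_int n * t) = H z" by (rule doubly_periodic_int) (use assms in auto)
  ultimately show ?thesis unfolding K_def by (force simp: image_iff)
 qed
 hence "range H <= H ` K" by blast
 moreover have "compact (H ` K)" using \<open>compact K\<close> assms(2)
  by (intro compact_continuous_image) (auto intro: holomorphic_on_imp_continuous_on holomorphic_on_subset)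
 ultimately have "bounded (range H)" using compact_imp_bounded bounded_subset by blast
 thus ?thesis using Liouville_theorem[OF assms(2)] by (auto simp: constant_on_def)
qed

text \<open>F / G extends to an entire function, and equal multipliers make it doubly periodic,
  hence bounded and constant. All identities between theta functions below are instances of this
  principle.\<close>

lemma quasiperiodic_proportional:
 assumes "t : uhp" and F: "F holomorphic_on UNIV" and G: "G holomorphic_on UNIV"
  and zero: "!!z. G z = 0 ==> F z = 0 & deriv G z ~= 0"
  and 1: "!!z. F (z + 1) = e1 z * F z" "!!z. G (z + 1) = e1 z * G z" "!!z. e1 z ~= 0"
  and 2: "!!z. F (z + t) = e2 z * F z" "!!z. G (z + t) = e2 z * G z" "!!z. e2 z ~= 0"
 shows "EX c. ALL z. F z = c * G z"
proof -
 define H where "H = (%z. if G z = 0 then deriv F z / deriv G z else F z / G z)"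
 have hol: "H holomorphic_on UNIV" unfolding H_def by (rule holomorphic_quotient_simple_zeros) (use F G zero in auto)
 have FH: "F z = H z * G z" for z using zero by (auto simp: H_def)
 have per: "H (z + w) = H z" if "!!z. F (z + w) = e z * F z" "!!z. G (z + w) = e z * G z" "!!z. e z ~= 0" for z w e proof -
  have ev: "H (z + w) = H z" if "G z ~= 0" for z
   using that FH[of z] FH[of "z + w"] \<open>F (z + w) = e z * F z\<close> \<open>G (z + w) = e z * G z\<close> \<open>e z ~= 0\<close>
   by simp
  show ?thesis proof (cases "G z = 0")
   case True
   \<comment> \<open>At a zero of G the formula for \<open>H\<close> changes, so periodicity is
     carried over by continuity from a punctured neighbourhood, where G has no zero because this one
     is simple.\<close>
   have "(G has_field_derivative deriv G z) (at z)" using G by (auto intro!: holomorphic_derivI)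
   hence lim: "((%y. (G y - G z) / (y - z)) \<longlongrightarrow> deriv G z) (at z)" by (simp add: has_field_derivative_iff)
   have "\<forall>\<^sub>F y in at z. (G y - G z) / (y - z) ~= 0" using tendsto_imp_eventually_ne[OF lim] zero[OF True] by blast
   hence evG: "\<forall>\<^sub>F y in at z. H (y + w) = H y" by eventually_elim (use True ev in auto)
   have cont: "isCont H y" for y using hol by (meson UNIV_I continuous_on_eq_continuous_at holomorphic_on_imp_continuous_on open_UNIV)
   have "((%y. H (y + w)) \<longlongrightarrow> H (z + w)) (at z)" by (rule isCont_tendsto_compose[OF cont]) (intro tendsto_intros)
   hence "(H \<longlongrightarrow> H (z + w)) (at z)" by (rule Lim_transform_eventually) (use evG in eventually_elim, auto)
   moreover have "(H \<longlongrightarrow> H z) (at z)" using cont[of z] by (simp add: isCont_def)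
   ultimately show ?thesis using tendsto_unique[of "at z"] by auto
  qed (use ev in auto)
 qed
 have "EX c. ALL z. H z = c" by (rule doubly_periodic_entire_const[OF assms(1) hol]) (use per 1 2 in blast)+
 thus ?thesis using FH by metis
qed

subsection \<open>The theta function\<close>

definition ce :: "complex => complex" where
 "ce z = exp (2 * pi * \<i> * z)"

text \<open>Theta multipliers contain signs and half-integral exponents of e^(2 pi i z); as values
  of \<open>pe\<close> they combine additively, and on integers \<open>pe\<close> is the parity
  sign.\<close>

definition pe :: "complex => complex" where
 "pe z = exp (pi * \<i> * z)"

lemma pe_add: "pe (x + y) = pe x * pe y" by (simp add: pe_def exp_add algebra_simps)

lemma pe_diff: "pe (x - y) = pe x / pe y" by (simp add: pe_def exp_diff algebra_simps)

lemma pe_minus: "pe (- x) = inverse (pe x)" by (simp add: pe_def exp_minus)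

lemma pe_nz [simp]: "pe x ~= 0" by (simp add: pe_def)

lemma pe_0 [simp]: "pe 0 = 1" by (simp add: pe_def)

lemma ce_pe: "ce x = pe (2 * x)" by (simp add: ce_def pe_def algebra_simps)

lemma ce_add: "ce (x + y) = ce x * ce y" by (simp add: ce_def exp_add algebra_simps)

lemma ce_diff: "ce (x - y) = ce x / ce y" by (simp add: ce_def exp_diff algebra_simps)

lemma ce_nz [simp]: "ce x ~= 0" by (simp add: ce_def)

lemma pe_1 [simp]: "pe 1 = -1" by (simp add: pe_def)

lemma pe_of_int: "pe (of_int k) = (if even k then 1 else -1)"
proof -
 have 1: "pe (2 * of_int j) = 1" for j :: int proof -
  have "pe (2 * of_int j) = exp ((2 * of_int j * of_real pi) * \<i>)" by (simp add: pe_def algebra_simps)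
  thus ?thesis using exp_integer_2pi[of "of_int j"] by simp
 qed
 show ?thesis proof (cases "even k")
  case True
  then obtain j where "k = 2 * j" by blast
  thus ?thesis using 1[of j] by simp
 next
  case False
  then obtain j where "k = 2 * j + 1" using oddE by blast
  thus ?thesis using 1[of j] by (simp add: pe_add)
 qed
qed

lemma ce_of_int [simp]: "ce (of_int k) = 1" using pe_of_int[of "2 * k"] by (simp add: ce_pe)

lemma ce_1 [simp]: "ce 1 = 1" using ce_of_int[of 1] by (simp del: ce_of_int)

lemma ce_0 [simp]: "ce 0 = 1" by (simp add: ce_def)

lemma ce_eq_1_iff: "ce z = 1 \<longleftrightarrow> z : \<int>"
proof
 assume "ce z = 1"
 then obtain n :: int where n: "Re (2 * pi * \<i> * z) = 0" "Im (2 * pi * \<i> * z) = of_int (2 * n) * pi"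
  unfolding ce_def exp_eq_1 by blast
 hence "z = of_int n" by (simp add: complex_eq_iff)
 thus "z : \<int>" by simp
next
 assume "z : \<int>"
 thus "ce z = 1" by (auto elim!: Ints_cases)
qed

lemma norm_ce: "norm (ce z) = exp (- 2 * pi * Im z)" by (simp add: ce_def)

lemma norm_ce_less_1: "t : uhp ==> norm (ce t) < 1" by (simp add: norm_ce uhp_def)

lemma ce_power: "ce z ^ n = ce (of_nat n * z)" by (simp add: ce_def exp_of_nat_mult[symmetric] algebra_simps)

text \<open>Jacobi's odd theta function, up to a factor that depends on t alone.\<close>

definition thet :: "complex => complex => complex" where
 "thet z t = pe (- z) * qpoch (ce z) (ce t) * qpoch (ce (t - z)) (ce t)"

lemma ce_holomorphic [holomorphic_intros]:
 "f holomorphic_on S ==> (%t. ce (f t)) holomorphic_on S" unfolding ce_def by (intro holomorphic_intros)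

lemma pe_holomorphic [holomorphic_intros]:
 "f holomorphic_on S ==> (%t. pe (f t)) holomorphic_on S" unfolding pe_def by (intro holomorphic_intros)

lemma thet_holomorphic:
 assumes "open S" "f holomorphic_on S" "g holomorphic_on S" "!!t. t : S ==> g t : uhp"
 shows "(%t. thet (f t) (g t)) holomorphic_on S" unfolding thet_def by (intro holomorphic_intros assms norm_ce_less_1)

lemma thet_rewrite:
 assumes "t : uhp"
 shows "thet z t = (1 - ce z) * (pe (- z) * qpoch (ce (z + t)) (ce t) * qpoch (ce (t - z)) (ce t))"
 by (simp add: thet_def qpoch_rec[OF norm_ce_less_1[OF assms], of "ce z"] ce_add)

lemma thet_add_1: "thet (z + 1) t = - thet z t" by (simp add: thet_def ce_add ce_diff pe_diff pe_minus)

lemma thet_add_tau: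
 assumes "t : uhp"
 shows "thet (z + t) t = - pe (- t - 2 * z) * thet z t"
proof -
 have q: "qpoch (ce (- z)) (ce t) = (1 - ce (- z)) * qpoch (ce (t - z)) (ce t)"
  using qpoch_rec[OF norm_ce_less_1[OF assms], of "ce (- z)"] ce_add[of "- z" t] by simp
 have "- (z + t) = - z - t" "t - (z + t) = - z" by simp_all
 hence "thet (z + t) t = pe (- z - t) * qpoch (ce (z + t)) (ce t) * qpoch (ce (- z)) (ce t)" unfolding thet_def by simp
 also have "... = pe (- z - t) * (1 - ce (- z)) * qpoch (ce (z + t)) (ce t) * qpoch (ce (t - z)) (ce t)"
  unfolding q by (simp add: algebra_simps)
 also have "pe (- z - t) * (1 - ce (- z)) = - pe (- t - 2 * z) * ((1 - ce z) * pe (- z))"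
  by (simp add: ce_pe pe_diff pe_minus divide_simps pe_add[symmetric])
 finally show ?thesis unfolding thet_rewrite[OF assms] by (simp add: algebra_simps)
qed

lemma thet_minus:
 assumes "t : uhp"
 shows "thet (- z) t = - thet z t"
proof -
 have q: "qpoch (ce (- z)) (ce t) = (1 - ce (- z)) * qpoch (ce (t - z)) (ce t)"
  using qpoch_rec[OF norm_ce_less_1[OF assms], of "ce (- z)"] ce_add[of "- z" t] by simp
 have "thet (- z) t = pe z * qpoch (ce (- z)) (ce t) * qpoch (ce (z + t)) (ce t)" by (simp add: thet_def algebra_simps)
 also have "... = (pe z * (1 - ce (- z))) * qpoch (ce (z + t)) (ce t) * qpoch (ce (t - z)) (ce t)" unfolding q by (simp add: algebra_simps)
 also have "pe z * (1 - ce (- z)) = - ((1 - ce z) * pe (- z))" by (simp add: ce_pe pe_minus divide_simps pe_add[symmetric])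
 finally show ?thesis unfolding thet_rewrite[OF assms] by (simp add: algebra_simps)
qed

lemma thet_lattice:
 assumes "t : uhp"
 shows "thet (z + of_int m + of_int n * t) t =
     pe (of_int m + of_int n - of_int n ^ 2 * t - 2 * of_int n * z) * thet z t"
proof -
 have 1: "thet (z + of_int m) t = pe (of_int m) * thet z t" for z m proof (induction m rule: int_induct[where k = 0])
  case (step1 i)
  thus ?case using thet_add_1[of "z + of_int i" t] by (simp add: pe_add algebra_simps)
 next
  case (step2 i)
  thus ?case using thet_add_1[of "z + of_int (i - 1)" t] by (simp add: pe_diff algebra_simps)
 qed auto
 have 2: "thet (z + of_int n * t) t = pe (of_int n - of_int n ^ 2 * t - 2 * of_int n * z) * thet z t" for z n
 proof (induction n rule: int_induct[where k = 0])
  case (step1 i)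
  have "thet (z + of_int (i + 1) * t) t = thet ((z + of_int i * t) + t) t" by (simp add: algebra_simps)
  also have "... = pe 1 * pe (- t - 2 * (z + of_int i * t)) * thet (z + of_int i * t) t" by (subst thet_add_tau[OF assms]) simp
  also have "... = (pe 1 * pe (- t - 2 * (z + of_int i * t)) *
           pe (of_int i - of_int i ^ 2 * t - 2 * of_int i * z)) * thet z t" unfolding step1.IH by (simp add: algebra_simps)
  also have "... = pe (of_int (i + 1) - of_int (i + 1) ^ 2 * t - 2 * of_int (i + 1) * z) * thet z t"
   unfolding pe_add[symmetric] by (simp add: algebra_simps power2_eq_square)
  finally show ?case .
 next
  case (step2 i)
  define y where "y = z + of_int (i - 1) * t"
  have "pe 1 * pe (- t - 2 * y) * thet y t = thet (y + t) t" by (subst thet_add_tau[OF assms]) simp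
  also have "... = pe (of_int i - of_int i ^ 2 * t - 2 * of_int i * z) * thet z t" using step2.IH by (simp add: y_def algebra_simps)
  finally have "thet y t = (inverse (pe 1) * inverse (pe (- t - 2 * y)) * 
          pe (of_int i - of_int i ^ 2 * t - 2 * of_int i * z)) * thet z t"
   by (simp add: divide_simps mult.commute) (metis minus_minus)
  also have "... = pe (of_int (i - 1) - of_int (i - 1) ^ 2 * t - 2 * of_int (i - 1) * z) * thet z t"
   unfolding pe_minus[symmetric] pe_add[symmetric] by (simp add: y_def algebra_simps power2_eq_square)
  finally show ?case by (simp add: y_def)
 qed auto
 have "pe (of_int n - of_int n ^ 2 * t - 2 * of_int n * (z + of_int m)) =
    pe (of_int n - of_int n ^ 2 * t - 2 * of_int n * z)" using pe_of_int[of "2 * n * m"] by (simp add: algebra_simps pe_diff pe_add)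
 thus ?thesis using 1[of z m] 2[of "z + of_int m" n] by (simp add: pe_add pe_diff)
qed

definition lat :: "complex => complex set" where
 "lat t = {of_int m + of_int n * t |m n. True}"

text \<open>A convergent product vanishes only if a factor does. The first product supplies the
  lattice points with nonpositive coefficient of t, the second those with positive
  coefficient.\<close>

lemma thet_eq_0_iff:
 assumes "t : uhp"
 shows "thet z t = 0 \<longleftrightarrow> z : lat t"
proof
 assume "thet z t = 0"
 hence "qpoch (ce z) (ce t) = 0 | qpoch (ce (t - z)) (ce t) = 0" by (simp add: thet_def)
 then obtain n :: nat where "ce z * ce t ^ n = 1 | ce (t - z) * ce t ^ n = 1" using qpoch_nonzero[OF norm_ce_less_1[OF assms]] by blast
 hence "z + of_nat n * t : \<int> | t - z + of_nat n * t : \<int>" by (simp add: ce_power ce_add[symmetric] ce_eq_1_iff)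
 thus "z : lat t" proof
  assume "z + of_nat n * t : \<int>"
  then obtain m where "z + of_nat n * t = of_int m" by (auto elim: Ints_cases)
  hence "z = of_int m + of_int (- int n) * t" by (simp add: algebra_simps)
  thus ?thesis unfolding lat_def by blast
 next
  assume "t - z + of_nat n * t : \<int>"
  then obtain m where "t - z + of_nat n * t = of_int m" by (auto elim: Ints_cases)
  hence "z = of_int (- m) + of_int (1 + int n) * t" by (simp add: algebra_simps)
  thus ?thesis unfolding lat_def by blast
 qed
next
 assume "z : lat t"
 then obtain m n where z: "z = 0 + of_int m + of_int n * t" by (auto simp: lat_def)
 show "thet z t = 0" unfolding z thet_lattice[OF assms] by (simp add: thet_rewrite[OF assms])
qed

text \<open>The factor 1 - \<open>ce z\<close> carries the zero at 0; the remaining product does not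
  vanish there because |\<open>ce t\<close>| < 1.\<close>

lemma thet_deriv_0:
 assumes "t : uhp"
 shows "deriv (%z. thet z t) 0 ~= 0"
proof -
 define R where "R = (%z. pe (- z) * qpoch (ce (z + t)) (ce t) * qpoch (ce (t - z)) (ce t))"
 have "R holomorphic_on UNIV" unfolding R_def by (intro holomorphic_intros norm_ce_less_1 assms) auto
 hence R: "(R has_field_derivative deriv R 0) (at 0)" by (intro holomorphic_derivI[of _ UNIV]) auto
 have "((%z. (1 - ce z) * R z) has_field_derivative - (2 * pi * \<i>) * R 0) (at 0)"
  unfolding ce_def by (auto intro!: derivative_eq_intros R)
 hence "deriv (%z. thet z t) 0 = - (2 * pi * \<i>) * R 0" unfolding thet_rewrite[OF assms] R_def by (rule DERIV_imp_deriv)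
 moreover have "ce t * ce t ^ n ~= 1" for n proof -
  have "norm (ce t * ce t ^ n) = norm (ce t) ^ Suc n" by (simp add: norm_mult norm_power)
  also have "... < 1" using norm_ce_less_1[OF assms] by (intro power_Suc_less_one) auto
  finally show ?thesis by auto
 qed
 hence "R 0 ~= 0" unfolding R_def using qpoch_nonzero[OF norm_ce_less_1[OF assms], of "ce t"] by simp
 ultimately show ?thesis by simp
qed

lemma thet_deriv_lat:
 assumes "t : uhp" "z : lat t"
 shows "deriv (%z. thet z t) z ~= 0"
proof -
 obtain m n where z: "z = of_int m + of_int n * t" using assms(2) by (auto simp: lat_def)
 define E where "E = (%y. pe (of_int m + of_int n - of_int n ^ 2 * t - 2 * of_int n * (y - z)))"
 have "(%y. thet y t) holomorphic_on UNIV" "E holomorphic_on UNIV"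
  unfolding E_def by (intro thet_holomorphic holomorphic_intros assms; auto simp: assms)+
 hence D: "((%y. thet y t) has_field_derivative deriv (%y. thet y t) 0) (at 0)"
  and DE: "(E has_field_derivative deriv E z) (at z)" by (auto intro!: holomorphic_derivI[of _ UNIV])
 have "((%y. E y * thet (y - z) t) has_field_derivative E z * deriv (%y. thet y t) 0) (at z)" using D thet_eq_0_iff[OF assms(1), of 0]
  by (auto intro!: derivative_eq_intros DE DERIV_chain2[of "%y. thet y t"] simp: lat_def)
   (metis add.right_neutral mult_zero_left of_int_0)
 moreover have "E y * thet (y - z) t = thet y t" for y using thet_lattice[OF assms(1), of "y - z" m n] by (simp add: E_def z)
 ultimately have "deriv (%y. thet y t) z = E z * deriv (%y. thet y t) 0" by (simp add: DERIV_imp_deriv)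
 thus ?thesis using thet_deriv_0[OF assms(1)] by (simp add: E_def)
qed

lemma lat_real_iff:
 assumes "t : uhp"
 shows "complex_of_real u * t + complex_of_real v : lat t \<longleftrightarrow> u : \<int> & v : \<int>"
proof
 assume "complex_of_real u * t + complex_of_real v : lat t"
 then obtain m n where eq: "complex_of_real u * t + complex_of_real v = of_int m + of_int n * t" by (auto simp: lat_def)
 hence "u * Im t = of_int n * Im t" by (auto simp: complex_eq_iff)
 hence u: "u = of_int n" using assms by (simp add: uhp_def)
 hence "v = of_int m" using eq by (auto simp: complex_eq_iff)
 thus "u : \<int> & v : \<int>" using u by simp
next
 assume "u : \<int> & v : \<int>"
 then obtain n m where "u = of_int n" "v = of_int m" by (auto elim!: Ints_cases)
 thus "complex_of_real u * t + complex_of_real v : lat t"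
  unfolding lat_def mem_Collect_eq by (intro exI[of _ m] exI[of _ n]) (simp add: add.commute)
qed

lemma moebius_uhp:
 assumes "t : uhp" "a * d - b * c = (1::int)"
 shows "of_int c * t + of_int d ~= 0" "(of_int a * t + of_int b) / (of_int c * t + of_int d) : uhp"
  "Im ((of_int a * t + of_int b) / (of_int c * t + of_int d)) = Im t / norm (of_int c * t + of_int d) ^ 2"
proof -
 show nz: "of_int c * t + of_int d ~= 0" proof
  assume eq: "of_int c * t + of_int d = 0"
  hence "of_int c * Im t = 0" by (simp add: complex_eq_iff)
  hence "c = 0" using assms(1) by (simp add: uhp_def)
  with eq have "d = 0" by simp
  with \<open>c = 0\<close> assms(2) show False by simp
 qed
 have "Im ((of_int a * t + of_int b) / (of_int c * t + of_int d)) =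
    (of_int (a * d - b * c) * Im t) / norm (of_int c * t + of_int d) ^ 2" by (simp add: Im_divide cmod_power2 algebra_simps)
 thus eq: "Im ((of_int a * t + of_int b) / (of_int c * t + of_int d)) = Im t / norm (of_int c * t + of_int d) ^ 2" using assms(2) by simp
 show "(of_int a * t + of_int b) / (of_int c * t + of_int d) : uhp" using nz assms(1) unfolding uhp_def mem_Collect_eq eq by simp
qed

text \<open>As functions of z both sides have the same multipliers for the periods 1 and s, and the
  left side vanishes on the lattice of s, where the right side has its simple zeros. This treats the
  whole of SL_2(Z) at once, without generators, and leaves C as an unspecified function of
  s.\<close>

lemma thet_transform:
 assumes s: "s : uhp" and det: "a * d - b * c = (1::int)"
 defines "j \<equiv> of_int c * s + of_int d"
 defines "ga \<equiv> (of_int a * s + of_int b) / j"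
 shows "EX C. C ~= 0 & (ALL z. pe (- (of_int c * z\<^sup>2 / j)) * thet (z / j) ga = C * thet z s)"
proof -
 have j: "j ~= 0" and ga: "ga : uhp" unfolding ga_def j_def using moebius_uhp[OF s det] by auto
 have detc: "of_int a * of_int d - of_int b * of_int c = (1::complex)" using arg_cong[OF det, of "of_int :: int => complex"] by simp
 have 1: "1 / j = of_int a + of_int (- c) * ga" using j detc unfolding ga_def by (simp add: field_simps j_def)
 have t: "s / j = of_int (- b) + of_int d * ga" using j detc unfolding ga_def by (simp add: divide_simps j_def) algebra
 define F where "F = (%z. pe (- (of_int c * z\<^sup>2 / j)) * thet (z / j) ga)"
 have "EX C. ALL z. F z = C * thet z s"
 proof (rule quasiperiodic_proportional[OF s, where ?e1.0 = "%_. -1" and ?e2.0 = "%z. - pe (- s - 2 * z)"])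
  show "F holomorphic_on UNIV" unfolding F_def by (intro holomorphic_intros thet_holomorphic) (auto simp: j ga)
  show "(%z. thet z s) holomorphic_on UNIV" by (intro holomorphic_intros thet_holomorphic) (auto simp: s)
  show "F z = 0 & deriv (%z. thet z s) z ~= 0" if "thet z s = 0" for z proof
   have z: "z : lat s" using that thet_eq_0_iff[OF s] by blast
   thus "deriv (%z. thet z s) z ~= 0" by (rule thet_deriv_lat[OF s])
   obtain m n where mn: "z = of_int m + of_int n * s" using z by (auto simp: lat_def)
   have "z / j = of_int m * (1 / j) + of_int n * (s / j)" unfolding mn by (simp add: add_divide_distrib)
   also have "... = of_int (m * a - n * b) + of_int (- m * c + n * d) * ga" unfolding 1 t by (simp add: algebra_simps)
   finally have "z / j : lat ga" unfolding lat_def by blast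
   thus "F z = 0" using thet_eq_0_iff[OF ga] by (simp add: F_def)
  qed
  show "F (z + 1) = -1 * F z" for z proof -
   have eq: "of_int c ^ 2 * ga + of_int c * (1 / j) = of_int (a * c)" unfolding 1 by (simp add: algebra_simps power2_eq_square)
   \<comment> \<open>The integer a - c - a c is even only if a and c are both even, which the
     determinant excludes. The same parity argument for b and d serves the other period.\<close>
   have "pe (of_int (a - c - a * c)) = -1" unfolding pe_of_int proof (rule if_not_P, rule notI)
    assume "even (a - c - a * c)"
    hence "even a & even c" by auto
    hence "even (a * d - b * c)" by auto
    thus False using det by auto
   qed
   have "F (z + 1) = pe (- (of_int c * (z + 1)\<^sup>2 / j)) * thet (z / j + of_int a + of_int (- c) * ga) ga"
    unfolding F_def add_divide_distrib[of z 1] 1 by (simp only: add.assoc)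
   also have "... = (pe (- (of_int c * (z + 1)\<^sup>2 / j)) *
      pe (of_int a + of_int (- c) - of_int (- c) ^ 2 * ga - 2 * of_int (- c) * (z / j))) * thet (z / j) ga"
    by (subst thet_lattice[OF ga]) simp
   also have "pe (- (of_int c * (z + 1)\<^sup>2 / j)) * pe (of_int a + of_int (- c) - of_int (- c) ^ 2 * ga - 2 * of_int (- c) * (z / j))
    = pe (- (of_int c * z\<^sup>2 / j) + (of_int (a - c) - (of_int c ^ 2 * ga + of_int c * (1 / j))))"
    unfolding pe_add[symmetric] by (rule arg_cong[of _ _ pe])
     (simp add: power2_eq_square algebra_simps add_divide_distrib diff_divide_distrib)
   also have "... = pe (- (of_int c * z\<^sup>2 / j)) * pe (of_int (a - c - a * c))" unfolding eq pe_add[symmetric] by simp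
   finally show ?thesis using \<open>pe (of_int (a - c - a * c)) = -1\<close> by (simp add: F_def)
  qed
  show "F (z + s) = - pe (- s - 2 * z) * F z" for z proof -
   have eq: "of_int d ^ 2 * ga + of_int c * s\<^sup>2 / j = s + of_int (b * d)" proof -
    have dt: "of_int d * (of_int a * s) = s + of_int b * of_int c * s"
     using detc by (metis (no_types, opaque_lifting) diff_add_cancel distrib_right mult.assoc mult.commute mult_1)
    have "(of_int d ^ 2 * ga + of_int c * s\<^sup>2 / j) * j = of_int d * (of_int d * (of_int a * s)) + of_int d ^ 2 * of_int b + of_int c * s\<^sup>2"
     unfolding ga_def using j by (simp add: field_simps power2_eq_square)
    also have "... = (s + of_int (b * d)) * j" unfolding dt j_def by (simp add: algebra_simps power2_eq_square)
    finally show ?thesis using j by simp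
   qed
   have jj: "(of_int d + of_int c * s) / j = 1" using j by (simp add: j_def add.commute)
   have "pe (of_int (d - b - b * d)) = -1" unfolding pe_of_int proof (rule if_not_P, rule notI)
    assume "even (d - b - b * d)"
    hence "even b & even d" by auto
    hence "even (a * d - b * c)" by auto
    thus False using det by auto
   qed
   have "F (z + s) = pe (- (of_int c * (z + s)\<^sup>2 / j)) * thet (z / j + of_int (- b) + of_int d * ga) ga"
    unfolding F_def add_divide_distrib[of z s] t by (simp only: add.assoc)
   also have "... = (pe (- (of_int c * (z + s)\<^sup>2 / j)) *
      pe (of_int (- b) + of_int d - of_int d ^ 2 * ga - 2 * of_int d * (z / j))) * thet (z / j) ga"
    by (subst thet_lattice[OF ga]) simp
   also have "pe (- (of_int c * (z + s)\<^sup>2 / j)) * pe (of_int (- b) + of_int d - of_int d ^ 2 * ga - 2 * of_int d * (z / j))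
    = pe (- (of_int c * z\<^sup>2 / j) + (of_int (d - b) - (of_int d ^ 2 * ga + of_int c * s\<^sup>2 / j) - 2 * z * ((of_int d + of_int c * s) / j)))"
    unfolding pe_add[symmetric] by (rule arg_cong[of _ _ pe])
     (simp add: power2_eq_square algebra_simps add_divide_distrib diff_divide_distrib)
   also have "... = pe (- (of_int c * z\<^sup>2 / j) + (of_int (d - b - b * d) + (- s - 2 * z)))"
    unfolding eq jj by (simp add: algebra_simps)
   also have "... = pe (- (of_int c * z\<^sup>2 / j)) * (pe (of_int (d - b - b * d)) * pe (- s - 2 * z))" by (simp only: pe_add)
   finally show ?thesis using \<open>pe (of_int (d - b - b * d)) = -1\<close> by (simp add: F_def)
  qed
 qed (auto simp: thet_add_1 thet_add_tau[OF s])
 then obtain C where C: "!!z. F z = C * thet z s" by blast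
 \<comment> \<open>At z = j / 2 the left side is a nonzero factor times the theta value at 1/2,
   which is not a lattice point.\<close>
 have "C ~= 0" proof
  assume "C = 0"
  hence "F (j / 2) = 0" using C by simp
  hence "thet (1 / 2) ga = 0" using j by (simp add: F_def)
  hence "of_real 0 * ga + of_real (1/2) : lat ga" using thet_eq_0_iff[OF ga] by simp
  hence "(1/2 :: real) : \<int>" using lat_real_iff[OF ga] by blast
  then obtain k :: int where "(1/2 :: real) = of_int k" by (auto elim: Ints_cases)
  hence "(1::real) = of_int (2 * k)" by simp
  hence "1 = 2 * k" by linarith
  thus False by presburger
 qed
 thus ?thesis using C unfolding F_def by blast
qed

text \<open>Weierstrass's identity. As functions of a, the last two terms together have the
  multipliers of theta(a + b) theta(a - b) and vanish at a = b and a = -b. The first nonvanishing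
  condition keeps these zeros apart modulo the lattice, hence simple; the other two allow a division
  at a = c.\<close>

lemma thet_three_term:
 assumes h: "h : uhp"
  and nz: "thet (2 * b) h ~= 0" "thet (b + c) h ~= 0" "thet (b - c) h ~= 0"
 shows "thet (a + b) h * thet (a - b) h * (thet (c + d) h * thet (c - d) h)
   + thet (b + c) h * thet (b - c) h * (thet (a + d) h * thet (a - d) h)
   + thet (c + a) h * thet (c - a) h * (thet (b + d) h * thet (b - d) h) = 0"
proof -
 let ?t = "%z. thet z h"
 define F where "F = (%a. ?t (b + c) * ?t (b - c) * (?t (a + d) * ?t (a - d)) + ?t (c + a) * ?t (c - a) * (?t (b + d) * ?t (b - d)))"
 define G where "G = (%a. ?t (a + b) * ?t (a - b))"
 have tm: "?t (x - y) = - ?t (y - x)" for x y using thet_minus[OF h, of "y - x"] by simp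
 have hol: "F holomorphic_on UNIV" "G holomorphic_on UNIV"
  unfolding F_def G_def by (intro holomorphic_intros thet_holomorphic; auto simp: h)+
 have e1: "?t (z + 1 + x) * ?t (z + 1 - x) = ?t (z + x) * ?t (z - x)"
     "?t (x + (z + 1)) * ?t (x - (z + 1)) = ?t (x + z) * ?t (x - z)" for z x
  using thet_add_1[of "z + x" h] thet_add_1[of "z - x" h] tm[of x z] tm[of x "z + 1"] by (simp_all add: algebra_simps)
 have e2: "?t (z + h + x) * ?t (z + h - x) = pe (- 2 * h - 4 * z) * (?t (z + x) * ?t (z - x))" for z x proof -
  have "?t (z + h + x) * ?t (z + h - x) = (pe (- h - 2 * (z + x)) * pe (- h - 2 * (z - x))) * (?t (z + x) * ?t (z - x))"
   using thet_add_tau[OF h, of "z + x"] thet_add_tau[OF h, of "z - x"] by (simp add: algebra_simps)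
  thus ?thesis unfolding pe_add[symmetric] by (simp add: algebra_simps)
 qed
 have e3: "?t (x + (z + h)) * ?t (x - (z + h)) = pe (- 2 * h - 4 * z) * (?t (x + z) * ?t (x - z))" for z x
  using e2[of z x] tm[of x z] tm[of x "z + h"] by (simp add: add_ac)
 have F1: "F (z + 1) = 1 * F z" "G (z + 1) = 1 * G z" for z unfolding F_def G_def e1 by simp_all
 have F2: "F (z + h) = pe (- 2 * h - 4 * z) * F z" "G (z + h) = pe (- 2 * h - 4 * z) * G z" for z
  unfolding F_def G_def e2 e3 by (simp_all add: algebra_simps)
 have Fb: "F b = 0" "F (- b) = 0" unfolding F_def
  using tm[of b c] tm[of b d] tm[of "-b" d] tm[of "- b" "-d"] tm[of c "-b"] by (simp_all add: algebra_simps)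
 have "EX k. ALL z. F z = k * G z" proof (rule quasiperiodic_proportional[OF h hol _ F1 _ F2])
  fix z assume "G z = 0"
  hence "z + b : lat h | z - b : lat h" unfolding G_def using thet_eq_0_iff[OF h] by simp
  then obtain ep m n where ep: "ep = b | ep = - b" and z: "z = ep + of_int m + of_int n * h"
   unfolding lat_def by (force simp: algebra_simps)
  have zz: "z - ep : lat h" unfolding z lat_def by (auto simp: algebra_simps)
  have Flat: "F (x + of_int m) = 0 \<longleftrightarrow> F x = 0" "F (x + of_int m * h) = 0 \<longleftrightarrow> F x = 0" for x m proof -
   show "F (x + of_int m) = 0 \<longleftrightarrow> F x = 0" proof (induction m rule: int_induct[where k = 0])
    case (step1 i) thus ?case using F1(1)[of "x + of_int i"] by (simp add: add_ac)
   next
    case (step2 i) thus ?case using F1(1)[of "x + of_int (i - 1)"] by (simp add: add_ac)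
   qed auto
   show "F (x + of_int m * h) = 0 \<longleftrightarrow> F x = 0" proof (induction m rule: int_induct[where k = 0])
    case (step1 i) thus ?case using F2(1)[of "x + of_int i * h"] by (simp add: algebra_simps)
   next
    case (step2 i) thus ?case using F2(1)[of "x + of_int (i - 1) * h"] by (simp add: algebra_simps)
   qed auto
  qed
  have Fz: "F z = 0" unfolding z Flat using ep Fb by auto
  have holt: "?t holomorphic_on UNIV" by (intro thet_holomorphic holomorphic_intros) (auto simp: h)
  have D: "(?t has_field_derivative deriv ?t y) (at y)" for y using holomorphic_derivI[OF holt] by auto
  have "(G has_field_derivative deriv ?t (z + b) * ?t (z - b) + ?t (z + b) * deriv ?t (z - b)) (at z)" unfolding G_def
   by (rule derivative_eq_intros DERIV_chain2[OF D] refl | simp)+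
  hence dG: "deriv G z = deriv ?t (z + b) * ?t (z - b) + ?t (z + b) * deriv ?t (z - b)" by (rule DERIV_imp_deriv)
  have l2: "2 * b ~: lat h" using nz(1) thet_eq_0_iff[OF h] by blast
  have add: "x + y : lat h" "x - y : lat h" if xy: "x : lat h" "y : lat h" for x y proof -
   obtain p q r s where "x = of_int p + of_int q * h" "y = of_int r + of_int s * h" using xy unfolding lat_def by blast
   hence "x + y = of_int (p + r) + of_int (q + s) * h" "x - y = of_int (p - r) + of_int (q - s) * h" by (simp_all add: algebra_simps)
   thus "x + y : lat h" "x - y : lat h" unfolding lat_def by blast+
  qed
  have "deriv G z ~= 0" using ep proof
   assume e: "ep = b"
   have "z - b : lat h" using zz e by simp
   moreover have "z + b ~: lat h" using add(2)[of "z + b" "z - b"] calculation l2 by (auto simp: algebra_simps)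
   ultimately have "?t (z - b) = 0" "?t (z + b) ~= 0" "deriv ?t (z - b) ~= 0"
    using thet_deriv_lat[OF h, of "z - b"] thet_eq_0_iff[OF h] by auto
   thus ?thesis unfolding dG by simp
  next
   assume e: "ep = - b"
   have "z + b : lat h" using zz e by simp
   moreover have "z - b ~: lat h" using add(2)[of "z + b" "z - b"] calculation l2 by (auto simp: algebra_simps)
   ultimately have "?t (z + b) = 0" "?t (z - b) ~= 0" "deriv ?t (z + b) ~= 0"
    using thet_deriv_lat[OF h, of "z + b"] thet_eq_0_iff[OF h] by auto
   thus ?thesis unfolding dG by simp
  qed
  with Fz show "F z = 0 & deriv G z ~= 0" by blast
 qed auto
 then obtain k where k: "!!z. F z = k * G z" by blast
 have t0: "?t 0 = 0" using thet_minus[OF h, of 0] by simp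
 \<comment> \<open>At a = c the summand with the factor theta(c - a) drops out, which determines the
   constant of proportionality.\<close>
 have "F c = - (?t (c + d) * ?t (c - d)) * G c" unfolding F_def G_def using tm[of b c] t0 by (simp add: add.commute)
 hence "k * G c = - (?t (c + d) * ?t (c - d)) * G c" using k[of c] by simp
 moreover have "G c ~= 0" using nz tm[of b c] by (simp add: G_def add.commute)
 ultimately have "k = - (?t (c + d) * ?t (c - d))" using mult_right_cancel by blast
 thus ?thesis using k[of a] unfolding F_def G_def by (simp add: algebra_simps)
qed

subsection \<open>Klein forms\<close>

text \<open>
  The factor \<open>pe (u * (u * t + v))\<close> makes the behaviour under \<open>SL\<^sub>2(\<int>)\<close> uniform in \<open>(u, v)\<close>, so that
  it cancels in quotients.
\<close>
definition kf :: "real => real => complex => complex" where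
 "kf u v t = pe (of_real u * (of_real u * t + of_real v)) * thet (of_real u * t + of_real v) t"

lemma kf_eq_0_iff: "t : uhp ==> kf u v t = 0 \<longleftrightarrow> u : \<int> & v : \<int>" by (simp add: kf_def thet_eq_0_iff lat_real_iff)

lemma kf_minus: "t : uhp ==> kf (- u) (- v) t = - kf u v t"
 using thet_minus[of t "of_real u * t + of_real v"] by (simp add: kf_def algebra_simps)

lemma kf_shift:
 assumes "t : uhp"
 shows "kf (u + of_int m) (v + of_int n) t =
     pe (of_int (m + n + m * n) + of_int n * of_real u - of_int m * of_real v) * kf u v t"
proof -
 define z where "z = of_real u * t + of_real v"
 have zz: "of_real (u + of_int m) * t + of_real (v + of_int n) = z + of_int n + of_int m * t" by (simp add: z_def algebra_simps)
 have "kf (u + of_int m) (v + of_int n) t =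
  (pe (of_real (u + of_int m) * (z + of_int n + of_int m * t)) *
    pe (of_int n + of_int m - of_int m ^ 2 * t - 2 * of_int m * z)) * thet z t"
  unfolding kf_def zz thet_lattice[OF assms] by (simp only: mult.assoc)
 also have "pe (of_real (u + of_int m) * (z + of_int n + of_int m * t)) *
    pe (of_int n + of_int m - of_int m ^ 2 * t - 2 * of_int m * z) =
   pe ((of_int (m + n + m * n) + of_int n * of_real u - of_int m * of_real v) + of_real u * z)" unfolding pe_add[symmetric]
  by (rule arg_cong[of _ _ pe]) (simp add: z_def algebra_simps power2_eq_square)
 finally show ?thesis unfolding kf_def z_def[symmetric] by (simp add: pe_add)
qed

text \<open>With (U, V) the row vector (u, v) times the matrix, the argument at the image point is z
  / j with z = U t + V. The exponential in \<open>kf\<close> turns the quadratic factor of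
  \<open>thet_transform\<close> into the one belonging to (U, V), so C is the same for all (u,
  v).\<close>

lemma kf_transform:
 assumes "t : uhp" "a * d - b * c = (1::int)"
 shows "EX C. C ~= 0 & (ALL u v. kf u v ((of_int a * t + of_int b) / (of_int c * t + of_int d)) =
     C * kf (u * of_int a + v * of_int c) (u * of_int b + v * of_int d) t)"
proof -
 define j where "j = of_int c * t + of_int d"
 define ga where "ga = (of_int a * t + of_int b) / j"
 have j: "j ~= 0" unfolding j_def using moebius_uhp[OF assms] by auto
 obtain C where C: "C ~= 0" "!!z. pe (- (of_int c * z\<^sup>2 / j)) * thet (z / j) ga = C * thet z t"
  using thet_transform[OF assms] unfolding ga_def j_def by blast
 have "kf u v ga = C * kf (u * of_int a + v * of_int c) (u * of_int b + v * of_int d) t" for u v proof -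
  define U V where "U = u * of_int a + v * of_int c" and "V = u * of_int b + v * of_int d"
  define z where "z = of_real U * t + of_real V"
  have "of_real u * (of_int a * t + of_int b) + of_real v * j = z" by (simp add: z_def U_def V_def j_def algebra_simps)
  hence zj: "of_real u * ga + of_real v = z / j" using j by (simp add: ga_def field_simps)
  have "u * (of_int a * of_int d - of_int b * of_int c) = U * of_int d - of_int c * V" by (simp add: U_def V_def algebra_simps)
  also have "of_int a * of_int d - of_int b * of_int c = (1::real)" using arg_cong[OF assms(2), of "of_int :: int => real"] by simp
  finally have u: "complex_of_real u = of_real U * of_int d - of_int c * of_real V"
   by (metis mult.right_neutral of_real_diff of_real_mult of_real_of_int_eq)
  have "complex_of_real u + of_int c * z = of_real U * j" unfolding u by (simp add: z_def j_def algebra_simps)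
  hence "of_real u * (z / j) + of_int c * z\<^sup>2 / j = of_real U * z"
   using j by (simp add: field_simps power2_eq_square) (metis distrib_left mult.assoc mult.commute)
  hence e: "pe (of_real u * (z / j)) = pe (of_real U * z) * pe (- (of_int c * z\<^sup>2 / j))"
   unfolding pe_add[symmetric] by (metis add.commute add_uminus_conv_diff eq_diff_eq)
  show ?thesis unfolding U_def[symmetric] V_def[symmetric] kf_def zj z_def[symmetric] e using C(2)[of z] by (simp add: algebra_simps)
 qed
 thus ?thesis using C(1) unfolding ga_def j_def by blast
qed

text \<open>In a product over x + y and x - y the exponentials combine to one factor for x and one
  for y. Each of the three summands therefore carries the same total factor, and the theta identity
  passes over to Klein forms.\<close>

lemma kf_three_term:
 assumes t: "t : uhp"
  and nz: "kf (2 * b) (2 * b') t ~= 0" "kf (b + c) (b' + c') t ~= 0" "kf (b - c) (b' - c') t ~= 0"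
 shows "kf (a + b) (a' + b') t * kf (a - b) (a' - b') t * (kf (c + d) (c' + d') t * kf (c - d) (c' - d') t)
   + kf (b + c) (b' + c') t * kf (b - c) (b' - c') t * (kf (a + d) (a' + d') t * kf (a - d) (a' - d') t)
   + kf (c + a) (c' + a') t * kf (c - a) (c' - a') t * (kf (b + d) (b' + d') t * kf (b - d) (b' - d') t) = 0"
proof -
 define A where "A = of_real a * t + of_real a'"
 define B where "B = of_real b * t + of_real b'"
 define C where "C = of_real c * t + of_real c'"
 define D where "D = of_real d * t + of_real d'"
 let ?e = "%x y. pe (2 * (of_real x * y))"
 have pair: "kf (x + y) (x' + y') t * kf (x - y) (x' - y') t =
  ?e x X * ?e y Y * (thet (X + Y) t * thet (X - Y) t)"
  if "X = of_real x * t + of_real x'" "Y = of_real y * t + of_real y'" for x x' y y' X Y proof -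
  have *: "of_real (x + y) * t + of_real (x' + y') = X + Y" "of_real (x - y) * t + of_real (x' - y') = X - Y"
   using that by (simp_all add: algebra_simps)
  have "kf (x + y) (x' + y') t * kf (x - y) (x' - y') t =
   (pe (of_real (x + y) * (X + Y)) * pe (of_real (x - y) * (X - Y))) * (thet (X + Y) t * thet (X - Y) t)"
   unfolding kf_def * by (simp only: mult_ac)
  also have "pe (of_real (x + y) * (X + Y)) * pe (of_real (x - y) * (X - Y)) = ?e x X * ?e y Y"
   unfolding pe_add[symmetric] by (rule arg_cong[of _ _ pe]) (simp add: algebra_simps)
  finally show ?thesis .
 qed
 have "thet (2 * B) t ~= 0" "thet (B + C) t ~= 0" "thet (B - C) t ~= 0"
  using nz by (simp_all add: kf_def A_def B_def C_def D_def algebra_simps)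
 note three = thet_three_term[OF t this, of A D]
 have "?e a A * ?e b B * (thet (A + B) t * thet (A - B) t) * (?e c C * ?e d D * (thet (C + D) t * thet (C - D) t))
  + ?e b B * ?e c C * (thet (B + C) t * thet (B - C) t) * (?e a A * ?e d D * (thet (A + D) t * thet (A - D) t))
  + ?e c C * ?e a A * (thet (C + A) t * thet (C - A) t) * (?e b B * ?e d D * (thet (B + D) t * thet (B - D) t))
  = ?e a A * ?e b B * ?e c C * ?e d D * (thet (A + B) t * thet (A - B) t * (thet (C + D) t * thet (C - D) t)
   + thet (B + C) t * thet (B - C) t * (thet (A + D) t * thet (A - D) t)
   + thet (C + A) t * thet (C - A) t * (thet (B + D) t * thet (B - D) t))" by (simp add: algebra_simps)
 also have "... = 0" unfolding three by simp
 finally show ?thesis using pair[OF A_def B_def] pair[OF C_def D_def] pair[OF B_def C_def]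
   pair[OF A_def D_def] pair[OF C_def A_def] pair[OF B_def D_def] by simp
qed

lemma kf_holomorphic [holomorphic_intros]:
 assumes "open S" "f holomorphic_on S" "!!t. t : S ==> f t : uhp"
 shows "(%t. kf u v (f t)) holomorphic_on S" unfolding kf_def by (intro holomorphic_intros thet_holomorphic assms)

definition at_cusp :: "complex filter" where
 "at_cusp = filtercomap Im at_top"

lemma eventually_at_cusp: "eventually P at_cusp \<longleftrightarrow> (EX y. ALL t. Im t > y --> P t)"
 unfolding at_cusp_def eventually_filtercomap eventually_at_top_dense by blast

lemma at_cusp_neq_bot [simp]: "at_cusp ~= bot" unfolding trivial_limit_def eventually_at_cusp by (metis complex.sel(2) gt_ex)

lemma Im_at_cusp: "filterlim Im at_top at_cusp" unfolding at_cusp_def by (rule filterlim_filtercomap)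

lemma ce_tendsto_0:
 assumes "r > 0"
 shows "((%t. ce (of_real r * t + c)) \<longlongrightarrow> 0) at_cusp"
proof -
 have "filterlim (%t. 2 * pi * (r * Im t + Im c)) at_top at_cusp" using assms by (intro filterlim_tendsto_pos_mult_at_top[OF tendsto_const]
    filterlim_at_top_add_at_top[THEN filterlim_compose, rotated] filterlim_tendsto_add_at_top[where f = "%_. Im c", unfolded add.commute[of "Im c"]] Im_at_cusp)
   auto
 hence "((%t. exp (- (2 * pi * (r * Im t + Im c)))) \<longlongrightarrow> 0) at_cusp"
  by (intro filterlim_compose[OF exp_at_bot] filterlim_compose[OF filterlim_uminus_at_bot_at_top]) 
 hence "((%t. norm (ce (of_real r * t + c))) \<longlongrightarrow> 0) at_cusp" by (simp add: norm_ce algebra_simps)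
 thus ?thesis by (rule tendsto_norm_zero_cancel)
qed

text \<open>The order in q at infinity: half the second Bernoulli polynomial of the fractional part,
  without its constant term, which would cancel in quotients with equally many factors.\<close>

definition kord :: "real => real" where
 "kord u = (frac u ^ 2 - frac u) / 2"

text \<open>For u = 0 the factor 1 - \<open>ce\<close> (z) of the product does not tend to 1 but to
  1 - e^(2 pi i v); this is nonzero because v is then not an integer. All other factors tend to
  1.\<close>

lemma kf_limit_frac:
 assumes "0 <= u" "u < 1" "~ (u : \<int> & v : \<int>)"
 shows "EX c. c ~= 0 & ((%t. kf u v t * ce (- of_real ((u ^ 2 - u) / 2) * t)) \<longlongrightarrow> c) at_cusp"
proof -
 have uhp: "\<forall>\<^sub>F t in at_cusp. t : uhp" unfolding eventually_at_cusp uhp_def by auto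
 have q: "(ce \<longlongrightarrow> 0) at_cusp" using ce_tendsto_0[of 1 0] by simp
 define k where "k = pe (of_real (u * v - v))"
 have 1: "((%t. qpoch (ce (t - (of_real u * t + of_real v))) (ce t)) \<longlongrightarrow> 1) at_cusp" proof (rule tendsto_qpoch_1[OF _ q])
  show "((%t. ce (t - (of_real u * t + of_real v))) \<longlongrightarrow> 0) at_cusp"
   using ce_tendsto_0[of "1 - u" "- of_real v"] assms by (simp add: algebra_simps)
 qed
 define l where "l = (if u = 0 then 1 - ce (of_real v) else 1)"
 have 2: "((%t. qpoch (ce (of_real u * t + of_real v)) (ce t)) \<longlongrightarrow> l) at_cusp" proof (cases "u = 0")
  case False
  thus ?thesis unfolding l_def using tendsto_qpoch_1[OF ce_tendsto_0[of u "of_real v"] q] assms(1) by simp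
 next
  case True
  have "((%t. (1 - ce (of_real v)) * qpoch (ce (1 * t + of_real v)) (ce t)) \<longlongrightarrow> (1 - ce (of_real v)) * 1) at_cusp"
   using tendsto_qpoch_1[OF ce_tendsto_0[of 1 "of_real v"] q] by (intro tendsto_mult tendsto_const) simp
  moreover have "\<forall>\<^sub>F t in at_cusp. (1 - ce (of_real v)) * qpoch (ce (1 * t + of_real v)) (ce t) =
    qpoch (ce (of_real u * t + of_real v)) (ce t)" using uhp proof eventually_elim
   case (elim t)
   show ?case using qpoch_rec[OF norm_ce_less_1[OF elim], of "ce (of_real v)"] by (simp add: True ce_add[symmetric] add.commute)
  qed
  ultimately have "((%t. qpoch (ce (of_real u * t + of_real v)) (ce t)) \<longlongrightarrow> (1 - ce (of_real v)) * 1) at_cusp"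
   by (rule Lim_transform_eventually)
  thus ?thesis using True by (simp add: l_def)
 qed
 have eq: "kf u v t * ce (- of_real ((u ^ 2 - u) / 2) * t) =
  k * qpoch (ce (of_real u * t + of_real v)) (ce t) * qpoch (ce (t - (of_real u * t + of_real v))) (ce t)" for t proof -
  have "pe (of_real u * (of_real u * t + of_real v)) * pe (- (of_real u * t + of_real v)) *
   ce (- of_real ((u ^ 2 - u) / 2) * t) = k" unfolding ce_pe pe_add[symmetric] k_def
   by (rule arg_cong[of _ _ pe]) (simp add: algebra_simps power2_eq_square diff_divide_distrib)
  thus ?thesis unfolding kf_def thet_def by (simp add: algebra_simps)
 qed
 have "((%t. kf u v t * ce (- of_real ((u ^ 2 - u) / 2) * t)) \<longlongrightarrow> k * l * 1) at_cusp"
  unfolding eq by (intro tendsto_mult tendsto_const 1 2)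
 moreover have "l ~= 0" proof -
  have "u = 0 ==> v ~: \<int>" using assms by auto
  hence "u = 0 ==> complex_of_real v ~: \<int>" by (metis Ints_cases Ints_of_int of_real_eq_iff of_real_of_int_eq)
  thus ?thesis by (auto simp: l_def ce_eq_1_iff)
 qed
 moreover have "k ~= 0" by (simp add: k_def)
 ultimately show ?thesis by (intro exI[of _ "k * l * 1"]) auto
qed

lemma kf_limit:
 assumes "~ (u : \<int> & v : \<int>)"
 shows "EX c. c ~= 0 & ((%t. kf u v t * ce (- of_real (kord u) * t)) \<longlongrightarrow> c) at_cusp"
proof -
 have "~ (frac u : \<int> & v : \<int>)" using assms by (metis frac_def Ints_add Ints_of_int diff_add_cancel)
 from kf_limit_frac[OF _ _ this] obtain c where c: "c ~= 0"
  "((%t. kf (frac u) v t * ce (- of_real (kord u) * t)) \<longlongrightarrow> c) at_cusp" by (auto simp: kord_def frac_lt_1)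
 define e where "e = pe (of_int \<lfloor>u\<rfloor> - of_int \<lfloor>u\<rfloor> * of_real v)"
 have "\<forall>\<^sub>F t in at_cusp. t : uhp" unfolding eventually_at_cusp uhp_def by auto
 hence "\<forall>\<^sub>F t in at_cusp. e * (kf (frac u) v t * ce (- of_real (kord u) * t)) = kf u v t * ce (- of_real (kord u) * t)"
 proof eventually_elim
  case (elim t)
  show ?case using kf_shift[OF elim, of "frac u" "\<lfloor>u\<rfloor>" v 0] by (simp add: frac_def e_def)
 qed
 moreover have "((%t. e * (kf (frac u) v t * ce (- of_real (kord u) * t))) \<longlongrightarrow> e * c) at_cusp"
  by (intro tendsto_mult tendsto_const c)
 ultimately have "((%t. kf u v t * ce (- of_real (kord u) * t)) \<longlongrightarrow> e * c) at_cusp"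
  by (rule Lim_transform_eventually[rotated])
 thus ?thesis using c(1) by (intro exI[of _ "e * c"]) (auto simp: e_def)
qed

subsection \<open>The theta series\<close>

text \<open>The general term of the series side of Jacobi's triple product, shifted so that
  \<open>theta_a k\<close> becomes a value of \<open>tseries (7 * t)\<close> at k t.\<close>

definition tterm :: "complex => int => complex => complex" where
 "tterm t n z = pe (of_int n + of_int (n\<^sup>2 + n) * t - 2 * of_int n * z)"

definition tseries :: "complex => complex => complex" where
 "tseries t z = (\<Sum>\<^sub>\<infinity>n. tterm t n z)"

lemma exp_neg_abs_summable: "(%n::int. exp (- \<bar>of_int n\<bar>) :: real) summable_on UNIV"
proof -
 have nat: "(%n::nat. exp (- real n)) summable_on UNIV" proof (rule norm_summable_imp_summable_on)
  have "summable (%n. exp (- 1 :: real) ^ n)" by (rule summable_geometric) simp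
  thus "summable (%n. norm (exp (- real n)))" by (simp add: exp_of_nat_mult[symmetric])
 qed
 have 1: "(%n::int. exp (- \<bar>of_int n\<bar>) :: real) summable_on (range int)"
  by (subst summable_on_reindex) (use nat in \<open>auto simp: o_def\<close>)
 have 2: "(%n::int. exp (- \<bar>of_int n\<bar>) :: real) summable_on (range (%k. - int k))"
  by (subst summable_on_reindex) (use nat in \<open>auto simp: o_def inj_def\<close>)
 have "range int \<union> range (%k. - int k) = UNIV" proof -
  have "n : range int \<union> range (%k. - int k)" for n by (cases n rule: int_cases2) auto
  thus ?thesis by blast
 qed
 thus ?thesis using summable_on_union[OF 1 2] by simp
qed

lemma tterm_summable_bound:
 assumes "s : uhp"
 obtains M where "M summable_on UNIV" "!!n z. norm z <= R ==> norm (tterm s n z) <= M n"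
proof -
 define y where "y = Im s"
 have y: "y > 0" using assms by (simp add: uhp_def y_def)
 \<comment> \<open>\<open>B\<close> collects the coefficients linear in |n|, plus 1 to leave room
   for exp (-|n|); \<open>D\<close> is the constant produced by completing the square.\<close>
 define B where "B = pi * y + 2 * pi * R + 1"
 define D where "D = B\<^sup>2 / (4 * pi * y)"
 show ?thesis proof (rule that[of "%n. exp D * exp (- \<bar>of_int n\<bar>)"])
  show "(%n. exp D * exp (- \<bar>real_of_int n\<bar>)) summable_on UNIV" by (intro summable_on_cmult_right exp_neg_abs_summable)
  fix n :: int and z :: complex assume z: "norm z <= R"
  define t where "t = \<bar>real_of_int n\<bar>"
  have t: "t >= 0" "real_of_int n ^ 2 = t ^ 2" "- real_of_int n <= t" by (auto simp: t_def)
  define c where "c = pi * y"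
  have c: "c > 0" using y by (simp add: c_def)
  have nrm: "norm (tterm s n z) = exp (2 * pi * (real_of_int n * Im z) - c * (real_of_int n ^ 2 + real_of_int n))"
   unfolding tterm_def pe_def c_def by (simp add: y_def algebra_simps)
  have "real_of_int n * Im z <= \<bar>real_of_int n\<bar> * \<bar>Im z\<bar>" by (metis abs_ge_self abs_mult)
  also have "... <= t * R" unfolding t_def using z abs_Im_le_cmod[of z] by (intro mult_left_mono) auto
  finally have 1: "2 * pi * (real_of_int n * Im z) <= 2 * pi * (t * R)" by (intro mult_left_mono) auto
  have 2: "c * (t\<^sup>2 - t) <= c * (real_of_int n ^ 2 + real_of_int n)" using t c by (intro mult_left_mono) auto
  have 3: "c * (t - B / (2 * c))\<^sup>2 = c * t\<^sup>2 - t * B + D"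
   using y unfolding D_def by (simp add: power2_eq_square field_simps c_def)
  have 4: "c * (t - B / (2 * c))\<^sup>2 >= 0" using c by simp
  have 5: "2 * pi * (t * R) - c * (t\<^sup>2 - t) = - c * t\<^sup>2 + t * B - t" unfolding B_def c_def by (simp add: algebra_simps)
  have "2 * pi * (real_of_int n * Im z) - c * (real_of_int n ^ 2 + real_of_int n) <= D - t" using 1 2 3 4 5 by linarith
  hence "norm (tterm s n z) <= exp (D - t)" unfolding nrm by simp
  thus "norm (tterm s n z) <= exp D * exp (- \<bar>real_of_int n\<bar>)" by (simp add: t_def exp_diff exp_minus divide_inverse)
 qed
qed

lemma tseries_uniform:
 assumes "t : uhp"
 shows "uniform_limit (cball 0 R) (%A z. SUM n:A. tterm t n z) (tseries t) (finite_subsets_at_top UNIV)"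
proof -
 obtain M where "M summable_on UNIV" "!!n y. norm y <= R ==> norm (tterm t n y) <= M n" using tterm_summable_bound[OF assms] by blast
 thus ?thesis unfolding tseries_def by (intro Weierstrass_m_test_general[where M = M]) auto
qed

lemma tseries_holomorphic:
 assumes "t : uhp"
 shows "tseries t holomorphic_on UNIV"
proof -
 have "tseries t holomorphic_on ball 0 R" for R proof (rule holomorphic_uniform_limit[OF _ tseries_uniform[OF assms]])
  show "\<forall>\<^sub>F A in finite_subsets_at_top UNIV. continuous_on (cball 0 R) (%z. SUM n:A. tterm t n z) \<and>
      (%z. SUM n:A. tterm t n z) holomorphic_on ball 0 R" unfolding tterm_def
   by (intro always_eventually allI conjI holomorphic_on_imp_continuous_on holomorphic_intros)
 qed auto
 hence "tseries t holomorphic_on (\<Union>R. ball 0 R)" by (intro holomorphic_on_UN_open) auto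
 also have "(\<Union>R. ball (0::complex) R) = UNIV" by (auto intro: gt_ex)
 finally show ?thesis .
qed

lemma tseries_shift:
 assumes "t : uhp"
 shows "tseries t (z + 1) = tseries t z" "tseries t (z + t) = - pe (- 2 * z) * tseries t z"
  "tseries t 0 = 0"
proof -
 have "tterm t n (z + 1) = tterm t n z" for n proof -
  have "tterm t n (z + 1) = pe (of_int n + of_int (n\<^sup>2 + n) * t - 2 * of_int n * z + of_int (- 2 * n))"
   unfolding tterm_def by (rule arg_cong[of _ _ pe]) (simp add: algebra_simps)
  thus ?thesis unfolding pe_add[of _ "of_int (- 2 * n)"] pe_of_int tterm_def by simp
 qed
 thus "tseries t (z + 1) = tseries t z" by (simp add: tseries_def)
 have "tterm t (n + 1) (z + t) = - pe (- 2 * z) * tterm t n z" for n proof -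
  have "tterm t (n + 1) (z + t) = pe (1 + (- 2 * z + (of_int n + of_int (n\<^sup>2 + n) * t - 2 * of_int n * z)))"
   unfolding tterm_def by (rule arg_cong[of _ _ pe]) (simp add: algebra_simps power2_eq_square)
  thus ?thesis unfolding pe_add tterm_def by simp
 qed
 moreover have "(\<Sum>\<^sub>\<infinity>n. tterm t (n + 1) (z + t)) = tseries t (z + t)" unfolding tseries_def
  by (rule infsum_reindex_bij_witness[of _ "%n. n - 1" "%n. n + 1"]) auto
 ultimately have "tseries t (z + t) = (\<Sum>\<^sub>\<infinity>n. - pe (- 2 * z) * tterm t n z)" by simp
 thus "tseries t (z + t) = - pe (- 2 * z) * tseries t z" by (simp only: infsum_cmult_right' tseries_def)
 have "tterm t (- 1 - n) 0 = - tterm t n 0" for n proof -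
  have "tterm t (- 1 - n) 0 = pe (of_int (- 1 - 2 * n) + (of_int n + of_int (n\<^sup>2 + n) * t))"
   unfolding tterm_def by (rule arg_cong[of _ _ pe]) (simp add: algebra_simps power2_eq_square)
  thus ?thesis unfolding pe_add[of "of_int (- 1 - 2 * n)"] pe_of_int tterm_def by simp
 qed
 moreover have "(\<Sum>\<^sub>\<infinity>n. tterm t (- 1 - n) 0) = tseries t 0" unfolding tseries_def
  by (rule infsum_reindex_bij_witness[of _ "%n. - 1 - n" "%n. - 1 - n"]) auto
 ultimately have "tseries t 0 = - tseries t 0" by (simp add: tseries_def infsum_uminus)
 thus "tseries t 0 = 0" by simp
qed

text \<open>Fourier coefficients are read off from a finite partial sum. If the series vanished,
  some partial sum containing n = 0 would be smaller than 1/2 on the unit disc; averaging it over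
  the points j / N isolates the coefficient 1 of n = 0.\<close>

lemma tseries_nonzero:
 assumes "t : uhp"
 shows "EX z. tseries t z ~= 0"
proof (rule ccontr)
 assume "~ ?thesis"
 hence zero: "tseries t = (%_. 0)" by auto
 have "\<forall>\<^sub>F A in finite_subsets_at_top UNIV. ALL z:cball 0 1. dist (SUM n:A. tterm t n z) 0 < 1 / 2"
  using uniform_limitD[OF tseries_uniform[OF assms, of 1], of "1/2"] zero by simp
 then obtain A0 where "finite A0" and A0: "ALL A. finite A & A0 <= A & A <= UNIV \<longrightarrow>
   (ALL z:cball 0 1. dist (SUM n:A. tterm t n z) 0 < 1 / 2)" unfolding eventually_finite_subsets_at_top by metis
 define A where "A = insert 0 A0"
 have A: "finite A" "0 : A" using \<open>finite A0\<close> by (auto simp: A_def)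
 \<comment> \<open>\<open>N\<close> exceeds |n| for every n in \<open>A\<close>, so n = 0 is the
   only index in \<open>A\<close> divisible by \<open>N\<close>.\<close>
 define N where "N = Suc (SUM a:A. nat \<bar>a\<bar>)"
 have small: "~ int N dvd n" if "n : A" "n ~= 0" for n proof
  assume "int N dvd n"
  hence "int N <= \<bar>n\<bar>" using that dvd_imp_le_int[of n "int N"] by simp
  moreover have "nat \<bar>n\<bar> <= (SUM a:A. nat \<bar>a\<bar>)" using A that by (intro member_le_sum) auto
  ultimately show False unfolding N_def by linarith
 qed
 have N: "N > 0" by (simp add: N_def)
 have root: "(\<Sum>j<N. pe (- 2 * of_int n * (of_nat j / of_nat N))) = 0" if "n : A" "n ~= 0" for n proof -
  define w where "w = ce (- of_int n / of_nat N)"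
  have "w ~= 1" proof
   assume "w = 1"
   then obtain m where "- of_int n / of_nat N = (of_int m :: complex)" unfolding w_def ce_eq_1_iff by (rule Ints_cases)
   hence "(of_int (- n) :: complex) = of_int (m * int N)" using N by (simp add: field_simps)
   hence "- n = m * int N" by (simp only: of_int_eq_iff)
   hence "int N dvd n" by (metis dvd_minus_iff dvd_triv_right)
   with small that show False by blast
  qed
  moreover have "w ^ N = 1" using N by (simp add: w_def ce_power) (metis ce_of_int of_int_minus)
  moreover have "pe (- 2 * of_int n * (of_nat j / of_nat N)) = w ^ j" for j
   unfolding w_def ce_power unfolding ce_pe by (rule arg_cong[of _ _ pe]) (simp add: algebra_simps)
  ultimately show ?thesis by (simp add: geometric_sum)
 qed
 have tt: "tterm t n z = tterm t n 0 * pe (- 2 * of_int n * z)" for n z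
  unfolding tterm_def pe_add[symmetric] by (rule arg_cong[of _ _ pe]) simp
 have "(\<Sum>j<N. SUM n:A. tterm t n (of_nat j / of_nat N)) =
    (SUM n:A. tterm t n 0 * (\<Sum>j<N. pe (- 2 * of_int n * (of_nat j / of_nat N))))"
  by (subst sum.swap) (simp add: tt[of _ "_ / _"] sum_distrib_left)
 also have "... = (SUM n:{0}. tterm t n 0 * (\<Sum>j<N. pe (- 2 * of_int n * (of_nat j / of_nat N))))" proof (rule sum.mono_neutral_right)
  show "ALL n:A - {0}. tterm t n 0 * (\<Sum>j<N. pe (- 2 * of_int n * (of_nat j / of_nat N))) = 0" proof
   fix n assume "n : A - {0}"
   hence "n : A" "n ~= 0" by auto
   from root[OF this] show "tterm t n 0 * (\<Sum>j<N. pe (- 2 * of_int n * (of_nat j / of_nat N))) = 0" by (simp only: mult_zero_right)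
  qed
 qed (use A in auto)
 also have "... = of_nat N" by (simp add: tterm_def)
 finally have "real N = norm (\<Sum>j<N. SUM n:A. tterm t n (of_nat j / of_nat N))" by simp
 also have "... <= (\<Sum>j<N. norm (SUM n:A. tterm t n (of_nat j / of_nat N)))" by (rule norm_sum)
 also have "... <= (\<Sum>j<N. 1 / 2)" proof (rule sum_mono)
  fix j assume "j : {..<N}"
  hence "(of_nat j / of_nat N :: complex) : cball 0 1" by (simp add: norm_divide)
  moreover have "ALL z:cball 0 1. dist (SUM n:A. tterm t n z) 0 < 1 / 2"
   using A0[rule_format, of A] A unfolding A_def by (metis subset_UNIV subset_insertI)
  ultimately show "norm (SUM n:A. tterm t n (of_nat j / of_nat N)) <= 1 / 2"
   unfolding dist_0_norm dist_norm diff_zero by (metis less_imp_le)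
 qed
 finally show False using N by simp
qed

text \<open>Jacobi's triple product without its constant: series and product have the same
  multipliers, and the series vanishes at 0 because n and -1 - n cancel.\<close>

lemma tseries_eq_thet:
 assumes "t : uhp"
 shows "EX C. C ~= 0 & (ALL z. tseries t z = C * (pe z * thet z t))"
proof -
 have "EX C. ALL z. tseries t z = C * (pe z * thet z t)"
 proof (rule quasiperiodic_proportional[OF assms, where ?e1.0 = "%_. 1" and ?e2.0 = "%z. - pe (- 2 * z)"])
  have hol: "(%z. thet z t) holomorphic_on UNIV" by (intro holomorphic_intros thet_holomorphic) (auto simp: assms)
  thus "(%z. pe z * thet z t) holomorphic_on UNIV" by (intro holomorphic_intros)
  have tau: "pe (z + t) * thet (z + t) t = - pe (- 2 * z) * (pe z * thet z t)" for z
   unfolding thet_add_tau[OF assms] by (simp add: pe_add pe_diff pe_minus field_simps)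
  thus "pe (z + t) * thet (z + t) t = - pe (- 2 * z) * (pe z * thet z t)" for z .
  show "tseries t z = 0 & deriv (%z. pe z * thet z t) z ~= 0" if "pe z * thet z t = 0" for z proof
   have z: "z : lat t" using that thet_eq_0_iff[OF assms] by simp
   then obtain m n where mn: "z = 0 + of_int m + of_int n * t" unfolding lat_def by auto
   have 1: "tseries t (x + of_int m) = 0 \<longleftrightarrow> tseries t x = 0" for x m proof (induction m rule: int_induct[where k = 0])
    case (step1 i) thus ?case using tseries_shift(1)[OF assms, of "x + of_int i"] by (simp add: add_ac)
   next
    case (step2 i) thus ?case using tseries_shift(1)[OF assms, of "x + of_int (i - 1)"] by (simp add: add_ac)
   qed auto
   have 2: "tseries t (x + of_int m * t) = 0 \<longleftrightarrow> tseries t x = 0" for x m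
   proof (induction m rule: int_induct[where k = 0])
    case (step1 i) thus ?case using tseries_shift(2)[OF assms, of "x + of_int i * t"] by (simp add: algebra_simps)
   next
    case (step2 i) thus ?case using tseries_shift(2)[OF assms, of "x + of_int (i - 1) * t"] by (simp add: algebra_simps)
   qed auto
   show "tseries t z = 0" unfolding mn 1 2 by (rule tseries_shift(3)[OF assms])
   have "((%z. pe z * thet z t) has_field_derivative deriv pe z * thet z t + deriv (%z. thet z t) z * pe z) (at z)"
    by (intro DERIV_mult holomorphic_derivI[of _ UNIV] hol) (auto intro!: holomorphic_intros)
   hence "deriv (%z. pe z * thet z t) z = deriv (%z. thet z t) z * pe z" using that by (simp add: DERIV_imp_deriv)
   thus "deriv (%z. pe z * thet z t) z ~= 0" using thet_deriv_lat[OF assms z] by simp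
  qed
 qed (use tseries_shift[OF assms] tseries_holomorphic[OF assms] in \<open>auto simp: thet_add_1 pe_add\<close>)
 then obtain C where C: "!!z. tseries t z = C * (pe z * thet z t)" by blast
 moreover have "C ~= 0" using tseries_nonzero[OF assms] C by auto
 ultimately show ?thesis by blast
qed

text \<open>Completing the square in the exponent leaves a factor depending on k, which is exactly
  the exponential of the Klein form, times the factor \<open>pe (7 / 4 * t)\<close> common to all
  k.\<close>

lemma theta_a_eq_kf:
 assumes "t : uhp"
 shows "EX C. C ~= 0 & (ALL k. theta_a k t = C * ((-1) ^ (k + 1) * kf (of_nat k / 7) 0 (7 * t)))"
proof -
 have 7: "7 * t : uhp" using assms by (simp add: uhp_def)
 obtain C where C: "C ~= 0" "!!z. tseries (7 * t) z = C * (pe z * thet z (7 * t))" using tseries_eq_thet[OF 7] by blast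
 have "theta_a k t = (C * pe (7 / 4 * t)) * ((-1) ^ (k + 1) * kf (of_nat k / 7) 0 (7 * t))" for k proof -
  define E where "E = pe (of_int ((7 - 2 * int k)\<^sup>2) / 28 * t)"
  have "(-1) powi (n + int k + 1) * exp (2 * pi * \<i> * (of_int ((14 * n + 7 - 2 * int k)\<^sup>2) / 56) * t) =
     ((-1) ^ (k + 1) * E) * tterm (7 * t) n (of_nat k * t)" for n proof -
   have "(-1 :: complex) powi (n + int k + 1) = (-1) powi n * (-1) powi (int (k + 1))"
    by (simp add: power_int_add add.assoc del: of_nat_add)
   also have "(-1 :: complex) powi n = pe (of_int n)" by (simp add: pe_of_int power_int_minus_one_minus power_int_minus_left)
   also have "(-1 :: complex) powi (int (k + 1)) = (-1) ^ (k + 1)" by (rule power_int_of_nat)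
   finally have 1: "(-1 :: complex) powi (n + int k + 1) = (-1) ^ (k + 1) * pe (of_int n)" by simp
   have 2: "exp (2 * pi * \<i> * (of_int ((14 * n + 7 - 2 * int k)\<^sup>2) / 56) * t) =
    pe (of_int ((14 * n + 7 - 2 * int k)\<^sup>2) / 28 * t)" unfolding pe_def by (rule arg_cong[of _ _ exp]) (simp add: field_simps)
   have "pe (of_int n) * pe (of_int ((14 * n + 7 - 2 * int k)\<^sup>2) / 28 * t) = E * tterm (7 * t) n (of_nat k * t)"
    unfolding E_def tterm_def pe_add[symmetric] by (rule arg_cong[of _ _ pe]) (simp add: field_simps power2_eq_square)
   thus ?thesis unfolding 1 2 by (simp add: mult.assoc)
  qed
  hence "theta_a k t = ((-1) ^ (k + 1) * E) * tseries (7 * t) (of_nat k * t)"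
   unfolding theta_a_def tseries_def by (simp only: infsum_cmult_right')
  also have "... = C * (-1) ^ (k + 1) * (E * pe (of_nat k * t)) * thet (of_nat k * t) (7 * t)" unfolding C(2) by (simp add: mult_ac)
  also have "E * pe (of_nat k * t) = pe (7 / 4 * t) * pe (of_nat k / 7 * (of_nat k * t))" unfolding E_def pe_add[symmetric]
   by (rule arg_cong[of _ _ pe]) (simp add: field_simps power2_eq_square)
  finally show ?thesis unfolding kf_def by (simp add: mult_ac)
 qed
 thus ?thesis using C(1) by (intro exI[of _ "C * pe (7 / 4 * t)"]) auto
qed

section \<open>The generators in terms of Klein forms\<close>

text \<open>Normalised so that \<open>S\<close> is odd, \<open>T\<close> and \<open>U\<close> are even, and all three are 7-periodic in \<open>k\<close>.\<close>

definition Sk :: "int => complex => complex" where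
 "Sk k t = pe (of_int k) * kf (of_int k / 7) 0 (7 * t)"

definition Tk :: "int => complex => complex" where
 "Tk k t = pe (- of_int k / 14) * kf (of_int k / 7) (1 / 2) (7 * t)"

definition Uk :: "int => complex => complex" where
 "Uk k t = pe (of_int k) * kf (of_int k / 7 + 1 / 2) 0 (7 * t)"

lemma uhp_7: "t : uhp ==> 7 * t : uhp" by (simp add: uhp_def)

lemma pe_neg_of_int: "pe (- of_int k) = pe (of_int k)" using pe_of_int[of "- k"] pe_of_int[of k] by simp

lemma pe_of_int_sq [simp]: "pe (of_int k) * pe (of_int k) = 1" by (simp add: pe_of_int)

lemma Sk_minus: "t : uhp ==> Sk (- k) t = - Sk k t" using kf_minus[OF uhp_7, of t "of_int k / 7" 0] by (simp add: Sk_def pe_neg_of_int)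

lemma Sk_7: "t : uhp ==> Sk (k + 7) t = Sk k t" using kf_shift[OF uhp_7, of t "of_int k / 7" 1 0 0] pe_of_int[of 7]
 by (simp add: Sk_def pe_add add_divide_distrib)

lemma Tk_minus:
 assumes "t : uhp"
 shows "Tk (- k) t = Tk k t"
proof -
 have 1: "kf (- (of_int k / 7)) (1 / 2) (7 * t) = - kf (of_int k / 7) (- 1 / 2) (7 * t)"
  using kf_minus[OF uhp_7[OF assms], of "of_int k / 7" "- 1 / 2"] by simp
 have 2: "kf (of_int k / 7) (1 / 2) (7 * t) = pe (1 + of_int k / 7) * kf (of_int k / 7) (- 1 / 2) (7 * t)"
  using kf_shift[OF uhp_7[OF assms], of "of_int k / 7" 0 "- 1 / 2" 1] by simp
 have 3: "pe (of_int k / 14) = pe (- of_int k / 14) * pe (of_int k / 7)" unfolding pe_add[symmetric] by (simp add: field_simps)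
 show ?thesis unfolding Tk_def using 1 2 3 by (simp add: pe_add)
qed

lemma Tk_7:
 assumes "t : uhp"
 shows "Tk (k + 7) t = Tk k t"
proof -
 have "kf (of_int (k + 7) / 7) (1 / 2) (7 * t) = pe (1 - 1 / 2) * kf (of_int k / 7) (1 / 2) (7 * t)"
  using kf_shift[OF uhp_7[OF assms], of "of_int k / 7" 1 "1 / 2" 0] by (simp add: add_divide_distrib)
 moreover have "pe (- of_int (k + 7) / 14) * pe (1 - 1 / 2) = pe (- of_int k / 14)"
  unfolding pe_add[symmetric] by (rule arg_cong[of _ _ pe]) (simp add: field_simps)
 ultimately show ?thesis unfolding Tk_def by (simp add: mult.assoc[symmetric])
qed

lemma Uk_minus:
 assumes "t : uhp"
 shows "Uk (- k) t = Uk k t"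
proof -
 have 1: "kf (- (of_int k / 7) + 1 / 2) 0 (7 * t) = - kf (of_int k / 7 - 1 / 2) 0 (7 * t)"
  using kf_minus[OF uhp_7[OF assms], of "of_int k / 7 - 1 / 2" 0] by simp
 have 2: "kf (of_int k / 7 + 1 / 2) 0 (7 * t) = - kf (of_int k / 7 - 1 / 2) 0 (7 * t)"
  using kf_shift[OF uhp_7[OF assms], of "of_int k / 7 - 1 / 2" 1 0 0] by (simp add: algebra_simps)
 show ?thesis unfolding Uk_def using 1 2 by (simp add: pe_neg_of_int)
qed

lemma Uk_7: "t : uhp ==> Uk (k + 7) t = Uk k t" using kf_shift[OF uhp_7, of t "of_int k / 7 + 1 / 2" 1 0 0] pe_of_int[of 7]
 by (simp add: Uk_def pe_add add_divide_distrib add.commute)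

lemma Sk_nonzero: "t : uhp ==> ~ 7 dvd k ==> Sk k t ~= 0"
proof
 assume t: "t : uhp" and k: "~ 7 dvd k" and "Sk k t = 0"
 hence "of_int k / (7 :: real) : \<int>" using kf_eq_0_iff[OF uhp_7[OF t]] by (simp add: Sk_def)
 then obtain m where "of_int k / (7 :: real) = of_int m" by (auto elim: Ints_cases)
 hence "real_of_int k = of_int (7 * m)" by simp
 hence "k = 7 * m" by linarith
 thus False using k by simp
qed

lemma half_not_Int: "(1 / 2 :: real) ~: \<int>"
proof
 assume "(1 / 2 :: real) : \<int>"
 then obtain k :: int where "(1/2 :: real) = of_int k" by (auto elim: Ints_cases)
 hence "(1::real) = of_int (2 * k)" by simp
 hence "1 = 2 * k" by linarith
 thus False by presburger
qed

lemma Tk_nonzero: "t : uhp ==> Tk k t ~= 0" using kf_eq_0_iff[OF uhp_7, of t] half_not_Int by (simp add: Tk_def)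

lemma Uk_nonzero: "t : uhp ==> Uk k t ~= 0"
proof
 assume t: "t : uhp" and "Uk k t = 0"
 hence "of_int k / (7 :: real) + 1 / 2 : \<int>" using kf_eq_0_iff[OF uhp_7[OF t]] by (simp add: Uk_def)
 then obtain m where "of_int k / (7 :: real) + 1 / 2 = of_int m" by (auto elim: Ints_cases)
 hence "real_of_int (2 * k + 7) = of_int (14 * m)" by simp
 hence "2 * k + 7 = 14 * m" by linarith
 thus False by presburger
qed

text \<open>Only a carries the shift by a two-division point, since it enters symmetrically in a + x
  and a - x. In each pair the normalising factors multiply to 1, or for \<open>Tk\<close> to a power
  depending on a alone, so they cancel from the identity.\<close>

lemma Sk_three_term:
 assumes s: "s : uhp" and "~ 7 dvd 2 * b" "~ 7 dvd b + c" "~ 7 dvd b - c"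
 shows "Sk (a + b) s * Sk (a - b) s * (Sk (c + d) s * Sk (c - d) s)
   + Sk (b + c) s * Sk (b - c) s * (Sk (a + d) s * Sk (a - d) s)
   - Sk (a + c) s * Sk (a - c) s * (Sk (b + d) s * Sk (b - d) s) = 0"
  and "Tk (a + b) s * Tk (a - b) s * (Sk (c + d) s * Sk (c - d) s)
   + Sk (b + c) s * Sk (b - c) s * (Tk (a + d) s * Tk (a - d) s)
   - Tk (a + c) s * Tk (a - c) s * (Sk (b + d) s * Sk (b - d) s) = 0"
  and "Uk (a + b) s * Uk (a - b) s * (Sk (c + d) s * Sk (c - d) s)
   + Sk (b + c) s * Sk (b - c) s * (Uk (a + d) s * Uk (a - d) s)
   - Uk (a + c) s * Uk (a - c) s * (Sk (b + d) s * Sk (b - d) s) = 0"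
proof -
 let ?K = "%x y. kf x y (7 * s)"
 have 7: "7 * s : uhp" by (rule uhp_7[OF s])
 have "Sk (2 * b) s ~= 0" "Sk (b + c) s ~= 0" "Sk (b - c) s ~= 0" using assms Sk_nonzero by blast+
 hence nz: "?K (2 * (of_int b / 7)) (2 * 0) ~= 0" "?K (of_int b / 7 + of_int c / 7) (0 + 0) ~= 0"
  "?K (of_int b / 7 - of_int c / 7) (0 - 0) ~= 0" by (auto simp: Sk_def add_divide_distrib diff_divide_distrib)
 note three = kf_three_term[OF 7 nz, where d = "of_int d / 7" and d' = 0]
 have S: "Sk (x + y) s * Sk (x - y) s = ?K (of_int x / 7 + of_int y / 7) 0 * ?K (of_int x / 7 - of_int y / 7) 0" for x y proof -
  have "Sk (x + y) s * Sk (x - y) s = (pe (of_int (x + y)) * pe (of_int (x - y))) *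
   (?K (of_int x / 7 + of_int y / 7) 0 * ?K (of_int x / 7 - of_int y / 7) 0)"
   unfolding Sk_def by (simp add: add_divide_distrib diff_divide_distrib mult_ac)
  also have "pe (of_int (x + y)) * pe (of_int (x - y)) = 1" unfolding pe_of_int by simp
  finally show ?thesis by simp
 qed
 have T: "Tk (x + y) s * Tk (x - y) s = pe (- of_int x / 7) *
   (?K (of_int x / 7 + of_int y / 7) (1 / 2) * ?K (of_int x / 7 - of_int y / 7) (1 / 2))" for x y proof -
  have "Tk (x + y) s * Tk (x - y) s = (pe (- of_int (x + y) / 14) * pe (- of_int (x - y) / 14)) *
   (?K (of_int x / 7 + of_int y / 7) (1 / 2) * ?K (of_int x / 7 - of_int y / 7) (1 / 2))"
   unfolding Tk_def by (simp add: add_divide_distrib diff_divide_distrib mult_ac)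
  also have "pe (- of_int (x + y) / 14) * pe (- of_int (x - y) / 14) = pe (- of_int x / 7)"
   unfolding pe_add[symmetric] by (rule arg_cong[of _ _ pe]) (simp add: field_simps)
  finally show ?thesis .
 qed
 have U: "Uk (x + y) s * Uk (x - y) s = 
   ?K (of_int x / 7 + 1 / 2 + of_int y / 7) 0 * ?K (of_int x / 7 + 1 / 2 - of_int y / 7) 0" for x y proof -
  have e: "of_int (x + y) / 7 + 1 / 2 = of_int x / 7 + 1 / 2 + of_int y / (7 :: real)"
   "of_int (x - y) / 7 + 1 / 2 = of_int x / 7 + 1 / 2 - of_int y / (7 :: real)" by (simp_all add: add_divide_distrib diff_divide_distrib)
  have "Uk (x + y) s * Uk (x - y) s = (pe (of_int (x + y)) * pe (of_int (x - y))) *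
   (?K (of_int x / 7 + 1 / 2 + of_int y / 7) 0 * ?K (of_int x / 7 + 1 / 2 - of_int y / 7) 0)" unfolding Uk_def e by (simp only: mult_ac)
  also have "pe (of_int (x + y)) * pe (of_int (x - y)) = 1" unfolding pe_of_int by simp
  finally show ?thesis by simp
 qed
 have neg: "?K (c - x) (- y) = - ?K (x - c) y" for c x y using kf_minus[OF 7, of "x - c" y] by simp
 show "Sk (a + b) s * Sk (a - b) s * (Sk (c + d) s * Sk (c - d) s)
   + Sk (b + c) s * Sk (b - c) s * (Sk (a + d) s * Sk (a - d) s)
   - Sk (a + c) s * Sk (a - c) s * (Sk (b + d) s * Sk (b - d) s) = 0"
  unfolding S using three[of "of_int a / 7" 0] neg[of "of_int c / 7" "of_int a / 7" 0] by (simp add: add.commute)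
 show "Tk (a + b) s * Tk (a - b) s * (Sk (c + d) s * Sk (c - d) s)
   + Sk (b + c) s * Sk (b - c) s * (Tk (a + d) s * Tk (a - d) s)
   - Tk (a + c) s * Tk (a - c) s * (Sk (b + d) s * Sk (b - d) s) = 0" proof -
  let ?p = "pe (- of_int a / 7)"
  have t: "?K (of_int a / 7 + of_int b / 7) (1 / 2) * ?K (of_int a / 7 - of_int b / 7) (1 / 2) * (?K (of_int c / 7 + of_int d / 7) 0 * ?K (of_int c / 7 - of_int d / 7) 0)
   + ?K (of_int b / 7 + of_int c / 7) 0 * ?K (of_int b / 7 - of_int c / 7) 0 * (?K (of_int a / 7 + of_int d / 7) (1 / 2) * ?K (of_int a / 7 - of_int d / 7) (1 / 2))
   - ?K (of_int a / 7 + of_int c / 7) (1 / 2) * ?K (of_int a / 7 - of_int c / 7) (1 / 2) * (?K (of_int b / 7 + of_int d / 7) 0 * ?K (of_int b / 7 - of_int d / 7) 0) = 0"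
   using three[of "of_int a / 7" "1 / 2"] neg[of "of_int c / 7" "of_int a / 7" "1 / 2"] by (simp add: add.commute)
  show ?thesis unfolding S T using arg_cong[OF t, of "%x. ?p * x"] by (simp add: algebra_simps)
 qed
 show "Uk (a + b) s * Uk (a - b) s * (Sk (c + d) s * Sk (c - d) s)
   + Sk (b + c) s * Sk (b - c) s * (Uk (a + d) s * Uk (a - d) s)
   - Uk (a + c) s * Uk (a - c) s * (Sk (b + d) s * Sk (b - d) s) = 0"
  unfolding S U using three[of "of_int a / 7 + 1 / 2" 0] neg[of "of_int c / 7" "of_int a / 7 + 1 / 2" 0] by (simp add: add.commute)
qed

section \<open>Relations between seven-division values: the Klein quartic and the cubic\<close>

lemma Sk_values:
 assumes "t : uhp"
 shows "Sk 4 t = - Sk 3 t" "Sk 5 t = - Sk 2 t" "Sk 6 t = - Sk 1 t" "Sk 8 t = Sk 1 t"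
  "Sk (- 2) t = - Sk 2 t" "Sk (- 4) t = Sk 3 t"
 using Sk_7[OF assms, of "-3"] Sk_7[OF assms, of "-2"] Sk_7[OF assms, of "-1"] Sk_7[OF assms, of 1]
  Sk_minus[OF assms, of 3] Sk_minus[OF assms, of 2] Sk_minus[OF assms, of 1] Sk_minus[OF assms, of 4] by simp_all

lemma even_periodic_values:
 fixes T :: "int => complex"
 assumes e: "!!k. T (- k) = T k" and p: "!!k. T (k + 7) = T k"
 shows "T 4 = T 3" "T 5 = T 2" "T 6 = T 1" "T 8 = T 1" "T 10 = T 3" "T 12 = T 2" "T 16 = T 2"
 using p[of "-3"] e[of 3] p[of "-2"] e[of 2] p[of "-1"] e[of 1] p[of 1] p[of 3] p[of 5] p[of 9] p[of 2] by simp_all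

text \<open>Klein's equation for X(7) up to signs: the three-term relation for (a, b, c, d) = (3, 2,
  1, 0), with indices reduced modulo 7.\<close>

lemma Klein_quartic:
 assumes "t : uhp"
 shows "Sk 1 t * Sk 3 t ^ 3 = Sk 1 t ^ 3 * Sk 2 t - Sk 2 t ^ 3 * Sk 3 t"
proof -
 have "Sk (3 + 2) t * Sk (3 - 2) t * (Sk (1 + 0) t * Sk (1 - 0) t)
   + Sk (2 + 1) t * Sk (2 - 1) t * (Sk (3 + 0) t * Sk (3 - 0) t)
   - Sk (3 + 1) t * Sk (3 - 1) t * (Sk (2 + 0) t * Sk (2 - 0) t) = 0" by (rule Sk_three_term(1)[OF assms]) auto
 thus ?thesis by (simp add: Sk_values[OF assms] power3_eq_cube) (simp add: algebra_simps)
qed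

text \<open>The second relation uses the parameters (2, 6, 10, 0), the doubles of (1, 3, 5, 0);
  modulo 7 this permutes the indices 1, 2, 3 cyclically up to sign.\<close>

lemma two_torsion_relations:
 assumes "t : uhp" and T: "T = (%k. Tk k t) | T = (%k. Uk k t)"
 shows "Sk 2 t * Sk 3 t * T 2 ^ 2 - Sk 1 t ^ 2 * T 1 * T 2 + Sk 3 t ^ 2 * T 1 * T 3 = 0"
  "Sk 1 t * Sk 3 t * T 3 ^ 2 - Sk 2 t ^ 2 * T 2 * T 3 + Sk 1 t ^ 2 * T 1 * T 2 = 0"
proof -
 have e: "T (- k) = T k" and p: "T (k + 7) = T k" for k
  using T Tk_minus[OF assms(1)] Uk_minus[OF assms(1)] Tk_7[OF assms(1)] Uk_7[OF assms(1)] by auto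
 note v = even_periodic_values[of T, OF e p] Sk_values[OF assms(1)]
 have three: "T (a + b) * T (a - b) * (Sk (c + d) t * Sk (c - d) t)
   + Sk (b + c) t * Sk (b - c) t * (T (a + d) * T (a - d))
   - T (a + c) * T (a - c) * (Sk (b + d) t * Sk (b - d) t) = 0"
  if "~ 7 dvd 2 * b" "~ 7 dvd b + c" "~ 7 dvd b - c" for a b c d using T Sk_three_term(2,3)[OF assms(1) that] by auto
 show "Sk 2 t * Sk 3 t * T 2 ^ 2 - Sk 1 t ^ 2 * T 1 * T 2 + Sk 3 t ^ 2 * T 1 * T 3 = 0"
  using three[of 1 3 5 0] by (simp add: v power2_eq_square) (simp add: algebra_simps)
 show "Sk 1 t * Sk 3 t * T 3 ^ 2 - Sk 2 t ^ 2 * T 2 * T 3 + Sk 1 t ^ 2 * T 1 * T 2 = 0"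
  using three[of 2 6 10 0] by (simp add: v power2_eq_square) (simp add: algebra_simps)
qed

text \<open>In terms of the ratios \<open>r\<close> and \<open>p\<close> the relation 1 is linear in
  p. Eliminating p gives the cubic \<open>e2\<close> for r, and g is a constant multiple of 1 / r
  over the field of X, Y, Z. The last identity is the product of the roots, with the product of the
  other two already expressed through T2 / T1.\<close>

lemma cubic_algebra:
 fixes X Y Z T1 T2 T3 :: "'a :: field"
 assumes nz: "X ~= 0" "Y ~= 0" "Z ~= 0" "T1 ~= 0" "T2 ~= 0" "T3 ~= 0"
  and K: "X * Z ^ 3 = X ^ 3 * Y - Y ^ 3 * Z"
  and 1: "Y * Z * T2 ^ 2 - X ^ 2 * T1 * T2 + Z ^ 2 * T1 * T3 = 0"
  and 2: "X * Z * T3 ^ 2 - Y ^ 2 * T2 * T3 + X ^ 2 * T1 * T2 = 0"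
 defines "g \<equiv> - (Z / Y) * (T2 / T3)" and "u \<equiv> Y ^ 2 * Z / X ^ 3"
 shows "u * g ^ 3 + u * g ^ 2 - (u ^ 2 - 1) * g + (u - 1) ^ 2 = 0" "u ~= 0"
  "Z ^ 5 / (X * Y ^ 4) = (u - 1) ^ 2 / u"
  "(Z ^ 2 / Y ^ 2) * (X / Y - (Z / Y) * (Y / X * (T2 / T1))) * g = - ((u - 1) ^ 2 / u)"
proof -
 define r where "r = T3 / T2"
 define p where "p = T2 / T1"
 have rp: "r ~= 0" "p ~= 0" using nz by (auto simp: r_def p_def)
 have T: "T2 = p * T1" "T3 = r * p * T1" using nz by (auto simp: r_def p_def)
 have "p * T1 ^ 2 * (Y * Z * p - X ^ 2 + Z ^ 2 * r) = 0" using 1 unfolding T by (simp add: algebra_simps power2_eq_square)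
 hence "Y * Z * p - X ^ 2 + Z ^ 2 * r = 0" using nz rp by simp
 hence e1: "Y * Z * p = X ^ 2 - Z ^ 2 * r" by algebra
 have "p * T1 ^ 2 * (X * Z * r ^ 2 * p - Y ^ 2 * p * r + X ^ 2) = 0" using 2 unfolding T by (simp add: algebra_simps power2_eq_square)
 hence "X * Z * r ^ 2 * p - Y ^ 2 * p * r + X ^ 2 = 0" using nz rp by simp
 hence "(X * Z * r ^ 2 - Y ^ 2 * r) * (Y * Z * p) + X ^ 2 * Y * Z = 0" by algebra
 hence e2: "(X * Z * r ^ 2 - Y ^ 2 * r) * (X ^ 2 - Z ^ 2 * r) + X ^ 2 * Y * Z = 0" unfolding e1 .
 have g: "g = - (Z / (Y * r))" using nz by (simp add: g_def r_def)
 show u: "u ~= 0" using nz by (simp add: u_def)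
 \<comment> \<open>The Klein quartic turns u - 1 into a monomial in X, Y, Z; this is what makes the
   coefficients of the cubic comparable with those of \<open>e2\<close>.\<close>
 have um: "u - 1 = - (Z ^ 3) / (X ^ 2 * Y)" proof -
  have "(u - 1) * (X ^ 3 * Y) = - (X * Z ^ 3)" unfolding u_def K using nz by (simp add: field_simps power2_eq_square power3_eq_cube)
  hence "u - 1 = - (X * Z ^ 3) / (X ^ 3 * Y)" using nz by (intro eq_divide_imp) auto
  thus ?thesis using nz by (simp add: power2_eq_square power3_eq_cube mult.assoc)
 qed
 show c: "Z ^ 5 / (X * Y ^ 4) = (u - 1) ^ 2 / u" unfolding um unfolding u_def using nz by (simp add: field_simps eval_nat_numeral)
 \<comment> \<open>The factor \<open>X ^ 5 * Y ^ 2 * r ^ 3\<close> clears all denominators and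
   leaves a multiple of \<open>e2\<close>.\<close>
 have "(u * g ^ 3 + u * g ^ 2 - (u ^ 2 - 1) * g + (u - 1) ^ 2) = 0" proof -
  have up: "u + 1 = (X ^ 3 + Y ^ 2 * Z) / X ^ 3" using nz by (simp add: u_def field_simps)
  have "(u ^ 2 - 1) = (u + 1) * (u - 1)" by (simp add: power2_eq_square algebra_simps)
  also have "... = - ((X ^ 3 + Y ^ 2 * Z) * Z ^ 3) / (X ^ 5 * Y)" unfolding up um using nz by (simp add: field_simps eval_nat_numeral)
  finally have u2: "u ^ 2 - 1 = - ((X ^ 3 + Y ^ 2 * Z) * Z ^ 3) / (X ^ 5 * Y)" .
  have "(u * g ^ 3 + u * g ^ 2 - (u ^ 2 - 1) * g + (u - 1) ^ 2) * (X ^ 5 * Y ^ 2 * r ^ 3) = 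
   - (Z ^ 3) * ((X * Z * r ^ 2 - Y ^ 2 * r) * (X ^ 2 - Z ^ 2 * r) + X ^ 2 * Y * Z)" proof -
   have 1: "u * g ^ 3 * (X ^ 5 * Y ^ 2 * r ^ 3) = - (Z ^ 3) * (X ^ 2 * Y * Z)"
    unfolding g u_def using nz rp by (simp add: field_simps eval_nat_numeral)
   have 2: "u * g ^ 2 * (X ^ 5 * Y ^ 2 * r ^ 3) = Z ^ 3 * (X ^ 2 * Y ^ 2 * r)"
    unfolding g u_def using nz rp by (simp add: field_simps eval_nat_numeral)
   have 3: "(u ^ 2 - 1) * g * (X ^ 5 * Y ^ 2 * r ^ 3) = Z ^ 3 * ((X ^ 3 + Y ^ 2 * Z) * Z * r ^ 2)"
    unfolding u2 g using nz rp by (simp add: field_simps eval_nat_numeral)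
   have 4: "(u - 1) ^ 2 * (X ^ 5 * Y ^ 2 * r ^ 3) = Z ^ 3 * (X * Z ^ 3 * r ^ 3)"
    unfolding um using nz rp by (simp add: field_simps eval_nat_numeral)
   have dist: "(a + b - c + d) * M = a * M + b * M - c * M + d * M" for a b c d M :: 'a by (simp add: algebra_simps)
   show ?thesis unfolding dist 1 2 3 4 by (simp add: algebra_simps eval_nat_numeral)
  qed
  thus ?thesis using nz rp unfolding e2 by simp
 qed
 thus "u * g ^ 3 + u * g ^ 2 - (u ^ 2 - 1) * g + (u - 1) ^ 2 = 0" .
 have "X / Y - (Z / Y) * (Y / X * (T2 / T1)) = (X ^ 2 - Y * Z * p) / (X * Y)"
  unfolding p_def[symmetric] using nz by (simp add: field_simps power2_eq_square)
 also have "... = Z ^ 2 * r / (X * Y)" unfolding e1 by simp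
 finally have eq: "X / Y - (Z / Y) * (Y / X * (T2 / T1)) = Z ^ 2 * r / (X * Y)" .
 have "(Z ^ 2 / Y ^ 2) * (Z ^ 2 * r / (X * Y)) * g = - (Z ^ 5 / (X * Y ^ 4))"
  unfolding g using nz rp by (simp add: field_simps eval_nat_numeral)
 hence "(Z ^ 2 / Y ^ 2) * (X / Y - (Z / Y) * (Y / X * (T2 / T1))) * g = - (Z ^ 5 / (X * Y ^ 4))" unfolding eq .
 thus "(Z ^ 2 / Y ^ 2) * (X / Y - (Z / Y) * (Y / X * (T2 / T1))) * g = - ((u - 1) ^ 2 / u)" unfolding c .
qed

text \<open>The distribution relation for the isogeny with kernel generated by 1/2; here the
  two-division point (0, 1/2) enters.\<close>

lemma thet_double:
 assumes "t : uhp"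
 shows "thet (2 * z) (2 * t) = pe (1 / 2) * (thet z t * thet (z + 1 / 2) t)"
proof -
 have sq: "ce (2 * x) = (ce x)\<^sup>2" for x by (simp add: ce_power)
 have half: "ce (x + 1 / 2) = - ce x" for x by (simp add: ce_add) (simp add: ce_pe)
 have "ce (t - (z + 1 / 2)) = - ce (t - z)" using half[of "t - z - 1"] ce_add[of "t - z - 1" 1] by (simp add: algebra_simps)
 hence "pe (1 / 2) * (thet z t * thet (z + 1 / 2) t) = (pe (1 / 2) * pe (- z) * pe (- (z + 1 / 2))) *
  (qpoch (ce z) (ce t) * qpoch (- ce z) (ce t)) * (qpoch (ce (t - z)) (ce t) * qpoch (- ce (t - z)) (ce t))"
  unfolding thet_def half by (simp add: mult_ac)
 also have "pe (1 / 2) * pe (- z) * pe (- (z + 1 / 2)) = pe (- (2 * z))" unfolding pe_add[symmetric] by (rule arg_cong[of _ _ pe]) simp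
 finally show ?thesis unfolding qpoch_square[OF norm_ce_less_1[OF assms], symmetric] sq[symmetric] thet_def by (simp add: algebra_simps)
qed

text \<open>The distribution relation in the other direction. With 2 t as period, t is half a
  period, so the two-division point (1/2, 0) enters.\<close>

lemma thet_halve:
 assumes "t : uhp"
 shows "thet z t = pe (z + t) * (thet z (2 * t) * thet (z + t) (2 * t))"
proof -
 have sq: "ce (2 * x) = (ce x)\<^sup>2" for x by (simp add: ce_power)
 have eo: "qpoch (ce x) (ce t) = qpoch (ce x) (ce (2 * t)) * qpoch (ce (x + t)) (ce (2 * t))" for x
  using qpoch_even_odd[OF norm_ce_less_1[OF assms], of "ce x"] by (simp add: sq ce_add)
 have "pe (z + t) * (thet z (2 * t) * thet (z + t) (2 * t)) = (pe (z + t) * pe (- z) * pe (- (z + t))) *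
   (qpoch (ce z) (ce (2 * t)) * qpoch (ce (z + t)) (ce (2 * t))) *
   (qpoch (ce (2 * t - (z + t))) (ce (2 * t)) * qpoch (ce (2 * t - z)) (ce (2 * t)))" unfolding thet_def by (simp add: mult_ac)
 also have "pe (z + t) * pe (- z) * pe (- (z + t)) = pe (- z)" unfolding pe_add[symmetric] by (rule arg_cong[of _ _ pe]) simp
 also have "2 * t - (z + t) = t - z" by simp
 also have "2 * t - z = t - z + t" by simp
 finally show ?thesis unfolding eo[symmetric] by (simp add: thet_def)
qed

lemma phi_values:
 assumes "t : uhp"
 shows "upsilon_fun t = Sk 2 t ^ 2 * Sk 3 t / Sk 1 t ^ 3"
  "phi1 t = - Sk 3 t / Sk 2 t" "phi2 t = - Sk 2 t / Sk 1 t"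
  "phi1 t = kf (3 / 7) 0 (7 * t) / kf (2 / 7) 0 (7 * t)"
proof -
 obtain C where C: "C ~= 0" "!!k. theta_a k t = C * ((-1) ^ (k + 1) * kf (of_nat k / 7) 0 (7 * t))" using theta_a_eq_kf[OF assms] by blast
 have "theta_a k t = - C * Sk (int k) t" for k unfolding C(2) Sk_def pe_of_int by simp
 from this[of 1] this[of 2] this[of 3]
 have a: "theta_a 1 t = - C * Sk 1 t" "theta_a 2 t = - C * Sk 2 t" "theta_a 3 t = - C * Sk 3 t" by auto
 have nz: "Sk 1 t ~= 0" "Sk 2 t ~= 0" "Sk 3 t ~= 0" using Sk_nonzero[OF assms] by auto
 show "upsilon_fun t = Sk 2 t ^ 2 * Sk 3 t / Sk 1 t ^ 3"
  unfolding upsilon_fun_def a using nz C(1) by (simp add: field_simps eval_nat_numeral)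
 show p1: "phi1 t = - Sk 3 t / Sk 2 t" unfolding phi1_def a using nz C(1) by simp
 show "phi2 t = - Sk 2 t / Sk 1 t" unfolding phi2_def a using nz C(1) by simp
 show "phi1 t = kf (3 / 7) 0 (7 * t) / kf (2 / 7) 0 (7 * t)" unfolding p1 Sk_def pe_of_int by simp
qed

lemma phi1_double:
 assumes "t : uhp"
 shows "phi1 (2 * t) = - Sk 3 t / Sk 2 t * (Tk 3 t / Tk 2 t)"
proof -
 have 2: "2 * t : uhp" using assms by (simp add: uhp_def)
 have "kf (of_int k / 7) 0 (2 * (7 * t)) = pe (1 / 2) * (kf (of_int k / 7) 0 (7 * t) * Tk k t)" for k proof -
  define t' where "t' = 7 * t"
  define u where "u = (of_int k / 7 :: real)"
  have t': "t' : uhp" unfolding t'_def by (rule uhp_7[OF assms])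
  have "kf u 0 (2 * t') = pe (of_real u * (of_real u * (2 * t'))) * thet (2 * (of_real u * t')) (2 * t')"
   unfolding kf_def by (simp add: mult_ac)
  also have "... = (pe (of_real u * (of_real u * (2 * t'))) * pe (1 / 2)) * (thet (of_real u * t') t' * thet (of_real u * t' + 1 / 2) t')"
   unfolding thet_double[OF t'] by simp
  also have "pe (of_real u * (of_real u * (2 * t'))) * pe (1 / 2) = pe (1 / 2) * pe (of_real u * (of_real u * t')) *
    (pe (- (of_real u / 2)) * pe (of_real u * (of_real u * t' + 1 / 2)))"
   unfolding pe_add[symmetric] by (rule arg_cong[of _ _ pe]) (simp add: field_simps)
  finally have "kf u 0 (2 * t') = pe (1 / 2) * (kf u 0 t' * (pe (- (of_real u / 2)) * kf u (1 / 2) t'))"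
   unfolding kf_def by (simp add: mult_ac)
  thus ?thesis unfolding u_def t'_def Tk_def by simp
 qed
 from this[of 3] this[of 2] show ?thesis unfolding phi_values(4)[OF 2] Sk_def pe_of_int by (simp add: mult.left_commute)
qed

lemma phi1_halve:
 assumes "t : uhp"
 shows "phi1 (t / 2) = Sk 2 t / Sk 1 t * (Uk 2 t / Uk 1 t)"
proof -
 define t' where "t' = 7 * t"
 have t': "t' : uhp" unfolding t'_def by (rule uhp_7[OF assms])
 have h: "t / 2 : uhp" "t' / 2 : uhp" using assms t' by (simp_all add: uhp_def)
 have kf: "kf u 0 (t' / 2) = pe (t' / 4) * (kf (u / 2) 0 t' * kf ((u + 1) / 2) 0 t')" for u proof -
  have "kf u 0 (t' / 2) = pe (of_real u * (of_real u * (t' / 2))) * pe (of_real u * (t' / 2) + t' / 2) *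
    (thet (of_real u * (t' / 2)) t' * thet (of_real u * (t' / 2) + t' / 2) t')"
   unfolding kf_def using thet_halve[OF h(2), of "of_real u * (t' / 2)"] by (simp add: mult.assoc)
  also have "pe (of_real u * (of_real u * (t' / 2))) * pe (of_real u * (t' / 2) + t' / 2) =
   pe (t' / 4) * (pe (of_real (u / 2) * (of_real (u / 2) * t')) * pe (of_real ((u + 1) / 2) * (of_real ((u + 1) / 2) * t')))"
   unfolding pe_add[symmetric] by (rule arg_cong[of _ _ pe]) (simp add: field_simps)
  finally show ?thesis unfolding kf_def by (simp add: mult_ac add_divide_distrib distrib_left)
 qed
 \<comment> \<open>Halving 3/7 and 2/7 produces 3/14, 5/7 and 1/7, 9/14. Here 5/7 = 1 - 2/7, 3/14 =
   1/2 - 2/7 and 9/14 = 1/2 + 1/7, which leads back to \<open>Sk\<close> and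
   \<open>Uk\<close>.\<close>
 have 5: "kf (5 / 7) 0 t' = kf (2 / 7) 0 t'" using kf_shift[OF t', of "- (2 / 7)" 1 0 0] kf_minus[OF t', of "2 / 7" 0] by simp
 have 3: "kf (3 / 14) 0 t' = Uk 2 t" using Uk_minus[OF assms, of 2] unfolding Uk_def t'_def pe_of_int by simp
 have 9: "kf (9 / 14) 0 t' = - Uk 1 t" unfolding Uk_def t'_def pe_of_int by simp
 have "phi1 (t / 2) = kf (3 / 7) 0 (t' / 2) / kf (2 / 7) 0 (t' / 2)" unfolding phi_values(4)[OF h(1)] t'_def by simp
 also have "... = (kf (3 / 14) 0 t' * kf (5 / 7) 0 t') / (kf (1 / 7) 0 t' * kf (9 / 14) 0 t')" unfolding kf by simp
 also have "... = Sk 2 t / Sk 1 t * (Uk 2 t / Uk 1 t)" unfolding 5 3 9 unfolding Sk_def t'_def pe_of_int by simp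
 finally show ?thesis .
qed

text \<open>The formula for \<open>g1\<close> with the two-division point (1/2, 0) in place of (0,
  1/2). Its identification with the third root is \<open>g_sym\<close>.\<close>

definition g0_fun :: "complex => complex" where
 "g0_fun t = - (Sk 3 t / Sk 2 t) * (Uk 2 t / Uk 3 t)"

lemma g1_fun_eq:
 assumes "t : uhp"
 shows "g1_fun t = - (Sk 3 t / Sk 2 t) * (Tk 2 t / Tk 3 t)" unfolding g1_fun_def phi1_double[OF assms] phi_values(2)[OF assms]
 using Sk_nonzero[OF assms, of 2] Sk_nonzero[OF assms, of 3] Tk_nonzero[OF assms] by (simp add: field_simps power2_eq_square)

lemma upsilon_nonzero: "t : uhp ==> upsilon_fun t ~= 0" using Sk_nonzero[of t] by (simp add: phi_values)

theorem root_relations: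
 assumes "t : uhp"
 defines "u \<equiv> upsilon_fun t"
 shows "u * g1_fun t ^ 3 + u * g1_fun t ^ 2 - (u ^ 2 - 1) * g1_fun t + (u - 1) ^ 2 = 0"
  "u * g0_fun t ^ 3 + u * g0_fun t ^ 2 - (u ^ 2 - 1) * g0_fun t + (u - 1) ^ 2 = 0"
  "g1_fun t * g2_fun t * g0_fun t = - ((u - 1) ^ 2 / u)"
proof -
 have nz: "Sk 1 t ~= 0" "Sk 2 t ~= 0" "Sk 3 t ~= 0" using Sk_nonzero[OF assms(1)] by auto
 note c1 = cubic_algebra[OF nz Tk_nonzero Tk_nonzero Tk_nonzero Klein_quartic two_torsion_relations[OF _ disjI1[OF refl]], OF assms(1) assms(1) assms(1) assms(1) assms(1) assms(1)]
 note c2 = cubic_algebra[OF nz Uk_nonzero Uk_nonzero Uk_nonzero Klein_quartic two_torsion_relations[OF _ disjI2[OF refl]], OF assms(1) assms(1) assms(1) assms(1) assms(1) assms(1)]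
 have u: "u = Sk 2 t ^ 2 * Sk 3 t / Sk 1 t ^ 3" unfolding u_def by (rule phi_values[OF assms(1)])
 show "u * g1_fun t ^ 3 + u * g1_fun t ^ 2 - (u ^ 2 - 1) * g1_fun t + (u - 1) ^ 2 = 0" using c1(1) unfolding u g1_fun_eq[OF assms(1)] .
 show "u * g0_fun t ^ 3 + u * g0_fun t ^ 2 - (u ^ 2 - 1) * g0_fun t + (u - 1) ^ 2 = 0" using c2(1) unfolding u g0_fun_def .
 \<comment> \<open>The value of \<open>phi1\<close> at 2 t cancels, so the product of
   \<open>g1\<close> and \<open>g2\<close> involves only the halved argument, that is, only
   \<open>Uk\<close>. It can therefore be combined with \<open>g0\<close>.\<close>
 have "g1_fun t * g2_fun t = (phi1 t)\<^sup>2 * (phi1 t * phi1 (t / 2) - 1 / phi2 t)" proof -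
  have "phi1 (2 * t) ~= 0" unfolding phi1_double[OF assms(1)] using nz Tk_nonzero[OF assms(1)] by simp
  thus ?thesis unfolding g1_fun_def g2_fun_def by (simp add: field_simps)
 qed
 also have "... = (Sk 3 t ^ 2 / Sk 2 t ^ 2) * (Sk 1 t / Sk 2 t - (Sk 3 t / Sk 2 t) * (Sk 2 t / Sk 1 t * (Uk 2 t / Uk 1 t)))"
  unfolding phi_values[OF assms(1)] phi1_halve[OF assms(1)] by (simp add: power_divide)
 finally show "g1_fun t * g2_fun t * g0_fun t = - ((u - 1) ^ 2 / u)" using c2(4) unfolding u g0_fun_def by simp
qed

section \<open>The action of the modular group on meromorphic functions\<close>

subsection \<open>Matrices\<close>

abbreviation m11 :: "int^2^2 => int" where "m11 A \<equiv> A $ 1 $ 1"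
abbreviation m12 :: "int^2^2 => int" where "m12 A \<equiv> A $ 1 $ 2"
abbreviation m21 :: "int^2^2 => int" where "m21 A \<equiv> A $ 2 $ 1"
abbreviation m22 :: "int^2^2 => int" where "m22 A \<equiv> A $ 2 $ 2"

definition mat2 :: "int => int => int => int => int^2^2" where
 "mat2 a b c d = vector [vector [a, b], vector [c, d]]"

lemma mat2_nth [simp]:
 "m11 (mat2 a b c d) = a" "m12 (mat2 a b c d) = b" "m21 (mat2 a b c d) = c" "m22 (mat2 a b c d) = d"
 unfolding mat2_def vector_2 by (rule refl)+

lemma mat2_eqI:
 "m11 A = m11 B ==> m12 A = m12 B ==> m21 A = m21 B ==> m22 A = m22 B ==> A = B" unfolding vec_eq_iff forall_2 by blast

lemma SL2Z_iff: "A : SL2Z \<longleftrightarrow> m11 A * m22 A - m12 A * m21 A = 1" by (simp add: SL2Z_def det_2)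

lemma mult_nth:
 fixes A B :: "int^2^2"
 shows "m11 (A ** B) = m11 A * m11 B + m12 A * m21 B" "m12 (A ** B) = m11 A * m12 B + m12 A * m22 B"
  "m21 (A ** B) = m21 A * m11 B + m22 A * m21 B" "m22 (A ** B) = m21 A * m12 B + m22 A * m22 B"
 by (simp_all add: matrix_matrix_mult_def sum_2)

lemma SL2Z_mult: "A : SL2Z ==> B : SL2Z ==> A ** B : SL2Z" by (simp add: SL2Z_def det_mul)

definition minv :: "int^2^2 => int^2^2" where
 "minv A = mat2 (m22 A) (- m12 A) (- m21 A) (m11 A)"

lemma minv_nth [simp]:
 "m11 (minv A) = m22 A" "m12 (minv A) = - m12 A" "m21 (minv A) = - m21 A" "m22 (minv A) = m11 A" by (simp_all add: minv_def)

lemma minv_SL2Z: "A : SL2Z ==> minv A : SL2Z" by (simp add: SL2Z_iff mult.commute)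

lemma minv_mult: "A : SL2Z ==> minv A ** A = mat 1" "A : SL2Z ==> A ** minv A = mat 1"
 by (rule mat2_eqI; simp add: mult_nth mat_def SL2Z_iff algebra_simps)+

lemma mat_1_SL2Z: "mat 1 : SL2Z" by (simp add: SL2Z_def)

lemma moebius_in_uhp: "A : SL2Z ==> t : uhp ==> moebius A t : uhp" unfolding moebius_def by (rule moebius_uhp(2)) (auto simp: SL2Z_iff)

lemma moebius_denom: "A : SL2Z ==> t : uhp ==> of_int (m21 A) * t + of_int (m22 A) ~= (0 :: complex)"
 by (rule moebius_uhp(1)[of t "m11 A" _ "m12 A"]) (auto simp: SL2Z_iff)

lemma moebius_1 [simp]: "moebius (mat 1) t = t" by (simp add: moebius_def mat_def)

lemma moebius_mult:
 assumes "A : SL2Z" "B : SL2Z" "t : uhp"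
 shows "moebius (A ** B) t = moebius A (moebius B t)"
proof -
 have nz: "of_int (m21 B) * t + of_int (m22 B) ~= 0" by (rule moebius_denom[OF assms(2,3)])
 have nz2: "of_int (m21 A) * moebius B t + of_int (m22 A) ~= 0" by (rule moebius_denom[OF assms(1) moebius_in_uhp[OF assms(2,3)]])
 let ?j = "of_int (m21 B) * t + of_int (m22 B)"
 have *: "moebius B t * ?j = of_int (m11 B) * t + of_int (m12 B)" unfolding moebius_def using nz by simp
 have n: "of_int (r1 * m11 B + r2 * m21 B) * t + of_int (r1 * m12 B + r2 * m22 B) =
  (of_int r1 * moebius B t + of_int r2) * ?j" for r1 r2 proof -
  have "(of_int r1 * moebius B t + of_int r2) * ?j = of_int r1 * (moebius B t * ?j) + of_int r2 * ?j" by (simp add: algebra_simps)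
  thus ?thesis unfolding * by (simp add: algebra_simps)
 qed
 show ?thesis unfolding moebius_def[of "A ** B"] mult_nth n using nz by (simp add: moebius_def[of A])
qed

lemma moebius_minv: "A : SL2Z ==> t : uhp ==> moebius A (moebius (minv A) t) = t"
 "A : SL2Z ==> t : uhp ==> moebius (minv A) (moebius A t) = t" by (simp_all add: moebius_mult[symmetric] minv_SL2Z minv_mult)

lemma moebius_holomorphic: "A : SL2Z ==> moebius A holomorphic_on uhp"
 unfolding moebius_def by (intro holomorphic_intros) (auto simp: moebius_denom)

lemma moebius_filterlim:
 assumes "A : SL2Z" "x : uhp"
 shows "filterlim (moebius A) (at (moebius A x)) (at x)" unfolding filterlim_at
proof (intro conjI)
 have "isCont (moebius A) x" using moebius_holomorphic[OF assms(1)] assms(2) open_uhp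
  by (meson continuous_on_eq_continuous_at holomorphic_on_imp_continuous_on)
 thus "(moebius A \<longlongrightarrow> moebius A x) (at x)" by (simp add: isCont_def)
 have "\<forall>\<^sub>F y in at x. y : uhp - {x}" by (rule eventually_at_in_open[OF open_uhp assms(2)])
 thus "\<forall>\<^sub>F y in at x. moebius A y : UNIV & moebius A y ~= moebius A x" proof eventually_elim
  case (elim y)
  thus ?case using moebius_minv(2)[OF assms(1), of y] moebius_minv(2)[OF assms] by auto
 qed
qed

lemma cosparse_moebius:
 assumes "A : SL2Z" "\<forall>\<^sub>\<approx>t\<in>uhp. P t"
 shows "\<forall>\<^sub>\<approx>t\<in>uhp. P (moebius A t)" unfolding eventually_cosparse_open_eq[OF open_uhp]
proof
 fix x assume x: "x : uhp"
 have "\<forall>\<^sub>F y in at (moebius A x). P y"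
  using assms(2) moebius_in_uhp[OF assms(1) x] unfolding eventually_cosparse_open_eq[OF open_uhp] by blast
 thus "\<forall>\<^sub>F y in at x. P (moebius A y)" using moebius_filterlim[OF assms(1) x] by (rule eventually_compose_filterlim)
qed

lemma meromorphic_moebius:
 assumes "A : SL2Z" "f meromorphic_on uhp"
 shows "(%t. f (moebius A t)) meromorphic_on uhp"
proof (rule meromorphic_on_compose[OF assms(2)])
 show "moebius A analytic_on uhp" using moebius_holomorphic[OF assms(1)] open_uhp by (simp add: analytic_on_open)
qed (use moebius_in_uhp[OF assms(1)] in auto)

subsection \<open>Normal forms of meromorphic functions\<close>

lemma mero_of_eq_iff:
 assumes "f meromorphic_on uhp" "g meromorphic_on uhp"
 shows "mero_of f = mero_of g \<longleftrightarrow> (\<forall>\<^sub>\<approx>t\<in>uhp. f t = g t)"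
proof -
 have "mero_of f = mero_of g \<longleftrightarrow> mero_eq f g" unfolding mero_of_def using assms Quotient3_rel[OF Quotient3_mero, of f g]
  by (auto simp: mero_eq_def)
 thus ?thesis using assms by (simp add: mero_eq_def)
qed

lemma rep_mero_meromorphic: "rep_mero x meromorphic_on uhp" using Quotient3_rep_reflp[OF Quotient3_mero, of x] by (simp add: mero_eq_def)

lemma mero_of_rep: "mero_of (rep_mero x) = x" unfolding mero_of_def using rep_mero_meromorphic Quotient3_abs_rep[OF Quotient3_mero] by simp

text \<open>A canonical representative, continuous off its poles and 0 at them. It allows equality
  in \<open>mero\<close> to be tested at every point instead of away from a discrete set.\<close>

definition nf :: "mero => complex => complex" where
 "nf x = remove_sings (rep_mero x)"

lemma nf_nicely: "nf x nicely_meromorphic_on uhp" unfolding nf_def by (rule remove_sings_nicely_meromorphic[OF rep_mero_meromorphic])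

lemma nf_meromorphic [meromorphic_intros]: "nf x meromorphic_on uhp" using nf_nicely by (simp add: nicely_meromorphic_on_def)

lemma mero_of_nf [simp]: "mero_of (nf x) = x"
proof -
 have "mero_of (nf x) = mero_of (rep_mero x)" unfolding mero_of_eq_iff[OF nf_meromorphic rep_mero_meromorphic]
  unfolding nf_def by (rule eventually_remove_sings_eq[OF rep_mero_meromorphic])
 thus ?thesis by (simp add: mero_of_rep)
qed

text \<open>The values in a punctured neighbourhood decide whether there is a pole, where the value
  is 0 by convention, and otherwise determine the value by continuity.\<close>

lemma nicely_eq:
 assumes "f nicely_meromorphic_on uhp" "g nicely_meromorphic_on uhp" "\<forall>\<^sub>\<approx>t\<in>uhp. f t = g t" "t : uhp"
 shows "f t = g t"
proof -
 have ev: "\<forall>\<^sub>F y in at t. f y = g y" using assms(3,4) by (simp add: eventually_cosparse_open_eq[OF open_uhp])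
 have pole: "is_pole f t \<longleftrightarrow> is_pole g t" by (rule is_pole_cong[OF ev refl])
 show ?thesis proof (cases "is_pole f t")
  case True
  hence "~ f \<midarrow>t\<rightarrow> f t" "~ g \<midarrow>t\<rightarrow> g t"
   using pole not_tendsto_and_filterlim_at_infinity[of "at t"] by (auto simp: is_pole_def)
  hence "f t = 0" "g t = 0" using assms(1,2,4) unfolding nicely_meromorphic_on_def by blast+
  thus ?thesis by simp
 next
  case False
  hence "f \<midarrow>t\<rightarrow> f t" "g \<midarrow>t\<rightarrow> g t" using assms(1,2,4) pole by (auto simp: nicely_meromorphic_on_def)
  moreover have "f \<midarrow>t\<rightarrow> g t"
   using \<open>g \<midarrow>t\<rightarrow> g t\<close> by (rule Lim_transform_eventually) (use ev in eventually_elim, auto)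
  ultimately show ?thesis using tendsto_unique[of "at t" f] by auto
 qed
qed

lemma nf_mero_of:
 assumes "f nicely_meromorphic_on uhp" "t : uhp"
 shows "nf (mero_of f) t = f t"
proof (rule nicely_eq[OF nf_nicely assms(1) _ assms(2)])
 have "f meromorphic_on uhp" using assms(1) by (simp add: nicely_meromorphic_on_def)
 thus "\<forall>\<^sub>\<approx>t\<in>uhp. nf (mero_of f) t = f t" using mero_of_eq_iff[OF nf_meromorphic, of f "mero_of f"] by simp
qed

lemma holomorphic_nicely: "f holomorphic_on uhp ==> f nicely_meromorphic_on uhp"
 by (rule analytic_on_imp_nicely_meromorphic_on) (simp add: analytic_on_open[OF open_uhp])

lemma holomorphic_meromorphic: "f holomorphic_on uhp ==> f meromorphic_on uhp"
 using holomorphic_nicely by (simp add: nicely_meromorphic_on_def)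

lemma mero_eq_refl: "f meromorphic_on uhp ==> mero_eq f f" by (simp add: mero_eq_def)

lemma mero_of_add:
 assumes "f meromorphic_on uhp" "g meromorphic_on uhp"
 shows "mero_of (%t. f t + g t) = mero_of f + mero_of g" using plus_mero.abs_eq[OF mero_eq_refl mero_eq_refl, OF assms] assms
 by (simp add: mero_of_def meromorphic_intros)

lemma mero_of_mult:
 assumes "f meromorphic_on uhp" "g meromorphic_on uhp"
 shows "mero_of (%t. f t * g t) = mero_of f * mero_of g" using times_mero.abs_eq[OF mero_eq_refl mero_eq_refl, OF assms] assms
 by (simp add: mero_of_def meromorphic_intros)

lemma mero_of_inverse:
 assumes "f meromorphic_on uhp"
 shows "mero_of (%t. inverse (f t)) = inverse (mero_of f)" using inverse_mero.abs_eq[OF mero_eq_refl, OF assms] assms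
 by (simp add: mero_of_def meromorphic_intros)

lemma mero_of_const: "mero_of (%_. c) = mero_const c" by (simp add: mero_of_def mero_const_def meromorphic_on_const)

lemma mero_const_0: "mero_const 0 = 0" by (simp add: mero_const_def zero_mero_def)

lemma mero_const_minus: "mero_const (- c) = - mero_const c"
 using mero_const_add[of c "- c"] by (simp add: mero_const_0 eq_neg_iff_add_eq_0 add.commute)

lemma mero_const_diff: "mero_const (a - b) = mero_const a - mero_const b" using mero_const_add[of a "- b"] by (simp add: mero_const_minus)

lemma mero_const_inverse: "mero_const (inverse c) = inverse (mero_const c)"
proof (cases "c = 0")
 case False
 hence "mero_const (inverse c) * mero_const c = 1" by (simp add: mero_const_mult[symmetric] mero_const_1)
 thus ?thesis by (metis inverse_unique mult.commute)
qed (simp add: mero_const_0)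

lemma mero_const_divide: "mero_const (a / b) = mero_const a / mero_const b" by (simp add: divide_inverse mero_const_mult mero_const_inverse)

lemma mero_const_power: "mero_const (a ^ n) = mero_const a ^ n" by (induction n) (simp_all add: mero_const_1 mero_const_mult)

lemma mero_const_of_nat: "mero_const (of_nat n) = of_nat n" by (induction n) (simp_all add: mero_const_0 mero_const_1 mero_const_add)

lemma mero_const_numeral: "mero_const (numeral n) = numeral n" using mero_const_of_nat[of "numeral n"] by simp

lemma nf_const: "t : uhp ==> nf (mero_const c) t = c" unfolding mero_of_const[symmetric] by (rule nf_mero_of[OF holomorphic_nicely]) auto

lemma mero_const_eq_iff: "mero_const a = mero_const b \<longleftrightarrow> a = b"
 using nf_const[of \<i>] by (metis complex_i_not_zero imaginary_unit.sel(2) mem_Collect_eq uhp_def zero_less_one)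

lemma mero_const_eq_0_iff: "mero_const a = 0 \<longleftrightarrow> a = 0" using mero_const_eq_iff[of a 0] by (simp add: mero_const_0)

text \<open>The condition under which \<open>nf\<close> respects sums and products at a point: the
  convention at poles is not compatible with the field operations.\<close>

definition reg :: "mero => complex => bool" where
 "reg x t \<longleftrightarrow> t : uhp & nf x analytic_on {t}"

lemma nf_eq_at:
 assumes "f analytic_on {t}" "t : uhp" and ev: "\<forall>\<^sub>F y in at t. f y = nf x y"
 shows "reg x t" "nf x t = f t"
proof -
 have "isCont f t" using analytic_at_imp_isCont assms(1) by blast
 hence "f \<midarrow>t\<rightarrow> f t" by (simp add: isCont_def)
 hence lim: "nf x \<midarrow>t\<rightarrow> f t" by (rule Lim_transform_eventually) (rule ev)
 hence np: "~ is_pole (nf x) t" using not_tendsto_and_filterlim_at_infinity[of "at t"] by (auto simp: is_pole_def)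
 show "reg x t" unfolding reg_def using nicely_meromorphic_on_imp_analytic_at[OF nf_nicely assms(2) np] assms(2) by simp
 have "nf x \<midarrow>t\<rightarrow> nf x t" using nf_nicely[of x] np assms(2) by (auto simp: nicely_meromorphic_on_def)
 thus "nf x t = f t" using lim tendsto_unique[of "at t" "nf x"] by auto
qed

lemma nf_eqI:
 assumes "f analytic_on {t}" "t : uhp" "f meromorphic_on uhp" "mero_of f = x"
 shows "reg x t" "nf x t = f t"
proof -
 have "\<forall>\<^sub>\<approx>t\<in>uhp. f t = nf x t" using mero_of_eq_iff[OF assms(3) nf_meromorphic[of x]] assms(4) by simp
 hence ev: "\<forall>\<^sub>F y in at t. f y = nf x y" using assms(2) by (simp add: eventually_cosparse_open_eq[OF open_uhp])
 show "reg x t" "nf x t = f t" using nf_eq_at[OF assms(1,2) ev] by auto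
qed

lemma reg_iff: "t : uhp ==> reg x t \<longleftrightarrow> ~ is_pole (nf x) t"
 using nicely_meromorphic_on_imp_analytic_at[OF nf_nicely[of x]] analytic_at_imp_no_pole by (auto simp: reg_def)

lemma nf_add:
 assumes "reg x t" "reg y t"
 shows "reg (x + y) t" "nf (x + y) t = nf x t + nf y t" by (rule nf_eqI[of "%t. nf x t + nf y t"];
   use assms in \<open>auto simp: reg_def mero_of_add nf_meromorphic intro!: analytic_intros meromorphic_intros\<close>)+

lemma nf_mult:
 assumes "reg x t" "reg y t"
 shows "reg (x * y) t" "nf (x * y) t = nf x t * nf y t" by (rule nf_eqI[of "%t. nf x t * nf y t"];
   use assms in \<open>auto simp: reg_def mero_of_mult nf_meromorphic intro!: analytic_intros meromorphic_intros\<close>)+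

lemma reg_const: "t : uhp ==> reg (mero_const c) t" by (rule nf_eqI[of "%_. c"]) (auto simp: mero_of_const)

lemma nf_diff:
 assumes "reg x t" "reg y t"
 shows "reg (x - y) t" "nf (x - y) t = nf x t - nf y t"
proof -
 have eq: "x - y = x + mero_const (- 1) * y" by (simp add: mero_const_minus mero_const_1)
 have u: "t : uhp" using assms by (simp add: reg_def)
 show "reg (x - y) t" "nf (x - y) t = nf x t - nf y t"
  unfolding eq using assms by (simp_all add: nf_add nf_mult reg_const[OF u] nf_const[OF u])
qed

lemma nf_power:
 assumes "reg x t"
 shows "reg (x ^ n) t" "nf (x ^ n) t = nf x t ^ n"
proof -
 have u: "t : uhp" using assms by (simp add: reg_def)
 have "reg (x ^ n) t & nf (x ^ n) t = nf x t ^ n" using assms reg_const[OF u, of 1] nf_const[OF u, of 1]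
  by (induction n) (auto simp: nf_mult mero_const_1)
 thus "reg (x ^ n) t" "nf (x ^ n) t = nf x t ^ n" by auto
qed

lemma nf_prod:
 assumes "!!i. i : I ==> reg (f i) t" "t : uhp"
 shows "reg (PROD i:I. f i) t" "nf (PROD i:I. f i) t = (PROD i:I. nf (f i) t)"
proof -
 have "reg (PROD i:I. f i) t & nf (PROD i:I. f i) t = (PROD i:I. nf (f i) t)"
  using assms reg_const[OF assms(2), of 1] nf_const[OF assms(2), of 1]
  by (induction I rule: infinite_finite_induct) (auto simp: nf_mult mero_const_1)
 thus "reg (PROD i:I. f i) t" "nf (PROD i:I. f i) t = (PROD i:I. nf (f i) t)" by auto
qed

subsection \<open>The action\<close>

text \<open>A right action: acting by A and then by B is acting by A B.\<close>

definition mact :: "int^2^2 => mero => mero" where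
 "mact A x = mero_of (%t. nf x (moebius A t))"

lemma mact_mero_of:
 assumes "A : SL2Z" "f meromorphic_on uhp"
 shows "mact A (mero_of f) = mero_of (%t. f (moebius A t))"
proof -
 have "\<forall>\<^sub>\<approx>t\<in>uhp. nf (mero_of f) t = f t" using mero_of_eq_iff[OF nf_meromorphic assms(2), of "mero_of f"] by simp
 from cosparse_moebius[OF assms(1) this] show ?thesis
  unfolding mact_def by (subst mero_of_eq_iff) (auto intro!: meromorphic_moebius assms nf_meromorphic)
qed

lemma nf_mact:
 assumes "A : SL2Z" "t : uhp"
 shows "nf (mact A x) t = nf x (moebius A t)" "reg (mact A x) t \<longleftrightarrow> reg x (moebius A t)"
proof -
 have 1: "reg (mact A x) t & nf (mact A x) t = nf x (moebius A t)" if "reg x (moebius A t)" "A : SL2Z" "t : uhp" for A x t proof -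
  have "(nf x \<circ> moebius A) analytic_on {t}" proof (rule analytic_on_compose_gen[of _ _ _ "{moebius A t}"])
   show "moebius A analytic_on {t}" using moebius_holomorphic[OF that(2)] that(3) open_uhp analytic_at by blast
  qed (use that(1) in \<open>auto simp: reg_def\<close>)
  hence an: "(%t. nf x (moebius A t)) analytic_on {t}" by (simp add: o_def)
  show ?thesis using nf_eqI[OF an that(3) meromorphic_moebius[OF that(2) nf_meromorphic] mact_def[symmetric]] by blast
 qed
 have 2: "reg x (moebius A t)" if "reg (mact A x) t" proof -
  have "moebius (minv A) (moebius A t) = t" by (rule moebius_minv(2)[OF assms])
  hence "reg (mact (minv A) (mact A x)) (moebius A t)"
   using 1[of "mact A x" "minv A" "moebius A t"] that minv_SL2Z[OF assms(1)] moebius_in_uhp[OF assms] by simp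
  also have "mact (minv A) (mact A x) = x" proof -
   have "mact (minv A) (mact A x) = mero_of (%t. nf x (moebius A (moebius (minv A) t)))"
    unfolding mact_def[of A] by (rule mact_mero_of[OF minv_SL2Z[OF assms(1)] meromorphic_moebius[OF assms(1) nf_meromorphic]])
   also have "... = mero_of (nf x)" proof (subst mero_of_eq_iff)
    have "\<forall>\<^sub>\<approx>t\<in>uhp. t : uhp" by (rule eventually_in_cosparse) (auto simp: open_uhp)
    thus "\<forall>\<^sub>\<approx>t\<in>uhp. nf x (moebius A (moebius (minv A) t)) = nf x t"
     by eventually_elim (simp add: moebius_minv assms)
    show "(%t. nf x (moebius A (moebius (minv A) t))) meromorphic_on uhp"
     by (rule meromorphic_moebius[OF minv_SL2Z[OF assms(1)] meromorphic_moebius[OF assms(1) nf_meromorphic]])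
   qed (rule nf_meromorphic)
   finally show ?thesis by simp
  qed
  finally show ?thesis .
 qed
 show r: "reg (mact A x) t \<longleftrightarrow> reg x (moebius A t)" using 1[OF _ assms] 2 by blast
 show "nf (mact A x) t = nf x (moebius A t)" proof (cases "reg x (moebius A t)")
  case True thus ?thesis using 1[OF _ assms] by blast
 next
  case False
  have z: "nf y sg = 0" if "~ reg y sg" "sg : uhp" for y sg
   using that nf_nicely[of y] reg_iff[OF that(2)] not_tendsto_and_filterlim_at_infinity[of "at sg"]
   unfolding nicely_meromorphic_on_def is_pole_def by (metis at_neq_bot)
  show ?thesis using z False r moebius_in_uhp[OF assms] assms(2) by simp
 qed
qed

lemma mact_add: "A : SL2Z ==> mact A (x + y) = mact A x + mact A y" using mact_mero_of[of A "%t. nf x t + nf y t"]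
 by (simp add: mero_of_add nf_meromorphic meromorphic_intros meromorphic_moebius mact_def[symmetric])

lemma mact_mult: "A : SL2Z ==> mact A (x * y) = mact A x * mact A y" using mact_mero_of[of A "%t. nf x t * nf y t"]
 by (simp add: mero_of_mult nf_meromorphic meromorphic_intros meromorphic_moebius mact_def[symmetric])

lemma mact_inverse: "A : SL2Z ==> mact A (inverse x) = inverse (mact A x)" using mact_mero_of[of A "%t. inverse (nf x t)"]
 by (simp add: mero_of_inverse nf_meromorphic meromorphic_intros meromorphic_moebius mact_def[symmetric])

lemma mact_const: "A : SL2Z ==> mact A (mero_const c) = mero_const c"
 using mact_mero_of[of A "%_. c"] by (simp add: mero_of_const meromorphic_on_const)

lemma mact_minus: "A : SL2Z ==> mact A (- x) = - mact A x"
 using mact_mult[of A "mero_const (-1)" x] mact_const[of A "-1"] by (simp add: mero_const_minus mero_const_1)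

lemma mact_diff: "A : SL2Z ==> mact A (x - y) = mact A x - mact A y" using mact_add[of A x "- y"] by (simp add: mact_minus)

lemma mact_0: "A : SL2Z ==> mact A 0 = 0" and mact_1: "A : SL2Z ==> mact A 1 = 1"
 using mact_const[of A 0] mact_const[of A 1] by (simp_all add: mero_const_0 mero_const_1)

lemma mact_power: "A : SL2Z ==> mact A (x ^ n) = mact A x ^ n" by (induction n) (simp_all add: mact_1 mact_mult)

lemma mact_prod: "A : SL2Z ==> mact A (PROD i:I. f i) = (PROD i:I. mact A (f i))"
 by (induction I rule: infinite_finite_induct) (simp_all add: mact_1 mact_mult)

lemma mact_sum: "A : SL2Z ==> mact A (SUM i:I. f i) = (SUM i:I. mact A (f i))"
 by (induction I rule: infinite_finite_induct) (simp_all add: mact_0 mact_add)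

lemma eq_nfI:
 assumes "!!t. t : uhp ==> nf x t = nf y t"
 shows "x = y"
proof -
 have "\<forall>\<^sub>\<approx>t\<in>uhp. t : uhp" by (rule eventually_in_cosparse) (auto simp: open_uhp)
 hence "\<forall>\<^sub>\<approx>t\<in>uhp. nf x t = nf y t" by eventually_elim (rule assms)
 thus ?thesis using mero_of_eq_iff[OF nf_meromorphic nf_meromorphic, of x y] by simp
qed

lemma mact_mat1 [simp]: "mact (mat 1) x = x" by (rule eq_nfI) (simp add: nf_mact mat_1_SL2Z)

lemma mact_mact:
 assumes "A : SL2Z" "B : SL2Z"
 shows "mact B (mact A x) = mact (A ** B) x" by (rule eq_nfI) (simp add: nf_mact assms moebius_in_uhp SL2Z_mult moebius_mult)

lemma mact_inj: "A : SL2Z ==> mact A x = mact A y \<longleftrightarrow> x = y" by (metis mact_mact mact_mat1 minv_SL2Z minv_mult(2))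

lemma mact_uminus_mat: "mact (- A) x = mact A x"
proof -
 have "moebius (- A) t = moebius A t" for t
  using minus_divide_divide[of "of_int (m11 A) * t + of_int (m12 A)" "of_int (m21 A) * t + of_int (m22 A)"] by (simp add: moebius_def)
 thus ?thesis by (simp add: mact_def)
qed

subsection \<open>Behaviour at the cusps\<close>

lemma open_Im_gt: "open {t. Im t > y}" by (rule open_halfspace_Im_gt)

lemma meromorphic_at_infinity_cusp_cong:
 assumes "meromorphic_at_infinity_cusp f" "\<forall>\<^sub>\<approx>t\<in>uhp. f t = g t"
 shows "meromorphic_at_infinity_cusp g"
proof -
 obtain N h y where *: "N > 0" "h meromorphic_on {0}" "y > 0"
  "\<forall>\<^sub>\<approx>t\<in>{t. Im t > y}. f t = h (exp (2 * pi * \<i> * t / of_nat N))"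
  using assms(1) unfolding meromorphic_at_infinity_cusp_def by blast
 have "\<forall>\<^sub>\<approx>t\<in>{t. Im t > y}. f t = g t"
  using assms(2) \<open>y > 0\<close> unfolding eventually_cosparse_open_eq[OF open_uhp] eventually_cosparse_open_eq[OF open_Im_gt]
  by (auto simp: uhp_def)
 with *(4) have "\<forall>\<^sub>\<approx>t\<in>{t. Im t > y}. g t = h (exp (2 * pi * \<i> * t / of_nat N))" by eventually_elim simp
 thus ?thesis using *(1-3) unfolding meromorphic_at_infinity_cusp_def by blast
qed

definition mcusp :: "mero => bool" where
 "mcusp x \<longleftrightarrow> meromorphic_at_infinity_cusp (nf x)"

lemma mcusp_mero_of:
 assumes "f meromorphic_on uhp"
 shows "mcusp (mero_of f) \<longleftrightarrow> meromorphic_at_infinity_cusp f"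
proof -
 have "\<forall>\<^sub>\<approx>t\<in>uhp. nf (mero_of f) t = f t" using mero_of_eq_iff[OF nf_meromorphic assms, of "mero_of f"] by simp
 moreover from this have "\<forall>\<^sub>\<approx>t\<in>uhp. f t = nf (mero_of f) t" by eventually_elim simp
 ultimately show ?thesis unfolding mcusp_def using meromorphic_at_infinity_cusp_cong by blast
qed

lemma mcusp_const: "mcusp (mero_const c)"
proof -
 have "meromorphic_at_infinity_cusp (%_. c)" unfolding meromorphic_at_infinity_cusp_def
  by (intro exI[of _ "1::nat"] conjI exI[of _ "%_. c"] exI[of _ "1::real"]) auto
 thus ?thesis using mcusp_mero_of[of "%_. c"] by (simp add: mero_of_const meromorphic_on_const)
qed

lemma mcusp_inverse:
 assumes "mcusp x"
 shows "mcusp (inverse x)"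
proof -
 obtain N h y where *: "N > 0" "h meromorphic_on {0}" "y > 0"
  "\<forall>\<^sub>\<approx>t\<in>{t. Im t > y}. nf x t = h (exp (2 * pi * \<i> * t / of_nat N))"
  using assms unfolding mcusp_def meromorphic_at_infinity_cusp_def by blast
 have "meromorphic_at_infinity_cusp (%t. inverse (nf x t))" unfolding meromorphic_at_infinity_cusp_def proof (intro exI conjI)
  show "(%w. inverse (h w)) meromorphic_on {0}" using *(2) by (intro meromorphic_intros)
  show "\<forall>\<^sub>\<approx>t\<in>{t. Im t > y}. inverse (nf x t) = inverse (h (exp (2 * pi * \<i> * t / of_nat N)))"
   using *(4) by eventually_elim simp
 qed (use * in auto)
 thus ?thesis using mcusp_mero_of[of "%t. inverse (nf x t)"] by (simp add: mero_of_inverse nf_meromorphic meromorphic_intros)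
qed

text \<open>Expansions in q^(1/N) and q^(1/M) are both expansions in q^(1/(N M)).\<close>

lemma mcusp_binop:
 assumes "mcusp x" "mcusp y"
 shows "mcusp (x + y)" "mcusp (x * y)"
proof -
 obtain N h a where 1: "N > 0" "h meromorphic_on {0}" "a > 0"
  "\<forall>\<^sub>\<approx>t\<in>{t. Im t > a}. nf x t = h (exp (2 * pi * \<i> * t / of_nat N))"
  using assms(1) unfolding mcusp_def meromorphic_at_infinity_cusp_def by blast
 obtain M k b where 2: "M > 0" "k meromorphic_on {0}" "b > 0"
  "\<forall>\<^sub>\<approx>t\<in>{t. Im t > b}. nf y t = k (exp (2 * pi * \<i> * t / of_nat M))"
  using assms(2) unfolding mcusp_def meromorphic_at_infinity_cusp_def by blast
 define c where "c = max a b"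
 have m1: "(%w. h (w ^ M)) meromorphic_on {0}"
  by (rule meromorphic_on_compose[OF 1(2)]) (use 2(1) in \<open>auto intro!: analytic_intros\<close>)
 have m2: "(%w. k (w ^ N)) meromorphic_on {0}"
  by (rule meromorphic_on_compose[OF 2(2)]) (use 1(1) in \<open>auto intro!: analytic_intros\<close>)
 have e1: "exp (2 * pi * \<i> * t / of_nat N) = exp (2 * pi * \<i> * t / of_nat (N * M)) ^ M" for t
  using 1(1) 2(1) by (simp add: exp_of_nat_mult[symmetric])
 have e2: "exp (2 * pi * \<i> * t / of_nat M) = exp (2 * pi * \<i> * t / of_nat (N * M)) ^ N" for t
  using 1(1) 2(1) by (simp add: exp_of_nat_mult[symmetric])
 have ev1: "\<forall>\<^sub>\<approx>t\<in>{t. Im t > c}. nf x t = h (exp (2 * pi * \<i> * t / of_nat N))"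
  using 1(4) unfolding eventually_cosparse_open_eq[OF open_Im_gt] by (auto simp: c_def)
 have ev2: "\<forall>\<^sub>\<approx>t\<in>{t. Im t > c}. nf y t = k (exp (2 * pi * \<i> * t / of_nat M))"
  using 2(4) unfolding eventually_cosparse_open_eq[OF open_Im_gt] by (auto simp: c_def)
 have "meromorphic_at_infinity_cusp (%t. nf x t + nf y t)" unfolding meromorphic_at_infinity_cusp_def proof (intro exI conjI)
  show "(%w. h (w ^ M) + k (w ^ N)) meromorphic_on {0}" using m1 m2 by (intro meromorphic_intros)
  show "\<forall>\<^sub>\<approx>t\<in>{t. Im t > c}. nf x t + nf y t = h (exp (2 * pi * \<i> * t / of_nat (N * M)) ^ M) + k (exp (2 * pi * \<i> * t / of_nat (N * M)) ^ N)"
   using ev1 ev2 by eventually_elim (simp only: e1 e2)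
 qed (use 1 2 in \<open>auto simp: c_def\<close>)
 thus "mcusp (x + y)" using mcusp_mero_of[of "%t. nf x t + nf y t"] by (simp add: mero_of_add nf_meromorphic meromorphic_intros)
 have "meromorphic_at_infinity_cusp (%t. nf x t * nf y t)" unfolding meromorphic_at_infinity_cusp_def proof (intro exI conjI)
  show "(%w. h (w ^ M) * k (w ^ N)) meromorphic_on {0}" using m1 m2 by (intro meromorphic_intros)
  show "\<forall>\<^sub>\<approx>t\<in>{t. Im t > c}. nf x t * nf y t = h (exp (2 * pi * \<i> * t / of_nat (N * M)) ^ M) * k (exp (2 * pi * \<i> * t / of_nat (N * M)) ^ N)"
   using ev1 ev2 by eventually_elim (simp only: e1 e2)
 qed (use 1 2 in \<open>auto simp: c_def\<close>)
 thus "mcusp (x * y)" using mcusp_mero_of[of "%t. nf x t * nf y t"] by (simp add: mero_of_mult nf_meromorphic meromorphic_intros)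
qed

lemma mcusp_minus: "mcusp x ==> mcusp (- x)"
 using mcusp_binop(2)[OF mcusp_const[of "- 1"], of x] by (simp add: mero_const_minus mero_const_1)

text \<open>Describes the field by elements of \<open>mero\<close>: invariance becomes an equation,
  so the field axioms and Galois arguments need no exceptional sets.\<close>

lemma A0_altdef:
 assumes "G <= SL2Z"
 shows "A0 G = {x. (ALL A:G. mact A x = x) & (ALL A:SL2Z. mcusp (mact A x))}"
proof -
 have iff: "modular_function G f \<longleftrightarrow>
  (ALL A:G. mact A (mero_of f) = mero_of f) & (ALL A:SL2Z. mcusp (mact A (mero_of f)))"
  if f: "f meromorphic_on uhp" for f proof -
  have "(\<forall>\<^sub>\<approx>t\<in>uhp. f (moebius A t) = f t) \<longleftrightarrow> mact A (mero_of f) = mero_of f" if "A : SL2Z" for A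
   using mact_mero_of[OF that f] mero_of_eq_iff[OF meromorphic_moebius[OF that f] f] by simp
  moreover have "meromorphic_at_infinity_cusp (%t. f (moebius A t)) \<longleftrightarrow> mcusp (mact A (mero_of f))" if "A : SL2Z" for A
   using mact_mero_of[OF that f] mcusp_mero_of[OF meromorphic_moebius[OF that f]] by simp
  ultimately show ?thesis unfolding modular_function_def using assms f by blast
 qed
 show ?thesis proof (intro equalityI subsetI)
  fix x assume "x : A0 G"
  then obtain f where "modular_function G f" "x = mero_of f" by (auto simp: A0_def)
  thus "x : {x. (ALL A:G. mact A x = x) & (ALL A:SL2Z. mcusp (mact A x))}" using iff[of f] by (simp add: modular_function_def)
 next
  fix x assume "x : {x. (ALL A:G. mact A x = x) & (ALL A:SL2Z. mcusp (mact A x))}"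
  hence "modular_function G (nf x)" using iff[OF nf_meromorphic] by simp
  thus "x : A0 G" unfolding A0_def by (metis image_eqI mem_Collect_eq mero_of_nf)
 qed
qed

lemma A0_subfield:
 assumes "G <= SL2Z"
 shows "C_subfield (A0 G)"
proof -
 have *: "A : SL2Z" if "A : G" for A using assms that by blast
 show ?thesis unfolding C_subfield_def A0_altdef[OF assms]
  by (auto simp: mact_const mcusp_const mact_add mact_mult mact_minus mact_inverse mcusp_binop mcusp_minus mcusp_inverse *)
qed

text \<open>The leading term of the expansion in q^(1/N), with r the exponent divided by N. Orders
  with respect to q are rational, but reals suffice to compare them.\<close>

lemma cusp_order:
 assumes "mcusp x" "x ~= 0"
 obtains r :: real and c where "c ~= 0" "((%t. nf x t * ce (- (of_real r * t))) \<longlongrightarrow> c) at_cusp"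
  "eventually (reg x) at_cusp"
proof -
 obtain N h y where *: "N > 0" "h meromorphic_on {0}" "y > 0"
  "\<forall>\<^sub>\<approx>t\<in>{t. Im t > y}. nf x t = h (exp (2 * pi * \<i> * t / of_nat N))"
  using assms(1) unfolding mcusp_def meromorphic_at_infinity_cusp_def by blast
 define q where "q = (%t. ce (of_real (1 / real N) * t + 0))"
 have q: "exp (2 * pi * \<i> * t / of_nat N) = q t" for t by (simp add: q_def ce_def)
 have q0: "(q \<longlongrightarrow> 0) at_cusp" unfolding q_def by (rule ce_tendsto_0) (use *(1) in simp)
 have qnz: "q t ~= 0" for t by (simp add: q_def)
 have small: "\<exists>y1\<ge>y. ALL t. Im t > y1 --> norm (q t) < rh" if "rh > 0" for rh proof -
  have "\<forall>\<^sub>F t in at_cusp. norm (q t) < rh" using tendstoD[OF q0 that] by simp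
  then obtain y1 where "ALL t. Im t > y1 --> norm (q t) < rh" unfolding eventually_at_cusp by blast
  thus ?thesis by (intro exI[of _ "max y y1"]) auto
 qed
 have iso: "isolated_singularity_at h 0" "not_essential h 0" using *(2) meromorphic_at_iff by auto
 \<comment> \<open>If h vanished near 0, x would vanish on an open set, hence everywhere on the
   connected half-plane.\<close>
 have freq: "\<exists>\<^sub>F w in at 0. h w ~= 0" proof (rule ccontr)
  assume "~ ?thesis"
  hence "\<forall>\<^sub>F w in at 0. h w = 0" by (simp add: frequently_def)
  then obtain rh where rh: "rh > 0" "!!w. w ~= 0 ==> norm w < rh ==> h w = 0" by (auto simp: eventually_at)
  obtain y1 where y1: "y1 >= y" "!!t. Im t > y1 ==> norm (q t) < rh" using small[OF rh(1)] by blast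
  define t0 where "t0 = Complex 0 (y1 + 1)"
  have im: "Im t0 > y1" "Im t0 > y" "t0 : uhp" using y1(1) *(3) by (auto simp: t0_def uhp_def)
  have e1: "\<forall>\<^sub>F t in at t0. nf x t = h (q t)"
   using *(4) im(2) unfolding eventually_cosparse_open_eq[OF open_Im_gt] q by auto
  have e2: "\<forall>\<^sub>F t in at t0. t : {t. Im t > y1}" by (rule eventually_at_in_open'[OF open_Im_gt]) (use im in auto)
  have z: "\<forall>\<^sub>F t in at t0. nf x t = 0" using e1 e2 by eventually_elim (simp add: rh(2) qnz y1(2))
  from nicely_meromorphic_imp_constant_or_avoid[OF nf_nicely open_uhp connected_uhp, of x 0]
  show False proof
   assume "ALL t:uhp. nf x t = 0"
   hence "x = 0" using eq_nfI[of x 0] nf_const[of _ 0] by (simp add: mero_const_0)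
   thus False using assms(2) by simp
  next
   assume "\<forall>\<^sub>\<approx>t\<in>uhp. nf x t ~= 0"
   hence "\<forall>\<^sub>F t in at t0. nf x t ~= 0" using im(3) by (simp add: eventually_cosparse_open_eq[OF open_uhp])
   with z have "\<forall>\<^sub>F t in at t0. False" by eventually_elim simp
   thus False by simp
  qed
 qed
 define k where "k = zorder h 0"
 define g where "g = zor_poly h 0"
 obtain rh where rh: "g 0 ~= 0" "rh > 0" "g holomorphic_on cball 0 rh"
  "!!w. w : cball 0 rh - {0} ==> h w = g w * w powi k" using zorder_exist[OF iso freq] unfolding k_def g_def by auto
 obtain y1 where y1: "y1 >= y" "!!t. Im t > y1 ==> norm (q t) < rh" using small[OF rh(2)] by blast
 have F: "reg x t & nf x t = g (q t) * q t powi k" if "Im t > y1" for t proof -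
  have u: "t : uhp" using that y1(1) *(3) by (auto simp: uhp_def)
  have "(%t. g (q t) * q t powi k) holomorphic_on {t. Im t > y1}" proof -
   have hq: "q holomorphic_on {t. Im t > y1}" unfolding q_def by (intro holomorphic_intros)
   have "(g \<circ> q) holomorphic_on {t. Im t > y1}" by (rule holomorphic_on_compose_gen[OF hq, of g "ball 0 rh"])
     (use rh(3) y1(2) in \<open>auto intro: holomorphic_on_subset\<close>)
   thus ?thesis using hq qnz by (intro holomorphic_intros) (auto simp: o_def)
  qed
  hence an: "(%t. g (q t) * q t powi k) analytic_on {t}" using that open_Im_gt analytic_at by blast
  have e1: "\<forall>\<^sub>F t in at t. nf x t = h (q t)"
   using *(4) that y1(1) unfolding eventually_cosparse_open_eq[OF open_Im_gt] q by auto
  have e2: "\<forall>\<^sub>F t in at t. t : {t. Im t > y1}" by (rule eventually_at_in_open'[OF open_Im_gt]) (use that in auto)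
  have "\<forall>\<^sub>F t in at t. g (q t) * q t powi k = nf x t" using e1 e2 proof eventually_elim
   case (elim sg)
   have "q sg : cball 0 rh - {0}" using y1(2)[of sg] elim(2) qnz by auto
   thus ?case using rh(4) elim(1) by simp
  qed
  from nf_eq_at[OF an u this] show ?thesis by blast
 qed
 have qk: "q t powi k * ce (- (of_real (of_int k / real N) * t)) = 1" for t proof -
  have "q t powi k = ce (of_int k * (of_real (1 / real N) * t))" unfolding q_def ce_def by (simp add: exp_power_int mult_ac)
  thus ?thesis by (simp add: ce_add[symmetric])
 qed
 have "isCont g 0" by (rule continuous_on_interior[OF holomorphic_on_imp_continuous_on[OF rh(3)]]) (use rh(2) in simp)
 hence "((%t. g (q t)) \<longlongrightarrow> g 0) at_cusp" using q0 by (rule isCont_tendsto_compose)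
 moreover have "\<forall>\<^sub>F t in at_cusp. g (q t) = nf x t * ce (- (of_real (of_int k / real N) * t))" unfolding eventually_at_cusp
 proof (intro exI[of _ y1] allI impI)
  fix t assume "Im t > y1"
  thus "g (q t) = nf x t * ce (- (of_real (of_int k / real N) * t))" using F[of t] qk[of t] by (simp add: mult.assoc)
 qed
 ultimately have "((%t. nf x t * ce (- (of_real (of_int k / real N) * t))) \<longlongrightarrow> g 0) at_cusp"
  by (rule Lim_transform_eventually)
 moreover have "eventually (reg x) at_cusp" unfolding eventually_at_cusp using F by blast
 ultimately show ?thesis using that rh(1) by blast
qed

text \<open>Periodicity makes f a function h of w = q^(1/N) on the punctured disc, and the given
  growth turns the singularity at w = 0 into a pole at worst.\<close>

lemma meromorphic_at_infinity_cuspI: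
 assumes hol: "f holomorphic_on uhp" and N: "N > 0"
  and per: "!!t. t : uhp ==> f (t + of_nat N) = f t"
  and lim: "((%t. f t * ce (- (of_real r * t))) \<longlongrightarrow> c) at_cusp"
 shows "meromorphic_at_infinity_cusp f"
proof -
 have uN: "t + of_int k * of_nat N : uhp \<longleftrightarrow> t : uhp" for t k by (simp add: uhp_def)
 have perk: "f (t + of_int k * of_nat N) = f t" if "t : uhp" for t k proof (induction k rule: int_induct[where k = 0])
  case (step1 i)
  thus ?case using per[of "t + of_int i * of_nat N"] uN that by (simp add: algebra_simps)
 next
  case (step2 i)
  thus ?case using per[of "t + of_int (i - 1) * of_nat N"] uN[of t "i - 1"] that by (simp add: algebra_simps)
 qed auto
 \<comment> \<open>Two branches of the inverse of t |-> q^(1/N), cut along the negative and the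
   positive real axis. Together they cover the punctured disc, and periodicity makes f agree on
   them.\<close>
 define ph where "ph = (%w. of_nat N * Ln w / (2 * pi * \<i>))"
 define \<psi> where "\<psi> = (%w. of_nat N * (Ln (- w) + pi * \<i>) / (2 * pi * \<i>))"
 define B where "B = ball (0::complex) 1 - {0}"
 have ex: "ce (ph w / of_nat N) = w" "ce (\<psi> w / of_nat N) = w" if "w ~= 0" for w
  using that N by (simp_all add: ph_def \<psi>_def ce_def exp_add)
 have im: "Im (ph w) = - (real N / (2 * pi)) * ln (norm w)" "Im (\<psi> w) = - (real N / (2 * pi)) * ln (norm w)" if "w ~= 0" for w proof -
  have "Im z = - (real N / (2 * pi)) * ln (norm w)" if "ce (z / of_nat N) = w" for z proof -
   have "ln (norm w) = - 2 * pi * Im (z / of_nat N)" unfolding that[symmetric] norm_ce by simp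
   also have "Im (z / of_nat N) = Im z / real N" by (simp add: Im_divide_of_nat)
   finally show ?thesis using N by (simp add: field_simps)
  qed
  thus "Im (ph w) = - (real N / (2 * pi)) * ln (norm w)" "Im (\<psi> w) = - (real N / (2 * pi)) * ln (norm w)" using ex[OF that] by blast+
 qed
 have up: "ph w : uhp" "\<psi> w : uhp" if "w : B" for w proof -
  have "ln (norm w) < 0" using that by (auto simp: B_def)
  moreover have "real N / (2 * pi) > 0" using N by simp
  ultimately have "(real N / (2 * pi)) * ln (norm w) < 0" by (rule mult_pos_neg[rotated])
  hence "0 < - (real N / (2 * pi)) * ln (norm w)" by linarith
  thus "ph w : uhp" "\<psi> w : uhp" using that im[of w] by (auto simp: B_def uhp_def)
 qed
 have same: "f sg = f t" if "ce (sg / of_nat N) = ce (t / of_nat N)" "t : uhp" for sg t proof -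
  have "ce (sg / of_nat N - t / of_nat N) = 1" using that by (simp add: ce_diff)
  then obtain k where "sg / of_nat N - t / of_nat N = of_int k" unfolding ce_eq_1_iff by (rule Ints_cases)
  hence "sg = t + of_int k * of_nat N" using N by (simp add: field_simps)
  thus ?thesis using perk[OF that(2)] by simp
 qed
 define h where "h = (%w. f (ph w))"
 have hol1: "h holomorphic_on (B - \<real>\<^sub>\<le>\<^sub>0)" proof -
  have "ph holomorphic_on (B - \<real>\<^sub>\<le>\<^sub>0)" unfolding ph_def by (intro holomorphic_intros) auto
  hence "(f \<circ> ph) holomorphic_on (B - \<real>\<^sub>\<le>\<^sub>0)" by (rule holomorphic_on_compose_gen[OF _ hol]) (use up in auto)
  thus ?thesis by (simp add: o_def h_def)
 qed
 have hol2: "h holomorphic_on (B - \<real>\<^sub>\<ge>\<^sub>0)" proof -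
  have "\<psi> holomorphic_on (B - \<real>\<^sub>\<ge>\<^sub>0)" unfolding \<psi>_def
   by (intro holomorphic_intros) (auto simp: complex_nonpos_Reals_iff complex_nonneg_Reals_iff)
  hence "(f \<circ> \<psi>) holomorphic_on (B - \<real>\<^sub>\<ge>\<^sub>0)"
   by (rule holomorphic_on_compose_gen[OF _ hol]) (use up in auto)
  moreover have "(f \<circ> \<psi>) w = h w" if "w : B - \<real>\<^sub>\<ge>\<^sub>0" for w
   using same[of "\<psi> w" "ph w"] ex[of w] up[of w] that by (auto simp: h_def B_def)
  ultimately show ?thesis by (rule holomorphic_transform)
 qed
 have "open B" unfolding B_def by (intro open_Diff) auto
 have "(B - \<real>\<^sub>\<le>\<^sub>0) \<union> (B - \<real>\<^sub>\<ge>\<^sub>0) = B"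
  by (auto simp: B_def complex_nonpos_Reals_iff complex_nonneg_Reals_iff complex_eq_iff)
 hence holB: "h holomorphic_on B"
  using holomorphic_on_Un[OF hol1 hol2] \<open>open B\<close> closed_nonpos_Reals_complex closed_nonneg_Reals_complex by (metis open_Diff)
 \<comment> \<open>In terms of w = q^(1/N) the exponent r becomes r N; multiplying by w^m makes the
   total order positive, so that 0 is the limit and the singularity is removable.\<close>
 obtain m :: nat where m: "r * real N + real m > 0" proof -
  obtain m :: nat where "- r * real N < real m" using reals_Archimedean2 by blast
  hence "r * real N + real m > 0" by simp
  thus ?thesis by (rule that)
 qed
 define H where "H = (%w. if w = 0 then 0 else h w * w ^ m)"
 have lim0: "((%w. h w * w ^ m) \<longlongrightarrow> 0) (at 0)" proof -
  have fl: "filterlim ph at_cusp (at 0)" unfolding at_cusp_def filterlim_filtercomap_iff proof -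
   have "filterlim (%w::complex. ln (norm w)) at_bot (at 0)" by (rule filterlim_compose[OF ln_at_0])
     (auto simp: filterlim_at eventually_at_filter intro!: tendsto_eq_intros)
   hence "filterlim (%w::complex. - ln (norm w)) at_top (at 0)" by (simp add: filterlim_uminus_at_bot)
   hence "filterlim (%w::complex. (real N / (2 * pi)) * - ln (norm w)) at_top (at 0)"
    using N by (intro filterlim_tendsto_pos_mult_at_top[OF tendsto_const]) auto
   hence "filterlim (%w::complex. - (real N / (2 * pi)) * ln (norm w)) at_top (at 0)" by simp
   moreover have "\<forall>\<^sub>F w in at 0. - (real N / (2 * pi)) * ln (norm w) = (Im \<circ> ph) w"
    using im by (auto simp: eventually_at_filter)
   ultimately show "filterlim (Im \<circ> ph) at_top (at 0)" by (rule filterlim_cong[OF refl refl, THEN iffD1, rotated])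
  qed
  have "((%t. (f t * ce (- (of_real r * t))) * ce (of_real (r + real m / real N) * t + 0)) \<longlongrightarrow> c * 0) at_cusp"
   by (intro tendsto_mult lim ce_tendsto_0) (use m N in \<open>simp add: field_simps\<close>)
  from filterlim_compose[OF this fl]
  have "((%w. (f (ph w) * ce (- (of_real r * ph w))) * ce (of_real (r + real m / real N) * ph w + 0)) \<longlongrightarrow> 0) (at 0)"
   by simp
  moreover have "\<forall>\<^sub>F w in at 0. (f (ph w) * ce (- (of_real r * ph w))) * ce (of_real (r + real m / real N) * ph w + 0) = h w * w ^ m"
   unfolding eventually_at_filter proof (intro always_eventually allI impI)
   fix w :: complex assume w: "w ~= 0"
   have "ce (- (of_real r * ph w)) * ce (of_real (r + real m / real N) * ph w + 0) = ce (of_nat m * (ph w / of_nat N))"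
    unfolding ce_add[symmetric] by (rule arg_cong[of _ _ ce]) (simp add: algebra_simps)
   also have "... = w ^ m" unfolding ce_power[symmetric] ex(1)[OF w] by simp
   finally show "(f (ph w) * ce (- (of_real r * ph w))) * ce (of_real (r + real m / real N) * ph w + 0) = h w * w ^ m"
    by (simp add: h_def mult.assoc)
  qed
  ultimately show ?thesis by (rule Lim_transform_eventually)
 qed
 have "H holomorphic_on ball 0 1" proof (rule no_isolated_singularity'[where K = "{0}"])
  have "(H \<longlongrightarrow> 0) (at 0)" using lim0 by (rule Lim_transform_eventually) (auto simp: H_def eventually_at_filter)
  thus "(H \<longlongrightarrow> H z) (at z within ball 0 1)" if "z : {0}" for z
   using that by (auto simp: H_def intro: tendsto_within_subset)
  have "(%w. h w * w ^ m) holomorphic_on (ball 0 1 - {0})" using holB unfolding B_def by (intro holomorphic_intros)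
  thus "H holomorphic_on (ball 0 1 - {0})" by (rule holomorphic_transform) (auto simp: H_def)
 qed auto
 hence "H analytic_on {0}" unfolding analytic_at by (intro exI[of _ "ball 0 1"]) auto
 hence mer: "(%w. H w / w ^ m) meromorphic_on {0}" by (intro meromorphic_intros analytic_on_imp_meromorphic_on)
 have eq: "f t = H (exp (2 * pi * \<i> * t / of_nat N)) / exp (2 * pi * \<i> * t / of_nat N) ^ m" if "Im t > 1" for t proof -
  have q: "exp (2 * pi * \<i> * t / of_nat N) = ce (t / of_nat N)" by (simp add: ce_def)
  have "h (ce (t / of_nat N)) = f t"
   unfolding h_def by (rule same) (use that ex(1)[of "ce (t / of_nat N)"] in \<open>auto simp: uhp_def\<close>)
  thus ?thesis unfolding q H_def by simp
 qed
 have "\<forall>\<^sub>\<approx>t\<in>{t. Im t > 1}. t : {t. Im t > 1}" by (rule eventually_in_cosparse) (auto simp: open_Im_gt)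
 hence "\<forall>\<^sub>\<approx>t\<in>{t. Im t > 1}. f t = H (exp (2 * pi * \<i> * t / of_nat N)) / exp (2 * pi * \<i> * t / of_nat N) ^ m"
  by eventually_elim (use eq in auto)
 thus ?thesis unfolding meromorphic_at_infinity_cusp_def using N mer
  by (intro exI[of _ N] conjI exI[of _ "%w. H w / w ^ m"] exI[of _ "1::real"]) auto
qed

subsection \<open>Reduction theory and Liouville's theorem for modular functions\<close>

text \<open>A pair (c, d) minimising |c t + d| maximises the imaginary part over the orbit. Only
  finitely many pairs have |c t + d| <= 1, so a minimum exists; it is completed to a matrix and
  followed by a translation.\<close>

lemma uhp_reduction:
 assumes "t : uhp"
 obtains A where "A : SL2Z" "\<bar>Re (moebius A t)\<bar> <= 1 / 2" "Im (moebius A t) >= 1 / 2"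
proof -
 have im: "Im t > 0" using assms by (simp add: uhp_def)
 define f where "f = (%p::int \<times> int. norm (of_int (fst p) * t + of_int (snd p)))"
 define S where "S = {p. p ~= (0, 0) & f p <= 1}"
 define k where "k = \<lceil>1 / Im t\<rceil>"
 define l where "l = \<lceil>1 + of_int k * norm t\<rceil>"
 have "S <= {-k..k} \<times> {-l..l}" proof
  fix p assume p: "p : S"
  obtain c d where cd: "p = (c, d)" by (cases p)
  have f1: "norm (of_int c * t + of_int d) <= 1" using p by (simp add: S_def f_def cd)
  have "\<bar>real_of_int c\<bar> * Im t <= 1" using abs_Im_le_cmod[of "of_int c * t + of_int d"] f1 im by (simp add: abs_mult)
  hence c1: "\<bar>real_of_int c\<bar> <= 1 / Im t" using im by (simp add: field_simps)
  hence "real_of_int \<bar>c\<bar> <= of_int k" unfolding k_def by linarith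
  hence c2: "\<bar>c\<bar> <= k" by (simp only: of_int_le_iff)
  have "\<bar>real_of_int d\<bar> = norm ((of_int c * t + of_int d) - of_int c * t :: complex)" by simp
  also have "... <= norm (of_int c * t + of_int d) + norm (of_int c * t)" by (rule norm_triangle_ineq4)
  also have "... <= 1 + \<bar>real_of_int c\<bar> * norm t" using f1 by (simp add: norm_mult)
  also have "... <= 1 + of_int k * norm t" using c2 by (intro add_left_mono mult_right_mono) auto
  finally have "real_of_int \<bar>d\<bar> <= of_int l" unfolding l_def by linarith
  hence "\<bar>d\<bar> <= l" by (simp only: of_int_le_iff)
  thus "p : {-k..k} \<times> {-l..l}" using c2 unfolding cd by auto
 qed
 hence fin: "finite S" by (rule finite_subset) auto
 have "(0, 1) : S" by (simp add: S_def f_def)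
 hence ne: "f ` S ~= {}" "finite (f ` S)" using fin by auto
 obtain c d where cdS: "(c, d) : S" and "f (c, d) = Min (f ` S)" using Min_in[OF ne(2,1)] by (metis (no_types, lifting) imageE surj_pair)
 hence min: "f (c, d) <= f p" if "p ~= (0, 0)" for p proof (cases "p : S")
  case True thus ?thesis using Min_le[OF ne(2), of "f p"] \<open>f (c, d) = Min (f ` S)\<close> by simp
 next
  case False thus ?thesis using that cdS by (auto simp: S_def)
 qed
 have fpos: "f p > 0" if "p ~= (0, 0)" for p proof -
  obtain a b where ab: "p = (a, b)" by (cases p)
  have "of_int a * t + of_int b ~= (0::complex)" proof
   assume eq: "of_int a * t + of_int b = (0::complex)"
   hence "of_int a * Im t = 0" by (simp add: complex_eq_iff)
   hence "a = 0" using im by simp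
   with eq that show False by (simp add: ab)
  qed
  thus ?thesis by (simp add: f_def ab)
 qed
 have cd0: "(c, d) ~= (0, 0)" using cdS by (simp add: S_def)
 \<comment> \<open>A common factor could be divided out, giving a pair with a smaller value.\<close>
 have "coprime c d" proof -
  define g where "g = gcd c d"
  have g: "g > 0" using cd0 by (auto simp: g_def)
  define c' d' where "c' = c div g" and "d' = d div g"
  have eq: "c = g * c'" "d = g * d'" by (auto simp: c'_def d'_def g_def)
  have "(c', d') ~= (0, 0)" using cd0 eq by auto
  have "f (c, d) = norm (of_int g * (of_int c' * t + of_int d'))"
   unfolding f_def by (subst (1) eq(1), subst (1) eq(2)) (simp add: algebra_simps)
  also have "... = of_int g * f (c', d')" using g by (simp only: norm_mult f_def) simp
  finally have "of_int g * f (c', d') <= 1 * f (c', d')" using min[OF \<open>(c', d') ~= (0, 0)\<close>] by simp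
  hence "real_of_int g <= 1" using fpos[OF \<open>(c', d') ~= (0, 0)\<close>] mult_le_cancel_right_pos by blast
  hence "g = 1" using g by linarith
  thus ?thesis by (simp add: g_def coprime_iff_gcd_eq_1)
 qed
 then obtain u v where uv: "u * c + v * d = 1" using bezout_int[of c d] by auto
 define A0 where "A0 = mat2 v (- u) c d"
 have A0: "A0 : SL2Z" using uv by (simp add: A0_def SL2Z_iff algebra_simps)
 define k where "k = round (Re (moebius A0 t))"
 define T where "T = mat2 1 (- k) 0 1"
 have T: "T : SL2Z" by (simp add: T_def SL2Z_iff)
 define A where "A = T ** A0"
 have A: "A : SL2Z" using T A0 by (simp add: A_def SL2Z_mult)
 have mA: "moebius A t = moebius A0 t - of_int k"
  unfolding A_def moebius_mult[OF T A0 assms] by (simp add: moebius_def[of "mat2 _ _ _ _"] T_def)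
 have re: "\<bar>Re (moebius A t)\<bar> <= 1 / 2"
  unfolding mA using of_int_round_abs_le[of "Re (moebius A0 t)"] by (simp add: k_def abs_minus_commute)
 have row: "m21 A = c" "m22 A = d" by (simp_all add: A_def T_def A0_def mult_nth)
 have "(m11 A, m12 A) ~= (0, 0)" using A by (auto simp: SL2Z_iff)
 hence "f (c, d) <= f (m11 A, m12 A)" by (rule min)
 \<comment> \<open>The first row of \<open>A\<close> is another nonzero pair, so the numerator is at
   least as large as the denominator.\<close>
 hence "norm (moebius A t) >= 1" using fpos[OF cd0] by (simp add: moebius_def row f_def norm_divide)
 hence "1 <= norm (moebius A t) ^ 2" by simp
 also have "... = Re (moebius A t) ^ 2 + Im (moebius A t) ^ 2" by (rule cmod_power2)
 also have "Re (moebius A t) ^ 2 <= (1 / 2) ^ 2" using re by (metis abs_ge_zero power2_abs power_mono)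
 finally have "(1 / 2) ^ 2 <= Im (moebius A t) ^ 2" by (simp add: power2_eq_square)
 moreover have "Im (moebius A t) >= 0" using moebius_in_uhp[OF A assms] by (simp add: uhp_def)
 ultimately have "Im (moebius A t) >= 1 / 2" by (rule power2_le_imp_le)
 with A re show ?thesis by (rule that)
qed

text \<open>By reduction |f| takes all its values on a compact rectangle or high up, where it is
  small. Hence it attains its maximum inside the half-plane and f is constant, equal to its limit
  0.\<close>

lemma level_one_zero:
 assumes hol: "f holomorphic_on uhp"
  and inv: "!!A t. A : SL2Z ==> t : uhp ==> f (moebius A t) = f t"
  and lim: "(f \<longlongrightarrow> 0) at_cusp" and "t : uhp"
 shows "f t = 0"
proof (rule ccontr)
 assume nz: "f t ~= 0"
 have "\<forall>\<^sub>F sg in at_cusp. norm (f sg) < norm (f t)" using tendstoD[OF lim, of "norm (f t)"] nz by simp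
 then obtain y where y: "!!sg. Im sg > y ==> norm (f sg) < norm (f t)" unfolding eventually_at_cusp by blast
 define K where "K = cbox (Complex (- 1 / 2) (1 / 2)) (Complex (1 / 2) y)"
 have Kiff: "sg : K \<longleftrightarrow> - 1 / 2 <= Re sg & Re sg <= 1 / 2 & 1 / 2 <= Im sg & Im sg <= y" for sg
  by (auto simp: K_def in_cbox_complex_iff)
 have Ku: "K <= uhp" by (auto simp: Kiff uhp_def)
 have red: "EX sg:uhp. norm (f sg) = norm (f rh) & (sg : K | Im sg > y)" if rh: "rh : uhp" for rh proof -
  obtain A where A: "A : SL2Z" "\<bar>Re (moebius A rh)\<bar> <= 1 / 2" "Im (moebius A rh) >= 1 / 2" using uhp_reduction[OF rh] .
  thus ?thesis using inv[OF A(1) rh] moebius_in_uhp[OF A(1) rh] by (intro bexI[of _ "moebius A rh"]) (auto simp: Kiff abs_le_iff)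
 qed
 obtain sg0 where sg0: "norm (f sg0) = norm (f t)" "sg0 : K" using red[OF assms(4)] y by force
 have "continuous_on K (%sg. norm (f sg))"
  using holomorphic_on_imp_continuous_on[OF hol] Ku continuous_on_subset by (intro continuous_intros) auto
 moreover have "compact K" "K ~= {}" using sg0 by (auto simp: K_def)
 ultimately obtain \<kappa> where \<kappa>: "\<kappa> : K" "!!sg. sg : K ==> norm (f sg) <= norm (f \<kappa>)"
  using continuous_attains_sup[of K "%sg. norm (f sg)"] by auto
 have bd: "norm (f rh) <= norm (f \<kappa>)" if rh: "rh : uhp" for rh proof -
  obtain sg where sg: "norm (f sg) = norm (f rh)" "sg : K | Im sg > y" using red[OF rh] by blast
  from sg(2) show ?thesis proof
   assume "sg : K" thus ?thesis using \<kappa>(2) sg(1) by metis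
  next
   assume "Im sg > y"
   hence "norm (f rh) < norm (f t)" using y sg(1) by metis
   thus ?thesis using \<kappa>(2)[OF sg0(2)] sg0(1) by simp
  qed
 qed
 have "f constant_on uhp" by (rule maximum_modulus_principle[OF hol open_uhp connected_uhp open_uhp order_refl, of \<kappa>])
   (use \<kappa>(1) Ku bd in auto)
 then obtain c where c: "!!sg. sg : uhp ==> f sg = c" by (auto simp: constant_on_def)
 have "\<forall>\<^sub>F sg in at_cusp. f sg = c" unfolding eventually_at_cusp by (intro exI[of _ 0]) (auto simp: c uhp_def)
 hence "(f \<longlongrightarrow> c) at_cusp" by (rule tendsto_eventually)
 hence "c = 0" using lim tendsto_unique[OF at_cusp_neq_bot] by blast
 thus False using c[OF assms(4)] nz by simp
qed

section \<open>Finite orbits and modular functions without poles\<close>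

lemma finite_image_factor:
 assumes "finite (g ` S)" "!!a b. a : S ==> b : S ==> g a = g b ==> F a = F b"
 shows "finite (F ` S)"
proof -
 have "F a : (%v. F (SOME b. b : S & g b = v)) ` (g ` S)" if "a : S" for a proof -
  have "(SOME b. b : S & g b = g a) : S & g (SOME b. b : S & g b = g a) = g a" by (rule someI[of _ a]) (use that in auto)
  hence "F a = F (SOME b. b : S & g b = g a)" using assms(2)[OF that] by auto
  thus ?thesis using that by blast
 qed
 hence "F ` S <= (%v. F (SOME b. b : S & g b = v)) ` (g ` S)" by blast
 thus ?thesis using assms(1) finite_subset by blast
qed

lemma Gamma_principal_iff:
 "A : Gamma_principal N \<longleftrightarrow> A : SL2Z & [m11 A = 1] (mod N) & [m12 A = 0] (mod N) \<and>
  [m21 A = 0] (mod N) & [m22 A = 1] (mod N)" by (simp add: Gamma_principal_def)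

lemma congruent_mult_minv:
 assumes "A : SL2Z" "B : SL2Z" "[m11 A = m11 B] (mod N)" "[m12 A = m12 B] (mod N)"
  "[m21 A = m21 B] (mod N)" "[m22 A = m22 B] (mod N)"
 shows "A ** minv B : Gamma_principal N"
proof -
 have det: "m11 B * m22 B - m12 B * m21 B = 1" using assms(2) by (simp add: SL2Z_iff)
 have 1: "[m11 A * m22 B + m12 A * - m21 B = m11 B * m22 B + m12 B * - m21 B] (mod N)" by (intro cong_add cong_mult cong_refl assms)
 have 2: "[m11 A * - m12 B + m12 A * m11 B = m11 B * - m12 B + m12 B * m11 B] (mod N)" by (intro cong_add cong_mult cong_refl assms)
 have 3: "[m21 A * m22 B + m22 A * - m21 B = m21 B * m22 B + m22 B * - m21 B] (mod N)" by (intro cong_add cong_mult cong_refl assms)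
 have 4: "[m21 A * - m12 B + m22 A * m11 B = m21 B * - m12 B + m22 B * m11 B] (mod N)" by (intro cong_add cong_mult cong_refl assms)
 have e: "m11 B * m22 B + m12 B * - m21 B = 1" "m11 B * - m12 B + m12 B * m11 B = 0"
  "m21 B * m22 B + m22 B * - m21 B = 0" "m21 B * - m12 B + m22 B * m11 B = 1" using det by (simp_all add: algebra_simps)
 show ?thesis unfolding Gamma_principal_iff mult_nth minv_nth
  using 1 2 3 4 SL2Z_mult[OF assms(1) minv_SL2Z[OF assms(2)]] unfolding e by blast
qed

lemma mact_cong:
 assumes fx: "!!A. A : Gamma_principal N ==> mact A x = x"
  and AB: "A : SL2Z" "B : SL2Z" "[m11 A = m11 B] (mod N)" "[m12 A = m12 B] (mod N)"
  "[m21 A = m21 B] (mod N)" "[m22 A = m22 B] (mod N)"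
 shows "mact A x = mact B x"
proof -
 have C: "A ** minv B : Gamma_principal N" by (rule congruent_mult_minv[OF AB])
 hence CS: "A ** minv B : SL2Z" by (simp add: Gamma_principal_iff)
 have "(A ** minv B) ** B = A" by (simp add: matrix_mul_assoc[symmetric] minv_mult AB)
 hence "mact A x = mact B (mact (A ** minv B) x)" using mact_mact[OF CS AB(2)] by simp
 thus ?thesis using fx[OF C] by simp
qed

text \<open>The action on functions of level N depends only on the matrix entries modulo N. Pairs
  are tracked jointly because a function and its companion must be moved by the same matrix.\<close>

lemma finite_orbit:
 assumes "N > 0" "!!A. A : Gamma_principal N ==> mact A x = x" "!!A. A : Gamma_principal N ==> mact A y = y"
 shows "finite ((%A. (mact A x, mact A y)) ` SL2Z)"
proof (rule finite_image_factor[where g = "%A. (m11 A mod N, m12 A mod N, m21 A mod N, m22 A mod N)"])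
 have "(%A. (m11 A mod N, m12 A mod N, m21 A mod N, m22 A mod N)) ` SL2Z <= {0..N} \<times> {0..N} \<times> {0..N} \<times> {0..N}"
  using assms(1) pos_mod_sign[of N] pos_mod_bound[of N] by (force intro: less_imp_le)
 thus "finite ((%A. (m11 A mod N, m12 A mod N, m21 A mod N, m22 A mod N)) ` SL2Z)" by (rule finite_subset) auto
 fix A B assume "A : SL2Z" "B : SL2Z" "(m11 A mod N, m12 A mod N, m21 A mod N, m22 A mod N) = (m11 B mod N, m12 B mod N, m21 B mod N, m22 B mod N)"
 hence AB: "A : SL2Z" "B : SL2Z" "[m11 A = m11 B] (mod N)" "[m12 A = m12 B] (mod N)"
  "[m21 A = m21 B] (mod N)" "[m22 A = m22 B] (mod N)" by (auto simp: cong_def)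
 show "(mact A x, mact A y) = (mact B x, mact B y)" using mact_cong[OF assms(2) AB] mact_cong[OF assms(3) AB] by simp
qed

lemma reg_imp_holomorphic: "(!!t. t : uhp ==> reg x t) ==> nf x holomorphic_on uhp"
 by (meson analytic_imp_holomorphic analytic_on_analytic_at reg_def)

lemma eventually_uhp_at_cusp: "\<forall>\<^sub>F t in at_cusp. t : uhp" unfolding eventually_at_cusp uhp_def by auto

text \<open>The product of z - L over the finite orbit of x, with L the value of x at infinity, has
  level one and vanishes at the cusp. So it is 0, and in a field one of its factors is.\<close>

lemma bounded_modular_const:
 assumes "N > 0" and fx: "!!A. A : Gamma_principal N ==> mact A x = x"
  and reg: "!!t. t : uhp ==> reg x t"
  and lim: "!!A. A : SL2Z ==> EX l. (nf (mact A x) \<longlongrightarrow> l) at_cusp"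
 shows "EX c. x = mero_const c"
proof -
 define X where "X = (%A. mact A x) ` SL2Z"
 have "finite ((%A. (mact A x, mact A x)) ` SL2Z)" by (rule finite_orbit[OF assms(1)]) (use fx in auto)
 hence "finite (fst ` (%A. (mact A x, mact A x)) ` SL2Z)" by blast
 hence fin: "finite X" by (simp add: X_def image_image)
 have xX: "x : X" unfolding X_def by (rule image_eqI[of _ _ "mat 1"]) (auto simp: mat_1_SL2Z)
 obtain L where L: "(nf x \<longlongrightarrow> L) at_cusp" using lim[OF mat_1_SL2Z] by auto
 have regX: "reg z t" if "z : X" "t : uhp" for z t using that reg by (auto simp: X_def nf_mact moebius_in_uhp)
 have "ALL z:X. EX l. (nf z \<longlongrightarrow> l) at_cusp" using lim by (auto simp: X_def)
 then obtain l where l: "!!z. z : X ==> (nf z \<longlongrightarrow> l z) at_cusp" by metis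
 have lx: "l x = L" using l[OF xX] L tendsto_unique[OF at_cusp_neq_bot] by blast
 define P where "P = (PROD z:X. z - mero_const L)"
 have nfP: "reg P t & nf P t = (PROD z:X. nf z t - L)" if "t : uhp" for t unfolding P_def using nf_prod[of X "%z. z - mero_const L" t] that
  by (simp add: nf_diff regX reg_const nf_const)
 have inv: "mact B P = P" if B: "B : SL2Z" for B proof -
  have "mact B ` X <= X" using B by (auto simp: X_def mact_mact SL2Z_mult)
  moreover have inj: "inj_on (mact B) X" by (auto intro!: inj_onI simp: mact_inj[OF B])
  ultimately have img: "mact B ` X = X" using endo_inj_surj[OF fin] by blast
  have "mact B P = (PROD z:X. mact B z - mero_const L)" unfolding P_def by (simp add: mact_prod mact_diff mact_const B)
  also have "... = (PROD z:mact B ` X. z - mero_const L)" by (simp add: prod.reindex[OF inj])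
  finally show ?thesis unfolding img P_def .
 qed
 have "nf P t = 0" if "t : uhp" for t proof (rule level_one_zero[OF _ _ _ that])
  show "nf P holomorphic_on uhp" by (rule reg_imp_holomorphic) (use nfP in auto)
  show "nf P (moebius A sg) = nf P sg" if "A : SL2Z" "sg : uhp" for A sg using nf_mact(1)[OF that, of P] inv[OF that(1)] by simp
  have 1: "((%t. PROD z:X. nf z t - L) \<longlongrightarrow> (PROD z:X. l z - L)) at_cusp"
   by (intro tendsto_prod tendsto_diff tendsto_const l)
  have 2: "(PROD z:X. l z - L) = 0" using fin xX lx by (intro prod_zero) auto
  have 3: "\<forall>\<^sub>F t in at_cusp. (PROD z:X. nf z t - L) = nf P t"
   using eventually_uhp_at_cusp by eventually_elim (use nfP in auto)
  show "(nf P \<longlongrightarrow> 0) at_cusp" using Lim_transform_eventually[OF 1 3] unfolding 2 .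
 qed
 hence "P = 0" using eq_nfI[of P 0] nf_const[of _ 0] by (simp add: mero_const_0)
 then obtain z where "z : X" "z = mero_const L" using fin by (auto simp: P_def prod_zero_iff)
 then obtain A where A: "A : SL2Z" "mact A x = mero_const L" by (auto simp: X_def)
 hence "mact A x = mact A (mero_const L)" by (simp add: mact_const)
 thus ?thesis using mact_inj[OF A(1)] by blast
qed

lemma order_shift:
 assumes "((%t. f t * ce (- (of_real r * t))) \<longlongrightarrow> c) at_cusp" "s < r"
 shows "((%t. f t * ce (- (of_real s * t))) \<longlongrightarrow> 0) at_cusp"
proof -
 have "((%t. (f t * ce (- (of_real r * t))) * ce (of_real (r - s) * t + 0)) \<longlongrightarrow> c * 0) at_cusp"
  by (intro tendsto_mult assms(1) ce_tendsto_0) (use assms(2) in simp)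
 moreover have "(%t. (f t * ce (- (of_real r * t))) * ce (of_real (r - s) * t + 0)) = (%t. f t * ce (- (of_real s * t)))"
  unfolding mult.assoc ce_add[symmetric] by (simp add: algebra_simps)
 ultimately show ?thesis by (simp only: mult_zero_right)
qed

lemma order_less:
 assumes "((%t. f t * ce (- (of_real r * t))) \<longlongrightarrow> c) at_cusp" "c ~= 0"
  and "((%t. f t * ce (- (of_real s * t))) \<longlongrightarrow> 0) at_cusp"
 shows "s < r"
proof (rule ccontr)
 assume "~ s < r"
 hence "((%t. f t * ce (- (of_real r * t))) \<longlongrightarrow> 0) at_cusp"
  using order_shift[OF assms(3), of r] assms(3) by (cases "s = r") auto
 thus False using assms(1,2) tendsto_unique[OF at_cusp_neq_bot] by blast
qed

lemma order_unique:
 assumes "((%t. f t * ce (- (of_real r * t))) \<longlongrightarrow> c) at_cusp" "c ~= 0"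
  and "((%t. f t * ce (- (of_real s * t))) \<longlongrightarrow> d) at_cusp" "d ~= 0"
 shows "r = s"
proof (rule linorder_cases[of r s])
 assume "r < s"
 from order_less[OF assms(1,2) order_shift[OF assms(3) this]] show ?thesis by simp
next
 assume "s < r"
 from order_less[OF assms(3,4) order_shift[OF assms(1) this]] show ?thesis by simp
qed

text \<open>Replacing t by t + 1 multiplies q^r by e^(2 pi i r), so a nonzero leading coefficient
  forces r to be an integer.\<close>

lemma order_integral:
 assumes "((%t. f t * ce (- (of_real r * t))) \<longlongrightarrow> c) at_cusp" "c ~= 0"
  and per: "!!t. t : uhp ==> f (t + 1) = f t"
 shows "r : \<int>"
proof -
 have "filterlim (Im \<circ> (%t. t + 1)) at_top at_cusp" using Im_at_cusp by (simp add: o_def)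
 hence fl: "filterlim (%t. t + 1) at_cusp at_cusp" unfolding at_cusp_def filterlim_filtercomap_iff .
 from filterlim_compose[OF assms(1) fl]
 have 1: "((%t. f (t + 1) * ce (- (of_real r * (t + 1)))) \<longlongrightarrow> c) at_cusp" .
 have "((%t. (f t * ce (- (of_real r * t))) * ce (- of_real r)) \<longlongrightarrow> c * ce (- of_real r)) at_cusp"
  by (intro tendsto_mult tendsto_const assms)
 moreover have "\<forall>\<^sub>F t in at_cusp. (f t * ce (- (of_real r * t))) * ce (- of_real r) = f (t + 1) * ce (- (of_real r * (t + 1)))"
  using eventually_uhp_at_cusp proof eventually_elim
  case (elim t)
  show ?case unfolding per[OF elim] mult.assoc ce_add[symmetric] by (simp add: algebra_simps)
 qed
 ultimately have "((%t. f (t + 1) * ce (- (of_real r * (t + 1)))) \<longlongrightarrow> c * ce (- of_real r)) at_cusp"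
  by (rule Lim_transform_eventually)
 with 1 have "c * ce (- of_real r) = c" using tendsto_unique[OF at_cusp_neq_bot] by blast
 hence "ce (- of_real r) = 1" using assms(2) by simp
 then obtain k where "- complex_of_real r = of_int k" unfolding ce_eq_1_iff by (rule Ints_cases)
 hence "r = of_int (- k)" by (metis add.inverse_inverse of_int_minus of_real_eq_iff of_real_of_int_eq)
 thus ?thesis by simp
qed

subsection \<open>Hauptmoduln\<close>

lemma C_subfield_hull: "C_subfield (C_adjoin S)" unfolding C_adjoin_def by (rule hull_in) (auto simp: C_subfield_def subset_iff)

lemma C_adjoin_subset: "S <= C_adjoin S" unfolding C_adjoin_def by (rule hull_subset)

lemma C_adjoin_minimal: "S <= F ==> C_subfield F ==> C_adjoin S <= F" unfolding C_adjoin_def by (rule hull_minimal)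

lemma C_subfield_closed:
 assumes "C_subfield F"
 shows "mero_const c : F" "0 : F" "1 : F" "numeral k : F"
  "x : F ==> y : F ==> x + y : F" "x : F ==> y : F ==> x * y : F"
  "x : F ==> - x : F" "x : F ==> inverse x : F"
  "x : F ==> y : F ==> x - y : F" "x : F ==> y : F ==> x / y : F"
  "x : F ==> x ^ n : F"
proof -
 show c: "mero_const c : F" for c using assms unfolding C_subfield_def by blast
 show "0 : F" using c[of 0] by (simp add: mero_const_0)
 show 1: "1 : F" using c[of 1] by (simp add: mero_const_1)
 show "numeral k : F" using c[of "numeral k"] by (simp add: mero_const_numeral)
 show add: "x : F ==> y : F ==> x + y : F" for x y using assms unfolding C_subfield_def by blast
 show mult: "x : F ==> y : F ==> x * y : F" for x y using assms unfolding C_subfield_def by blast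
 show minus: "x : F ==> - x : F" for x using assms unfolding C_subfield_def by blast
 show inv: "x : F ==> inverse x : F" for x using assms unfolding C_subfield_def by blast
 show "x : F ==> y : F ==> x - y : F" using add[of x "- y"] minus by simp
 show "x : F ==> y : F ==> x / y : F" using mult[of x "inverse y"] inv by (simp add: divide_inverse)
 show "x : F ==> x ^ n : F" by (induction n) (auto intro: 1 mult)
qed

lemma C_subfield_sum: "C_subfield F ==> (!!i. i : I ==> f i : F) ==> (SUM i:I. f i) : F"
 by (induction I rule: infinite_finite_induct) (auto simp: C_subfield_closed)

lemma C_subfield_prod: "C_subfield F ==> (!!i. i : I ==> f i : F) ==> (PROD i:I. f i) : F"
 by (induction I rule: infinite_finite_induct) (auto simp: C_subfield_closed)

text \<open>A zero of w beats a pole of finite order. The conclusion holds for all large exponents,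
  so that finitely many poles can share one.\<close>

lemma kill_pole:
 assumes w: "reg w s" "nf w s = 0"
 shows "EX n. \<forall>m\<ge>n. reg (w ^ m * z) s"
proof (cases "z = 0")
 case True
 thus ?thesis using w reg_const[of s 0] by (auto simp: mero_const_0 reg_def)
next
 case False
 have u: "s : uhp" using w by (simp add: reg_def)
 have nz: "\<forall>\<^sub>\<approx>s\<in>uhp. nf z s ~= 0"
  using nicely_meromorphic_imp_constant_or_avoid[OF nf_nicely open_uhp connected_uhp, of z 0] proof
  assume "ALL s:uhp. nf z s = 0"
  hence "z = 0" using eq_nfI[of z 0] nf_const[of _ 0] by (simp add: mero_const_0)
  thus ?thesis using False by simp
 qed
 have iso: "isolated_singularity_at (nf z) s" "not_essential (nf z) s"
  using meromorphic_on_subset[OF nf_meromorphic[of z], of "{s}"] u by (auto simp: meromorphic_at_iff)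
 have "\<forall>\<^sub>F t in at s. nf z t ~= 0" using nz u by (simp add: eventually_cosparse_open_eq[OF open_uhp])
 hence freq: "\<exists>\<^sub>F t in at s. nf z t ~= 0" by (rule eventually_frequently[rotated]) simp
 define p where "p = zorder (nf z) s"
 define g where "g = zor_poly (nf z) s"
 obtain r where r: "r > 0" "g holomorphic_on cball s r"
  "!!t. t : cball s r - {s} ==> nf z t = g t * (t - s) powi p" using zorder_exist[OF iso freq] unfolding p_def g_def by auto
 obtain S where S: "open S" "s : S" "nf w holomorphic_on S" using w(1) unfolding reg_def analytic_at by blast
 define w1 where "w1 = (%t. if t = s then deriv (nf w) s else (nf w t - nf w s) / (t - s))"
 have w1: "w1 holomorphic_on S" unfolding w1_def by (rule pole_lemma_open[OF S(3,1)])
 have ww: "nf w t = (t - s) * w1 t" for t using w(2) by (auto simp: w1_def)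
 define U where "U = S \<inter> ball s r"
 have U: "open U" "s : U" using S r by (auto simp: U_def)
 show ?thesis proof (intro exI[of _ "nat (- p)"] allI impI)
  fix m assume m: "m >= nat (- p)"
  define F where "F = (%t. w1 t ^ m * g t * (t - s) ^ nat (int m + p))"
  have "F holomorphic_on U" unfolding F_def using w1 r(2) by (intro holomorphic_intros) (auto simp: U_def intro: holomorphic_on_subset)
  hence an: "F analytic_on {s}" unfolding analytic_at using U by blast
  have "mero_of (%t. nf w t ^ m * nf z t) = w ^ m * z" proof -
   have "mero_of (%t. nf w t ^ k) = w ^ k" for k proof (induction k)
    case 0 show ?case by (simp add: mero_of_const mero_const_1)
   next
    case (Suc k)
    have "mero_of (%t. nf w t * nf w t ^ k) = mero_of (nf w) * mero_of (%t. nf w t ^ k)"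
     by (rule mero_of_mult) (intro meromorphic_intros)+
    thus ?case using Suc by simp
   qed
   thus ?thesis by (subst mero_of_mult) (auto intro!: meromorphic_intros)
  qed
  hence "\<forall>\<^sub>\<approx>t\<in>uhp. nf w t ^ m * nf z t = nf (w ^ m * z) t"
   using mero_of_eq_iff[of "%t. nf w t ^ m * nf z t" "nf (w ^ m * z)"] by (simp add: meromorphic_intros)
  hence 1: "\<forall>\<^sub>F t in at s. nf w t ^ m * nf z t = nf (w ^ m * z) t"
   using u by (simp add: eventually_cosparse_open_eq[OF open_uhp])
  have 2: "\<forall>\<^sub>F t in at s. t : U - {s}" by (rule eventually_at_in_open[OF U])
  have "\<forall>\<^sub>F t in at s. F t = nf (w ^ m * z) t" using 1 2 proof eventually_elim
   case (elim t)
   have t: "t - s ~= 0" "t : cball s r - {s}" using elim(2) by (auto simp: U_def)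
   have "(t - s) ^ m * (t - s) powi p = (t - s) powi (int m + p)" using t(1) by (simp add: power_int_add)
   also have "... = (t - s) ^ nat (int m + p)" using m by (simp add: power_int_def)
   finally have "(t - s) ^ m * (t - s) powi p = (t - s) ^ nat (int m + p)" .
   hence "nf w t ^ m * nf z t = F t" unfolding F_def ww r(3)[OF t(2)] by (simp add: power_mult_distrib mult_ac)
   thus ?case using elim(1) by simp
  qed
  from nf_eq_at(1)[OF an u this] show "reg (w ^ m * z) s" .
 qed
qed

text \<open>Near the cusp the leading term shows regularity, and what remains of the strip is
  compact.\<close>

lemma finite_poles:
 assumes "mcusp z"
 shows "finite {t. \<bar>Re t\<bar> <= 1 / 2 & Im t >= 1 / 2 & ~ reg z t}"
proof (cases "z = 0")
 case True
 have "{t. \<bar>Re t\<bar> <= 1 / 2 & Im t >= 1 / 2 & ~ reg z t} = {}" using reg_const[of _ 0] True by (auto simp: mero_const_0 uhp_def)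
 thus ?thesis by (simp only: finite.emptyI)
next
 case False
 obtain y where y: "!!t. Im t > y ==> reg z t" using cusp_order[OF assms False] unfolding eventually_at_cusp by metis
 define K where "K = cbox (Complex (- 1 / 2) (1 / 2)) (Complex (1 / 2) y)"
 have Ku: "K <= uhp" by (auto simp: K_def in_cbox_complex_iff uhp_def)
 have "{t. ~ nf z analytic_on {t}} sparse_in uhp"
  using meromorphic_on_imp_analytic_cosparse[OF nf_meromorphic[of z]] by (simp add: eventually_cosparse)
 hence "{t. ~ nf z analytic_on {t}} sparse_in K" using Ku by (rule sparse_in_subset)
 moreover have "compact K" by (simp add: K_def)
 ultimately have "finite (K \<inter> {t. ~ nf z analytic_on {t}})" by (rule sparse_in_compact_finite)
 moreover have "{t. \<bar>Re t\<bar> <= 1 / 2 & Im t >= 1 / 2 & ~ reg z t} <= K \<inter> {t. ~ nf z analytic_on {t}}"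
  using y by (force simp: K_def in_cbox_complex_iff reg_def uhp_def abs_le_iff not_less)
 ultimately show ?thesis by (rule finite_subset[rotated])
qed

lemma power_order:
 assumes "((%t. f t * ce (- (of_real r * t))) \<longlongrightarrow> c) at_cusp"
 shows "((%t. f t ^ m * ce (- (of_real (real m * r) * t))) \<longlongrightarrow> c ^ m) at_cusp"
proof -
 have "((%t. (f t * ce (- (of_real r * t))) ^ m) \<longlongrightarrow> c ^ m) at_cusp" by (intro tendsto_power assms)
 moreover have "(f t * ce (- (of_real r * t))) ^ m = f t ^ m * ce (- (of_real (real m * r) * t))" for t
  by (simp add: power_mult_distrib ce_power mult_ac)
 ultimately show ?thesis by simp
qed

lemma mult_order:
 assumes "((%t. f t * ce (- (of_real r * t))) \<longlongrightarrow> c) at_cusp"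
  and "((%t. g t * ce (- (of_real s * t))) \<longlongrightarrow> d) at_cusp"
 shows "((%t. f t * g t * ce (- (of_real (r + s) * t))) \<longlongrightarrow> c * d) at_cusp"
proof -
 have "((%t. (f t * ce (- (of_real r * t))) * (g t * ce (- (of_real s * t)))) \<longlongrightarrow> c * d) at_cusp"
  by (intro tendsto_mult assms)
 moreover have "(f t * ce (- (of_real r * t))) * (g t * ce (- (of_real s * t))) = f t * g t * ce (- (of_real (r + s) * t))" for t proof -
  have "ce (- (of_real (r + s) * t)) = ce (- (of_real r * t)) * ce (- (of_real s * t))"
   unfolding ce_add[symmetric] by (simp add: algebra_simps)
  thus ?thesis by simp
 qed
 ultimately show ?thesis by simp
qed

text \<open>The last assumption says that infinity is the only cusp with a pole: at any other cusp
  the function stays finite, and a matrix for which it does not must act trivially on the whole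
  field. The translation in G gives infinity width one, and \<open>c0\<close> makes the pole there
  simple.\<close>

locale hauptmodul =
 fixes G :: "(int^2^2) set" and N :: int and \<upsilon> :: mero and c0 :: complex
 assumes G: "G <= SL2Z" and N: "N > 0" "Gamma_principal N <= G" and T: "mat2 1 1 0 1 : G"
  and \<upsilon>: "\<upsilon> : A0 G" and \<upsilon>_reg: "!!t. t : uhp ==> reg \<upsilon> t"
  and \<upsilon>_lim: "((%t. nf \<upsilon> t * ce t) \<longlongrightarrow> c0) at_cusp" and c0: "c0 ~= 0"
  and cusps: "!!A. A : SL2Z ==> (EX l. (nf (mact A \<upsilon>) \<longlongrightarrow> l) at_cusp) | (ALL x:A0 G. mact A x = x)"
begin

lemma A0_fixed: "x : A0 G ==> A : Gamma_principal N ==> mact A x = x" using N(2) by (auto simp: A0_altdef[OF G])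

lemma A0_cusp: "x : A0 G ==> A : SL2Z ==> mcusp (mact A x)" by (auto simp: A0_altdef[OF G])

text \<open>Subtracting a suitable multiple of \<open>\<upsilon> ^ Suc m\<close> lowers the pole
  order at infinity without creating poles elsewhere; once no pole is left the function is
  constant.\<close>

lemma regular_poly:
 assumes "y : A0 G" "!!t. t : uhp ==> reg y t"
  and "!!A. A : SL2Z ==> EX l. (nf (mact A \<upsilon>) \<longlongrightarrow> l) at_cusp ==> EX l. (nf (mact A y) \<longlongrightarrow> l) at_cusp"
  and "((%t. nf y t * ce (- (of_real (- real m) * t))) \<longlongrightarrow> c) at_cusp"
 shows "y : C_adjoin {\<upsilon>}" using assms
proof (induction m arbitrary: y c)
 case 0
 hence "EX l. (nf (mact A y) \<longlongrightarrow> l) at_cusp" if "A : SL2Z" for A using cusps[OF that] that by auto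
 then obtain k where "y = mero_const k" using bounded_modular_const[OF N(1) A0_fixed[OF 0(1)] 0(2)] by blast
 thus ?case using C_subfield_closed(1)[OF C_subfield_hull] by simp
next
 case (Suc m y c)
 define k where "k = c / c0 ^ Suc m"
 define y' where "y' = y - mero_const k * \<upsilon> ^ Suc m"
 note cl = C_subfield_closed[OF A0_subfield[OF G]]
 have y'A: "y' : A0 G" unfolding y'_def by (intro cl Suc.prems(1) \<upsilon>)
 have p: "reg (mact A x) t" if "A : SL2Z" "t : uhp" "!!t. t : uhp ==> reg x t" for A x t using that by (simp add: nf_mact moebius_in_uhp)
 have nfA: "nf (mact A y') t = nf (mact A y) t - k * nf (mact A \<upsilon>) t ^ Suc m" "reg (mact A y') t" if A: "A : SL2Z" "t : uhp" for A t
 proof -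
  note r = p[OF A \<upsilon>_reg] p[OF A Suc.prems(2)]
  have r2: "reg (mero_const k * mact A \<upsilon> ^ Suc m) t" by (rule nf_mult(1)[OF reg_const[OF A(2)] nf_power(1)[OF r(1)]])
  have eq: "mact A y' = mact A y - mero_const k * mact A \<upsilon> ^ Suc m"
   unfolding y'_def by (simp only: mact_diff mact_mult mact_const mact_power A)
  show "reg (mact A y') t" unfolding eq by (rule nf_diff(1)[OF r(2) r2])
  show "nf (mact A y') t = nf (mact A y) t - k * nf (mact A \<upsilon>) t ^ Suc m"
   by (simp only: eq nf_diff(2)[OF r(2) r2] nf_mult(2)[OF reg_const[OF A(2)] nf_power(1)[OF r(1)]]
     nf_power(2)[OF r(1)] nf_const[OF A(2)])
 qed
 have reg': "reg y' t" if "t : uhp" for t using nfA(2)[OF mat_1_SL2Z that] by simp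
 have lim': "EX l. (nf (mact A y') \<longlongrightarrow> l) at_cusp" if A: "A : SL2Z" "EX l. (nf (mact A \<upsilon>) \<longlongrightarrow> l) at_cusp" for A
 proof -
  obtain l1 l2 where l: "(nf (mact A \<upsilon>) \<longlongrightarrow> l1) at_cusp" "(nf (mact A y) \<longlongrightarrow> l2) at_cusp"
   using A(2) Suc.prems(3)[OF A] by blast
  have "((%t. nf (mact A y) t - k * nf (mact A \<upsilon>) t ^ Suc m) \<longlongrightarrow> l2 - k * l1 ^ Suc m) at_cusp"
   by (intro tendsto_intros l)
  moreover have "\<forall>\<^sub>F t in at_cusp. nf (mact A y) t - k * nf (mact A \<upsilon>) t ^ Suc m = nf (mact A y') t"
   using eventually_uhp_at_cusp by eventually_elim (simp only: nfA A)
  ultimately have "(nf (mact A y') \<longlongrightarrow> l2 - k * l1 ^ Suc m) at_cusp" by (rule Lim_transform_eventually)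
  thus ?thesis by blast
 qed
 have "y' : C_adjoin {\<upsilon>}" proof (cases "y' = 0")
  case True thus ?thesis by (simp add: C_subfield_closed(2)[OF C_subfield_hull])
 next
  case False
  have z: "((%t. nf y' t * ce (- (of_real (- real (Suc m)) * t))) \<longlongrightarrow> 0) at_cusp" proof -
   have "((%t. nf \<upsilon> t * ce (- (of_real (- 1) * t))) \<longlongrightarrow> c0) at_cusp" using \<upsilon>_lim by simp
   from power_order[OF this, of "Suc m"]
   have "((%t. nf \<upsilon> t ^ Suc m * ce (- (of_real (- real (Suc m)) * t))) \<longlongrightarrow> c0 ^ Suc m) at_cusp"
    by (simp only: mult_minus1_right)
   hence "((%t. nf y t * ce (- (of_real (- real (Suc m)) * t)) - k * (nf \<upsilon> t ^ Suc m * ce (- (of_real (- real (Suc m)) * t)))) \<longlongrightarrow> c - k * c0 ^ Suc m) at_cusp"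
    by (intro tendsto_diff tendsto_mult tendsto_const Suc.prems(4))
   moreover have "c - k * c0 ^ Suc m = 0" using c0 by (simp add: k_def)
   moreover have "\<forall>\<^sub>F t in at_cusp. nf y t * ce (- (of_real (- real (Suc m)) * t)) - k * (nf \<upsilon> t ^ Suc m * ce (- (of_real (- real (Suc m)) * t))) = nf y' t * ce (- (of_real (- real (Suc m)) * t))"
    using eventually_uhp_at_cusp proof eventually_elim
    case (elim t)
    show ?case using nfA(1)[OF mat_1_SL2Z elim] by (simp add: left_diff_distrib)
   qed
   ultimately show ?thesis using Lim_transform_eventually[of _ "c - k * c0 ^ Suc m"] by simp
  qed
  obtain r d where r: "d ~= 0" "((%t. nf y' t * ce (- (of_real r * t))) \<longlongrightarrow> d) at_cusp"
   using cusp_order[OF A0_cusp[OF y'A mat_1_SL2Z, unfolded mact_mat1] False] by metis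
  have TS: "mat2 1 1 0 1 : SL2Z" using T G by blast
  have "mact (mat2 1 1 0 1) y' = y'" using y'A T by (auto simp: A0_altdef[OF G])
  hence "nf y' (t + 1) = nf y' t" if "t : uhp" for t using nf_mact(1)[OF TS that, of y'] by (simp add: moebius_def)
  \<comment> \<open>Width one makes the order integral, so cancelling the leading term gains a full
    unit.\<close>
  hence "r : \<int>" by (rule order_integral[OF r(2,1)])
  moreover have "- real (Suc m) < r" by (rule order_less[OF r(2,1) z])
  ultimately have "r >= - real m" proof -
   obtain k where k: "r = of_int k" using \<open>r : \<int>\<close> by (rule Ints_cases)
   hence "real_of_int (- int m - 1) < of_int k" using \<open>- real (Suc m) < r\<close> by simp
   hence "- int m <= k" by (simp only: of_int_less_iff)
   hence "real_of_int (- int m) <= of_int k" by (simp only: of_int_le_iff)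
   thus ?thesis by (simp add: k)
  qed
  hence "EX c'. ((%t. nf y' t * ce (- (of_real (- real m) * t))) \<longlongrightarrow> c') at_cusp"
   using order_shift[OF r(2), of "- real m"] r(2) by (cases "r = - real m") auto
  thus ?thesis using Suc.IH[OF y'A reg' lim'] by blast
 qed
 moreover have "y = y' + mero_const k * \<upsilon> ^ Suc m" by (simp add: y'_def)
 moreover have "\<upsilon> : C_adjoin {\<upsilon>}" using C_adjoin_subset by blast
 ultimately show ?case using C_subfield_closed[OF C_subfield_hull[of "{\<upsilon>}"]] by simp
qed

lemma not_const: "\<upsilon> - mero_const v ~= 0"
proof
 assume "\<upsilon> - mero_const v = 0"
 hence eq: "\<upsilon> = mero_const v" by simp
 have "((%t. v * ce (of_real 1 * t + 0)) \<longlongrightarrow> v * 0) at_cusp" by (intro tendsto_mult tendsto_const ce_tendsto_0) simp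
 moreover have "\<forall>\<^sub>F t in at_cusp. v * ce (of_real 1 * t + 0) = nf \<upsilon> t * ce t"
  using eventually_uhp_at_cusp by eventually_elim (simp add: eq nf_const)
 ultimately have "((%t. nf \<upsilon> t * ce t) \<longlongrightarrow> v * 0) at_cusp" by (rule Lim_transform_eventually)
 thus False using \<upsilon>_lim c0 tendsto_unique[OF at_cusp_neq_bot] by fastforce
qed

lemma factor_props:
 fixes n :: nat
 assumes "finite V"
 defines "R \<equiv> PROD v:V. (\<upsilon> - mero_const v) ^ n"
 shows "R : A0 G" "R : C_adjoin {\<upsilon>}" "R ~= 0" "t : uhp ==> reg R t"
  "A : SL2Z ==> mact A R = (PROD v:V. (mact A \<upsilon> - mero_const v) ^ n)"
proof -
 note cl = C_subfield_closed[OF A0_subfield[OF G]]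
 note cl2 = C_subfield_closed[OF C_subfield_hull[of "{\<upsilon>}"]]
 have u: "\<upsilon> : C_adjoin {\<upsilon>}" using C_adjoin_subset by blast
 show "R : A0 G" unfolding R_def by (intro C_subfield_prod A0_subfield G cl \<upsilon>)
 show "R : C_adjoin {\<upsilon>}" unfolding R_def by (intro C_subfield_prod C_subfield_hull cl2 u)
 show "R ~= 0" unfolding R_def using not_const assms(1) by (simp add: prod_zero_iff)
 show "reg R t" if "t : uhp" unfolding R_def by (intro nf_prod nf_power nf_diff \<upsilon>_reg reg_const that)
 show "A : SL2Z ==> mact A R = (PROD v:V. (mact A \<upsilon> - mero_const v) ^ n)"
  unfolding R_def by (simp add: mact_prod mact_power mact_diff mact_const)
qed

text \<open>For each pole a high power of \<open>\<upsilon>\<close> minus its value there removes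
  the pole. Up to the group only finitely many poles lie in the reduced strip, so a finite product
  does.\<close>

lemma kill_all_poles:
 assumes "x : A0 G"
 obtains R where "R : A0 G" "R : C_adjoin {\<upsilon>}" "R ~= 0" "ALL t:uhp. reg (R * x) t"
proof -
 define Orb where "Orb = (%A. (mact A x, mact A \<upsilon>)) ` SL2Z"
 have fin: "finite Orb" unfolding Orb_def by (rule finite_orbit[OF N(1)]) (use A0_fixed assms \<upsilon> in auto)
 define Bad where "Bad = (%z. {t. \<bar>Re t\<bar> <= 1 / 2 & Im t >= 1 / 2 & ~ reg z t})"
 \<comment> \<open>Poles are listed with the translate of \<open>\<upsilon>\<close> belonging to
   them, because the value of \<open>\<upsilon>\<close> at the original pole is the value of that
   translate at the reduced point.\<close>
 define Q where "Q = (SIGMA p:Orb. Bad (fst p))"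
 have finQ: "finite Q" unfolding Q_def proof (rule finite_SigmaI[OF fin])
  fix p assume "p : Orb"
  hence "mcusp (fst p)" using A0_cusp[OF assms] by (auto simp: Orb_def)
  thus "finite (Bad (fst p))" unfolding Bad_def by (rule finite_poles)
 qed
 have regw: "reg w t" if "(z, w) : Orb" "t : uhp" for z w t using that \<upsilon>_reg by (auto simp: Orb_def nf_mact moebius_in_uhp)
 have "EX n. \<forall>m\<ge>n. reg ((snd (fst q) - mero_const (nf (snd (fst q)) (snd q))) ^ m * fst (fst q)) (snd q)" if "q : Q" for q
 proof -
  obtain z w t where q: "q = ((z, w), t)" by (metis surj_pair)
  have t: "(z, w) : Orb" "t : uhp" using that by (auto simp: q Q_def Bad_def uhp_def)
  have "reg (w - mero_const (nf w t)) t" "nf (w - mero_const (nf w t)) t = 0"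
   using nf_diff[OF regw[OF t] reg_const[OF t(2)]] nf_const[OF t(2)] by auto
  from kill_pole[OF this] show ?thesis by (simp add: q)
 qed
 then obtain n where n: "!!q m. q : Q ==> m >= n q ==> reg ((snd (fst q) - mero_const (nf (snd (fst q)) (snd q))) ^ m * fst (fst q)) (snd q)"
  by metis
 define n0 where "n0 = (SUM q:Q. n q)"
 have n0: "n0 >= n q" if "q : Q" for q unfolding n0_def using finQ that by (intro member_le_sum) auto
 define V where "V = (%q. nf (snd (fst q)) (snd q)) ` Q"
 have finV: "finite V" using finQ by (simp add: V_def)
 define R where "R = (PROD v:V. (\<upsilon> - mero_const v) ^ n0)"
 note props = factor_props[OF finV, where n = n0, folded R_def]
 have "reg (R * x) t" if t: "t : uhp" for t proof (cases "reg x t")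
  case True thus ?thesis using props(4)[OF t] nf_mult(1) by blast
 next
  case False
  obtain A where A: "A : SL2Z" "\<bar>Re (moebius A t)\<bar> <= 1 / 2" "Im (moebius A t) >= 1 / 2" using uhp_reduction[OF t] .
  define B where "B = minv A"
  define sg where "sg = moebius A t"
  have B: "B : SL2Z" and sg: "sg : uhp" and Bsg: "moebius B sg = t"
   using A t by (auto simp: B_def sg_def minv_SL2Z moebius_in_uhp moebius_minv)
  define z w where "z = mact B x" and "w = mact B \<upsilon>"
  have zw: "(z, w) : Orb" using B by (auto simp: Orb_def z_def w_def)
  have "~ reg z sg" using False Bsg nf_mact(2)[OF B sg] by (simp add: z_def)
  hence q: "((z, w), sg) : Q" using zw A by (simp add: Q_def Bad_def sg_def)
  define v where "v = nf w sg"
  have v: "v : V" using q unfolding V_def v_def by force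
  have 1: "reg ((w - mero_const v) ^ n0 * z) sg" using n[OF q n0[OF q]] by (simp add: v_def)
  have 2: "reg (PROD v:V - {v}. (w - mero_const v) ^ n0) sg" by (intro nf_prod nf_power nf_diff regw[OF zw] reg_const sg)
  have "mact B (R * x) = (PROD v:V - {v}. (w - mero_const v) ^ n0) * ((w - mero_const v) ^ n0 * z)"
   using finV v props(5)[OF B] by (simp add: mact_mult B w_def z_def prod.remove[of V v] mult_ac)
  hence "reg (mact B (R * x)) sg" using nf_mult(1)[OF 2 1] by simp
  thus ?thesis using nf_mact(2)[OF B sg] Bsg by simp
 qed
 thus ?thesis using that[OF props(1-3)] by blast
qed

text \<open>The same device at the cusps where \<open>\<upsilon>\<close> is finite: subtracting its
  limit gives a function of positive order, a high power of which outweighs the pole of x.\<close>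

lemma kill_cusp_poles:
 assumes "x : A0 G" "!!t. t : uhp ==> reg x t" "x ~= 0"
 obtains R where "R : A0 G" "R : C_adjoin {\<upsilon>}" "R ~= 0" "ALL t:uhp. reg (R * x) t"
  "ALL A:SL2Z. (EX l. (nf (mact A \<upsilon>) \<longlongrightarrow> l) at_cusp) --> (EX l. (nf (mact A (R * x)) \<longlongrightarrow> l) at_cusp)"
proof -
 define Orb where "Orb = {p : (%A. (mact A x, mact A \<upsilon>)) ` SL2Z. EX l. (nf (snd p) \<longlongrightarrow> l) at_cusp}"
 have "finite ((%A. (mact A x, mact A \<upsilon>)) ` SL2Z)" by (rule finite_orbit[OF N(1)]) (use A0_fixed assms \<upsilon> in auto)
 hence fin: "finite Orb" by (simp add: Orb_def)
 have "EX l. (nf (snd p) \<longlongrightarrow> l) at_cusp" if "p : Orb" for p using that by (simp add: Orb_def)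
 then obtain l where l: "!!p. p : Orb ==> (nf (snd p) \<longlongrightarrow> l p) at_cusp" by metis
 have regs: "reg (fst p) t & reg (snd p) t" if "p : Orb" "t : uhp" for p t
  using that \<upsilon>_reg assms(2) by (auto simp: Orb_def nf_mact moebius_in_uhp)
 have "EX n. \<forall>m\<ge>n. ((%t. (nf (snd p) t - l p) ^ m * nf (fst p) t) \<longlongrightarrow> 0) at_cusp" if p: "p : Orb" for p
 proof -
  obtain A where A: "A : SL2Z" "fst p = mact A x" "snd p = mact A \<upsilon>" using p by (auto simp: Orb_def)
  define w where "w = snd p - mero_const (l p)"
  have "w = mact A (\<upsilon> - mero_const (l p))" by (simp add: w_def A mact_diff mact_const)
  hence wnz: "w ~= 0" using not_const mact_inj[OF A(1), of _ 0] mact_0[OF A(1)] by metis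
  have znz: "fst p ~= 0" using assms(3) mact_inj[OF A(1), of x 0] mact_0[OF A(1)] A(2) by metis
  have "mcusp w" unfolding w_def A
   using mcusp_binop(1)[OF A0_cusp[OF \<upsilon> A(1)] mcusp_const[of "- l p"]] A by (simp add: mero_const_minus)
  then obtain r c where r: "c ~= 0" "((%t. nf w t * ce (- (of_real r * t))) \<longlongrightarrow> c) at_cusp"
   using cusp_order[OF _ wnz] by metis
  obtain s d where s: "((%t. nf (fst p) t * ce (- (of_real s * t))) \<longlongrightarrow> d) at_cusp"
   using cusp_order[OF _ znz] A0_cusp[OF assms(1) A(1)] A(2) by metis
  have nfw: "\<forall>\<^sub>F t in at_cusp. nf (snd p) t - l p = nf w t" using eventually_uhp_at_cusp
   by eventually_elim (use regs[OF p] in \<open>simp add: w_def nf_diff reg_const nf_const\<close>)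
  have "((%t. nf (snd p) t - l p) \<longlongrightarrow> l p - l p) at_cusp" by (intro tendsto_intros l p)
  hence "(nf w \<longlongrightarrow> 0) at_cusp" using Lim_transform_eventually[OF _ nfw] by simp
  hence "((%t. nf w t * ce (- (of_real 0 * t))) \<longlongrightarrow> 0) at_cusp" by simp
  from order_less[OF r(2,1) this] have rpos: "r > 0" .
  obtain n :: nat where n: "- s / r < real n" using reals_Archimedean2 by blast
  show ?thesis proof (intro exI[of _ n] allI impI)
   fix m assume "m >= n"
   hence "- s / r < real m" using n by (meson le_less_trans less_le_trans of_nat_le_iff order_less_le_trans)
   hence pos: "real m * r + s > 0" using rpos by (simp add: field_simps)
   from order_shift[OF mult_order[OF power_order[OF r(2)] s] this]
   have "((%t. nf w t ^ m * nf (fst p) t) \<longlongrightarrow> 0) at_cusp" by simp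
   moreover have "\<forall>\<^sub>F t in at_cusp. nf w t ^ m * nf (fst p) t = (nf (snd p) t - l p) ^ m * nf (fst p) t"
    using nfw by eventually_elim simp
   ultimately show "((%t. (nf (snd p) t - l p) ^ m * nf (fst p) t) \<longlongrightarrow> 0) at_cusp" by (rule Lim_transform_eventually)
  qed
 qed
 then obtain n where n: "!!p m. p : Orb ==> m >= n p ==> ((%t. (nf (snd p) t - l p) ^ m * nf (fst p) t) \<longlongrightarrow> 0) at_cusp"
  by metis
 define n0 where "n0 = (SUM p:Orb. n p)"
 have n0: "n0 >= n p" if "p : Orb" for p unfolding n0_def using fin that by (intro member_le_sum) auto
 define V where "V = l ` Orb"
 have finV: "finite V" using fin by (simp add: V_def)
 define R where "R = (PROD v:V. (\<upsilon> - mero_const v) ^ n0)"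
 note props = factor_props[OF finV, where n = n0, folded R_def]
 have "EX l. (nf (mact A (R * x)) \<longlongrightarrow> l) at_cusp" if A: "A : SL2Z" "EX l. (nf (mact A \<upsilon>) \<longlongrightarrow> l) at_cusp" for A
 proof -
  define p where "p = (mact A x, mact A \<upsilon>)"
  have p: "p : Orb" using A by (auto simp: Orb_def p_def)
  have v: "l p : V" using p by (simp add: V_def)
  let ?f = "%t. (PROD v:V - {l p}. (nf (snd p) t - v) ^ n0) * ((nf (snd p) t - l p) ^ n0 * nf (fst p) t)"
  have "(?f \<longlongrightarrow> (PROD v:V - {l p}. (l p - v) ^ n0) * 0) at_cusp"
   by (intro tendsto_mult tendsto_prod tendsto_power tendsto_diff tendsto_const l p n n0)
  moreover have "\<forall>\<^sub>F t in at_cusp. ?f t = nf (mact A (R * x)) t" using eventually_uhp_at_cusp proof eventually_elim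
   case (elim t)
   have "mact A (R * x) = (PROD v:V. (snd p - mero_const v) ^ n0) * fst p" using props(5)[OF A(1)] by (simp add: mact_mult A p_def)
   moreover have "nf ... t = (PROD v:V. (nf (snd p) t - v) ^ n0) * nf (fst p) t"
    using regs[OF p elim] elim by (simp add: nf_mult nf_prod nf_power nf_diff reg_const nf_const)
   ultimately show ?case using finV v by (simp add: prod.remove[of V "l p"] mult_ac)
  qed
  ultimately have "(nf (mact A (R * x)) \<longlongrightarrow> (PROD v:V - {l p}. (l p - v) ^ n0) * 0) at_cusp"
   by (rule Lim_transform_eventually)
  thus ?thesis by blast
 qed
 moreover have "reg (R * x) t" if "t : uhp" for t using nf_mult(1)[OF props(4)[OF that] assms(2)[OF that]] .
 ultimately show ?thesis using that[OF props(1-3)] by blast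
qed

text \<open>After multiplication by two factors from \<open>C_adjoin {\<upsilon>}\<close>, only a
  pole at infinity can remain, which \<open>regular_poly\<close> handles.\<close>

theorem A0_eq: "A0 G = C_adjoin {\<upsilon>}"
proof
 show "C_adjoin {\<upsilon>} <= A0 G" by (rule C_adjoin_minimal[OF _ A0_subfield[OF G]]) (use \<upsilon> in auto)
 show "A0 G <= C_adjoin {\<upsilon>}" proof
  fix x assume x: "x : A0 G"
  note cl = C_subfield_closed[OF A0_subfield[OF G]]
  note cl2 = C_subfield_closed[OF C_subfield_hull[of "{\<upsilon>}"]]
  show "x : C_adjoin {\<upsilon>}" proof (cases "x = 0")
   case True thus ?thesis by (simp add: cl2)
  next
   case False
   obtain R1 where R1: "R1 : A0 G" "R1 : C_adjoin {\<upsilon>}" "R1 ~= 0" "ALL t:uhp. reg (R1 * x) t" using kill_all_poles[OF x] .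
   have x1: "R1 * x : A0 G" "R1 * x ~= 0" using cl R1 x False by auto
   obtain R2 where R2: "R2 : A0 G" "R2 : C_adjoin {\<upsilon>}" "R2 ~= 0" "ALL t:uhp. reg (R2 * (R1 * x)) t"
    "ALL A:SL2Z. (EX l. (nf (mact A \<upsilon>) \<longlongrightarrow> l) at_cusp) --> (EX l. (nf (mact A (R2 * (R1 * x))) \<longlongrightarrow> l) at_cusp)"
    using kill_cusp_poles[OF x1(1) bspec[OF R1(4)] x1(2)] .
   define y where "y = R2 * (R1 * x)"
   have y: "y : A0 G" "y ~= 0" using x1 R2(1,3) cl by (auto simp: y_def)
   obtain r c where r: "((%t. nf y t * ce (- (of_real r * t))) \<longlongrightarrow> c) at_cusp"
    using cusp_order[OF A0_cusp[OF y(1) mat_1_SL2Z, unfolded mact_mat1] y(2)] by metis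
   obtain m :: nat where "- r < real m" using reals_Archimedean2 by blast
   hence "((%t. nf y t * ce (- (of_real (- real m) * t))) \<longlongrightarrow> 0) at_cusp" by (intro order_shift[OF r]) simp
   hence "y : C_adjoin {\<upsilon>}" by (intro regular_poly[OF y(1), of m 0]) (use R2(4,5) in \<open>auto simp: y_def\<close>)
   hence "y / (R2 * R1) : C_adjoin {\<upsilon>}" by (intro cl2(10) cl2(6) R1(2) R2(2))
   moreover have "y / (R2 * R1) = x" using R1(3) R2(3) by (simp add: y_def)
   ultimately show ?thesis by simp
  qed
 qed
qed

end

section \<open>Modularity of the generators\<close>

definition kp :: "(real \<times> real) list => complex => complex" where
 "kp xs t = prod_list (map (%(u, v). kf u v t) xs)"

definition kact :: "int => int => int => int => real \<times> real => real \<times> real" where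
 "kact a b c d = (%(u, v). (u * of_int a + v * of_int c, u * of_int b + v * of_int d))"

definition kgood :: "(real \<times> real) list => bool" where
 "kgood xs \<longleftrightarrow> (\<forall>(u, v)\<in>set xs. ~ (u : \<int> & v : \<int>))"

definition kords :: "(real \<times> real) list => real" where
 "kords xs = sum_list (map (%(u, v). kord u) xs)"

definition kq :: "(real \<times> real) list => (real \<times> real) list => complex => complex" where
 "kq xs ys t = kp xs (7 * t) / kp ys (7 * t)"

lemma kp_nonzero: "kgood xs ==> t : uhp ==> kp xs t ~= 0" by (induction xs) (auto simp: kp_def kgood_def kf_eq_0_iff)

lemma kp_holomorphic:
 assumes "open S" "f holomorphic_on S" "!!t. t : S ==> f t : uhp"
 shows "(%t. kp xs (f t)) holomorphic_on S"
proof (induction xs)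
 case (Cons x xs)
 thus ?case unfolding kp_def by (cases x) (auto intro!: holomorphic_intros assms)
qed (simp add: kp_def)

lemma kq_holomorphic: "kgood ys ==> kq xs ys holomorphic_on uhp" unfolding kq_def
 by (intro holomorphic_intros kp_holomorphic) (auto simp: open_uhp uhp_7 kp_nonzero)

lemma kgood_kact:
 assumes "a * d - b * c = 1" "kgood xs"
 shows "kgood (map (kact a b c d) xs)"
proof -
 have *: "u : \<int> & v : \<int>" if U: "u * of_int a + v * of_int c : \<int>" and V: "u * of_int b + v * of_int d : \<int>" for u v :: real
 proof -
  have det: "real_of_int a * of_int d - of_int b * of_int c = 1" using arg_cong[OF assms(1), of real_of_int] by simp
  have "of_int d * (u * of_int a + v * of_int c) - of_int c * (u * of_int b + v * of_int d) : \<int>"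
   by (rule Ints_diff[OF Ints_mult[OF Ints_of_int U] Ints_mult[OF Ints_of_int V]])
  moreover have "of_int d * (u * of_int a + v * of_int c) - of_int c * (u * of_int b + v * of_int d) =
    u * (real_of_int a * of_int d - of_int b * of_int c)" by (simp add: algebra_simps)
  moreover have "of_int a * (u * of_int b + v * of_int d) - of_int b * (u * of_int a + v * of_int c) : \<int>"
   by (rule Ints_diff[OF Ints_mult[OF Ints_of_int V] Ints_mult[OF Ints_of_int U]])
  moreover have "of_int a * (u * of_int b + v * of_int d) - of_int b * (u * of_int a + v * of_int c) =
    v * (real_of_int a * of_int d - of_int b * of_int c)" by (simp add: algebra_simps)
  ultimately show ?thesis unfolding det by simp
 qed
 show ?thesis unfolding kgood_def proof
  fix p assume "p : set (map (kact a b c d) xs)"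
  then obtain u v where uv: "(u, v) : set xs" "p = (u * of_int a + v * of_int c, u * of_int b + v * of_int d)" by (auto simp: kact_def)
  hence "~ (u : \<int> & v : \<int>)" using assms(2) unfolding kgood_def by blast
  hence "~ (fst p : \<int> & snd p : \<int>)" using *[of u v] unfolding uv(2) fst_conv snd_conv by blast
  thus "case p of (u, v) => ~ (u : \<int> & v : \<int>)" by (cases p) simp
 qed
qed

lemma kp_transform:
 assumes "t : uhp" "a * d - b * c = (1::int)"
 shows "EX C. C ~= 0 & (ALL xs. kp xs ((of_int a * t + of_int b) / (of_int c * t + of_int d)) =
     C ^ length xs * kp (map (kact a b c d) xs) t)"
proof -
 obtain C where C: "C ~= 0" "!!u v. kf u v ((of_int a * t + of_int b) / (of_int c * t + of_int d)) =
     C * kf (u * of_int a + v * of_int c) (u * of_int b + v * of_int d) t" using kf_transform[OF assms] by blast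
 have "kp xs ((of_int a * t + of_int b) / (of_int c * t + of_int d)) = C ^ length xs * kp (map (kact a b c d) xs) t" for xs
  by (induction xs) (auto simp: kp_def kact_def C(2))
 thus ?thesis using C(1) by blast
qed

lemma kq_transform:
 assumes "t : uhp" "a * d - b * c = (1::int)" "length xs = length ys"
  and "7 * sg = (of_int a * t + of_int b) / (of_int c * t + of_int d)"
 shows "kq xs ys sg = kp (map (kact a b c d) xs) t / kp (map (kact a b c d) ys) t"
proof -
 obtain C where C: "C ~= 0" "!!xs. kp xs (7 * sg) = C ^ length xs * kp (map (kact a b c d) xs) t"
  using kp_transform[OF assms(1,2)] unfolding assms(4) by blast
 show ?thesis unfolding kq_def C(2) using C(1) assms(3) by simp
qed

lemma kp_limit:
 assumes "kgood xs"
 shows "EX c. c ~= 0 & ((%t. kp xs t * ce (- (of_real (kords xs) * t))) \<longlongrightarrow> c) at_cusp" using assms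
proof (induction xs)
 case Nil
 show ?case by (intro exI[of _ 1]) (simp add: kp_def kords_def)
next
 case (Cons x xs)
 obtain u v where x: "x = (u, v)" by (cases x)
 obtain c where c: "c ~= 0" "((%t. kp xs t * ce (- (of_real (kords xs) * t))) \<longlongrightarrow> c) at_cusp"
  using Cons by (auto simp: kgood_def)
 obtain d where d: "d ~= 0" "((%t. kf u v t * ce (- (of_real (kord u) * t))) \<longlongrightarrow> d) at_cusp"
  using kf_limit[of u v] Cons.prems by (auto simp: kgood_def x)
 have "((%t. kf u v t * kp xs t * ce (- (of_real (kord u + kords xs) * t))) \<longlongrightarrow> d * c) at_cusp"
  by (rule mult_order[OF d(2) c(2)])
 thus ?case using c(1) d(1) by (intro exI[of _ "d * c"]) (simp add: kp_def kords_def x)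
qed

text \<open>The hypothesis on \<open>h\<close> factors the matrix of multiplication by 7 after
  \<open>h\<close> into a unimodular matrix and an upper triangular one. The first acts on the
  parameters of the Klein forms, the second rescales the order by al / de.\<close>

lemma kq_limit:
 assumes good: "kgood xs" "kgood ys" and len: "length xs = length ys" and det: "a * d - b * c = (1::int)"
  and pos: "al > 0" "de > (0::int)"
  and eq: "!!s. s : uhp ==> 7 * h s = (of_int a * ((of_int al * s + of_int be) / of_int de) + of_int b) /
     (of_int c * ((of_int al * s + of_int be) / of_int de) + of_int d)"
 defines "r \<equiv> of_int al / of_int de * (kords (map (kact a b c d) xs) - kords (map (kact a b c d) ys))"
 shows "EX k. k ~= 0 & ((%s. kq xs ys (h s) * ce (- (of_real r * s))) \<longlongrightarrow> k) at_cusp"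
proof -
 define xs' ys' where "xs' = map (kact a b c d) xs" and "ys' = map (kact a b c d) ys"
 have g: "kgood xs'" "kgood ys'" unfolding xs'_def ys'_def by (intro kgood_kact det good)+
 obtain k l where k: "k ~= 0" "((%s. kp xs' s * ce (- (of_real (kords xs') * s))) \<longlongrightarrow> k) at_cusp"
  and l: "l ~= 0" "((%s. kp ys' s * ce (- (of_real (kords ys') * s))) \<longlongrightarrow> l) at_cusp"
  using kp_limit[OF g(1)] kp_limit[OF g(2)] by blast
 define t where "t = (%s. (of_int al * s + of_int be) / of_int de :: complex)"
 have imt: "Im (t s) = of_int al / of_int de * Im s" for s by (simp add: t_def Im_divide_of_real)
 have tu: "t s : uhp" if "s : uhp" for s using that pos by (simp add: uhp_def imt)
 have "filterlim (%s. of_int al / of_int de * Im s) at_top at_cusp"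
  using pos by (intro filterlim_tendsto_pos_mult_at_top[OF tendsto_const] Im_at_cusp) auto
 hence "filterlim (Im \<circ> t) at_top at_cusp" by (simp add: o_def imt)
 hence fl: "filterlim t at_cusp at_cusp" unfolding at_cusp_def filterlim_filtercomap_iff .
 have "((%s. (kp xs' (t s) * ce (- (of_real (kords xs') * t s))) / (kp ys' (t s) * ce (- (of_real (kords ys') * t s)))) \<longlongrightarrow> k / l) at_cusp"
  by (intro tendsto_divide filterlim_compose[OF k(2) fl] filterlim_compose[OF l(2) fl] l(1))
 define e where "e = ce (of_real (kords xs' - kords ys') * (of_int be / of_int de))"
 have "((%s. e * ((kp xs' (t s) * ce (- (of_real (kords xs') * t s))) / (kp ys' (t s) * ce (- (of_real (kords ys') * t s))))) \<longlongrightarrow> e * (k / l)) at_cusp"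
  by (intro tendsto_mult tendsto_const) fact
 moreover have "\<forall>\<^sub>F s in at_cusp. e * ((kp xs' (t s) * ce (- (of_real (kords xs') * t s))) / (kp ys' (t s) * ce (- (of_real (kords ys') * t s)))) = kq xs ys (h s) * ce (- (of_real r * s))"
  using eventually_uhp_at_cusp proof eventually_elim
  case (elim s)
  have "7 * h s = (of_int a * t s + of_int b) / (of_int c * t s + of_int d)" using eq[OF elim] by (simp only: t_def)
  hence q: "kq xs ys (h s) = kp xs' (t s) / kp ys' (t s)" unfolding xs'_def ys'_def by (rule kq_transform[OF tu[OF elim] det len])
  have "e * (ce (- (of_real (kords xs') * t s)) / ce (- (of_real (kords ys') * t s))) = ce (- (of_real r * s))"
   unfolding e_def ce_diff[symmetric] ce_add[symmetric]
   by (rule arg_cong[of _ _ ce]) (simp add: t_def r_def xs'_def[symmetric] ys'_def[symmetric] algebra_simps add_divide_distrib diff_divide_distrib)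
  note e = this
  have ass: "e * ((X * c1) / (Y * c2)) = (X / Y) * (e * (c1 / c2))" for X Y c1 c2 :: complex by simp
  show ?case unfolding q ass e ..
 qed
 ultimately have "((%s. kq xs ys (h s) * ce (- (of_real r * s))) \<longlongrightarrow> e * (k / l)) at_cusp"
  by (rule Lim_transform_eventually)
 thus ?thesis using k(1) l(1) by (intro exI[of _ "e * (k / l)"]) (auto simp: e_def)
qed

lemma moebius7_dvd:
 assumes "A : SL2Z" "t : uhp" "m21 A = 7 * c"
 shows "7 * moebius A t = (of_int (m11 A) * (7 * t) + of_int (7 * m12 A)) / (of_int c * (7 * t) + of_int (m22 A))"
  "m11 A * m22 A - (7 * m12 A) * c = 1" using assms(1) by (simp_all add: moebius_def assms(3) SL2Z_iff algebra_simps)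

text \<open>If 7 divides the lower left entry, the triangular factor is multiplication by 7;
  otherwise it is (t + be) / 7, with \<open>be\<close> solving m21 be = m22 modulo 7, and the upper
  left entry becomes divisible by 7.\<close>

lemma cusp7:
 assumes A: "A : SL2Z"
 obtains a b c d al be de :: int where "a * d - b * c = 1" "al > 0" "de > 0"
  "ALL t:uhp. 7 * moebius A t = (of_int a * ((of_int al * t + of_int be) / of_int de) + of_int b) /
     (of_int c * ((of_int al * t + of_int be) / of_int de) + of_int d)"
  "7 dvd m21 A ==> a = m11 A & al = 7 & de = 1 & m21 A = 7 * c" "~ 7 dvd m21 A ==> 7 dvd a"
proof (cases "7 dvd m21 A")
 case True
 then obtain c where c: "m21 A = 7 * c" by blast
 show ?thesis by (rule that[of "m11 A" "m22 A" "7 * m12 A" c 7 1 0])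
   (use moebius7_dvd[OF A _ c] moebius7_dvd(2)[OF A, of \<i>] True c in \<open>auto simp: uhp_def\<close>)
next
 case False
 moreover have "prime (7::int)" by simp
 ultimately have "coprime (m21 A) 7" using prime_imp_coprime[of 7 "m21 A"] by (simp add: coprime_commute)
 then obtain u where "[m21 A * u = 1] (mod 7)" using cong_solve_coprime_int by blast
 hence "[m21 A * u * m22 A = 1 * m22 A] (mod 7)" by (rule cong_mult) simp
 define be where "be = u * m22 A"
 have "[m21 A * be = m22 A] (mod 7)" using \<open>[m21 A * u * m22 A = 1 * m22 A] (mod 7)\<close> by (simp add: be_def mult.assoc)
 then obtain d where d: "m22 A - m21 A * be = 7 * d" by (metis cong_iff_dvd_diff cong_sym dvd_def)
 show ?thesis proof (rule that[of "7 * m11 A" d "m12 A - m11 A * be" "m21 A" 1 7 be])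
  have "7 * (m11 A * d) = m11 A * (m22 A - m21 A * be)" using d by simp
  thus "7 * m11 A * d - (m12 A - m11 A * be) * m21 A = 1" using A by (simp add: SL2Z_iff algebra_simps)
  show "ALL t:uhp. 7 * moebius A t = (of_int (7 * m11 A) * ((of_int 1 * t + of_int be) / of_int 7) + of_int (m12 A - m11 A * be)) /
     (of_int (m21 A) * ((of_int 1 * t + of_int be) / of_int 7) + of_int d)" proof
   fix t assume t: "t : uhp"
   have "7 * of_int d = of_int (m22 A) - of_int (m21 A) * (of_int be :: complex)"
    using arg_cong[OF d, of "of_int :: int => complex"] by simp
   hence d': "of_int d = (of_int (m22 A) - of_int (m21 A) * (of_int be :: complex)) / 7" by (simp add: mult.commute)
   have den: "of_int (m21 A) * ((of_int 1 * t + of_int be) / of_int 7) + of_int d = (of_int (m21 A) * t + of_int (m22 A)) / 7"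
    unfolding d' by (simp add: field_simps)
   have num: "of_int (7 * m11 A) * ((of_int 1 * t + of_int be) / of_int 7) + of_int (m12 A - m11 A * be) = of_int (m11 A) * t + of_int (m12 A)"
    by (simp add: field_simps)
   show "7 * moebius A t = (of_int (7 * m11 A) * ((of_int 1 * t + of_int be) / of_int 7) + of_int (m12 A - m11 A * be)) /
     (of_int (m21 A) * ((of_int 1 * t + of_int be) / of_int 7) + of_int d)" unfolding den num by (simp add: moebius_def)
  qed
 qed (use False in auto)
qed

text \<open>Growth of the form q^r suffices at the cusps, because a translation by N conjugated by A
  lies in the principal subgroup and gives the required period.\<close>

lemma A0I:
 assumes G: "G <= SL2Z" and N: "N > 0" "Gamma_principal (int N) <= G" and hol: "f holomorphic_on uhp"
  and inv: "!!A t. A : G ==> t : uhp ==> f (moebius A t) = f t"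
  and lim: "!!A. A : SL2Z ==> EX r c. ((%t. f (moebius A t) * ce (- (of_real r * t))) \<longlongrightarrow> c) at_cusp"
 shows "mero_of f : A0 G"
proof -
 have mer: "f meromorphic_on uhp" by (rule holomorphic_meromorphic[OF hol])
 have "mact A (mero_of f) = mero_of f" if A: "A : G" for A proof -
  have AS: "A : SL2Z" using A G by blast
  have "\<forall>\<^sub>\<approx>t\<in>uhp. t : uhp" by (rule eventually_in_cosparse) (auto simp: open_uhp)
  hence "\<forall>\<^sub>\<approx>t\<in>uhp. f (moebius A t) = f t" by eventually_elim (rule inv[OF A])
  thus ?thesis using mact_mero_of[OF AS mer] mero_of_eq_iff[OF meromorphic_moebius[OF AS mer] mer] by simp
 qed
 moreover have "mcusp (mact A (mero_of f))" if A: "A : SL2Z" for A proof -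
  define Tn where "Tn = mat2 1 (int N) 0 1"
  have Tn: "Tn : SL2Z" by (simp add: Tn_def SL2Z_iff)
  have AT: "A ** Tn : SL2Z" by (rule SL2Z_mult[OF A Tn])
  have B: "(A ** Tn) ** minv A : Gamma_principal (int N)" by (rule congruent_mult_minv[OF AT A]) (auto simp: mult_nth Tn_def cong_def)
  obtain r c where rc: "((%t. f (moebius A t) * ce (- (of_real r * t))) \<longlongrightarrow> c) at_cusp" using lim[OF A] by blast
  have "meromorphic_at_infinity_cusp (%t. f (moebius A t))" proof (rule meromorphic_at_infinity_cuspI[OF _ N(1) _ rc])
   have "(f \<circ> moebius A) holomorphic_on uhp"
    by (rule holomorphic_on_compose_gen[OF moebius_holomorphic[OF A] hol]) (use moebius_in_uhp[OF A] in auto)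
   thus "(%t. f (moebius A t)) holomorphic_on uhp" by (simp add: o_def)
   show "f (moebius A (t + of_nat N)) = f (moebius A t)" if t: "t : uhp" for t proof -
    have "((A ** Tn) ** minv A) ** A = A ** Tn" by (simp add: matrix_mul_assoc[symmetric] minv_mult A)
    hence "moebius (A ** Tn) t = moebius ((A ** Tn) ** minv A) (moebius A t)"
     using moebius_mult[OF SL2Z_mult[OF AT minv_SL2Z[OF A]] A t] by simp
    moreover have "moebius (A ** Tn) t = moebius A (t + of_nat N)" by (simp add: moebius_mult[OF A Tn t]) (simp add: moebius_def Tn_def)
    ultimately show ?thesis using inv[OF subsetD[OF N(2) B] moebius_in_uhp[OF A t]] by simp
   qed
  qed
  thus ?thesis using mact_mero_of[OF A mer] mcusp_mero_of[OF meromorphic_moebius[OF A mer]] by simp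
 qed
 ultimately show ?thesis by (simp add: A0_altdef[OF G])
qed

lemma kq_cusp_limit:
 assumes "kgood xs" "kgood ys" "length xs = length ys" "A : SL2Z"
 shows "EX r k. k ~= 0 & ((%t. kq xs ys (moebius A t) * ce (- (of_real r * t))) \<longlongrightarrow> k) at_cusp"
proof -
 obtain a b c d al be de :: int where *: "a * d - b * c = 1" "al > 0" "de > 0"
  "ALL t:uhp. 7 * moebius A t = (of_int a * ((of_int al * t + of_int be) / of_int de) + of_int b) /
     (of_int c * ((of_int al * t + of_int be) / of_int de) + of_int d)" using cusp7[OF assms(4)] by metis
 from kq_limit[OF assms(1-3) *(1-3) bspec[OF *(4)]] show ?thesis by blast
qed

lemma kord_shift [simp]: "kord (u + of_int n) = kord u" by (simp add: kord_def frac_def)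

lemma kord_eqI: "u = f + of_int n ==> 0 <= f ==> f < 1 ==> kord u = (f\<^sup>2 - f) / 2" by (simp add: kord_def frac_eq[THEN iffD2])

lemma mero_of_cong:
 assumes "!!t. t : uhp ==> f t = g t" "g holomorphic_on uhp"
 shows "mero_of f = mero_of g" "t : uhp ==> nf (mero_of f) t = g t" "t : uhp ==> reg (mero_of f) t"
proof -
 have "\<forall>\<^sub>\<approx>t\<in>uhp. t : uhp" by (rule eventually_in_cosparse) (auto simp: open_uhp)
 hence ev: "\<forall>\<^sub>\<approx>t\<in>uhp. f t = g t" by eventually_elim (rule assms(1))
 have g: "g meromorphic_on uhp" by (rule holomorphic_meromorphic[OF assms(2)])
 hence f: "f meromorphic_on uhp" using meromorphic_on_cong'[OF ev refl] by blast
 show eq: "mero_of f = mero_of g" using mero_of_eq_iff[OF f g] ev by blast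
 show "nf (mero_of f) t = g t" if "t : uhp" unfolding eq by (rule nf_mero_of[OF holomorphic_nicely[OF assms(2)] that])
 show "reg (mero_of f) t" if "t : uhp" unfolding eq by (rule nf_eqI(1)[of g]) (use that assms(2) g open_uhp analytic_at in auto)
qed

lemma not_Int: "0 < x ==> x < 1 ==> (x::real) ~: \<int>" using frac_eq_0_iff[of x] frac_eq[of x] by auto

text \<open>Numerator and denominator parameters for \<open>upsilon\<close>, \<open>g1\<close> and
  \<open>g0\<close>. The entries 11/14 = 2/7 + 1/2 and 13/14 = 3/7 + 1/2 are the shifts by the
  two-division point (1/2, 0).\<close>

abbreviation "ux \<equiv> [(2 / 7, 0), (2 / 7, 0), (3 / 7, 0)]"
abbreviation "uy \<equiv> [(1 / 7, 0), (1 / 7, 0), (1 / 7, 0)]"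
abbreviation "gx \<equiv> [(3 / 7, 0), (2 / 7, 1 / 2)]"
abbreviation "gy \<equiv> [(2 / 7, 0), (3 / 7, 1 / 2)]"
abbreviation "hx \<equiv> [(3 / 7, 0), (11 / 14, 0)]"
abbreviation "hy \<equiv> [(2 / 7, 0), (13 / 14, 0)]"

lemma kgood_lists: "kgood ux" "kgood uy" "kgood gx" "kgood gy" "kgood hx" "kgood hy" by (auto simp: kgood_def dest: not_Int[rotated 2])

lemma fun_eq_kq:
 assumes "t : uhp"
 shows "upsilon_fun t = kq ux uy t" "g1_fun t = pe (1 / 14) * kq gx gy t" "g0_fun t = - kq hx hy t"
proof -
 show "upsilon_fun t = kq ux uy t"
  unfolding phi_values[OF assms] kq_def kp_def Sk_def pe_of_int by (simp add: power2_eq_square power3_eq_cube mult.assoc)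
 have "pe (- (1 / 7)) = pe (1 / 14) * pe (- (3 / 14))" unfolding pe_add[symmetric] by simp
 thus "g1_fun t = pe (1 / 14) * kq gx gy t" unfolding g1_fun_eq[OF assms] kq_def kp_def Sk_def Tk_def pe_of_int by simp
 show "g0_fun t = - kq hx hy t" unfolding g0_fun_def kq_def kp_def Sk_def Uk_def pe_of_int by simp
qed

definition g0 :: mero where
 "g0 = mero_of g0_fun"

lemma gen_holomorphic: "kq ux uy holomorphic_on uhp" "(%t. pe (1 / 14) * kq gx gy t) holomorphic_on uhp"
 "(%t. - kq hx hy t) holomorphic_on uhp" by (intro holomorphic_intros kq_holomorphic kgood_lists)+

lemma upsilon_props: "upsilon = mero_of (kq ux uy)" "t : uhp ==> nf upsilon t = kq ux uy t" "t : uhp ==> reg upsilon t"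
 unfolding upsilon_def by (rule mero_of_cong[OF fun_eq_kq(1) gen_holomorphic(1)]; assumption)+

lemma g1_props: "g1 = mero_of (%t. pe (1 / 14) * kq gx gy t)" "t : uhp ==> nf g1 t = pe (1 / 14) * kq gx gy t" "t : uhp ==> reg g1 t"
 unfolding g1_def by (rule mero_of_cong[OF fun_eq_kq(2) gen_holomorphic(2)]; assumption)+

lemma g0_props: "g0 = mero_of (%t. - kq hx hy t)" "t : uhp ==> nf g0 t = - kq hx hy t" "t : uhp ==> reg g0 t"
 unfolding g0_def by (rule mero_of_cong[OF fun_eq_kq(3) gen_holomorphic(3)]; assumption)+

lemma Gamma1_iff: "A : Gamma1 N \<longleftrightarrow> A : SL2Z & [m11 A = 1] (mod N) & [m21 A = 0] (mod N) & [m22 A = 1] (mod N)"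
 by (simp add: Gamma1_def)

lemma cong_1_obtain: "[x = 1] (mod N) ==> \<exists>k::int. x = 1 + N * k" by (metis cong_iff_dvd_diff dvd_def add.commute diff_add_cancel)

lemma kf_shift_eq:
 assumes "t : uhp" "u' = u + of_int m" "v' = v + of_int n"
 shows "kf u' v' t = pe (of_int (m + n + m * n) + of_int n * of_real u - of_int m * of_real v) * kf u v t"
 unfolding assms(2,3) by (rule kf_shift[OF assms(1)])

text \<open>A matrix in the group shifts (k/7, 0) by integers, with multiplier
  \<open>pe (E k)\<close>. The quadratic parts balance because 2^2 + 2^2 + 3^2 - 3 = 14, which
  leaves an even integer as difference of the exponents.\<close>

lemma upsilon_invariant:
 assumes A: "A : Gamma1 7" and s: "s : uhp"
 shows "kq ux uy (moebius A s) = kq ux uy s"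
proof -
 have AS: "A : SL2Z" using A by (simp add: Gamma1_iff)
 obtain m where m: "m11 A = 1 + 7 * m" using A cong_1_obtain by (auto simp: Gamma1_iff)
 obtain c where c: "m21 A = 7 * c" using A by (auto simp: Gamma1_iff cong_0_iff)
 define b where "b = m12 A"
 let ?t = "7 * s"
 have t: "?t : uhp" by (rule uhp_7[OF s])
 have k: "kf (of_int k / 7 * of_int (1 + 7 * m)) (of_int k / 7 * of_int (7 * b)) ?t =
   pe (of_int (k * m + k * b + k * m * (k * b)) + of_int (k * b) * of_real (of_int k / 7)) * kf (of_int k / 7) 0 ?t" for k
  using kf_shift_eq[OF t, of "of_int k / 7 * of_int (1 + 7 * m)" "of_int k / 7" "k * m" "of_int k / 7 * of_int (7 * b)" 0 "k * b"]
  by (simp add: algebra_simps)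
 define E where "E = (%k. of_int (k * m + k * b + k * m * (k * b)) + of_int (k * b) * of_real (of_int k / 7) :: complex)"
 have E: "E 2 + E 2 + E 3 = E 1 + E 1 + E 1 + of_int (2 * (2 * m + 3 * b + 7 * (m * b)))" by (simp add: E_def field_simps)
 have pE: "pe (E 2) * pe (E 2) * pe (E 3) = pe (E 1) * pe (E 1) * pe (E 1)"
  unfolding pe_add[symmetric] unfolding E unfolding pe_add[of _ "of_int _"] pe_of_int by simp
 have "kq ux uy (moebius A s) = kp (map (kact (m11 A) (7 * m12 A) c (m22 A)) ux) ?t / kp (map (kact (m11 A) (7 * m12 A) c (m22 A)) uy) ?t"
  by (rule kq_transform[OF t moebius7_dvd(2)[OF AS s c] _ moebius7_dvd(1)[OF AS s c]]) simp
 also have "... = (pe (E 2) * pe (E 2) * pe (E 3)) * kp ux ?t / ((pe (E 1) * pe (E 1) * pe (E 1)) * kp uy ?t)"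
  using k[of 1] k[of 2] k[of 3] by (simp add: kp_def kact_def m b_def[symmetric] E_def mult_ac)
 finally show ?thesis unfolding pE kq_def by simp
qed

text \<open>\<open>ES\<close>, \<open>ET\<close> and \<open>EU\<close> are the exponents of the
  multipliers for the points (k/7, 0), (k/7, 1/2) and (k/7 + 1/2, 0). For each quotient the
  exponents above and below differ by an even integer.\<close>

lemma g_invariant:
 assumes A: "A : Gamma_principal 2 \<inter> Gamma1 7" and s: "s : uhp"
 shows "kq gx gy (moebius A s) = kq gx gy s" "kq hx hy (moebius A s) = kq hx hy s"
proof -
 have AS: "A : SL2Z" using A by (simp add: Gamma1_iff)
 obtain m0 where m0: "m11 A = 1 + 7 * m0" using A cong_1_obtain by (auto simp: Gamma1_iff)
 have "odd (m11 A)" using A by (simp add: Gamma_principal_iff cong_def odd_iff_mod_2_eq_one)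
 then obtain m where "m0 = 2 * m" using m0 by (auto elim!: evenE)
 hence m: "m11 A = 1 + 14 * m" using m0 by simp
 obtain d0 where d0: "m22 A = 1 + 7 * d0" using A cong_1_obtain by (auto simp: Gamma1_iff)
 have "odd (m22 A)" using A by (simp add: Gamma_principal_iff cong_def odd_iff_mod_2_eq_one)
 then obtain d where "d0 = 2 * d" using d0 by (auto elim!: evenE)
 hence d: "m22 A = 1 + 14 * d" using d0 by simp
 obtain b where b: "m12 A = 2 * b" using A by (auto simp: Gamma_principal_iff cong_0_iff)
 obtain c0 where c0: "m21 A = 7 * c0" using A by (auto simp: Gamma1_iff cong_0_iff)
 have "even (m21 A)" using A by (auto simp: Gamma_principal_iff cong_0_iff)
 then obtain c where c1: "c0 = 2 * c" using c0 by (auto elim!: evenE)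
 have c: "m21 A = 7 * (2 * c)" using c0 c1 by simp
 \<comment> \<open>The determinant condition, which forces m and d to have the same parity; the
   multipliers for the point (0, 1/2) need this.\<close>
 have "m + d + 14 * (m * d) - 2 * (b * c) = 0" using AS unfolding SL2Z_iff m d b c by (simp add: algebra_simps)
 hence "even (m + d)" by presburger
 hence "even (m - d)" by simp
 then obtain e where e: "m - d = 2 * e" by blast
 let ?t = "7 * s"
 let ?act = "kact (m11 A) (7 * m12 A) (2 * c) (m22 A)"
 have t: "?t : uhp" by (rule uhp_7[OF s])
 have tr: "kq xs ys (moebius A s) = kp (map ?act xs) ?t / kp (map ?act ys) ?t" if "length xs = length ys" for xs ys
  by (rule kq_transform[OF t moebius7_dvd(2)[OF AS s c] that moebius7_dvd(1)[OF AS s c]])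
 define ES where "ES = (%k. of_int (2*k*m + 2*k*b + 2*k*m * (2*k*b)) + of_int (2*k*b) * of_real (of_int k / 7) :: complex)"
 define ET where "ET = (%k. of_int ((2*k*m + c) + (2*k*b + 7*d) + (2*k*m + c) * (2*k*b + 7*d)) + of_int (2*k*b + 7*d) * of_real (of_int k / 7) - of_int (2*k*m + c) * of_real (1 / 2) :: complex)"
 define EU where "EU = (%k. of_int ((2*k*m + 7*m) + (2*k*b + 7*b) + (2*k*m + 7*m) * (2*k*b + 7*b)) + of_int (2*k*b + 7*b) * of_real (of_int k / 7 + 1 / 2) :: complex)"
 have S: "kf (of_int k / 7 * of_int (1 + 14 * m)) (of_int k / 7 * of_int (7 * (2 * b))) ?t = pe (ES k) * kf (of_int k / 7) 0 ?t" for k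
  using kf_shift_eq[OF t, of "of_int k / 7 * of_int (1 + 14 * m)" "of_int k / 7" "2 * k * m" "of_int k / 7 * of_int (7 * (2 * b))" 0 "2 * k * b"]
  unfolding ES_def by (simp add: algebra_simps)
 have T: "kf (of_int k / 7 * of_int (1 + 14 * m) + 1 / 2 * of_int (2 * c)) (of_int k / 7 * of_int (7 * (2 * b)) + 1 / 2 * of_int (1 + 14 * d)) ?t = pe (ET k) * kf (of_int k / 7) (1 / 2) ?t" for k
  using kf_shift_eq[OF t, of "of_int k / 7 * of_int (1 + 14 * m) + 1 / 2 * of_int (2 * c)" "of_int k / 7" "2 * k * m + c" "of_int k / 7 * of_int (7 * (2 * b)) + 1 / 2 * of_int (1 + 14 * d)" "1 / 2" "2 * k * b + 7 * d"]
  unfolding ET_def by (simp add: algebra_simps)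
 have U: "kf ((of_int k / 7 + 1 / 2) * of_int (1 + 14 * m)) ((of_int k / 7 + 1 / 2) * of_int (7 * (2 * b))) ?t = pe (EU k) * kf (of_int k / 7 + 1 / 2) 0 ?t" for k
  using kf_shift_eq[OF t, of "(of_int k / 7 + 1 / 2) * of_int (1 + 14 * m)" "of_int k / 7 + 1 / 2" "2 * k * m + 7 * m" "(of_int k / 7 + 1 / 2) * of_int (7 * (2 * b))" 0 "2 * k * b + 7 * b"]
  unfolding EU_def by (simp add: algebra_simps)
 have "ES 3 + ET 2 = ES 2 + ET 3 + of_int (- 14 * (m * d) - 2 * (b * c) + (m - d))" by (simp add: ES_def ET_def field_simps)
 also have "- 14 * (m * d) - 2 * (b * c) + (m - d) = 2 * (- 7 * (m * d) - b * c + e)" using e by simp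
 finally have pT: "pe (ES 3) * pe (ET 2) = pe (ES 2) * pe (ET 3)"
  unfolding pe_add[symmetric] by (simp only: pe_add[of _ "of_int _"] pe_of_int) simp
 have "ES 3 + EU 2 = ES 2 + EU 3 + of_int (2 * (- 14 * (m * b) - b))" by (simp add: ES_def EU_def field_simps)
 hence pU: "pe (ES 3) * pe (EU 2) = pe (ES 2) * pe (EU 3)"
  unfolding pe_add[symmetric] by (simp only: pe_add[of _ "of_int _"] pe_of_int) simp
 have "kq gx gy (moebius A s) = (pe (ES 3) * pe (ET 2)) * kp gx ?t / ((pe (ES 2) * pe (ET 3)) * kp gy ?t)"
  using S[of 2] S[of 3] T[of 2] T[of 3] by (simp add: tr kp_def kact_def m b d mult_ac)
 thus "kq gx gy (moebius A s) = kq gx gy s" unfolding pT by (simp add: kq_def)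
 have "kq hx hy (moebius A s) = (pe (ES 3) * pe (EU 2)) * kp hx ?t / ((pe (ES 2) * pe (EU 3)) * kp hy ?t)"
  using S[of 2] S[of 3] U[of 2] U[of 3] by (simp add: tr kp_def kact_def m b mult_ac)
 thus "kq hx hy (moebius A s) = kq hx hy s" unfolding pU by (simp add: kq_def)
qed

abbreviation "G14 \<equiv> Gamma_principal 2 \<inter> Gamma1 7"

lemma group_subsets: "Gamma1 7 <= SL2Z" "G14 <= SL2Z" "G14 <= Gamma1 7"
 "Gamma_principal 7 <= Gamma1 7" "Gamma_principal 14 <= G14"
proof -
 show "Gamma1 7 <= SL2Z" "G14 <= SL2Z" "G14 <= Gamma1 7" "Gamma_principal 7 <= Gamma1 7" by (auto simp: Gamma1_iff Gamma_principal_iff)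
 have "[x = y] (mod 2) & [x = y] (mod 7)" if "[x = y] (mod 14)" for x y :: int by (auto intro: cong_dvd_modulus[OF that])
 thus "Gamma_principal 14 <= G14" by (auto simp: Gamma1_iff Gamma_principal_iff)
qed

lemma upsilon_in_A0: "upsilon : A0 (Gamma1 7)" unfolding upsilon_props(1)
proof (rule A0I[where N = 7])
 show "EX r c. ((%t. kq ux uy (moebius A t) * ce (- (of_real r * t))) \<longlongrightarrow> c) at_cusp" if "A : SL2Z" for A
  using kq_cusp_limit[OF kgood_lists(1,2) _ that] by auto
qed (use group_subsets gen_holomorphic upsilon_invariant in auto)

lemma g_in_A0: "g1 : A0 G14" "g0 : A0 G14"
proof -
 have lim: "EX r c. ((%t. K * kq xs ys (moebius A t) * ce (- (of_real r * t))) \<longlongrightarrow> c) at_cusp"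
  if A: "A : SL2Z" and xy: "kgood xs" "kgood ys" "length xs = length ys" for A K xs ys proof -
  obtain r k where "((%t. kq xs ys (moebius A t) * ce (- (of_real r * t))) \<longlongrightarrow> k) at_cusp"
   using kq_cusp_limit[OF xy A] by blast
  from tendsto_mult[OF tendsto_const[of K] this] show ?thesis by (auto simp: mult.assoc)
 qed
 show "g1 : A0 G14" unfolding g1_props(1) proof (rule A0I[where N = 14])
  show "EX r c. ((%t. pe (1 / 14) * kq gx gy (moebius A t) * ce (- (of_real r * t))) \<longlongrightarrow> c) at_cusp" if "A : SL2Z" for A
   using lim[OF that kgood_lists(3,4)] by simp
 qed (use group_subsets gen_holomorphic g_invariant in auto)
 show "g0 : A0 G14" unfolding g0_props(1) proof (rule A0I[where N = 14])
  show "EX r c. ((%t. - kq hx hy (moebius A t) * ce (- (of_real r * t))) \<longlongrightarrow> c) at_cusp" if "A : SL2Z" for A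
   using lim[OF that kgood_lists(5,6), of "-1"] by simp
 qed (use group_subsets gen_holomorphic g_invariant in auto)
qed

lemma Gamma1_limit:
 assumes "A : SL2Z" "m21 A = 7 * c" "kgood xs" "kgood ys" "length xs = length ys"
 shows "EX k. k ~= 0 & ((%t. kq xs ys (moebius A t) * ce (- (of_real (7 * (kords (map (kact (m11 A) (7 * m12 A) c (m22 A)) xs) -
   kords (map (kact (m11 A) (7 * m12 A) c (m22 A)) ys))) * t))) \<longlongrightarrow> k) at_cusp"
 using kq_limit[OF assms(3-5) moebius7_dvd(2)[OF assms(1) _ assms(2), of \<i>], of 7 1 "moebius A" 0]
  moebius7_dvd(1)[OF assms(1) _ assms(2)] by (simp add: uhp_def)

text \<open>If 7 does not divide the lower left entry, all first coordinates become integral and the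
  order is 0. Otherwise the order depends on the upper left entry modulo 7: the classes 1 and -1
  give the cusp infinity itself, where A or -A lies in the group.\<close>

lemma upsilon_cusps:
 assumes A: "A : SL2Z"
 shows "(EX l. (nf (mact A upsilon) \<longlongrightarrow> l) at_cusp) | (ALL x:A0 (Gamma1 7). mact A x = x)"
proof -
 have conv: "EX l. (nf (mact A upsilon) \<longlongrightarrow> l) at_cusp"
  if "((%t. kq ux uy (moebius A t) * ce (- (of_real r * t))) \<longlongrightarrow> k) at_cusp" "r >= 0" for r k proof -
  have "EX l. ((%t. kq ux uy (moebius A t) * ce (- (of_real 0 * t))) \<longlongrightarrow> l) at_cusp"
   using order_shift[OF that(1), of 0] that by (cases "r = 0") auto
  then obtain l where l: "((%t. kq ux uy (moebius A t)) \<longlongrightarrow> l) at_cusp" by auto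
  have "\<forall>\<^sub>F t in at_cusp. kq ux uy (moebius A t) = nf (mact A upsilon) t"
   using eventually_uhp_at_cusp by eventually_elim (simp add: nf_mact A upsilon_props(2) moebius_in_uhp)
  from Lim_transform_eventually[OF l this] show ?thesis by blast
 qed
 show ?thesis proof (cases "7 dvd m21 A")
  case False
  obtain a b c d al be de :: int where *: "a * d - b * c = 1" "al > 0" "de > 0"
   "ALL t:uhp. 7 * moebius A t = (of_int a * ((of_int al * t + of_int be) / of_int de) + of_int b) /
      (of_int c * ((of_int al * t + of_int be) / of_int de) + of_int d)" "7 dvd a" using cusp7[OF A] False by metis
  then obtain a' where a': "a = 7 * a'" by blast
  have "kord (k / 7 * of_int a) = 0" if "k = of_int i" for k i using kord_eqI[of "k / 7 * of_int a" 0 "i * a'"] that by (simp add: a')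
  from this[of 1 1] this[of 2 2] this[of 3 3]
  have "kords (map (kact a b c d) ux) = 0" "kords (map (kact a b c d) uy) = 0" by (simp_all add: kords_def kact_def)
  with kq_limit[OF kgood_lists(1,2) _ *(1-3) bspec[OF *(4)]] conv[of 0] show ?thesis by auto
 next
  case True
  then obtain c where c: "m21 A = 7 * c" by blast
  define a where "a = m11 A"
  define j where "j = a mod 7"
  define q where "q = a div 7"
  have a: "a = 7 * q + j" by (simp add: q_def j_def)
  have det: "a * m22 A - 7 * (m12 A * c) = 1" using A by (simp add: SL2Z_iff c a_def mult_ac)
  have "j ~= 0" proof
   assume "j = 0"
   hence "7 * (q * m22 A - m12 A * c) = 1" using det a by (simp add: algebra_simps)
   thus False by presburger
  qed
  moreover have "0 <= j" "j < 7" by (auto simp: j_def)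
  ultimately consider "j = 1" | "j = 6" | "j : {2, 3, 4, 5}" by force
  thus ?thesis proof cases
   case 1
   have "[m22 A = 1] (mod 7)" proof -
    have "m22 A - 1 = 7 * (m12 A * c - q * m22 A)" using det a 1 by (simp add: algebra_simps)
    thus ?thesis by (metis cong_iff_dvd_diff dvd_triv_left)
   qed
   moreover have "[m11 A = 1] (mod 7)" using 1 by (simp add: cong_def j_def a_def)
   ultimately have "A : Gamma1 7" using A c by (simp add: Gamma1_iff cong_0_iff)
   thus ?thesis using group_subsets(1) by (auto simp: A0_altdef)
  next
   case 2
   have "[- m22 A = 1] (mod 7)" proof -
    have "- m22 A - 1 = 7 * (m12 A * c - q * m22 A - m22 A)" using det a 2 by (simp add: algebra_simps)
    thus ?thesis by (metis cong_iff_dvd_diff dvd_triv_left)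
   qed
   moreover have "[- m11 A = 1] (mod 7)" proof -
    have "- m11 A - 1 = 7 * (- q - 1)" using a 2 by (simp add: a_def)
    thus ?thesis by (metis cong_iff_dvd_diff dvd_triv_left)
   qed
   ultimately have "- A : Gamma1 7" using A c by (simp add: Gamma1_iff cong_0_iff SL2Z_iff)
   hence "mact (- A) x = x" if "x : A0 (Gamma1 7)" for x using that group_subsets(1) by (auto simp: A0_altdef)
   thus ?thesis by (simp add: mact_uminus_mat)
  next
   case 3
   have k: "kord (1 / 7 * of_int a) = kord (of_int j / 7)" "kord (2 / 7 * of_int a) = kord (2 * of_int j / 7)" "kord (3 / 7 * of_int a) = kord (3 * of_int j / 7)"
    using kord_shift[of "of_int j / 7" q] kord_shift[of "2 * of_int j / 7" "2 * q"] kord_shift[of "3 * of_int j / 7" "3 * q"]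
    by (simp_all add: a algebra_simps add_divide_distrib)
   \<comment> \<open>These values give order 0 for j = 2, 5 and order 1 for j = 3, 4.\<close>
   have v: "kord (2 / 7) = - 5 / 49" "kord (3 / 7) = - 6 / 49" "kord (4 / 7) = - 6 / 49" "kord (5 / 7) = - 5 / 49"
    "kord (6 / 7) = - 3 / 49" "kord (8 / 7) = - 3 / 49" "kord (9 / 7) = - 5 / 49" "kord (10 / 7) = - 6 / 49"
    "kord (12 / 7) = - 5 / 49" "kord (15 / 7) = - 3 / 49"
    using kord_eqI[of "2/7" "2/7" 0] kord_eqI[of "3/7" "3/7" 0] kord_eqI[of "4/7" "4/7" 0] kord_eqI[of "5/7" "5/7" 0] kord_eqI[of "6/7" "6/7" 0]
     kord_eqI[of "8/7" "1/7" 1] kord_eqI[of "9/7" "2/7" 1] kord_eqI[of "10/7" "3/7" 1] kord_eqI[of "12/7" "5/7" 1] kord_eqI[of "15/7" "1/7" 2]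
    by (simp_all add: power2_eq_square)
   define r where "r = 7 * (kords (map (kact (m11 A) (7 * m12 A) c (m22 A)) ux) - kords (map (kact (m11 A) (7 * m12 A) c (m22 A)) uy))"
   have "r >= 0" using 3 k v by (auto simp: r_def kords_def kact_def a_def[symmetric])
   moreover have "EX k. k ~= 0 & ((%t. kq ux uy (moebius A t) * ce (- (of_real r * t))) \<longlongrightarrow> k) at_cusp"
    unfolding r_def by (rule Gamma1_limit[OF A c kgood_lists(1,2)]) simp
   ultimately show ?thesis using conv by blast
  qed
 qed
qed

lemma kord_values: "kord (1 / 7) = - 3 / 49" "kord (2 / 7) = - 5 / 49" "kord (3 / 7) = - 6 / 49"
 "kord (11 / 14) = - 33 / 392" "kord (13 / 14) = - 13 / 392"
 using kord_eqI[of "1/7" "1/7" 0] kord_eqI[of "2/7" "2/7" 0] kord_eqI[of "3/7" "3/7" 0]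
  kord_eqI[of "11/14" "11/14" 0] kord_eqI[of "13/14" "13/14" 0] by (simp_all add: power2_eq_square)

text \<open>The orders at infinity are -1, 0 and -1/2. The half-integral order distinguishes
  \<open>g0\<close> from \<open>g1\<close> and detects odd translations.\<close>

lemma limits_at_infinity:
 "EX k. k ~= 0 & ((%t. nf upsilon t * ce t) \<longlongrightarrow> k) at_cusp"
 "EX k. k ~= 0 & ((%t. nf g1 t * ce (- (of_real 0 * t))) \<longlongrightarrow> k) at_cusp"
 "EX k. k ~= 0 & ((%t. nf g0 t * ce (- (of_real (- 1 / 2) * t))) \<longlongrightarrow> k) at_cusp"
proof -
 have m1: "m21 (mat 1) = 7 * 0" "m11 (mat 1) = 1" "m12 (mat 1) = 0" "m22 (mat 1) = 1" by (simp_all add: mat_def)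
 note L = Gamma1_limit[OF mat_1_SL2Z m1(1), unfolded m1(2-4)]
 obtain k where k: "k ~= 0" "((%t. kq ux uy t * ce t) \<longlongrightarrow> k) at_cusp"
  using L[OF kgood_lists(1,2)] by (auto simp: kords_def kact_def kord_values)
 have "\<forall>\<^sub>F t in at_cusp. kq ux uy t * ce t = nf upsilon t * ce t"
  using eventually_uhp_at_cusp by eventually_elim (simp add: upsilon_props(2))
 from Lim_transform_eventually[OF k(2) this] k(1)
 show "EX k. k ~= 0 & ((%t. nf upsilon t * ce t) \<longlongrightarrow> k) at_cusp" by blast
 obtain k where k: "k ~= 0" "((%t. kq gx gy t * ce (- (of_real 0 * t))) \<longlongrightarrow> k) at_cusp"
  using L[OF kgood_lists(3,4)] by (auto simp: kords_def kact_def kord_values)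
 have "\<forall>\<^sub>F t in at_cusp. pe (1 / 14) * (kq gx gy t * ce (- (of_real 0 * t))) = nf g1 t * ce (- (of_real 0 * t))"
  using eventually_uhp_at_cusp by eventually_elim (simp add: g1_props(2))
 from Lim_transform_eventually[OF tendsto_mult[OF tendsto_const k(2)] this] k(1)
 show "EX k. k ~= 0 & ((%t. nf g1 t * ce (- (of_real 0 * t))) \<longlongrightarrow> k) at_cusp" by (intro exI[of _ "pe (1 / 14) * k"]) auto
 obtain k where k: "k ~= 0" "((%t. kq hx hy t * ce (- (of_real (- 1 / 2) * t))) \<longlongrightarrow> k) at_cusp"
  using L[OF kgood_lists(5,6)] by (auto simp: kords_def kact_def kord_values)
 have "\<forall>\<^sub>F t in at_cusp. - 1 * (kq hx hy t * ce (- (of_real (- 1 / 2) * t))) = nf g0 t * ce (- (of_real (- 1 / 2) * t))"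
  using eventually_uhp_at_cusp by eventually_elim (simp add: g0_props(2))
 from Lim_transform_eventually[OF tendsto_mult[OF tendsto_const k(2)] this] k(1)
 show "EX k. k ~= 0 & ((%t. nf g0 t * ce (- (of_real (- 1 / 2) * t))) \<longlongrightarrow> k) at_cusp" by (intro exI[of _ "- 1 * k"]) auto
qed

lemma T_in_Gamma1: "mat2 1 1 0 1 : Gamma1 7" by (simp add: Gamma1_iff SL2Z_iff)

lemma hauptmodul_upsilon: "EX k. hauptmodul (Gamma1 7) 7 upsilon k"
proof -
 obtain k where "k ~= 0" "((%t. nf upsilon t * ce t) \<longlongrightarrow> k) at_cusp" using limits_at_infinity(1) by blast
 hence "hauptmodul (Gamma1 7) 7 upsilon k" by unfold_locales
   (use group_subsets T_in_Gamma1 upsilon_in_A0 upsilon_cusps upsilon_props(3) in auto)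
 thus ?thesis by blast
qed

theorem A0_Gamma1_7: "A0 (Gamma1 7) = C_adjoin {upsilon}" using hauptmodul_upsilon hauptmodul.A0_eq by blast

text \<open>An odd multiple of 7 in the lower left corner would change the order of
  \<open>g1\<close> at infinity from 0 to -1/2. An odd upper right entry would make
  \<open>g0\<close> invariant under t + 1, against its half-integral order.\<close>

lemma stabilizer:
 assumes A: "A : Gamma1 7" and fx: "mact A g1 = g1" "mact A g0 = g0"
 shows "A : G14"
proof -
 have AS: "A : SL2Z" using A by (simp add: Gamma1_iff)
 obtain m where m: "m11 A = 1 + 7 * m" using A cong_1_obtain by (auto simp: Gamma1_iff)
 obtain c where c: "m21 A = 7 * c" using A by (auto simp: Gamma1_iff cong_0_iff)
 have "even c" proof (rule ccontr)
  assume "odd c"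
  then obtain c' where c': "c = 2 * c' + 1" by (elim oddE)
  have k: "kord (3 / 7 * of_int (1 + 7 * m)) = kord (3 / 7)" "kord (2 / 7 * of_int (1 + 7 * m)) = kord (2 / 7)"
   "kord (2 / 7 * of_int (1 + 7 * m) + 1 / 2 * of_int c) = kord (11 / 14)" "kord (3 / 7 * of_int (1 + 7 * m) + 1 / 2 * of_int c) = kord (13 / 14)"
   using kord_shift[of "3/7" "3 * m"] kord_shift[of "2/7" "2 * m"] kord_shift[of "11/14" "2 * m + c'"] kord_shift[of "13/14" "3 * m + c'"]
   by (simp_all add: c' algebra_simps add_divide_distrib)
  obtain k where k: "k ~= 0" "((%t. kq gx gy (moebius A t) * ce (- (of_real (- 1 / 2) * t))) \<longlongrightarrow> k) at_cusp"
   using Gamma1_limit[OF AS c kgood_lists(3,4)] by (auto simp: kords_def kact_def m k[simplified] kord_values)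
  have "\<forall>\<^sub>F t in at_cusp. pe (1 / 14) * (kq gx gy (moebius A t) * ce (- (of_real (- 1 / 2) * t))) = nf g1 t * ce (- (of_real (- 1 / 2) * t))"
   using eventually_uhp_at_cusp proof eventually_elim
   case (elim t)
   have "nf g1 t = pe (1 / 14) * kq gx gy (moebius A t)"
    using nf_mact(1)[OF AS elim, of g1] fx(1) g1_props(2)[OF moebius_in_uhp[OF AS elim]] by simp
   thus ?case by simp
  qed
  note l = Lim_transform_eventually[OF tendsto_mult[OF tendsto_const k(2)] this]
  obtain k' where k': "k' ~= 0" "((%t. nf g1 t * ce (- (of_real 0 * t))) \<longlongrightarrow> k') at_cusp"
   using limits_at_infinity(2) by blast
  have "(- 1 / 2 :: real) = 0" by (rule order_unique[OF l _ k'(2,1)]) (use k(1) in simp)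
  thus False by simp
 qed
 have odd: "odd (m11 A)" "odd (m22 A)" proof -
  have "m11 A * m22 A = 1 + 7 * (m12 A * c)" using AS by (simp add: SL2Z_iff c algebra_simps)
  hence "odd (m11 A * m22 A)" using \<open>even c\<close> by simp
  thus "odd (m11 A)" "odd (m22 A)" by auto
 qed
 have "even (m12 A)" proof (rule ccontr)
  assume o: "odd (m12 A)"
  \<comment> \<open>Undoing one translation makes the upper right entry even, so the rest lies in
    \<open>G14\<close> and fixes \<open>g0\<close>; then the translation fixes it too.\<close>
  define T where "T = mat2 1 1 0 1"
  have T: "T : SL2Z" by (simp add: T_def SL2Z_iff)
  define B where "B = A ** minv T"
  have B: "B : SL2Z" unfolding B_def by (intro SL2Z_mult AS minv_SL2Z T)
  have ent: "m11 B = m11 A" "m12 B = m12 A - m11 A" "m21 B = m21 A" "m22 B = m22 A - 7 * c" by (simp_all add: B_def T_def mult_nth c)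
  have "(m22 A - 7 * c) mod 7 = m22 A mod 7" using mod_mult_self2[of "m22 A" 7 "- c"] by simp
  hence 7: "[m22 A - 7 * c = 1] (mod 7)" using A by (simp add: Gamma1_iff cong_def)
  have ev: "odd (m22 A - 7 * c)" "even (m12 A - m11 A)" "even (m21 A)" using odd o \<open>even c\<close> c by auto
  have o2: "[x = 1] (mod 2)" if "odd x" for x :: int using that by (simp add: cong_def odd_iff_mod_2_eq_one)
  have "B : G14" unfolding Int_iff Gamma1_iff Gamma_principal_iff ent
   using A B 7 o2[OF odd(1)] o2[OF ev(1)] ev(2,3) unfolding Gamma1_iff cong_0_iff by blast
  hence "mact B g0 = g0" using g_in_A0(2) group_subsets(2) by (auto simp: A0_altdef)
  moreover have "B ** T = A" by (simp add: B_def matrix_mul_assoc[symmetric] minv_mult T)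
  ultimately have Tg: "mact T g0 = g0" using mact_mact[OF B T, of g0] fx(2) by simp
  have per: "nf g0 (t + 1) = nf g0 t" if "t : uhp" for t using nf_mact(1)[OF T that, of g0] Tg by (simp add: moebius_def T_def)
  obtain k where k: "k ~= 0" "((%t. nf g0 t * ce (- (of_real (- 1 / 2) * t))) \<longlongrightarrow> k) at_cusp"
   using limits_at_infinity(3) by blast
  have "(- 1 / 2 :: real) : \<int>" by (rule order_integral[OF k(2,1) per])
  hence "(1 / 2 :: real) : \<int>" using Ints_minus by fastforce
  thus False using half_not_Int by simp
 qed
 moreover have "even (m21 A)" using \<open>even c\<close> c by simp
 moreover have "[x = 1] (mod 2)" if "odd x" for x :: int using that by (simp add: cong_def odd_iff_mod_2_eq_one)
 ultimately show ?thesis using A AS odd unfolding Int_iff Gamma_principal_iff cong_0_iff by blast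
qed

section \<open>The function field of \<open>\<Gamma>(2) \<inter> \<Gamma>\<^sub>1(7)\<close>\<close>

lemma coeff_linear_mult: "coeff ([:a, b:] * q) k = a * coeff q k + (case k of 0 => 0 | Suc j => b * coeff q j)"
 by (cases k) (simp_all add: mult_pCons_left)

lemma coeff_prod_mact:
 assumes "A : SL2Z" "finite S"
 shows "coeff (PROD t:S. [:- mact A t, 1:]) k = mact A (coeff (PROD t:S. [:- t, 1:]) k)" using assms(2)
proof (induction S arbitrary: k rule: finite_induct)
 case empty
 show ?case by (cases k) (simp_all add: mact_0 mact_1 assms(1))
next
 case (insert t S)
 show ?case unfolding prod.insert[OF insert(1,2)] coeff_linear_mult insert(3)
  by (cases k) (simp_all add: mact_add mact_mult mact_minus mact_diff mact_0 assms(1))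
qed

lemma coeff_prod_mem:
 assumes "C_subfield F" "finite S" "S <= F"
 shows "coeff (PROD t:S. [:- t, 1:]) k : F" using assms(2,3)
proof (induction S arbitrary: k rule: finite_induct)
 case empty
 show ?case by (cases k) (simp_all add: C_subfield_closed[OF assms(1)])
next
 case (insert t S)
 have *: "t : F" "!!j. coeff (PROD t:S. [:- t, 1:]) j : F" using insert by auto
 show ?case unfolding prod.insert[OF insert(1,2)] coeff_linear_mult by (cases k) (auto intro!: C_subfield_closed[OF assms(1)] *)
qed

text \<open>
  Lagrange interpolation over the orbit \<open>Th\<close>: the coefficients of \<open>\<Prod>\<^sub>t (X - t)\<close> and of the interpolation
  polynomial are modular for the larger group, and they express \<open>f\<close> in terms of \<open>th\<close>.
\<close>
lemma interpolation:
 assumes th: "th : A0 G14" and f: "f : A0 G14"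
  and stab: "!!A. A : Gamma1 7 ==> mact A th = th ==> A : G14"
 defines "Th \<equiv> (%A. mact A th) ` Gamma1 7"
 shows "f * (PROD t:Th - {th}. th - t) : C_adjoin {upsilon, th}"
proof -
 let ?\<Gamma> = "Gamma1 7 :: (int^2^2) set"
 have sub: "A : SL2Z" if "A : ?\<Gamma>" for A using that group_subsets by blast
 have mult: "A ** B : ?\<Gamma>" if "A : ?\<Gamma>" "B : ?\<Gamma>" for A B proof -
  have "[m11 A * m11 B + m12 A * m21 B = 1 * 1 + m12 A * 0] (mod 7)" "[m21 A * m11 B + m22 A * m21 B = 0 * m11 B + m22 A * 0] (mod 7)"
   "[m21 A * m12 B + m22 A * m22 B = 0 * m12 B + 1 * 1] (mod 7)"
   using that by (intro cong_add cong_mult cong_refl; simp add: Gamma1_iff)+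
  thus ?thesis using that by (simp add: Gamma1_iff SL2Z_mult mult_nth)
 qed
 have inv: "minv A : ?\<Gamma>" if "A : ?\<Gamma>" for A using that by (simp add: Gamma1_iff minv_SL2Z cong_minus_minus_iff cong_0_iff)
 have one: "mat 1 : ?\<Gamma>" by (simp add: Gamma1_iff mat_1_SL2Z) (simp add: mat_def)
 have fixG: "mact A x = x" if "A : G14" "x : A0 G14" for A x using that by (auto simp: A0_altdef[OF group_subsets(2)])
 have fin: "finite Th" proof -
  have "finite ((%A. (mact A th, mact A th)) ` SL2Z)" by (rule finite_orbit[of 14]) (use fixG[OF _ th] group_subsets(5) in auto)
  hence "finite (fst ` (%A. (mact A th, mact A th)) ` SL2Z)" by blast
  hence "finite ((%A. mact A th) ` SL2Z)" by (simp add: image_image)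
  thus ?thesis unfolding Th_def using group_subsets(1) by (meson finite_subset image_mono)
 qed
 have thTh: "th : Th" unfolding Th_def by (rule image_eqI[of _ _ "mat 1"]) (auto simp: one)
 have well: "mact A f = mact B f" if "A : ?\<Gamma>" "B : ?\<Gamma>" "mact A th = mact B th" for A B proof -
  have m: "A ** minv B : ?\<Gamma>" using that mult inv by blast
  have "mact (A ** minv B) th = mact (minv B) (mact B th)"
   using mact_mact[OF sub[OF that(1)] minv_SL2Z[OF sub[OF that(2)]], of th] that(3) by simp
  also have "... = th" using mact_mact[OF sub[OF that(2)] minv_SL2Z[OF sub[OF that(2)]], of th] minv_mult(2)[OF sub[OF that(2)]] by simp
  finally have "A ** minv B : G14" by (rule stab[OF m])
  hence "mact B (mact (A ** minv B) f) = mact B f" using fixG[OF _ f] by simp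
  moreover have "(A ** minv B) ** B = A" using minv_mult(1)[OF sub[OF that(2)]] by (simp add: matrix_mul_assoc[symmetric])
  ultimately show ?thesis using mact_mact[OF sub[OF m] sub[OF that(2)], of f] by simp
 qed
 define ph where "ph = (%t. mact (SOME A. A : ?\<Gamma> & mact A th = t) f)"
 have ph: "ph (mact A th) = mact A f" if "A : ?\<Gamma>" for A proof -
  have "(SOME B. B : ?\<Gamma> & mact B th = mact A th) : ?\<Gamma> & mact (SOME B. B : ?\<Gamma> & mact B th = mact A th) th = mact A th"
   by (rule someI[of _ A]) (use that in auto)
  thus ?thesis unfolding ph_def by (intro well) (use that in auto)
 qed
 have phmact: "mact B t : Th & ph (mact B t) = mact B (ph t)" if B: "B : ?\<Gamma>" and t: "t : Th" for B t proof -
  obtain A where A: "A : ?\<Gamma>" "t = mact A th" using t by (auto simp: Th_def)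
  have "mact B t = mact (A ** B) th" "mact B (ph t) = mact (A ** B) f" using A ph[OF A(1)] mact_mact[OF sub[OF A(1)] sub[OF B]] by auto
  thus ?thesis using ph[OF mult[OF A(1) B]] mult[OF A(1) B] by (auto simp: Th_def)
 qed
 have perm: "mact B ` Th = Th" "inj_on (mact B) Th" if B: "B : ?\<Gamma>" for B proof -
  show inj: "inj_on (mact B) Th" by (auto intro!: inj_onI simp: mact_inj[OF sub[OF B]])
  have "mact B ` Th <= Th" using phmact[OF B] by blast
  thus "mact B ` Th = Th" using endo_inj_surj[OF fin _ inj] by blast
 qed
 \<comment> \<open>Only the condition at the cusps. Membership in the modular function field splits
   into this and invariance, and the two are checked separately for symmetric expressions.\<close>
 define M where "M = {x. ALL A:SL2Z. mcusp (mact A x)}"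
 have M: "C_subfield M" using A0_subfield[of "{}"] by (simp add: A0_altdef M_def)
 have A0M: "x : A0 ?\<Gamma> \<longleftrightarrow> x : M & (ALL A:?\<Gamma>. mact A x = x)" for x
  by (auto simp: A0_altdef[OF group_subsets(1)] M_def)
 have actM: "mact A x : M" if "A : SL2Z" "x : A0 G14" for A x
  using that by (auto simp: M_def A0_altdef[OF group_subsets(2)] mact_mact SL2Z_mult)
 have ThM: "Th <= M" using actM[OF _ th] sub by (auto simp: Th_def)
 have phM: "ph t : M" if "t : Th" for t using that ph actM[OF _ f] sub by (auto simp: Th_def)
 define s where "s = (%j. SUM t:Th. ph t * t ^ j)"
 have s: "s j : A0 ?\<Gamma>" for j unfolding A0M proof (intro conjI ballI)
  show "s j : M" unfolding s_def by (intro C_subfield_sum[OF M] C_subfield_closed[OF M] phM subsetD[OF ThM])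
  fix B assume B: "B : ?\<Gamma>"
  have "mact B (s j) = (SUM t:Th. ph (mact B t) * mact B t ^ j)"
   unfolding s_def mact_sum[OF sub[OF B]] using phmact[OF B] by (intro sum.cong) (auto simp: mact_mult mact_power sub[OF B])
  also have "... = (SUM t:mact B ` Th. ph t * t ^ j)" by (simp add: sum.reindex[OF perm(2)[OF B]])
  finally show "mact B (s j) = s j" unfolding perm(1)[OF B] s_def .
 qed
 define P where "P = (PROD t:Th. [:- t, 1:])"
 have P: "coeff P k : A0 ?\<Gamma>" for k unfolding A0M proof (intro conjI ballI)
  show "coeff P k : M" unfolding P_def by (rule coeff_prod_mem[OF M fin ThM])
  fix B assume B: "B : ?\<Gamma>"
  have "mact B (coeff P k) = coeff (PROD t:Th. [:- mact B t, 1:]) k"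
   unfolding P_def by (rule coeff_prod_mact[OF sub[OF B] fin, symmetric])
  also have "(PROD t:Th. [:- mact B t, 1:]) = (PROD t:mact B ` Th. [:- t, 1:])" by (simp add: prod.reindex[OF perm(2)[OF B]])
  finally show "mact B (coeff P k) = coeff P k" unfolding perm(1)[OF B] P_def .
 qed
 define F where "F = C_adjoin {upsilon, th}"
 have F: "C_subfield F" unfolding F_def by (rule C_subfield_hull)
 note cl = C_subfield_closed[OF F]
 have uF: "upsilon : F" "th : F" using C_adjoin_subset[of "{upsilon, th}"] by (auto simp: F_def)
 have "C_adjoin {upsilon} <= F" by (rule C_adjoin_minimal[OF _ F]) (use uF in auto)
 hence A0F: "A0 ?\<Gamma> <= F" by (simp add: A0_Gamma1_7)
 define R where "R = (PROD t:Th - {th}. [:- t, 1:])"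
 have PR: "P = [:- th, 1:] * R" unfolding P_def R_def using fin thTh by (rule prod.remove)
 \<comment> \<open>Synthetic division by X - \<open>th\<close>, from the leading coefficient
   downwards.\<close>
 have R: "coeff R k : F" for k proof (induction "degree R + 1 - k" arbitrary: k)
  case 0
  thus ?case by (simp add: coeff_eq_0 cl(2))
 next
  case (Suc n)
  have "coeff P (Suc k) = - th * coeff R (Suc k) + coeff R k" unfolding PR coeff_linear_mult by simp
  hence "coeff R k = coeff P (Suc k) + th * coeff R (Suc k)" by simp
  moreover have "coeff R (Suc k) : F" using Suc by (intro Suc.hyps(1)) simp
  ultimately show ?case using subsetD[OF A0F P] by (auto intro!: cl uF)
 qed
 have polyR: "poly R x = (PROD t:Th - {th}. x - t)" for x by (simp add: R_def poly_prod)
 \<comment> \<open>\<open>R\<close> vanishes at every conjugate other than \<open>th\<close>, so one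
   term survives; written in powers of t the same sum has coefficients in the smaller field.\<close>
 have "(SUM t:Th. ph t * poly R t) = (SUM t:{th}. ph t * poly R t)"
  using fin thTh by (intro sum.mono_neutral_right) (auto simp: polyR intro!: prod_zero)
 also have "... = f * poly R th" using ph[OF one] by simp
 finally have "f * poly R th = (SUM t:Th. ph t * (SUM j<=degree R. coeff R j * t ^ j))" by (simp add: poly_altdef)
 also have "... = (SUM j<=degree R. coeff R j * s j)" unfolding s_def sum_distrib_left by (subst sum.swap) (simp add: mult_ac)
 also have "... : F" by (intro C_subfield_sum[OF F] cl R subsetD[OF A0F s])
 finally show ?thesis unfolding polyR F_def .
qed

text \<open>A primitive element g1 + l g0: outside a finite set of l it is moved by every matrix
  that moves the pair. Interpolating both f and 1 and dividing removes the common factor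
  \<open>D\<close>.\<close>

lemma A0_G14_subset: "A0 G14 <= C_adjoin {upsilon, g1, g0}"
proof
 fix f assume f: "f : A0 G14"
 note cl = C_subfield_closed[OF A0_subfield[OF group_subsets(2)]]
 define PP where "PP = (%A. (mact A g1, mact A g0)) ` SL2Z"
 have fixG: "mact A x = x" if "A : G14" "x : A0 G14" for A x using that by (auto simp: A0_altdef[OF group_subsets(2)])
 have fin: "finite PP" unfolding PP_def by (rule finite_orbit[of 14]) (use fixG g_in_A0 group_subsets(5) in auto)
 define Bad where "Bad = (\<Union>p\<in>PP - {(g1, g0)}. {l. fst p + mero_const l * snd p = g1 + mero_const l * g0})"
 have "finite {l. fst p + mero_const l * snd p = g1 + mero_const l * g0}" if "p ~= (g1, g0)" for p proof -
  have "l = l'" if "fst p + mero_const l * snd p = g1 + mero_const l * g0" "fst p + mero_const l' * snd p = g1 + mero_const l' * g0" for l l'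
  proof (rule ccontr)
   assume ne: "l ~= l'"
   have "(mero_const l - mero_const l') * (snd p - g0) = 0" using that by algebra
   hence "snd p = g0" using ne by (simp add: mero_const_eq_iff)
   moreover from this have "fst p = g1" using that by simp
   ultimately show False using \<open>p ~= (g1, g0)\<close> by (simp add: prod_eq_iff)
  qed
  hence "EX a. {l. fst p + mero_const l * snd p = g1 + mero_const l * g0} <= {a}" by blast
  thus ?thesis by (meson finite.emptyI finite.insertI finite_subset)
 qed
 hence "finite Bad" unfolding Bad_def using fin by auto
 then obtain l where l: "l ~: Bad" using ex_new_if_finite[OF infinite_UNIV_char_0] by blast
 define th where "th = g1 + mero_const l * g0"
 have th: "th : A0 G14" unfolding th_def by (intro cl g_in_A0)
 have stab: "A : G14" if A: "A : Gamma1 7" and fx: "mact A th = th" for A proof -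
  have AS: "A : SL2Z" using A group_subsets(1) by blast
  have "mact A g1 + mero_const l * mact A g0 = g1 + mero_const l * g0" using fx by (simp add: th_def mact_add mact_mult mact_const AS)
  moreover have "(mact A g1, mact A g0) : PP" using AS by (simp add: PP_def)
  ultimately have "(mact A g1, mact A g0) = (g1, g0)" using l by (force simp: Bad_def)
  thus ?thesis using stabilizer[OF A] by simp
 qed
 define D where "D = (PROD t:(%A. mact A th) ` Gamma1 7 - {th}. th - t)"
 define F where "F = C_adjoin {upsilon, g1, g0}"
 have F: "C_subfield F" unfolding F_def by (rule C_subfield_hull)
 note clF = C_subfield_closed[OF F]
 have gen: "upsilon : F" "g1 : F" "g0 : F" using C_adjoin_subset[of "{upsilon, g1, g0}"] by (auto simp: F_def)
 have "C_adjoin {upsilon, th} <= F" by (rule C_adjoin_minimal[OF _ F]) (use gen clF in \<open>auto simp: th_def\<close>)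
 hence "f * D : F" "1 * D : F" using interpolation[OF th f stab] interpolation[OF th cl(3) stab] unfolding D_def by blast+
 hence "f * D / (1 * D) : F" by (rule clF(10))
 moreover have "D ~= 0" unfolding D_def by (cases "finite ((%A. mact A th) ` Gamma1 7 - {th})") (auto simp: prod_zero_iff)
 ultimately show "f : C_adjoin {upsilon, g1, g0}" by (simp add: F_def)
qed

section \<open>Symmetric functions of the roots and the plane equation\<close>

lemma nonzero_gens: "upsilon ~= 0" "g1 ~= 0" "g0 ~= 0"
proof -
 have i: "\<i> : uhp" by (simp add: uhp_def)
 have kq: "kq xs ys \<i> ~= 0" if "kgood xs" "kgood ys" for xs ys
  unfolding kq_def using kp_nonzero[OF that(1) uhp_7[OF i]] kp_nonzero[OF that(2) uhp_7[OF i]] by simp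
 show "upsilon ~= 0" "g1 ~= 0" "g0 ~= 0" using upsilon_props(2)[OF i] g1_props(2)[OF i] g0_props(2)[OF i] nf_const[OF i, of 0]
   kq[OF kgood_lists(1,2)] kq[OF kgood_lists(3,4)] kq[OF kgood_lists(5,6)] by (auto simp: mero_const_0)
qed

lemma g1_neq_g0: "g1 ~= g0"
proof
 assume eq: "g1 = g0"
 obtain k where k: "k ~= 0" "((%t. nf g1 t * ce (- (of_real 0 * t))) \<longlongrightarrow> k) at_cusp" using limits_at_infinity(2) by blast
 obtain l where l: "l ~= 0" "((%t. nf g1 t * ce (- (of_real (- 1 / 2) * t))) \<longlongrightarrow> l) at_cusp" using limits_at_infinity(3) eq by auto
 from order_unique[OF k(2,1) l(2,1)] show False by simp
qed

lemma root_relations_mero: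
 "upsilon * g1 ^ 3 + upsilon * g1 ^ 2 - (upsilon ^ 2 - 1) * g1 + (upsilon - 1) ^ 2 = 0"
 "upsilon * g0 ^ 3 + upsilon * g0 ^ 2 - (upsilon ^ 2 - 1) * g0 + (upsilon - 1) ^ 2 = 0"
 "upsilon * (g1 * g2 * g0) = - ((upsilon - 1) ^ 2)"
proof -
 have e: "nf upsilon t = upsilon_fun t" "nf g1 t = g1_fun t" "nf g0 t = g0_fun t" if "t : uhp" for t
  using that by (simp_all add: upsilon_props(2) g1_props(2) g0_props(2) fun_eq_kq)
 have r1: "reg 1 t" "nf 1 t = 1" if "t : uhp" for t using reg_const[OF that, of 1] nf_const[OF that, of 1] by (simp_all add: mero_const_1)
 note regs = upsilon_props(3) g1_props(3) g0_props(3) r1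
 note nfs = nf_add nf_mult nf_diff nf_power
 have z: "x = 0" if "!!t. t : uhp ==> nf x t = 0" for x using eq_nfI[of x 0] nf_const[of _ 0] that by (simp add: mero_const_0)
 show "upsilon * g1 ^ 3 + upsilon * g1 ^ 2 - (upsilon ^ 2 - 1) * g1 + (upsilon - 1) ^ 2 = 0"
  by (rule z) (simp add: regs nfs e root_relations(1))
 show "upsilon * g0 ^ 3 + upsilon * g0 ^ 2 - (upsilon ^ 2 - 1) * g0 + (upsilon - 1) ^ 2 = 0"
  by (rule z) (simp add: regs nfs e root_relations(2))
 \<comment> \<open>The product relation, solved for \<open>g2\<close>, gives a holomorphic function
   on the half-plane, which makes \<open>g2\<close> accessible to pointwise arguments.\<close>
 define G where "G = (%t. - ((kq ux uy t - 1) ^ 2) / (kq ux uy t * (pe (1 / 14) * kq gx gy t) * - kq hx hy t))"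
 have nz: "kq ux uy t ~= 0" "kq gx gy t ~= 0" "kq hx hy t ~= 0" if "t : uhp" for t
  unfolding kq_def using kp_nonzero[OF _ uhp_7[OF that]] kgood_lists by auto
 have G: "G holomorphic_on uhp" unfolding G_def by (intro holomorphic_intros kq_holomorphic kgood_lists) (use nz in auto)
 have g2G: "g2_fun t = G t" if "t : uhp" for t using root_relations(3)[OF that] nz[OF that] upsilon_nonzero[OF that]
  by (simp add: G_def fun_eq_kq that field_simps)
 have g2: "nf g2 t = g2_fun t" "reg g2 t" if "t : uhp" for t unfolding g2_def using mero_of_cong(2,3)[OF g2G G that] g2G[OF that] by auto
 have "upsilon * (g1 * g2 * g0) + (upsilon - 1) ^ 2 = 0"
  by (rule z) (use root_relations(3) upsilon_nonzero in \<open>simp add: regs nfs e g2\<close>)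
 thus "upsilon * (g1 * g2 * g0) = - ((upsilon - 1) ^ 2)" by (simp add: eq_neg_iff_add_eq_0)
qed

text \<open>Dividing the difference of the two cubics by a - b gives a quadratic relation, so -1 - a
  - b has the right product with a and b; the given product then identifies it with c.\<close>

lemma third_root:
 fixes u a b c :: "'a :: field"
 assumes "u * a ^ 3 + u * a ^ 2 - (u ^ 2 - 1) * a + (u - 1) ^ 2 = 0"
  "u * b ^ 3 + u * b ^ 2 - (u ^ 2 - 1) * b + (u - 1) ^ 2 = 0"
  "u * (a * c * b) = - ((u - 1) ^ 2)" "a ~= b" "u ~= 0" "a ~= 0" "b ~= 0"
 shows "b = - 1 - a - c" "u * (a * c * (1 + a + c)) = (u - 1) ^ 2"
  "u * (a * c - (a + c) - (a + c) ^ 2) = - (u ^ 2 - 1)"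
proof -
 have "(a - b) * (u * (a ^ 2 + a * b + b ^ 2) + u * (a + b) - (u ^ 2 - 1)) = 0" using assms(1,2) by algebra
 hence q: "u * (a ^ 2 + a * b + b ^ 2) + u * (a + b) - (u ^ 2 - 1) = 0" using assms(4) by simp
 have "u * a * b * (- 1 - a - b) = - ((u - 1) ^ 2)" using q assms(1) by algebra
 hence "u * a * b * (c - (- 1 - a - b)) = 0" using assms(3) by algebra
 hence c: "c = - 1 - a - b" using assms(5-7) by simp
 show b: "b = - 1 - a - c" unfolding c by simp
 show "u * (a * c * (1 + a + c)) = (u - 1) ^ 2" using assms(3) unfolding c by algebra
 show "u * (a * c - (a + c) - (a + c) ^ 2) = - (u ^ 2 - 1)" using q unfolding c by algebra
qed

lemmas g_sym = third_root[OF root_relations_mero g1_neq_g0 nonzero_gens]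

lemma two_nz: "(2 :: mero) ~= 0" using mero_const_eq_0_iff[of 2] by (simp add: mero_const_numeral)

text \<open>Subtracting the relation for pairwise products from that for the product of the roots
  cancels the constant terms, and a factor \<open>upsilon\<close> can be divided out.\<close>

lemma upsilon_rational: "upsilon = (g1 * g2 * (1 + g1 + g2) + 2 + (g1 + g2) + (g1 + g2) ^ 2 - g1 * g2) / 2"
proof -
 have "upsilon * (2 * upsilon) = upsilon * (g1 * g2 * (1 + g1 + g2) + 2 + (g1 + g2) + (g1 + g2) ^ 2 - g1 * g2)" using g_sym(2,3) by algebra
 hence "2 * upsilon = g1 * g2 * (1 + g1 + g2) + 2 + (g1 + g2) + (g1 + g2) ^ 2 - g1 * g2" using nonzero_gens(1) mult_left_cancel by blast
 thus ?thesis using two_nz by (simp add: eq_divide_eq mult.commute)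
qed

text \<open>The result of eliminating \<open>upsilon\<close> from the two symmetric relations; the
  factor \<open>upsilon ^ 2\<close> keeps the elimination polynomial.\<close>

lemma plane_equation:
 "(g1 + g2) * (g1 + g2 + 2) * g1\<^sup>2 * g2\<^sup>2 + 2 * (g1 + g2 + 1) * (g1 + g2 + 2) * g1 * g2
  - (g1 + g2)\<^sup>2 * (g1 + g2 + 1)\<^sup>2 = 0"
proof -
 have "upsilon ^ 2 * ((g1 + g2) * (g1 + g2 + 2) * g1\<^sup>2 * g2\<^sup>2 + 2 * (g1 + g2 + 1) * (g1 + g2 + 2) * g1 * g2
  - (g1 + g2)\<^sup>2 * (g1 + g2 + 1)\<^sup>2) = 0" using g_sym(2,3) by algebra
 thus ?thesis using nonzero_gens(1) by simp
qed

theorem function_field: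
 "A0 G14 = C_adjoin {upsilon, g1, g2}" "C_adjoin {upsilon, g1, g2} = C_adjoin {g1, g2}"
proof -
 define F where "F = C_adjoin {g1, g2}"
 have F: "C_subfield F" unfolding F_def by (rule C_subfield_hull)
 note cl = C_subfield_closed[OF F]
 have g: "g1 : F" "g2 : F" using C_adjoin_subset[of "{g1, g2}"] by (auto simp: F_def)
 have u: "upsilon : F" by (subst upsilon_rational) (intro cl g)
 have g0: "g0 : F" by (subst g_sym(1)) (intro cl g)
 define F' where "F' = C_adjoin {upsilon, g1, g2}"
 have "F' <= F" unfolding F'_def by (rule C_adjoin_minimal[OF _ F]) (use u g in auto)
 moreover have "F <= F'" unfolding F_def F'_def
  by (rule C_adjoin_minimal[OF _ C_subfield_hull]) (use C_adjoin_subset[of "{upsilon, g1, g2}"] in auto)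
 ultimately show eq: "C_adjoin {upsilon, g1, g2} = C_adjoin {g1, g2}" by (auto simp: F_def F'_def)
 have "A0 G14 <= F" using A0_G14_subset C_adjoin_minimal[OF _ F, of "{upsilon, g1, g0}"] u g g0 by auto
 moreover have "F <= A0 G14" unfolding F_def proof (rule C_adjoin_minimal[OF _ A0_subfield[OF group_subsets(2)]])
  have "g2 = - 1 - g1 - g0" by (subst g_sym(1)) simp
  also have "... : A0 G14" by (intro C_subfield_closed[OF A0_subfield[OF group_subsets(2)]] g_in_A0)
  finally show "{g1, g2} <= A0 G14" using g_in_A0 by simp
 qed
 ultimately show "A0 G14 = C_adjoin {upsilon, g1, g2}" unfolding eq F_def by blast
qed

section \<open>Places of function fields\<close>

definition cpoly :: "complex poly => mero => mero" where
 "cpoly p t = poly (map_poly mero_const p) t"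

lemma cpoly_pCons [simp]: "cpoly (pCons a p) t = mero_const a + t * cpoly p t" by (simp add: cpoly_def map_poly_pCons mero_const_0)

lemma cpoly_0 [simp]: "cpoly 0 t = 0" by (simp add: cpoly_def)

lemma cpoly_1 [simp]: "cpoly 1 t = 1" by (simp add: one_pCons mero_const_1)

lemma cpoly_add: "cpoly (p + q) t = cpoly p t + cpoly q t"
proof -
 have "map_poly mero_const (p + q) = map_poly mero_const p + map_poly mero_const q"
  by (rule poly_eqI) (simp add: coeff_map_poly mero_const_0 mero_const_add)
 thus ?thesis by (simp add: cpoly_def)
qed

lemma cpoly_smult: "cpoly (smult a p) t = mero_const a * cpoly p t" by (induction p) (simp_all add: mero_const_mult algebra_simps)

lemma cpoly_mult: "cpoly (p * q) t = cpoly p t * cpoly q t"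
 by (induction p) (simp_all add: cpoly_add cpoly_smult mero_const_0 algebra_simps)

lemma cpoly_minus: "cpoly (- p) t = - cpoly p t" by (induction p) (simp_all add: mero_const_minus)

lemma cpoly_diff: "cpoly (p - q) t = cpoly p t - cpoly q t" using cpoly_add[of p "- q" t] by (simp add: cpoly_minus)

lemma cpoly_power: "cpoly (p ^ k) t = cpoly p t ^ k" by (induction k) (simp_all add: cpoly_mult)

lemma cpoly_sum: "cpoly (SUM i:I. p i) t = (SUM i:I. cpoly (p i) t)" by (induction I rule: infinite_finite_induct) (simp_all add: cpoly_add)

lemma cpoly_monom: "cpoly (monom a k) t = mero_const a * t ^ k"
 by (induction k) (simp_all add: monom_0 monom_Suc mero_const_0 algebra_simps)

lemma cpoly_numeral: "cpoly (numeral k) t = numeral k" by (simp add: numeral_poly mero_const_numeral)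

lemma cpoly_pcompose: "cpoly (pcompose p q) t = cpoly p (cpoly q t)" by (induction p) (simp_all add: pcompose_pCons cpoly_add cpoly_mult)

lemma cpoly_altdef: "degree p <= N ==> cpoly p t = (SUM i<=N. mero_const (coeff p i) * t ^ i)"
proof -
 assume "degree p <= N"
 hence "p = (SUM i<=N. monom (coeff p i) i)" by (intro poly_eqI) (auto simp: coeff_sum coeff_eq_0)
 hence "cpoly p t = cpoly (SUM i<=N. monom (coeff p i) i) t" by simp
 thus ?thesis by (simp add: cpoly_sum cpoly_monom)
qed

lemmas cpoly_simps = cpoly_add cpoly_mult cpoly_minus cpoly_diff cpoly_power cpoly_smult cpoly_numeral

lemma cpoly_linear_mult: "cpoly ([:- c, 1:] * q) t = (t - mero_const c) * cpoly q t"
 by (simp only: cpoly_mult) (simp add: mero_const_minus mero_const_1)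

text \<open>Since the complex numbers are algebraically closed, a polynomial relation for t splits
  into linear factors, and t would have to be constant.\<close>

lemma cpoly_eq_0:
 assumes "t ~: range mero_const" "cpoly p t = 0"
 shows "p = 0" using assms(2)
proof (induction "degree p" arbitrary: p rule: less_induct)
 case less
 show ?case proof (cases "degree p = 0")
  case True
  then obtain a where "p = [:a:]" by (metis degree_eq_zeroE)
  thus ?thesis using less.prems by (simp add: mero_const_eq_0_iff)
 next
  case False
  then obtain c where "poly p c = 0" using fundamental_theorem_of_algebra[of p] by (auto simp: constant_degree)
  then obtain q where q: "p = [:- c, 1:] * q" by (auto simp: poly_eq_0_iff_dvd dvd_def)
  have "(t - mero_const c) * cpoly q t = 0" using less.prems unfolding q cpoly_linear_mult .
  moreover have "t - mero_const c ~= 0" using assms(1) by auto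
  ultimately have "cpoly q t = 0" by simp
  moreover have "degree q < degree p" proof -
   have "q ~= 0" using False q by auto
   thus ?thesis unfolding q by (subst degree_mult_eq) auto
  qed
  ultimately have "q = 0" using less.hyps by blast
  thus ?thesis using q by simp
 qed
qed

section \<open>Valuation rings and Chevalley's extension theorem\<close>

definition max_ideal :: "mero set => mero set" where
 "max_ideal R = R - place_units R"

locale valuation_ring =
 fixes F R :: "mero set"
 assumes F: "C_subfield F" and R: "R : places F"
begin

abbreviation m where "m \<equiv> max_ideal R"

lemma const: "mero_const c : R" and sub: "a : R ==> a : F" using R by (auto simp: places_def)

lemma ring: "a : R ==> b : R ==> a + b : R" "a : R ==> b : R ==> a - b : R"
  "a : R ==> b : R ==> a * b : R" "0 : R" "1 : R" "a : R ==> - a : R"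
proof -
 show r: "a : R ==> b : R ==> a + b : R" "a : R ==> b : R ==> a - b : R"
  "a : R ==> b : R ==> a * b : R" for a b using R by (auto simp: places_def)
 show z: "0 : R" "1 : R" using const[of 0] const[of 1] by (auto simp: mero_const_0 mero_const_1)
 show "a : R ==> - a : R" using r(2)[of 0 a] z by simp
qed

lemma power: "a : R ==> a ^ k : R" by (induction k) (auto intro: ring)

lemma sum: "(!!i. i : I ==> f i : R) ==> (SUM i:I. f i) : R" by (induction I rule: infinite_finite_induct) (auto intro: ring)

lemma cpoly_mem: "a : R ==> cpoly p a : R" by (induction p) (auto intro: ring const)

lemma m_iff: "a : m \<longleftrightarrow> a : R & (a = 0 | inverse a ~: R)" by (auto simp: max_ideal_def place_units_def)

lemma inverse_m: "a : F ==> a ~: R ==> inverse a : m" using R ring by (auto simp: places_def m_iff)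

lemma m_mult: assumes "a : m" "b : R" shows "a * b : m" "b * a : m"
proof -
 have "inverse a : R" if "inverse (a * b) : R" "a * b ~= 0" using ring(3)[OF assms(2) that(1)] that(2) by (simp add: field_simps)
 thus "a * b : m" using assms ring(3) by (auto simp: m_iff)
 thus "b * a : m" by (simp add: mult.commute)
qed

lemma zero_m: "0 : m" by (simp add: m_iff ring)

text \<open>One of a / b and b / a lies in the valuation ring, so the sum is a multiple of a or of
  b.\<close>

lemma m_add: assumes "a : m" "b : m" shows "a + b : m"
proof (cases "a = 0 | b = 0")
 case False
 have F: "a / b : F" using assms by (intro C_subfield_closed[OF F] sub) (auto simp: m_iff)
 show ?thesis proof (cases "a / b : R")
  case True
  have "b * (1 + a / b) : m" using assms True by (intro m_mult(1) ring)
  thus ?thesis using False by (simp add: field_simps)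
 next
  case r: False
  hence "inverse (a / b) : R" using inverse_m[OF F] by (simp add: m_iff)
  hence "a * (1 + inverse (a / b)) : m" using assms by (intro m_mult(1) ring)
  thus ?thesis using False by (simp add: field_simps)
 qed
qed (use assms in auto)

lemma m_minus: "a : m ==> - a : m" using m_mult(1)[of a "- 1"] ring(5,6) by auto

lemma m_sum: "(!!i. i : I ==> f i : m) ==> (SUM i:I. f i) : m"
proof (induction I rule: infinite_finite_induct)
 case (insert i I)
 hence "f i + sum f I : m" by (intro m_add) auto
 thus ?case using insert by simp
qed (simp_all only: sum.infinite sum.empty not_False_eq_True zero_m)

lemma const_notin_m: "c ~= 0 ==> mero_const c ~: m" using const[of "inverse c"] by (simp add: m_iff mero_const_eq_0_iff mero_const_inverse)

lemma one_notin_m: "1 ~: m" using const_notin_m[of 1] by (simp add: mero_const_1)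

lemma m_prime: assumes "a * b : m" "a : R" "b : R" shows "a : m | b : m"
proof (rule ccontr)
 assume "~ ?thesis"
 hence n: "a ~= 0" "b ~= 0" "inverse a : R" "inverse b : R" using assms by (auto simp: m_iff)
 have "a * b * (inverse a * inverse b) : m" by (rule m_mult(1)) (use n assms ring in auto)
 thus False using n one_notin_m by (simp add: field_simps)
qed

lemma m_power: "a ^ k : m ==> a : R ==> a : m"
proof (induction k)
 case (Suc k) thus ?case using m_prime[of a "a ^ k"] power by auto
qed (use one_notin_m in simp)

lemma root_closed: assumes "a : F" "a ^ k : R" "k > 0" shows "a : R"
proof (rule ccontr)
 assume a: "a ~: R"
 hence "a ~= 0" using ring by auto
 have "inverse a : m" using inverse_m[OF assms(1) a] .
 hence "inverse a * inverse a ^ (k - 1) : m" by (intro m_mult(1) power) (auto simp: m_iff)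
 hence "inverse a ^ k : m" using assms(3) by (simp add: power_eq_if)
 hence "inverse a ^ k * a ^ k : m" using assms by (intro m_mult(1))
 hence "1 : m" using \<open>a ~= 0\<close> by (simp flip: power_mult_distrib)
 thus False using one_notin_m by simp
qed

lemma m_poly_root:
 assumes "a : R" "p ~= 0" "cpoly p a : m"
 shows "EX c. poly p c = 0 & a - mero_const c : m" using assms(2,3)
proof (induction "degree p" arbitrary: p rule: less_induct)
 case less
 show ?case proof (cases "degree p = 0")
  case True
  then obtain k where "p = [:k:]" by (metis degree_eq_zeroE)
  thus ?thesis using less.prems const_notin_m[of k] by auto
 next
  case False
  then obtain c where c: "poly p c = 0" using fundamental_theorem_of_algebra[of p] by (auto simp: constant_degree)
  then obtain q where q: "p = [:- c, 1:] * q" by (auto simp: poly_eq_0_iff_dvd dvd_def)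
  have e: "cpoly p a = (a - mero_const c) * cpoly q a" unfolding q by (rule cpoly_linear_mult)
  have "a - mero_const c : m | cpoly q a : m" using less.prems(2) unfolding e by (rule m_prime) (intro ring assms(1) const cpoly_mem)+
  thus ?thesis proof
   assume "cpoly q a : m"
   moreover have "q ~= 0" using less.prems q by auto
   moreover have "degree q < degree p" using \<open>q ~= 0\<close> unfolding q by (subst degree_mult_eq) auto
   ultimately obtain d where "poly q d = 0" "a - mero_const d : m" using less.hyps by blast
   thus ?thesis unfolding q by auto
  qed (use c in auto)
 qed
qed

end

text \<open>A subring that is maximal among those containing S but not 1 / t is a valuation ring.
  Any element outside it produces an expression of 1 / t as a polynomial in that element, and two
  such expressions, for e and 1 / e, contradict each other.\<close>

lemma exists_place:
 assumes F: "C_subfield F" and S: "S <= F" "range mero_const <= S"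
  "!!a b. a : S ==> b : S ==> a + b : S & a - b : S & a * b : S"
  and t: "t : S" "inverse t ~: S"
 obtains R where "R : places F" "S <= R" "t : max_ideal R"
proof -
 define \<A> where "\<A> = {M. S <= M & M <= F & inverse t ~: M \<and>
  (ALL a:M. ALL b:M. a + b : M & a - b : M & a * b : M)}"
 have "EX M:\<A>. ALL X:\<A>. M <= X --> X = M" proof (rule subset_Zorn_nonempty)
  have "S : \<A>" using S t by (simp add: \<A>_def)
  thus "\<A> ~= {}" by blast
  fix C assume C: "C ~= {}" "subset.chain \<A> C"
  have in_A: "X : \<A>" if "X : C" for X using C(2) that by (auto simp: subset.chain_def)
  have "EX X:C. a : X & b : X" if ab: "a : \<Union>C" "b : \<Union>C" for a b proof -
   obtain X Y where XY: "X : C" "Y : C" "a : X" "b : Y" using ab by blast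
   have "X <= Y | Y <= X" using C(2) XY by (auto simp: subset.chain_def)
   thus ?thesis using XY by blast
  qed
  note common = this
  have "a + b : \<Union>C & a - b : \<Union>C & a * b : \<Union>C" if ab: "a : \<Union>C" "b : \<Union>C" for a b proof -
   obtain X where X: "X : C" "a : X" "b : X" using common[OF ab] by blast
   hence "a + b : X & a - b : X & a * b : X" using in_A[OF X(1)] by (simp add: \<A>_def)
   thus ?thesis using X(1) by blast
  qed
  moreover have "S <= X" "X <= F" "inverse t ~: X" if "X : C" for X using in_A[OF that] by (simp_all add: \<A>_def)
  hence "S <= \<Union>C" "\<Union>C <= F" "inverse t ~: \<Union>C" using C(1) by blast+
  ultimately show "\<Union>C : \<A>" by (simp add: \<A>_def)
 qed
 then obtain M where M: "M : \<A>" and max: "!!X. X : \<A> ==> M <= X ==> X = M" by blast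
 have r: "a + b : M" "a - b : M" "a * b : M" if "a : M" "b : M" for a b using M that by (simp_all add: \<A>_def)
 have SM: "S <= M" "M <= F" "inverse t ~: M" using M by (simp_all add: \<A>_def)
 have tM: "t : M" using t SM by blast
 have t0: "t ~= 0" using t by (cases "t = 0") simp_all
 have c: "mero_const k : M" for k using SM S by blast
 have z: "0 : M" "1 : M" using c[of 0] c[of 1] by (auto simp: mero_const_0 mero_const_1)
 have pw: "a ^ k : M" if "a : M" for a and k :: nat using that by (induction k) (auto intro: r z)
 have sm: "(SUM i:I. h i) : M" if "!!i. i : I ==> h i : M" for I :: "nat set" and h
  using that by (induction I rule: infinite_finite_induct) (auto intro: r z)
 have adj: "EX p. (ALL i. coeff p i : M) & poly p e = inverse t" if e: "e : F" "e ~: M" for e proof (rule ccontr)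
  assume no: "~ ?thesis"
  define N where "N = {poly p e | p. ALL i. coeff p i : M}"
  have "M <= N" proof
   fix a assume "a : M"
   hence "ALL i. coeff [:a:] i : M" using z by (auto simp: coeff_pCons split: nat.split)
   thus "a : N" unfolding N_def by (intro CollectI exI[of _ "[:a:]"]) simp
  qed
  moreover have "e : N" proof -
   have "ALL i. coeff [:0, 1:] i : M" using z by (auto simp: coeff_pCons split: nat.split)
   thus ?thesis unfolding N_def by (intro CollectI exI[of _ "[:0, 1:]"]) simp
  qed
  moreover have "N : \<A>" proof -
   have "a + b : N & a - b : N & a * b : N" if ab: "a : N" "b : N" for a b proof -
    obtain p q where p: "ALL i. coeff p i : M" "a = poly p e" and q: "ALL i. coeff q i : M" "b = poly q e"
     using ab unfolding N_def by blast
    have "ALL i. coeff (p + q) i : M" "ALL i. coeff (p - q) i : M" "ALL i. coeff (p * q) i : M"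
     using p q by (auto simp: coeff_mult intro!: r sm)
    moreover have "a + b = poly (p + q) e" "a - b = poly (p - q) e" "a * b = poly (p * q) e" using p q by auto
    ultimately show ?thesis unfolding N_def by blast
   qed
   moreover have "N <= F" proof
    fix a assume "a : N"
    then obtain p where p: "ALL i. coeff p i : M" "a = poly p e" unfolding N_def by blast
    have "(SUM i<=degree p. coeff p i * e ^ i) : F" using p SM e by (intro C_subfield_sum[OF F] C_subfield_closed(6,11)[OF F]) auto
    thus "a : F" using p by (simp add: poly_altdef)
   qed
   moreover have "inverse t ~: N" using no unfolding N_def by force
   moreover have "S <= N" using SM(1) \<open>M <= N\<close> by (rule subset_trans)
   ultimately show ?thesis by (simp add: \<A>_def)
  qed
  ultimately show False using max[of N] e by simp
 qed
 \<comment> \<open>If 1 / y were outside \<open>M\<close>, then 1 / t times a power of y would lie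
   in \<open>M\<close>; since powers of y are 1 minus multiples of t, so would 1 / t.\<close>
 have unit: "inverse (1 - t * a) : M" "1 - t * a ~= 0" if a: "a : M" for a proof -
  show nz: "1 - t * a ~= 0" proof
   assume "1 - t * a = 0"
   hence "inverse t = a" using t0 by (simp add: field_simps)
   thus False using a SM by simp
  qed
  define y where "y = 1 - t * a"
  have y: "y : M" "y ~= 0" using nz a tM z by (auto simp: y_def intro: r)
  show "inverse (1 - t * a) : M" proof (rule ccontr)
   assume "inverse (1 - t * a) ~: M"
   moreover have "inverse y : F" using y SM by (intro C_subfield_closed[OF F]) auto
   ultimately obtain p where p: "ALL i. coeff p i : M" "poly p (inverse y) = inverse t" using adj[of "inverse y"] by (auto simp: y_def)
   have "inverse t * y ^ degree p = (SUM i<=degree p. coeff p i * y ^ (degree p - i))"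
    unfolding p(2)[symmetric] poly_altdef sum_distrib_right using y(2)
    by (intro sum.cong) (auto simp: power_diff field_simps power_inverse)
   also have "... : M" using p y by (intro sm r pw) auto
   finally have *: "inverse t * y ^ degree p : M" .
   have "EX b:M. y ^ k = 1 - t * b" for k proof (induction k)
    case (Suc k)
    then obtain b where b: "b : M" "y ^ k = 1 - t * b" by blast
    have "y ^ Suc k = 1 - t * (a + b - t * a * b)" unfolding power_Suc b(2) by (simp add: y_def algebra_simps)
    moreover have "a + b - t * a * b : M" using a b tM by (intro r)
    ultimately show ?case by blast
   qed (use z in auto)
   then obtain b where b: "b : M" "y ^ degree p = 1 - t * b" by blast
   have "inverse t = inverse t * y ^ degree p + b" unfolding b(2) using t0 by (simp add: field_simps)
   hence "inverse t : M" using r(1)[OF * b(1)] by simp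
   thus False using SM by simp
  qed
 qed
  text \<open>Choosing both relations of minimal degree, the one for \<open>1/e\<close> lowers the degree of the one for \<open>e\<close>.\<close>
 have red: False if e: "e ~= 0"
  and p: "ALL i. coeff p i : M" "poly p e = inverse t"
  and q: "ALL i. coeff q i : M" "poly q (inverse e) = inverse t" "degree q <= degree p"
  and minp: "!!p'. ALL i. coeff p' i : M ==> poly p' e = inverse t ==> degree p <= degree p'" for e p q proof -
  define k where "k = degree p"
  define u where "u = 1 - t * coeff q 0"
  have u: "inverse u : M" "u ~= 0" using unit[of "coeff q 0"] q by (auto simp: u_def)
  have k: "k > 0" proof (rule ccontr)
   assume "~ k > 0"
   then obtain a where "p = [:a:]" unfolding k_def by (metis degree_eq_zeroE not_gr_zero)
   hence "inverse t = coeff p 0" using p(2) by simp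
   thus False using p(1) SM by metis
  qed
  define s where "s = (SUM i:{1..degree q}. monom (inverse u * coeff q i) (k - i))"
  have s: "coeff s i : M" for i unfolding s_def coeff_sum using u q z by (intro sm) (auto intro!: r)
  have "inverse t = coeff q 0 + (SUM i:{1..degree q}. coeff q i * inverse e ^ i)" unfolding q(2)[symmetric] poly_altdef
   by (simp add: atMost_atLeast0 sum.atLeast_Suc_atMost)
  hence "u = t * (SUM i:{1..degree q}. coeff q i * inverse e ^ i)" using t0 unfolding u_def by (simp add: field_simps)
  moreover have "poly s e = inverse u * (SUM i:{1..degree q}. coeff q i * inverse e ^ i) * e ^ k"
   unfolding s_def poly_sum sum_distrib_left sum_distrib_right poly_monom
   using e q(3) by (intro sum.cong) (auto simp: k_def power_diff field_simps power_inverse)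
  ultimately have "t * poly s e = inverse u * u * e ^ k" by (simp only: mult_ac)
  hence ek: "e ^ k = t * poly s e" using u by simp
  define p' where "p' = p - monom (coeff p k) k + smult (coeff p k * t) s"
  have "ALL i. coeff p' i : M" unfolding p'_def using p s tM z by (auto intro!: r)
  moreover have "poly p' e = inverse t" unfolding p'_def using ek p(2) by (simp add: poly_monom algebra_simps)
  ultimately have "k <= degree p'" using minp k_def by blast
  have "coeff s i = 0" if "i >= k" for i unfolding s_def coeff_sum using that k q(3) by (intro sum.neutral) (auto simp: k_def)
  hence "coeff p' i = 0" if "i >= k" for i using that unfolding p'_def by (cases "i = k") (auto simp: k_def intro: coeff_eq_0)
  hence "degree p' <= k - 1" using k by (intro degree_le) auto
  thus False using \<open>k <= degree p'\<close> k by simp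
 qed
 have val: "e : M | inverse e : M" if e: "e : F" for e proof (rule ccontr)
  assume no: "~ ?thesis"
  hence e0: "e ~= 0" using z by auto
  define A where "A e = (%p. (ALL i. coeff p i : M) & poly p e = inverse t)" for e
  have "EX p. A e p" "EX q. A (inverse e) q" using adj[of e] adj[of "inverse e"] no e C_subfield_closed(8)[OF F] by (auto simp: A_def)
  then obtain p q where p: "A e p" "!!p'. A e p' ==> degree p <= degree p'"
   and q: "A (inverse e) q" "!!q'. A (inverse e) q' ==> degree q <= degree q'"
   using ex_has_least_nat[of "A e" _ degree] ex_has_least_nat[of "A (inverse e)" _ degree] by metis
  show False proof (cases "degree q <= degree p")
   case True
   show False by (rule red[of e p q]) (use p q True e0 in \<open>auto simp: A_def\<close>)
  next
   case False
   show False by (rule red[of "inverse e" q p]) (use p q False e0 in \<open>auto simp: A_def\<close>)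
  qed
 qed
 have "t ~: range mero_const" proof
  assume "t : range mero_const"
  then obtain k where "t = mero_const k" by blast
  hence "inverse t = mero_const (inverse k)" by (simp add: mero_const_inverse)
  thus False using c SM by simp
 qed
 moreover have "inverse t : F" using t S by (intro C_subfield_closed[OF F]) auto
 ultimately have "M : places F" using SM S tM val r by (auto simp: places_def)
 moreover have "t : max_ideal M" using tM SM by (auto simp: max_ideal_def place_units_def)
 ultimately show ?thesis using that SM by blast
qed

section \<open>Finite extensions of a rational function field\<close>

definition unif :: "mero set => mero" where
 "unif R = (SOME t. uniformizer R t)"

lemma inverse_notin_cpoly: assumes "t ~: range mero_const" shows "inverse t ~: range (%p. cpoly p t)"
proof
 assume "inverse t : range (%p. cpoly p t)"
 then obtain p where p: "inverse t = cpoly p t" by blast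
 have "t ~= 0" using assms mero_const_0 by (metis rangeI)
 hence "cpoly (pCons (- 1) p) t = 0" by (simp add: p[symmetric] mero_const_minus mero_const_1)
 hence "pCons (- 1) p = 0" by (rule cpoly_eq_0[OF assms])
 thus False by simp
qed

lemma place_over:
 assumes F: "C_subfield F" and t: "t : F" "t ~: range mero_const"
 obtains R where "R : places F" "t : max_ideal R"
proof -
 define S where "S = range (%p. cpoly p t)"
 have mem: "cpoly p t : F" for p by (induction p) (auto intro!: C_subfield_closed[OF F] t)
 have "mero_const c : S" for c unfolding S_def by (rule range_eqI[of _ _ "[:c:]"]) simp
 moreover have "t : S" unfolding S_def by (rule range_eqI[of _ _ "[:0, 1:]"]) (simp add: mero_const_0 mero_const_1)
 moreover have "a + b : S & a - b : S & a * b : S" if ab: "a : S" "b : S" for a b proof -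
  obtain p q where "a = cpoly p t" "b = cpoly q t" using ab unfolding S_def by blast
  hence "a + b = cpoly (p + q) t" "a - b = cpoly (p - q) t" "a * b = cpoly (p * q) t" by (simp_all add: cpoly_simps)
  thus ?thesis unfolding S_def by blast
 qed
 moreover have "inverse t ~: S" unfolding S_def by (rule inverse_notin_cpoly[OF t(2)])
 moreover have "S <= F" unfolding S_def using mem by blast
 ultimately obtain R where "R : places F" "S <= R" "t : max_ideal R" using exists_place[OF F, of S t] by blast
 thus ?thesis using that by blast
qed

text \<open>The last assumption says that F has degree at most n over C(x), with denominators
  cleared so that dependence has coefficients in C[x].\<close>

locale curve =
 fixes F :: "mero set" and x :: mero and n :: nat
 assumes F: "C_subfield F" and x: "x : F" and trans: "x ~: range mero_const"
  and dep: "!!f. (!!i. i <= n ==> f i : F) ==> EX q. (EX i<=n. q i ~= 0) & (SUM i<=n. cpoly (q i) x * f i) = 0"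
begin

text \<open>The local parameters at all points of the x-line, the point at infinity included, so
  that finite and infinite points are treated alike.\<close>

definition par :: "mero set" where
 "par = insert (inverse x) (range (%c. x - mero_const c))"

lemma x_nz: "x ~= 0" using trans mero_const_0 by (metis rangeI)

lemma par_nz: "t : par ==> t ~= 0" using trans x_nz by (auto simp: par_def)

lemma par_F: "t : par ==> t : F" by (auto simp: par_def intro!: C_subfield_closed[OF F] x)

text \<open>A dependence relation is rewritten in the parameter t and divided by the largest common
  power of t. What is gained is that it stays nontrivial modulo t, which the arguments below
  exploit.\<close>

lemma dep_par:
 fixes f :: "'b => mero"
 assumes t: "t : par" and I: "finite I" "card I > n" and f: "!!i. i : I ==> f i : F"
 obtains rh s where "EX i:I. rh i ~= 0" "(SUM i:I. (mero_const (rh i) + t * cpoly (s i) t) * f i) = 0"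
proof -
 obtain J where J: "J <= I" "card J = Suc n" using I obtain_subset_with_card_n[of "Suc n" I] by (metis Suc_leI)
 have finJ: "finite J" using J I finite_subset by blast
 obtain h where "bij_betw h {0..<card J} J" using ex_bij_betw_nat_finite[OF finJ] by blast
 hence h: "bij_betw h {..n} J" using J by (simp add: atLeast0LessThan lessThan_Suc_atMost)
 hence hJ: "h i : J" if "i <= n" for i using that by (auto simp: bij_betw_def)
 obtain q where q: "EX i<=n. q i ~= 0" "(SUM i<=n. cpoly (q i) x * f (h i)) = 0" using dep[of "%i. f (h i)"] hJ J f by blast
 define Q where "Q i = (if i : J then q (inv_into {..n} h i) else 0)" for i
 have Qh: "Q (h i) = q i" if "i <= n" for i using that h hJ by (simp add: Q_def bij_betw_def inv_into_f_f)
 have "(SUM i:I. cpoly (Q i) x * f i) = (SUM i:J. cpoly (Q i) x * f i)"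
  by (rule sum.mono_neutral_right) (use I J in \<open>auto simp: Q_def\<close>)
 also have "... = (SUM i<=n. cpoly (Q (h i)) x * f (h i))" by (rule sum.reindex_bij_betw[OF h, symmetric])
 also have "... = 0" using q(2) by (simp add: Qh)
 finally have Q0: "(SUM i:I. cpoly (Q i) x * f i) = 0" .
 have Qn: "EX i:I. Q i ~= 0" using q(1) Qh hJ J(1) by (metis subsetD)
 have "EX T. (EX i:I. T i ~= 0) & (SUM i:I. cpoly (T i) t * f i) = 0" proof (cases "t = inverse x")
  case False
  then obtain c where c: "t = x - mero_const c" using t by (auto simp: par_def)
  define T where "T i = pcompose (Q i) [:c, 1:]" for i
  have "cpoly (T i) t = cpoly (Q i) x" for i by (simp add: T_def cpoly_pcompose c mero_const_1)
  moreover have "T i ~= 0" if "Q i ~= 0" for i using that pcompose_eq_0[of "Q i" "[:c, 1:]"] by (auto simp: T_def)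
  ultimately show ?thesis using Q0 Qn by (intro exI[of _ T]) auto
 next
  case True
  \<comment> \<open>At infinity the coefficients are reversed: multiplication by a common power of 1
    / x turns polynomials in x into polynomials in 1 / x.\<close>
  define N where "N = (SUM i:I. degree (Q i))"
  define T where "T i = (SUM j<=N. monom (coeff (Q i) (N - j)) j)" for i
  have TQ: "cpoly (T i) t = t ^ N * cpoly (Q i) x" if "i : I" for i proof -
   have "degree (Q i) <= N" unfolding N_def using that I by (intro member_le_sum) auto
   hence "t ^ N * cpoly (Q i) x = (SUM j<=N. mero_const (coeff (Q i) j) * (x ^ j * t ^ N))"
    by (simp add: cpoly_altdef[of _ N] sum_distrib_left mult_ac)
   also have "... = (SUM j<=N. mero_const (coeff (Q i) j) * t ^ (N - j))"
    using x_nz by (intro sum.cong) (auto simp: True power_diff field_simps power_inverse)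
   also have "... = (SUM j<=N. mero_const (coeff (Q i) (N - j)) * t ^ j)"
    by (rule sum.reindex_bij_witness[of _ "%j. N - j" "%j. N - j"]) auto
   finally show ?thesis by (simp add: T_def cpoly_sum cpoly_monom)
  qed
  have "(SUM i:I. cpoly (T i) t * f i) = t ^ N * (SUM i:I. cpoly (Q i) x * f i)"
   unfolding sum_distrib_left by (intro sum.cong) (auto simp: TQ)
  moreover have "T i ~= 0" if "Q i ~= 0" "i : I" for i proof
   assume "T i = 0"
   hence "cpoly (Q i) x = 0" using TQ[OF that(2)] par_nz[OF t] by simp
   thus False using cpoly_eq_0[OF trans] that by blast
  qed
  ultimately show ?thesis using Q0 Qn by (intro exI[of _ T]) auto
 qed
 then obtain T where T: "EX i:I. T i ~= 0" "(SUM i:I. cpoly (T i) t * f i) = 0" by blast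
 define k where "k = (LEAST k. EX i:I. coeff (T i) k ~= 0)"
 have "EX k. EX i:I. coeff (T i) k ~= 0" using T(1) by (metis leading_coeff_0_iff)
 hence k: "EX i:I. coeff (T i) k ~= 0" unfolding k_def by (rule LeastI_ex)
 have less: "coeff (T i) j = 0" if "j < k" "i : I" for i j using not_less_Least[OF that(1)[unfolded k_def]] that(2) by blast
 define S where "S i = poly_shift k (T i)" for i
 have TS: "T i = monom 1 k * S i" if "i : I" for i using less that by (intro poly_eqI) (auto simp: coeff_monom_mult S_def coeff_poly_shift)
 have S: "S i = pCons (coeff (S i) 0) (poly_shift 1 (S i))" for i
  by (intro poly_eqI) (auto simp: coeff_pCons coeff_poly_shift split: nat.split)
 have "t ^ k * (SUM i:I. cpoly (S i) t * f i) = (SUM i:I. cpoly (T i) t * f i)"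
  unfolding sum_distrib_left by (intro sum.cong) (auto simp: TS cpoly_mult cpoly_monom mero_const_1)
 hence "(SUM i:I. cpoly (S i) t * f i) = 0" using T(2) par_nz[OF t] by simp
 moreover have "cpoly (S i) t = mero_const (coeff (S i) 0) + t * cpoly (poly_shift 1 (S i)) t" for i by (subst S) simp
 ultimately have s0: "(SUM i:I. (mero_const (coeff (S i) 0) + t * cpoly (poly_shift 1 (S i)) t) * f i) = 0" by simp
 have "EX i:I. coeff (S i) 0 ~= 0" using k by (simp add: S_def coeff_poly_shift)
 thus ?thesis by (rule that[OF _ s0])
qed

end

section \<open>Discreteness of places, uniformizers and orders\<close>

locale curve_place = curve F x n + valuation_ring F R for F x n R
begin

lemma card_n: "n < card {..n}" by simp

text \<open>Every place lies over a point of the x-line. Otherwise all nonzero polynomials in x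
  would be units, and an algebraic relation for an f with a pole, divided by its top power, would
  put a unit into the maximal ideal.\<close>

lemma par_ex: obtains t where "t : par" "t : m"
proof -
 have "EX t:par. t : m" proof (rule ccontr)
  assume no: "~ ?thesis"
  have "x : R" using no inverse_m[OF x] by (auto simp: par_def)
  hence u: "cpoly p x ~: m" if "p ~= 0" for p using m_poly_root[of x p] that no by (auto simp: par_def)
  have "F <= R" proof
   fix f assume f: "f : F"
   show "f : R" proof (rule ccontr)
    assume fR: "f ~: R"
    hence h: "inverse f : m" "f ~= 0" using inverse_m[OF f] ring by auto
    obtain q where q: "EX i<=n. q i ~= 0" "(SUM i<=n. cpoly (q i) x * f ^ i) = 0"
     using dep[of "%i. f ^ i"] C_subfield_closed(11)[OF F f] by blast
    define d where "d = (GREATEST i. i <= n & q i ~= 0)"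
    have d: "d <= n & q d ~= 0" unfolding d_def by (rule GreatestI_ex_nat[of "%i. i <= n & q i ~= 0" n]) (use q(1) in auto)
    have gr: "q i = 0" if i: "d < i" "i <= n" for i proof (rule ccontr)
     assume "q i ~= 0"
     hence "i <= d" unfolding d_def by (intro Greatest_le_nat[of "%i. i <= n & q i ~= 0" i n]) (use i in auto)
     thus False using i by simp
    qed
    have "0 = (SUM i<=n. cpoly (q i) x * f ^ i) * inverse f ^ d" using q(2) by simp
    also have "(SUM i<=n. cpoly (q i) x * f ^ i) = (SUM i<=d. cpoly (q i) x * f ^ i)"
     by (rule sum.mono_neutral_right) (use d gr in auto)
    also have "... * inverse f ^ d = (SUM i<=d. cpoly (q i) x * inverse f ^ (d - i))" unfolding sum_distrib_right using h(2)
     by (intro sum.cong) (auto simp: power_diff field_simps power_inverse)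
    also have "... = cpoly (q d) x + (\<Sum>i<d. cpoly (q i) x * inverse f ^ (d - i))" by (simp add: lessThan_Suc_atMost[symmetric])
    finally have "cpoly (q d) x = - (\<Sum>i<d. cpoly (q i) x * inverse f ^ (d - i))" by (simp add: eq_neg_iff_add_eq_0)
    also have "... : m" proof (intro m_minus m_sum m_mult(2) cpoly_mem \<open>x : R\<close>)
     fix i assume "i : {..<d}"
     hence "inverse f ^ (d - i) = inverse f * inverse f ^ (d - i - 1)" by (simp add: power_eq_if)
     also have "... : m" using h(1) by (intro m_mult(1) power) (auto simp: m_iff)
     finally show "inverse f ^ (d - i) : m" .
    qed
    finally show False using u d by blast
   qed
  qed
  thus False using R by (auto simp: places_def)
 qed
 thus ?thesis using that by blast
qed

text \<open>The relation between powers of f reduces modulo the maximal ideal to a nonzero complex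
  polynomial in f, and one of its linear factors must vanish there.\<close>

lemma residue: assumes f: "f : R" shows "EX c. f - mero_const c : m"
proof -
 obtain t where t: "t : par" "t : m" by (rule par_ex)
 obtain rh s where r: "EX i:{..n}. rh i ~= 0" "(SUM i:{..n}. (mero_const (rh i) + t * cpoly (s i) t) * f ^ i) = 0"
  by (rule dep_par[OF t(1) finite_atMost card_n C_subfield_closed(11)[OF F sub[OF f]]])
 have tR: "t : R" using t by (simp add: m_iff)
 define p where "p = (SUM i<=n. monom (rh i) i)"
 have cf: "coeff p i = rh i" if "i <= n" for i using that by (simp add: p_def coeff_sum)
 have "p ~= 0" using r(1) cf by (metis atMost_iff coeff_0)
 moreover have "cpoly p f : m" proof -
  have "cpoly p f = (SUM i<=n. (mero_const (rh i) + t * cpoly (s i) t) * f ^ i) - (SUM i<=n. t * (cpoly (s i) t * f ^ i))"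
   by (simp add: p_def cpoly_sum cpoly_monom algebra_simps flip: sum_subtractf)
  also have "... = - (SUM i<=n. t * (cpoly (s i) t * f ^ i))" using r(2) by simp
  also have "... : m" by (intro m_minus m_sum m_mult(1) t ring cpoly_mem power tR f)
  finally show ?thesis .
 qed
 ultimately show ?thesis using m_poly_root[OF f] by blast
qed

text \<open>In a relation between n + 1 elements of strictly increasing value, all of value below t,
  the first term with nonzero constant coefficient cannot be cancelled. This bounds ramification by
  n.\<close>

lemma no_chain:
 assumes t: "t : par" and a: "!!i. i <= n ==> a i : R" "!!i. i <= n ==> a i ~= 0"
  and ch: "!!i j. i < j ==> j <= n ==> a j / a i : m" and ta: "!!i. i <= n ==> t / a i : m"
 shows False
proof -
 have aF: "a i : F" if "i : {..n}" for i using a(1) sub that by simp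
 obtain rh s where r: "EX i:{..n}. rh i ~= 0" "(SUM i:{..n}. (mero_const (rh i) + t * cpoly (s i) t) * a i) = 0"
  by (rule dep_par[OF t finite_atMost card_n aF])
 have "t / a 0 * a 0 : m" using ta a by (intro m_mult(1)) auto
 hence tR: "t : R" using a(2)[of 0] by (simp add: m_iff)
 define k where "k = (LEAST i. i <= n & rh i ~= 0)"
 have k: "k <= n & rh k ~= 0" unfolding k_def by (rule LeastI_ex[of "%i. i <= n & rh i ~= 0"]) (use r(1) in auto)
 have less: "rh i = 0" if "i < k" for i using not_less_Least[OF that[unfolded k_def]] that k by simp
 define A where "A = (SUM i:{..n} - {k}. mero_const (rh i) * (a i / a k))"
 define B where "B = (SUM i<=n. cpoly (s i) t * a i * (t / a k))"
 have "(SUM i<=n. mero_const (rh i) * (a i / a k)) + B = (SUM i<=n. (mero_const (rh i) + t * cpoly (s i) t) * a i) / a k"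
  unfolding B_def sum_divide_distrib sum.distrib[symmetric] by (intro sum.cong) (auto simp: algebra_simps add_divide_distrib)
 hence "(SUM i<=n. mero_const (rh i) * (a i / a k)) + B = 0" using r(2) by simp
 moreover have "(SUM i<=n. mero_const (rh i) * (a i / a k)) = mero_const (rh k) + A"
  unfolding A_def using k a(2)[of k] by (subst sum.remove[of _ k]) auto
 ultimately have "mero_const (rh k) + (A + B) = 0" by (simp only: add.assoc)
 hence "mero_const (rh k) = - (A + B)" by (rule eq_neg_iff_add_eq_0[THEN iffD2])
 also have "... : m" proof (intro m_minus m_add)
  show "A : m" unfolding A_def proof (rule m_sum)
   fix i assume "i : {..n} - {k}"
   thus "mero_const (rh i) * (a i / a k) : m" using less[of i] m_mult(2)[OF ch[of k i] const[of "rh i"]] zero_m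
    by (cases "i < k") (auto simp: mero_const_0)
  qed
  show "B : m" unfolding B_def using k by (intro m_sum m_mult(2) ta ring cpoly_mem tR a(1)) auto
 qed
 finally show False using const_notin_m k by blast
qed

text \<open>If the maximal ideal were not principal, each of its nonzero elements could be replaced
  by one of strictly smaller positive value; starting from t this gives a chain excluded by
  \<open>no_chain\<close>.\<close>

lemma ex_uniformizer: "EX t. uniformizer R t"
proof (rule ccontr)
 assume no: "~ ?thesis"
 have step: "EX z. z : m - {0} & y / z : m" if y: "y : m - {0}" for y proof -
  have "(%a. y * a) ` R <= m" using y m_mult(1) by blast
  moreover have "m ~= (%a. y * a) ` R" using no by (auto simp: uniformizer_def max_ideal_def)
  ultimately obtain z where z: "z : m" "z ~: (%a. y * a) ` R" by blast
  have "z ~= 0" using z(2) ring(4) by (auto simp: image_iff)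
  have "z / y ~: R" proof
   assume "z / y : R"
   moreover have "z = y * (z / y)" using y by simp
   ultimately show False using z(2) by blast
  qed
  moreover have "z / y : F" using z y by (intro C_subfield_closed[OF F] sub) (auto simp: m_iff)
  ultimately have "inverse (z / y) : m" by (intro inverse_m)
  thus ?thesis using z(1) \<open>z ~= 0\<close> by (intro exI[of _ z]) auto
 qed
 then obtain g where g: "!!y. y : m - {0} ==> g y : m - {0} & y / g y : m" by metis
 obtain t where t: "t : par" "t : m" by (rule par_ex)
 define b where "b i = (g ^^ i) t" for i
 have b: "b i : m - {0}" for i unfolding b_def using g t par_nz[OF t(1)] by (induction i) auto
 have bs: "b i / b (Suc i) : m" for i using g[OF b[of i]] by (simp add: b_def)
 have bl: "b i / b j : m" if "i < j" for i j using that proof (induction j)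
  case (Suc j)
  show ?case proof (cases "i = j")
   case False
   hence "b i / b j * (b j / b (Suc j)) : m" using Suc bs[of j] by (intro m_mult(1)) (auto simp: m_iff)
   thus ?thesis using b[of j] by simp
  qed (use bs in simp)
 qed simp
 have bR: "b i : R" "b i ~= 0" for i using b[of i] by (auto simp: m_iff)
 show False proof (rule no_chain[OF t(1), of "%i. b (Suc n - i)"])
  fix i assume "i <= n"
  thus "t / b (Suc n - i) : m" using bl[of 0 "Suc n - i"] by (simp add: b_def)
 qed (use bR bl in auto)
qed

abbreviation un where "un \<equiv> unif R"

lemma unif: "uniformizer R un" unfolding unif_def by (rule someI_ex[OF ex_uniformizer])

lemma m_eq: "uniformizer R t ==> m = (%a. t * a) ` R" by (simp add: uniformizer_def max_ideal_def)

lemma unif_m: "uniformizer R t ==> t : m" and unif_nz: "uniformizer R t ==> t ~= 0"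
proof -
 assume u: "uniformizer R t"
 show "t : m" unfolding m_eq[OF u] using ring(5) by (intro image_eqI[of _ _ 1]) auto
 show "t ~= 0" proof
  assume "t = 0"
  hence "m <= {0}" unfolding m_eq[OF u] by auto
  moreover obtain s where "s : par" "s : m" by (rule par_ex)
  ultimately show False using par_nz by blast
 qed
qed

lemma pi: "un : m" "un : R" "un ~= 0" "un : F" using unif_m[OF unif] unif_nz[OF unif] sub by (auto simp: m_iff)

lemma m_div: "a : m \<longleftrightarrow> a / un : R"
proof
 assume "a : m" thus "a / un : R" unfolding m_eq[OF unif] using pi(3) by auto
next
 assume "a / un : R"
 hence "un * (a / un) : m" by (intro m_mult(1) pi)
 thus "a : m" using pi(3) by simp
qed

lemma units_iff: "u : place_units R \<longleftrightarrow> u : R & u ~: m" by (auto simp: max_ideal_def place_units_def)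

lemma units: "u : place_units R ==> u : R" "u : place_units R ==> u ~= 0"
 "u : place_units R ==> inverse u : place_units R"
 "u : place_units R ==> v : place_units R ==> u * v : place_units R"
 "u : place_units R ==> u powi k : place_units R"
proof -
 show 1: "u : place_units R ==> u : R" "u : place_units R ==> u ~= 0"
  "u : place_units R ==> inverse u : place_units R"
  "u : place_units R ==> v : place_units R ==> u * v : place_units R" for u v by (auto simp: place_units_def intro: ring)
 have p: "u : place_units R ==> u ^ j : place_units R" for u j by (induction j) (auto intro!: 1, auto simp: place_units_def ring)
 show "u : place_units R ==> u powi k : place_units R" by (cases "k >= 0") (auto simp: power_int_def intro!: p 1)
qed

lemma finite_order:
 assumes f: "f : R" "f / un ^ K ~: R"
 shows "\<exists>k<K. EX u:place_units R. f = un ^ k * u" using assms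
proof (induction K)
 case (Suc K)
 show ?case proof (cases "f / un ^ K : R")
  case True
  have "f / un ^ K ~: m" using Suc.prems pi(3) by (subst m_div) (simp add: field_simps)
  hence "f / un ^ K : place_units R" using True units_iff by blast
  moreover have "f = un ^ K * (f / un ^ K)" using pi(3) by simp
  ultimately show ?thesis by blast
 next
  case False
  thus ?thesis using Suc by (meson less_Suc_eq)
 qed
qed simp

lemma unif_power: "k > 0 ==> un ^ k : m" using m_mult(1)[OF pi(1) power[OF pi(2), of "k - 1"]] by (simp add: power_eq_if)

lemma par_bound: assumes "t : par" shows "t / un ^ Suc n ~: R"
proof
 assume a: "t / un ^ Suc n : R"
 show False proof (rule no_chain[OF assms, of "%i. un ^ i"])
  fix i assume "i <= n"
  hence "un ^ (Suc n - i) * (t / un ^ Suc n) : m" using a by (intro m_mult(1) unif_power) auto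
  thus "t / un ^ i : m" using \<open>i <= n\<close> pi(3) by (simp add: power_diff field_simps)
 next
  fix i j :: nat assume "i < j"
  thus "un ^ j / un ^ i : m" using unif_power[of "j - i"] pi(3) by (simp add: power_diff)
 qed (use pi power in auto)
qed

text \<open>The lowest nonzero coefficient dominates, so the value of a polynomial in t is a
  multiple of the value of t.\<close>

lemma cpoly_par: assumes "t : m" "p ~= 0" shows "EX j. EX u:place_units R. cpoly p t = t ^ j * u" using assms(2)
proof (induction p)
 case (pCons a p)
 have tp: "t * cpoly p t : m" using assms(1) by (intro m_mult(1) cpoly_mem) (auto simp: m_iff)
 show ?case proof (cases "a = 0")
  case True
  then obtain j u where u: "u : place_units R" "cpoly p t = t ^ j * u" using pCons by auto
  have "cpoly (pCons a p) t = t ^ Suc j * u" using True u(2) by (simp add: mero_const_0)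
  thus ?thesis using u(1) by blast
 next
  case False
  have "mero_const a + t * cpoly p t ~: m" proof
   assume "mero_const a + t * cpoly p t : m"
   hence "mero_const a + t * cpoly p t + - (t * cpoly p t) : m" by (rule m_add[OF _ m_minus[OF tp]])
   thus False using const_notin_m[OF False] by simp
  qed
  moreover have "mero_const a + t * cpoly p t : R" using tp ring(1)[OF const, of "t * cpoly p t" a] m_iff by blast
  ultimately have "mero_const a + t * cpoly p t : place_units R" using units_iff by blast
  thus ?thesis by (intro exI[of _ 0] bexI[of _ "mero_const a + t * cpoly p t"]) auto
 qed
qed simp

text \<open>An f divisible by all powers of the uniformizer would divide a nonzero polynomial in t,
  namely the lowest coefficient in a relation between its powers. Such a polynomial has finite
  order.\<close>

lemma order_form: assumes f: "f : F" "f ~= 0" shows "EX k. EX u:place_units R. f = un powi k * u"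
proof -
 have R: "EX k. EX u:place_units R. f = un ^ k * u" if f: "f : R" "f ~= 0" for f proof (rule ccontr)
  assume no: "~ ?thesis"
  hence div: "f / un ^ K : R" for K using finite_order[OF f(1)] by blast
  obtain t where t: "t : par" "t : m" by (rule par_ex)
  have tR: "t : R" using t by (simp add: m_iff)
  obtain e v where e: "v : place_units R" "t = un ^ e * v" using finite_order[OF tR par_bound[OF t(1)]] by blast
  obtain rh s where r: "EX i:{..n}. rh i ~= 0" "(SUM i:{..n}. (mero_const (rh i) + t * cpoly (s i) t) * f ^ i) = 0"
   by (rule dep_par[OF t(1) finite_atMost card_n C_subfield_closed(11)[OF F sub[OF f(1)]]])
  define T where "T i = pCons (rh i) (s i)" for i
  have T0: "(SUM i<=n. cpoly (T i) t * f ^ i) = 0" using r(2) by (simp add: T_def)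
  define k where "k = (LEAST i. i <= n & T i ~= 0)"
  have k: "k <= n & T k ~= 0" unfolding k_def
   by (rule LeastI_ex[of "%i. i <= n & T i ~= 0"]) (use r(1) in \<open>auto simp: T_def\<close>)
  have less: "T i = 0" if "i < k" for i using not_less_Least[OF that[unfolded k_def]] that k by simp
  have "0 = (SUM i:{k..n}. cpoly (T i) t * f ^ i)" unfolding T0[symmetric] by (rule sum.mono_neutral_right) (use less in auto)
  also have "... = f ^ k * (SUM i:{k..n}. cpoly (T i) t * f ^ (i - k))"
   unfolding sum_distrib_left by (intro sum.cong) (auto simp: power_diff f(2) field_simps)
  finally have "(SUM i:{k..n}. cpoly (T i) t * f ^ (i - k)) = 0" using f(2) by simp
  moreover have "(SUM i:{k..n}. cpoly (T i) t * f ^ (i - k)) = cpoly (T k) t + (SUM i:{Suc k..n}. cpoly (T i) t * f ^ (i - k))"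
   using k by (simp add: sum.atLeast_Suc_atMost)
  moreover have "(SUM i:{Suc k..n}. cpoly (T i) t * f ^ (i - k)) = f * (SUM i:{Suc k..n}. cpoly (T i) t * f ^ (i - k - 1))"
   unfolding sum_distrib_left by (intro sum.cong) (auto simp: power_eq_if[of f "_ - k"])
  ultimately have "cpoly (T k) t = f * (- (SUM i:{Suc k..n}. cpoly (T i) t * f ^ (i - k - 1)))" by (simp add: eq_neg_iff_add_eq_0)
  then obtain g where g: "g : R" "cpoly (T k) t = f * g" using f tR by (metis (no_types, lifting) ring(3,6) sum cpoly_mem power)
  obtain j u where u: "u : place_units R" "cpoly (T k) t = t ^ j * u" using cpoly_par[OF t(2)] k by blast
  have "f / un ^ Suc (e * j) * g * (inverse u * inverse v powi int j) : R" by (intro ring div g units u e)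
  moreover have "f / un ^ Suc (e * j) * g * (inverse u * inverse v powi int j) = inverse un" proof -
   have "f * g = un ^ (e * j) * v ^ j * u" using g(2) u(2) e(2) by (simp add: power_mult_distrib power_mult)
   hence "f / un ^ Suc (e * j) * g * (inverse u * inverse v powi int j) =
    un ^ (e * j) * v ^ j * u / un ^ Suc (e * j) * (inverse u * inverse v ^ j)" by (simp add: field_simps)
   also have "... = inverse un" using pi(3) units(2)[OF u(1)] units(2)[OF e(1)] by (simp add: field_simps power_inverse)
   finally show ?thesis .
  qed
  ultimately have "inverse un : R" by simp
  thus False using pi(1,3) by (simp add: m_iff)
 qed
 show ?thesis proof (cases "f : R")
  case True
  then obtain k u where "u : place_units R" "f = un ^ k * u" using R f by blast
  thus ?thesis by (intro exI[of _ "int k"] bexI[of _ u]) auto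
 next
  case False
  hence "inverse f : R" using inverse_m[OF f(1)] by (simp add: m_iff)
  then obtain k u where u: "u : place_units R" "inverse f = un ^ k * u" using R[of "inverse f"] f by auto
  have "f = inverse (un ^ k * u)" using u(2) by (metis inverse_inverse_eq)
  hence "f = un powi (- int k) * inverse u" by (simp add: power_int_minus)
  thus ?thesis using units(3)[OF u(1)] by blast
 qed
qed

lemma power_R: assumes "u : place_units R" shows "un powi k * u : R \<longleftrightarrow> k >= 0"
proof
 assume "k >= 0"
 thus "un powi k * u : R" using units(1)[OF assms] power[OF pi(2)] by (auto simp: power_int_def intro: ring)
next
 assume a: "un powi k * u : R"
 show "k >= 0" proof (rule ccontr)
  assume k: "~ k >= 0"
  have "un ^ nat (- k) * (un powi k * u * inverse u) : m"
   by (rule m_mult(1)[OF unif_power ring(3)[OF a units(1)[OF units(3)[OF assms]]]]) (use k in simp)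
  moreover have "un ^ nat (- k) * (un powi k * u * inverse u) = 1"
   using k pi(3) units(2)[OF assms] by (simp add: power_int_def power_inverse field_simps)
  ultimately show False using one_notin_m by simp
 qed
qed

text \<open>Two uniformizers differ by a unit, so the description in \<open>place_ord\<close> is
  unambiguous.\<close>

lemma place_ord_eq: assumes u: "u : place_units R" shows "place_ord R (un powi k * u) = k" unfolding place_ord_def
proof (rule the_equality)
 show "EX t u'. uniformizer R t & u' : place_units R & un powi k * u = t powi k * u'" using unif u by blast
next
 fix j assume "EX t u'. uniformizer R t & u' : place_units R & un powi k * u = t powi j * u'"
 then obtain t u' where t: "uniformizer R t" "u' : place_units R" "un powi k * u = t powi j * u'" by blast
 obtain v where v: "v : R" "t = un * v" using unif_m[OF t(1)] unfolding m_eq[OF unif] by blast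
 obtain v' where v': "v' : R" "un = t * v'" using pi(1) unfolding m_eq[OF t(1)] by blast
 have "un * (v * v') = un" using v v' by (metis mult.assoc)
 hence "v * v' = 1" using pi(3) by simp
 hence vu: "v : place_units R" using v v' unif_nz[OF t(1)] by (auto simp: place_units_def inverse_unique)
 define w where "w = v powi j * u' * inverse u"
 have w: "w : place_units R" unfolding w_def by (intro units vu t u)
 have e: "un powi k = un powi j * w" using t(3) units(2)[OF u] unfolding v(2) w_def by (simp add: power_int_mult_distrib field_simps)
 have "un powi (k - j) * inverse w = 1" "un powi (j - k) * w = 1" using e pi(3) units(2)[OF w] by (auto simp: power_int_diff field_simps)
 hence "k - j >= 0" "j - k >= 0" using power_R[OF units(3)[OF w], of "k - j"] power_R[OF w, of "j - k"] ring(5) by auto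
 thus "j = k" by simp
qed

abbreviation ord where "ord \<equiv> place_ord R"

lemma ord_form: assumes "f : F" "f ~= 0" obtains u where "u : place_units R" "f = un powi ord f * u"
 using order_form[OF assms] place_ord_eq by metis

lemma ord_mult: assumes "f : F" "f ~= 0" "g : F" "g ~= 0" shows "ord (f * g) = ord f + ord g"
proof -
 obtain u where u: "u : place_units R" "f = un powi ord f * u" using ord_form assms by blast
 obtain v where v: "v : place_units R" "g = un powi ord g * v" using ord_form assms by blast
 have "f * g = un powi (ord f + ord g) * (u * v)" by (subst u(2), subst v(2)) (simp add: power_int_add pi)
 thus ?thesis using place_ord_eq[OF units(4)[OF u(1) v(1)]] by metis
qed

lemma ord_ge_iff: assumes "f : F" "f ~= 0" shows "k <= ord f \<longleftrightarrow> f * un powi (- k) : R"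
proof -
 obtain u where u: "u : place_units R" "f = un powi ord f * u" using ord_form assms by blast
 have "f * un powi (- k) = un powi (ord f - k) * u" by (subst u(2)) (simp add: power_int_diff power_int_minus field_simps pi)
 thus ?thesis using power_R[OF u(1), of "ord f - k"] by simp
qed

lemma ord_nonneg: "f : F ==> f ~= 0 ==> 0 <= ord f \<longleftrightarrow> f : R" using ord_ge_iff[of f 0] by simp

lemma ord_pos: "f : F ==> f ~= 0 ==> 0 < ord f \<longleftrightarrow> f : m"
 using ord_ge_iff[of f 1] m_div[of f] by (simp add: power_int_minus divide_inverse int_one_le_iff_zero_less)

lemma ord_unit: "f : R ==> f ~: m ==> ord f = 0" using place_ord_eq[of f 0] units_iff by auto

lemma ord_power: "f : F ==> f ~= 0 ==> ord (f ^ k) = int k * ord f"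
proof (induction k)
 case 0 thus ?case using ord_unit[of 1] ring one_notin_m by auto
next
 case (Suc k) thus ?case using ord_mult[of f "f ^ k"] C_subfield_closed(11)[OF F] by (simp add: algebra_simps)
qed

lemma ord_inverse: assumes "f : F" "f ~= 0" shows "ord (inverse f) = - ord f"
proof -
 have "ord (f * inverse f) = ord f + ord (inverse f)" using assms by (intro ord_mult C_subfield_closed[OF F]) auto
 thus ?thesis using assms ord_unit[of 1] ring one_notin_m by auto
qed

lemma ord_prod: "finite I ==> (!!i. i : I ==> f i : F & f i ~= 0) ==> ord (PROD i:I. f i) = (SUM i:I. ord (f i))"
proof (induction I rule: finite_induct)
 case empty thus ?case using ord_unit[of 1] ring one_notin_m by auto
next
 case (insert i I)
 have "ord (f i * prod f I) = ord (f i) + ord (prod f I)" using insert by (intro ord_mult C_subfield_prod[OF F]) auto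
 thus ?case using insert by simp
qed

lemma ord_unif: "ord un = 1" using place_ord_eq[of 1 1] by (simp add: place_units_def ring)

end

section \<open>Approximation and the inequality for ramification indices\<close>

context curve
begin

lemma curve_place: "R : places F ==> curve_place F x n R" by (intro curve_place.intro curve_axioms valuation_ring.intro F)

text \<open>A strictly larger place would contain the inverse of a uniformizer of the smaller one,
  and with it all of F.\<close>

lemma place_maximal:
 assumes "R : places F" "R0 : places F" "R0 <= R"
 shows "R <= R0"
proof
 interpret R: curve_place F x n R by (rule curve_place) fact
 interpret R0: curve_place F x n R0 by (rule curve_place) fact
 fix a assume a: "a : R"
 show "a : R0" proof (rule ccontr)
  assume "a ~: R0"
  hence "inverse a : R0.m" using R.sub[OF a] by (intro R0.inverse_m)
  hence "inverse a / unif R0 : R0" by (simp add: R0.m_div)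
  hence "inverse a / unif R0 * a : R" using a assms(3) by (intro R.ring) auto
  moreover have "a ~= 0" using \<open>a ~: R0\<close> R0.ring by auto
  ultimately have "inverse (unif R0) : R" by (simp add: field_simps)
  hence p: "unif R0 powi k : R" for k
   using R.power[of "inverse (unif R0)"] R.power[of "unif R0"] R0.pi(2) assms(3) by (auto simp: power_int_def)
  have "F <= R" proof
   fix f assume f: "f : F"
   show "f : R" proof (cases "f = 0")
    case False
    obtain u where u: "u : place_units R0" "f = unif R0 powi (place_ord R0 f) * u" using R0.ord_form[OF f False] by blast
    have "unif R0 powi (place_ord R0 f) * u : R" using p R0.units(1)[OF u(1)] assms(3) by (intro R.ring) auto
    thus ?thesis using u(2) by simp
   qed (use R.ring in simp)
  qed
  thus False using assms(1) by (auto simp: places_def)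
 qed
qed

text \<open>Take y with a pole at R0 and a zero at R. Then y / (s + y) has residue 1 at the poles of
  y and vanishes at R, and all but finitely many constants s keep it regular on S.\<close>

lemma separate2:
 assumes S: "finite S" "S <= places F" and R: "R : places F" "R0 : places F" "R ~= R0"
 shows "EX w:F. (ALL R':S. w : R') & w : R0 & w ~: max_ideal R0 & w : max_ideal R"
proof -
 interpret R: curve_place F x n R by (rule curve_place) fact
 interpret R0: curve_place F x n R0 by (rule curve_place) fact
 obtain a where a: "a : R0" "a ~: R" using place_maximal[of R R0] R by blast
 obtain b where b: "b : R" "b ~: R0" using place_maximal[of R0 R] R by blast
 define y where "y = b / a"
 have nz: "a ~= 0" "b ~= 0" using a b R.ring R0.ring by auto
 have yF: "y : F" unfolding y_def using R.sub[OF b(1)] R0.sub[OF a(1)] by (intro C_subfield_closed[OF F])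
 have "inverse b * a : R0.m" using a b R.sub by (intro R0.m_mult(1) R0.inverse_m) auto
 hence y0: "inverse y : R0.m" by (simp add: y_def divide_inverse mult.commute)
 have "inverse a * b : R.m" using a b R0.sub by (intro R.m_mult(1) R.inverse_m) auto
 hence yR: "y : R.m" by (simp add: y_def divide_inverse mult.commute)
 define bad where "bad = insert 0 (\<Union>R'\<in>S. {s. mero_const s + y : max_ideal R'})"
 have "finite {s. mero_const s + y : max_ideal R'}" if "R' : S" for R' proof -
  interpret R': curve_place F x n R' by (rule curve_place) (use that S in auto)
  have "s = s'" if ss: "mero_const s + y : max_ideal R'" "mero_const s' + y : max_ideal R'" for s s' proof (rule ccontr)
   assume "s ~= s'"
   moreover have "mero_const s + y + - (mero_const s' + y) : max_ideal R'" by (intro R'.m_add R'.m_minus ss)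
   hence "mero_const (s - s') : max_ideal R'" by (simp add: mero_const_diff)
   ultimately show False using R'.const_notin_m[of "s - s'"] by simp
  qed
  hence "EX s0. {s. mero_const s + y : max_ideal R'} <= {s0}" by blast
  thus ?thesis using finite_subset by blast
 qed
 hence "finite bad" unfolding bad_def using S by simp
 then obtain s where s: "s ~: bad" using ex_new_if_finite[OF infinite_UNIV_char_0] by blast
 have s0: "s ~= 0" using s by (auto simp: bad_def)
 define w where "w = y / (mero_const s + y)"
 have unit: "w : R' & w ~: max_ideal R'" if R': "R' : places F" "y ~: R'" for R' proof -
  interpret R': curve_place F x n R' by (rule curve_place) fact
  have i: "inverse y : max_ideal R'" by (rule R'.inverse_m[OF yF R'(2)])
  define v where "v = 1 + mero_const s * inverse y"
  have "mero_const s * inverse y : max_ideal R'" by (rule R'.m_mult(2)[OF i R'.const])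
  note si = this
  have "v ~: max_ideal R'" proof
   assume "v : max_ideal R'"
   hence "v + - (mero_const s * inverse y) : max_ideal R'" by (rule R'.m_add[OF _ R'.m_minus[OF si]])
   thus False using R'.one_notin_m by (simp add: v_def)
  qed
  moreover have "v : R'" unfolding v_def by (rule R'.ring(1)[OF R'.ring(5)]) (use si R'.m_iff in blast)
  ultimately have "v : place_units R'" using R'.units_iff by blast
  hence "inverse v : place_units R'" by (rule R'.units)
  moreover have "w = inverse v" using R'(2) R'.ring(4) by (cases "y = 0") (simp_all add: w_def v_def field_simps)
  ultimately show ?thesis using R'.units_iff by blast
 qed
 have wi: "w = y * inverse (mero_const s + y)" by (simp add: w_def divide_inverse)
 have "w : R'" if R': "R' : S" for R' proof (cases "y : R'")
  case True
  interpret R': curve_place F x n R' by (rule curve_place) (use R' S in auto)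
  have "mero_const s + y ~: max_ideal R'" using s R' by (auto simp: bad_def)
  moreover have "mero_const s + y : R'" using True R'.const by (intro R'.ring)
  ultimately have "inverse (mero_const s + y) : R'" using R'.m_iff by blast
  thus ?thesis unfolding wi using True by (intro R'.ring)
 qed (use unit R' S in auto)
 moreover have "y ~: R0" proof
  assume "y : R0"
  hence "inverse y * y : R0.m" by (intro R0.m_mult(1) y0)
  moreover have "y ~= 0" using nz by (simp add: y_def)
  ultimately show False using R0.one_notin_m by simp
 qed
 hence "w : R0 & w ~: max_ideal R0" using unit R by blast
 moreover have "w : R.m" proof -
  have "mero_const s + y ~: R.m" proof
   assume "mero_const s + y : R.m"
   hence "mero_const s + y + - y : R.m" by (rule R.m_add[OF _ R.m_minus[OF yR]])
   thus False using R.const_notin_m[OF s0] by simp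
  qed
  moreover have "mero_const s + y : R" by (rule R.ring(1)[OF R.const]) (use yR R.m_iff in blast)
  ultimately have "inverse (mero_const s + y) : R" using R.m_iff by blast
  thus ?thesis unfolding wi by (intro R.m_mult(1) yR)
 qed
 moreover have "w : F" unfolding w_def by (intro C_subfield_closed[OF F] yF)
 ultimately show ?thesis by blast
qed

lemma separate:
 assumes S: "finite S" "S <= places F" and R0: "R0 : S"
 shows "EX z:F. z : R0 & z ~: max_ideal R0 & (ALL R:S - {R0}. z : max_ideal R)"
proof -
 have "ALL R:S - {R0}. EX w. w : F & (ALL R':S. w : R') & w : R0 & w ~: max_ideal R0 & w : max_ideal R"
  using separate2[OF S, of _ R0] S R0 by blast
 from bchoice[OF this] obtain w where w0: "ALL R:S - {R0}. w R : F & (ALL R':S. w R : R') & w R : R0 & w R ~: max_ideal R0 & w R : max_ideal R"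
  by blast
 note w = bspec[OF w0]
 define z where "z = (PROD R:S - {R0}. w R)"
 interpret R0: curve_place F x n R0 by (rule curve_place) (use S R0 in auto)
 have mem: "(PROD R:T. w R) : R'" if T: "T <= S - {R0}" and R': "R' : S" for T R' proof -
  interpret R': curve_place F x n R' by (rule curve_place) (use S R' in auto)
  show ?thesis using T proof (induction T rule: infinite_finite_induct)
   case (insert R T) thus ?case using w[of R] R' by (auto intro!: R'.ring)
  qed (auto intro: R'.ring)
 qed
 have "(PROD R:T. w R) ~: max_ideal R0" if T: "T <= S - {R0}" for T using T proof (induction T rule: infinite_finite_induct)
  case (insert R T)
  thus ?case using R0.m_prime[of "w R" "PROD R:T. w R"] w[of R] mem[of T R0] R0 by auto
 qed (use R0.one_notin_m in auto)
 hence "z ~: max_ideal R0" "z : R0" "z : F" using mem[of "S - {R0}" R0] R0 R0.sub by (auto simp: z_def)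
 moreover have "z : max_ideal R" if R: "R : S - {R0}" for R proof -
  interpret R: curve_place F x n R by (rule curve_place) (use S R in auto)
  have "z = w R * (PROD R:S - {R0} - {R}. w R)" unfolding z_def using S R by (intro prod.remove) auto
  moreover have "w R * (PROD R:S - {R0} - {R}. w R) : max_ideal R" using w[OF R] mem[of "S - {R0} - {R}" R] R by (intro R.m_mult(1)) auto
  ultimately show ?thesis by simp
 qed
 ultimately show ?thesis by blast
qed

text \<open>If the sum exceeded n, the functions unif_R^j z_R^N with j below the ramification index
  at R would satisfy a relation that is nontrivial modulo t. At a place R0 with a nonzero constant
  coefficient, the term with smallest j has strictly smaller order than all others.\<close>

theorem fundamental_inequality:
 assumes t: "t : par" and S: "finite S" "S <= places F" "!!R. R : S ==> t : max_ideal R"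
 shows "(SUM R:S. place_ord R t) <= int n"
proof (rule ccontr)
 assume big: "~ ?thesis"
 have cp: "curve_place F x n R" if "R : S" for R using that S by (intro curve_place) auto
 have tF: "t : F" "t ~= 0" using t par_F par_nz by auto
 have pos: "place_ord R t > 0" if "R : S" for R using curve_place.ord_pos[OF cp[OF that] tF] S(3)[OF that] by blast
 define I where "I = (SIGMA R:S. {..<nat (place_ord R t)})"
 have finI: "finite I" unfolding I_def using S by auto
 have "int (card I) = (SUM R:S. place_ord R t)" proof -
  have "card I = (SUM R:S. nat (place_ord R t))" unfolding I_def using S by (subst card_SigmaI) auto
  thus ?thesis using pos by (simp add: order_less_imp_le)
 qed
 hence cardI: "card I > n" using big by simp
 have "ALL R0:S. EX z. z : F & z : R0 & z ~: max_ideal R0 & (ALL R:S - {R0}. z : max_ideal R)" using separate[OF S(1,2)] by blast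
 from bchoice[OF this] obtain z where z0: "ALL R0:S. z R0 : F & z R0 : R0 & z R0 ~: max_ideal R0 & (ALL R:S - {R0}. z R0 : max_ideal R)"
  by blast
 note z = bspec[OF z0]
 define K where "K = nat (SUM R:S. place_ord R t)"
 have K: "nat (place_ord R t) <= K" if "R : S" for R
  unfolding K_def using that S pos by (intro nat_mono member_le_sum) (auto simp: order_less_imp_le)
 \<comment> \<open>Large enough for the zero of z_R^N at another place to outweigh a possible pole
   of a power of the uniformizer of R there.\<close>
 define N where "N = K + (SUM R:S. SUM R':S. K * nat \<bar>place_ord R' (unif R)\<bar>)"
 have N: "K + K * nat \<bar>place_ord R' (unif R)\<bar> <= N" if R: "R : S" "R' : S" for R R' proof -
  have "K * nat \<bar>place_ord R' (unif R)\<bar> <= (SUM R':S. K * nat \<bar>place_ord R' (unif R)\<bar>)"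
   using R S by (intro member_le_sum) auto
  also have "... <= (SUM R:S. SUM R':S. K * nat \<bar>place_ord R' (unif R)\<bar>)" using R S by (intro member_le_sum) auto
  finally show ?thesis by (simp add: N_def)
 qed
 define f where "f = (%(R, j). unif R ^ j * z R ^ N)"
 have zF: "z R : F" "z R ~= 0" if "R : S" for R proof -
  interpret curve_place F x n R by (rule cp) fact
  show "z R : F" "z R ~= 0" using z[OF that] zero_m by auto
 qed
 have uF: "unif R : F" "unif R ~= 0" if "R : S" for R using curve_place.pi[OF cp[OF that]] by auto
 have fF: "f i : F" if "i : I" for i using that zF uF by (auto simp: f_def I_def intro!: C_subfield_closed(6,11)[OF F])
 obtain rh s where r: "EX i:I. rh i ~= 0" "(SUM i:I. (mero_const (rh i) + t * cpoly (s i) t) * f i) = 0"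
  by (rule dep_par[OF t finI cardI fF])
 obtain R0 j1 where i1: "(R0, j1) : I" "rh (R0, j1) ~= 0" using r(1) by force
 have R0: "R0 : S" using i1 by (auto simp: I_def)
 define j0 where "j0 = (LEAST j. j < nat (place_ord R0 t) & rh (R0, j) ~= 0)"
 have j0: "j0 < nat (place_ord R0 t) & rh (R0, j0) ~= 0" unfolding j0_def
  by (rule LeastI_ex[of "%j. j < nat (place_ord R0 t) & rh (R0, j) ~= 0"]) (use i1 in \<open>auto simp: I_def\<close>)
 have less: "rh (R0, j) = 0" if "j < j0" for j using not_less_Least[OF that[unfolded j0_def]] that j0 by simp
 interpret curve_place F x n R0 by (rule cp) fact
 have tm: "t : m" "t : R0" using S(3)[OF R0] m_iff by auto
 define ph where "ph = unif R0 ^ j0"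
 have phi: "ph : F" "ph ~= 0" "ord ph = int j0"
  unfolding ph_def using pi ord_power[of "unif R0" j0] ord_unif by (auto intro: C_subfield_closed(11)[OF F])
 have ord_div: "ord (a / ph) = ord a - int j0" if "a : F" "a ~= 0" for a
  using that phi ord_mult[of a "inverse ph"] ord_inverse[of ph] C_subfield_closed(8)[OF F, of ph] by (simp add: divide_inverse)
 define T where "T i = (mero_const (rh i) + t * cpoly (s i) t) * (f i / ph)" for i
 have coeff_R: "mero_const (rh i) + t * cpoly (s i) t : R0" for i by (intro ring const cpoly_mem tm)
 have "(SUM i:I. T i) = (SUM i:I. (mero_const (rh i) + t * cpoly (s i) t) * f i) / ph" unfolding sum_divide_distrib T_def by simp
 hence "(SUM i:I. T i) = 0" using r(2) by simp
 moreover have i0: "(R0, j0) : I" using R0 j0 by (simp add: I_def)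
 ultimately have "T (R0, j0) + (SUM i:I - {(R0, j0)}. T i) = 0" using sum.remove[OF finI i0, of T] by simp
 hence "T (R0, j0) = - (SUM i:I - {(R0, j0)}. T i)" by (rule eq_neg_iff_add_eq_0[THEN iffD2])
 also have "... : m" proof (intro m_minus m_sum)
  fix i assume i: "i : I - {(R0, j0)}"
  obtain R j where Rj: "i = (R, j)" by (cases i)
  have R: "R : S" "j < nat (place_ord R t)" using i Rj by (auto simp: I_def)
  have jK: "j <= K" using R K[OF R(1)] by linarith
  have fnz: "f i ~= 0" using zF[OF R(1)] uF[OF R(1)] by (simp add: f_def Rj)
  have fiF: "f i : F" using fF i by blast
  have ord_f: "ord (f i) = int j * ord (unif R) + int N * ord (z R)"
   using zF[OF R(1)] uF[OF R(1)] by (simp add: f_def Rj ord_mult ord_power C_subfield_closed(11)[OF F])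
  have quot: "f i / ph : F" "f i / ph ~= 0" "ord (f i / ph) = ord (f i) - int j0"
   using fiF fnz phi ord_div[OF fiF fnz] by (auto intro!: C_subfield_closed(10)[OF F])
  show "T i : m" proof (cases "R = R0 & j < j0")
   case True
   hence "rh i = 0" using less Rj by simp
   hence "T i = (t / ph) * (cpoly (s i) t * f i)" by (simp add: T_def mero_const_0)
   moreover have "t / ph : m" proof -
    have "ord (t / ph) = ord t - int j0" by (rule ord_div[OF tF])
    hence "ord (t / ph) > 0" using j0 by linarith
    thus ?thesis using ord_pos[of "t / ph"] tF phi by (simp add: C_subfield_closed(10)[OF F])
   qed
   moreover have "f i : R0" using True z[OF R0] pi by (auto simp: f_def Rj intro!: ring power)
   ultimately show ?thesis using m_mult(1) ring(3) cpoly_mem tm(2) by metis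
  next
   case False
   have "ord (f i) > int j0" proof (cases "R = R0")
    case True
    hence "j > j0" using False i Rj by auto
    moreover have "ord (z R0) = 0" using z[OF R0] by (intro ord_unit) auto
    ultimately show ?thesis unfolding ord_f using True ord_unif by simp
   next
    case R': False
    have "z R : m" using z[OF R(1)] R' R0 by blast
    hence "ord (z R) >= 1" using ord_pos[OF zF[OF R(1)]] by linarith
    hence "int N <= int N * ord (z R)" by (simp add: mult_le_cancel_left1)
    moreover have "- (int K * \<bar>ord (unif R)\<bar>) <= int j * ord (unif R)" proof -
     have "\<bar>int j * ord (unif R)\<bar> <= int K * \<bar>ord (unif R)\<bar>" unfolding abs_mult using jK by (intro mult_mono) auto
     thus ?thesis by linarith
    qed
    moreover have "int (K + K * nat \<bar>ord (unif R)\<bar>) <= int N" using N[OF R(1) R0] by (simp only: of_nat_le_iff)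
    hence "int K + int K * \<bar>ord (unif R)\<bar> <= int N" by simp
    moreover have "j0 < K" using j0 K[OF R0] by linarith
    ultimately show ?thesis unfolding ord_f by linarith
   qed
   hence "f i / ph : m" using ord_pos[OF quot(1,2)] quot(3) by simp
   thus ?thesis unfolding T_def by (rule m_mult(2)[OF _ coeff_R])
  qed
 qed
 finally have "T (R0, j0) : m" .
 moreover have "f (R0, j0) / ph = z R0 ^ N" using phi(2) by (simp add: f_def ph_def)
 ultimately have "mero_const (rh (R0, j0)) + t * cpoly (s (R0, j0)) t : m | z R0 ^ N : m"
  unfolding T_def using z[OF R0] by (intro m_prime coeff_R power) auto
 thus False proof
  assume a: "mero_const (rh (R0, j0)) + t * cpoly (s (R0, j0)) t : m"
  have "t * cpoly (s (R0, j0)) t : m" by (intro m_mult(1) tm cpoly_mem)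
  from m_add[OF a m_minus[OF this]] show False using const_notin_m j0 by simp
 next
  assume "z R0 ^ N : m"
  thus False using m_power z[OF R0] by blast
 qed
qed

lemma finite_fibre: assumes t: "t : par" shows "finite {R : places F. t : max_ideal R}"
proof (rule ccontr)
 assume "infinite {R : places F. t : max_ideal R}"
 then obtain S where S: "S <= {R : places F. t : max_ideal R}" "finite S" "card S = Suc n" using infinite_arbitrarily_large by blast
 have "place_ord R t >= 1" if "R : S" for R using curve_place.ord_pos[OF curve_place par_F[OF t] par_nz[OF t], of R] S that by fastforce
 hence "(SUM R:S. 1) <= (SUM R:S. place_ord R t)" by (intro sum_mono)
 moreover have "(SUM R:S. place_ord R t) <= int n" using S by (intro fundamental_inequality[OF t]) auto
 ultimately show False using S by simp
qed

end

section \<open>Riemann-Roch spaces and Riemann's inequality\<close>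

definition fbasis :: "mero set => mero set => bool" where
 "fbasis B V \<longleftrightarrow> finite B & mero.independent B & mero.span B = V"

lemma fbasis_dim: "fbasis B V ==> mero.dim V = card B" by (rule mero.dim_eq_card) (auto simp: fbasis_def mero.span_span)

context curve
begin

text \<open>Membership in a valuation ring is closed under linear combinations and covers f = 0
  without a case distinction, unlike the condition on orders.\<close>

lemma RR_iff: "f : RR_space F D \<longleftrightarrow> f : F & (ALL R:places F. f * unif R powi D R : R)"
proof (cases "f = 0")
 case True
 have "0 : R" if "R : places F" for R using valuation_ring.ring(4)[OF valuation_ring.intro[OF F that]] .
 thus ?thesis using True C_subfield_closed(2)[OF F] by (simp add: RR_space_def)
next
 case False
 have "place_ord R f >= - D R \<longleftrightarrow> f * unif R powi D R : R" if "R : places F" "f : F" for R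
  using curve_place.ord_ge_iff[OF curve_place[OF that(1)] that(2) False, of "- D R"] by simp
 thus ?thesis using False by (auto simp: RR_space_def)
qed

lemma RR_subspace: "mero.subspace (RR_space F D)"
proof (rule mero.subspaceI)
 show "0 : RR_space F D" using C_subfield_closed(2)[OF F] by (simp add: RR_space_def)
 fix f g assume fg: "f : RR_space F D" "g : RR_space F D"
 have "(f + g) * unif R powi D R : R" if "R : places F" for R proof -
  interpret valuation_ring F R by (rule valuation_ring.intro[OF F that])
  show ?thesis unfolding distrib_right using fg that by (intro ring(1)) (auto simp: RR_iff)
 qed
 thus "f + g : RR_space F D" using fg C_subfield_closed(5)[OF F] by (auto simp: RR_iff)
next
 fix c f assume f: "f : RR_space F D"
 have "mero_scale c f * unif R powi D R : R" if "R : places F" for R proof -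
  interpret valuation_ring F R by (rule valuation_ring.intro[OF F that])
  show ?thesis unfolding mero_scale_def mult.assoc by (rule ring(3)[OF const]) (use f that in \<open>simp add: RR_iff\<close>)
 qed
 thus "mero_scale c f : RR_space F D" using f C_subfield_closed(1,6)[OF F] by (auto simp: RR_iff mero_scale_def)
qed

lemma RR_mono: "(!!R. R : places F ==> D R <= D' R) ==> RR_space F D <= RR_space F D'" by (fastforce simp: RR_space_def)

text \<open>Allowing one more pole adds at most one dimension: the residue field consists of
  constants, so a constant multiple of g removes the new leading term of f.\<close>

lemma RR_step:
 assumes P: "P : places F" and D': "D' = D(P := D P + 1)"
  and fg: "f : RR_space F D'" "g : RR_space F D'" "g ~: RR_space F D"
 shows "EX c. f - mero_scale c g : RR_space F D"
proof -
 interpret curve_place F x n P by (rule curve_place[OF P])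
 have mem: "h : RR_space F D" if h: "h : RR_space F D'" "h * unif P powi (D P + 1) : m" for h proof -
  have "h * unif P powi D P : P" using h(2) pi(3) unfolding m_div by (simp add: power_int_add)
  moreover have "h * unif R powi D R : R" if "R : places F" "R ~= P" for R proof -
   have "h * unif R powi D' R : R" using h(1) that(1) by (simp add: RR_iff)
   thus ?thesis using that(2) by (simp add: D')
  qed
  ultimately show ?thesis using h(1) unfolding RR_iff by metis
 qed
 define a where "a = g * unif P powi (D P + 1)"
 define b where "b = f * unif P powi (D P + 1)"
 have ab: "a : P" "b : P" using fg P by (auto simp: a_def b_def RR_iff D')
 have am: "a ~: m" using mem fg(2,3) a_def by blast
 hence a: "inverse a : P" "a ~= 0" using ab m_iff by blast+
 obtain c where c: "b * inverse a - mero_const c : m" using residue[OF ring(3)[OF ab(2) a(1)]] by blast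
 have "(b * inverse a - mero_const c) * a : m" by (intro m_mult(1) c ab)
 moreover have "(b * inverse a - mero_const c) * a = b - mero_const c * a" using a(2) by (simp add: field_simps)
 ultimately have "b - mero_const c * a : m" by simp
 hence "(f - mero_scale c g) * unif P powi (D P + 1) : m" by (simp add: mero_scale_def b_def a_def algebra_simps)
 moreover have "f - mero_scale c g : RR_space F D'" by (intro mero.subspace_diff mero.subspace_scale RR_subspace fg)
 ultimately show ?thesis using mem by blast
qed

lemma RR_step_basis:
 assumes P: "P : places F" and B: "fbasis B (RR_space F D)"
 shows "EX B'. fbasis B' (RR_space F (D(P := D P + 1))) & card B' <= Suc (card B)"
proof -
 define D' where "D' = D(P := D P + 1)"
 have sub: "RR_space F D <= RR_space F D'" by (rule RR_mono) (auto simp: D'_def)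
 show ?thesis proof (cases "RR_space F D' <= RR_space F D")
  case True
  thus ?thesis using B sub D'_def by (intro exI[of _ B]) auto
 next
  case False
  then obtain g where g: "g : RR_space F D'" "g ~: RR_space F D" by blast
  have fin: "finite B" "mero.independent B" "mero.span B = RR_space F D" using B by (auto simp: fbasis_def)
  have "mero.independent (insert g B)" using fin g by (intro mero.independent_insertI) auto
  moreover have "mero.span (insert g B) = RR_space F D'" proof
   have "B <= RR_space F D'" using mero.span_superset[of B] fin(3) sub by blast
   thus "mero.span (insert g B) <= RR_space F D'" using g by (intro mero.span_minimal RR_subspace) auto
   show "RR_space F D' <= mero.span (insert g B)" using RR_step[OF P D'_def _ g] by (auto simp: mero.span_breakdown_eq fin(3))
  qed
  ultimately have "fbasis (insert g B) (RR_space F D')" using fin by (simp add: fbasis_def)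
  moreover have "card (insert g B) <= Suc (card B)" by (rule card_insert_le_m1) simp_all
  ultimately show ?thesis unfolding D'_def by blast
 qed
qed

lemma RR_chain:
 assumes T: "finite T" "T <= places F"
  and D: "!!R. R ~: T ==> D R = D' R" "!!R. R : T ==> D R <= D' R" and B: "fbasis B (RR_space F D)"
 shows "EX B'. fbasis B' (RR_space F D') & int (card B') <= int (card B) + (SUM R:T. D' R - D R)" using D B
proof (induction "nat (SUM R:T. D' R - D R)" arbitrary: D B)
 case 0
 have nn: "0 <= D' R - D R" if "R : T" for R using 0(3)[OF that] by simp
 have z: "(SUM R:T. D' R - D R) = 0" using 0(1) sum_nonneg[of T "%R. D' R - D R"] nn by simp
 hence "D' R - D R = 0" if "R : T" for R using sum_nonneg_eq_0_iff[OF T(1), of "%R. D' R - D R"] nn that by simp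
 hence "D = D'" using 0(2) by (metis eq_iff_diff_eq_0 ext)
 thus ?case using 0(4) by (intro exI[of _ B]) simp
next
 case (Suc k)
 have "EX P:T. D P ~= D' P" proof (rule ccontr)
  assume "~ ?thesis"
  hence "(SUM R:T. D' R - D R) = 0" by (intro sum.neutral) auto
  thus False using Suc(2) by simp
 qed
 then obtain P where P: "P : T" "D P < D' P" using Suc(4) by (metis order_le_less)
 define D1 where "D1 = D(P := D P + 1)"
 obtain B1 where B1: "fbasis B1 (RR_space F D1)" "card B1 <= Suc (card B)" using RR_step_basis[OF _ Suc(5), of P] P T D1_def by blast
 have s1: "(SUM R:T. D' R - D1 R) = (SUM R:T. D' R - D R) - 1" proof -
  have "(SUM R:T. D' R - D1 R) = (D' P - D1 P) + (SUM R:T - {P}. D' R - D1 R)" by (rule sum.remove) (use P T in auto)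
  also have "(SUM R:T - {P}. D' R - D1 R) = (SUM R:T - {P}. D' R - D R)" by (rule sum.cong) (auto simp: D1_def)
  also have "... = (SUM R:T. D' R - D R) - (D' P - D P)" using P T by (simp add: sum_diff1)
  finally show ?thesis by (simp add: D1_def)
 qed
 have "EX B'. fbasis B' (RR_space F D') & int (card B') <= int (card B1) + (SUM R:T. D' R - D1 R)" proof (rule Suc(1))
  show "k = nat (SUM R:T. D' R - D1 R)" using Suc(2) s1 by simp
  show "D1 R = D' R" if "R ~: T" for R using Suc(3) P that by (auto simp: D1_def)
  show "D1 R <= D' R" if "R : T" for R using Suc(4) P that by (auto simp: D1_def)
 qed (rule B1)
 then obtain B' where B': "fbasis B' (RR_space F D')" "int (card B') <= int (card B1) + (SUM R:T. D' R - D1 R)" by blast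
 have "int (card B') <= int (card B) + (SUM R:T. D' R - D R)" using B'(2) B1(2) s1 by linarith
 thus ?case using B'(1) by blast
qed

text \<open>A nonconstant f has a pole, at a place where 1 / f vanishes.\<close>

lemma RR_zero: "fbasis {1} (RR_space F (%_. 0))"
proof -
 have "RR_space F (%_. 0) = range mero_const" proof
  show "RR_space F (%_. 0) <= range mero_const" proof
   fix f assume "f : RR_space F (%_. 0)"
   hence f: "f : F" "!!R. R : places F ==> f : R" by (auto simp: RR_iff)
   show "f : range mero_const" proof (rule ccontr)
    assume no: "f ~: range mero_const"
    have "inverse f ~: range mero_const" proof
     assume "inverse f : range mero_const"
     then obtain c where "inverse f = mero_const c" by blast
     hence "f = mero_const (inverse c)" by (metis inverse_inverse_eq mero_const_inverse)
     thus False using no by blast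
    qed
    then obtain Q where Q: "Q : places F" "inverse f : max_ideal Q" using place_over[OF F C_subfield_closed(8)[OF F f(1)]] by blast
    interpret valuation_ring F Q by (rule valuation_ring.intro[OF F Q(1)])
    have "f ~= 0" using no mero_const_0 by (metis rangeI)
    thus False using m_mult(1)[OF Q(2) f(2)[OF Q(1)]] one_notin_m by simp
   qed
  qed
  show "range mero_const <= RR_space F (%_. 0)"
   using C_subfield_closed(1)[OF F] valuation_ring.const[OF valuation_ring.intro[OF F]] by (auto simp: RR_iff)
 qed
 moreover have "mero.span {1} = range mero_const" by (simp add: mero.span_singleton mero_scale_def)
 ultimately show ?thesis by (simp add: fbasis_def)
qed

lemma RR_basis: assumes D: "D : divisors F" obtains B where "fbasis B (RR_space F D)" "card B = RR_dim F D"
proof -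
 define D' where "D' R = max 0 (D R)" for R
 have "EX B'. fbasis B' (RR_space F D') & int (card B') <= int (card {1::mero}) + (\<Sum>R | D R ~= 0. D' R - 0)"
  by (rule RR_chain[OF _ _ _ _ RR_zero]) (use D in \<open>auto simp: divisors_def D'_def\<close>)
 then obtain B' where "fbasis B' (RR_space F D')" by blast
 hence B': "finite B'" "mero.span B' = RR_space F D'" by (auto simp: fbasis_def)
 have sub: "RR_space F D <= RR_space F D'" by (rule RR_mono) (simp add: D'_def)
 obtain B where B: "B <= RR_space F D" "mero.independent B" "RR_space F D <= mero.span B" using mero.basis_exists by metis
 have "finite B" using mero.independent_span_bound[OF B'(1) B(2)] B(1) sub B'(2) by blast
 moreover have "mero.span B = RR_space F D" using B mero.span_minimal[OF B(1) RR_subspace] by blast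
 ultimately have b: "fbasis B (RR_space F D)" using B by (simp add: fbasis_def)
 thus ?thesis using that fbasis_dim[OF b] by (simp add: RR_dim_def)
qed

text \<open>Consequently deg D - l(D) can only grow with D, so the bound for the genus may be proved
  for larger divisors.\<close>

lemma RR_dim_mono:
 assumes D: "D : divisors F" "D' : divisors F" "!!R. D R <= D' R"
 shows "int (RR_dim F D') <= int (RR_dim F D) + div_degree D' - div_degree D"
proof -
 define T where "T = {R. D R ~= 0} \<union> {R. D' R ~= 0}"
 have T: "finite T" "T <= places F" using D by (auto simp: T_def divisors_def)
 obtain B where B: "fbasis B (RR_space F D)" "card B = RR_dim F D" using RR_basis[OF D(1)] by blast
 have "EX B'. fbasis B' (RR_space F D') & int (card B') <= int (card B) + (SUM R:T. D' R - D R)"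
  by (rule RR_chain[OF T _ _ B(1)]) (use D(3) in \<open>auto simp: T_def\<close>)
 then obtain B' where B': "fbasis B' (RR_space F D')" "int (card B') <= int (card B) + (SUM R:T. D' R - D R)" by blast
 have "div_degree D = (SUM R:T. D R)" "div_degree D' = (SUM R:T. D' R)"
  unfolding div_degree_def using T by (intro sum.mono_neutral_left; auto simp: T_def)+
 thus ?thesis using B'(2) B(2) fbasis_dim[OF B'(1)] by (simp add: RR_dim_def sum_subtractf)
qed

text \<open>The divisor D is dominated by N times the fibres over the finitely many points below its
  support and over infinity. That divisor has degree at most n M, and dividing the functions in A by
  the polynomial \<open>H\<close> with those zeros moves them into its space.\<close>

theorem genus_bound:
 fixes g :: nat
 assumes A: "!!M. EX A. finite A & mero.independent A & int n * int M + 1 - int g <= int (card A) \<and>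
   (ALL a:A. a : F & (ALL R:places F. (x : R --> a : R) & (x ~: R --> a / x ^ M : R)))"
  and D: "D : divisors F"
 shows "div_degree D - int (RR_dim F D) + 1 <= int g"
proof -
 define T where "T = {R. D R ~= 0}"
 have T: "finite T" "T <= places F" using D by (auto simp: T_def divisors_def)
 define l where "l c = x - mero_const c" for c
 have l: "l c : par" "l c : F" "l c ~= 0" for c proof -
  show p: "l c : par" by (simp add: l_def par_def)
  show "l c : F" "l c ~= 0" using par_F[OF p] par_nz[OF p] .
 qed
 have ip: "inverse x : par" "inverse x : F" "inverse x ~= 0" proof -
  show p: "inverse x : par" by (simp add: par_def)
  show "inverse x : F" "inverse x ~= 0" using par_F[OF p] par_nz[OF p] .
 qed
 \<comment> \<open>The finite points of the x-line below the support of D.\<close>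
 define C where "C = (\<Union>R\<in>T. {c. l c : max_ideal R})"
 have finC: "finite C" unfolding C_def proof (intro finite_UN_I T(1))
  fix R assume "R : T"
  interpret curve_place F x n R by (rule curve_place) (use \<open>R : T\<close> T in auto)
  have "c = c'" if c: "l c : m" "l c' : m" for c c' proof (rule ccontr)
   assume "c ~= c'"
   moreover have "l c' + - l c : m" by (intro m_add m_minus c)
   hence "mero_const (c - c') : m" by (simp add: mero_const_diff l_def)
   ultimately show False using const_notin_m[of "c - c'"] by simp
  qed
  hence "EX c0. {c. l c : m} <= {c0}" by blast
  thus "finite {c. l c : m}" using finite_subset by blast
 qed
 define N where "N = nat (SUM R:T. \<bar>D R\<bar>)"
 define d where "d R = (SUM c:C. max 0 (place_ord R (l c))) + max 0 (place_ord R (inverse x))" for R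
 define D1 where "D1 R = (if R : places F then int N * d R else 0)" for R
 define fib where "fib t = {R : places F. t : max_ideal R}" for t
 define Z where "Z = (\<Union>c\<in>C. fib (l c)) \<union> fib (inverse x)"
 have finZ: "finite Z" "Z <= places F" unfolding Z_def fib_def using finC by (auto intro!: finite_fibre l ip)
 have d0: "d R >= 0" for R unfolding d_def by (intro add_nonneg_nonneg sum_nonneg) auto
 have nonfib: "max 0 (place_ord R t) = 0" if "R : places F" "t : F" "t ~= 0" "R ~: fib t" for R t
  using curve_place.ord_pos[OF curve_place[OF that(1)] that(2,3)] that(1,4) by (simp add: fib_def max_def)
 have supp: "{R. D1 R ~= 0} <= Z" proof
  fix R assume R: "R : {R. D1 R ~= 0}"
  hence P: "R : places F" by (auto simp: D1_def split: if_splits)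
  show "R : Z" proof (rule ccontr)
   assume "R ~: Z"
   hence "d R = 0" unfolding d_def using nonfib[OF P l(2,3)] nonfib[OF P ip(2,3)] by (auto simp: Z_def)
   thus False using R by (simp add: D1_def split: if_splits)
  qed
 qed
 have D1: "D1 : divisors F" using supp finZ finite_subset by (auto simp: divisors_def)
 have fibsum: "(SUM R:Z. max 0 (place_ord R t)) <= int n" if t: "t : par" "fib t <= Z" for t proof -
  have "(SUM R:Z. max 0 (place_ord R t)) = (SUM R:fib t. max 0 (place_ord R t))" by (rule sum.mono_neutral_right)
    (use finZ t nonfib[OF _ par_F[OF t(1)] par_nz[OF t(1)]] in auto)
  also have "... = (SUM R:fib t. place_ord R t)" proof (rule sum.cong[OF refl])
   fix R assume "R : fib t"
   hence "0 < place_ord R t" using curve_place.ord_pos[OF curve_place par_F[OF t(1)] par_nz[OF t(1)]] by (simp add: fib_def)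
   thus "max 0 (place_ord R t) = place_ord R t" by simp
  qed
  also have "... <= int n" by (rule fundamental_inequality[OF t(1)]) (use finite_fibre[OF t(1)] in \<open>auto simp: fib_def\<close>)
  finally show ?thesis .
 qed
 \<comment> \<open>N for each point of \<open>C\<close> and N for infinity: the pole order at
   infinity, in units of that of x, that division by \<open>H\<close> reduces to N.\<close>
 define M where "M = N * (card C + 1)"
 have "div_degree D1 = (SUM R:Z. D1 R)" unfolding div_degree_def by (rule sum.mono_neutral_left) (use supp finZ in auto)
 also have "... = int N * (SUM R:Z. d R)" unfolding sum_distrib_left using finZ by (intro sum.cong) (auto simp: D1_def)
 also have "(SUM R:Z. d R) = (SUM c:C. SUM R:Z. max 0 (place_ord R (l c))) + (SUM R:Z. max 0 (place_ord R (inverse x)))"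
  unfolding d_def sum.distrib by (subst sum.swap) simp
 also have "int N * ... <= int N * ((SUM c:C. int n) + int n)" by (intro mult_left_mono add_mono sum_mono fibsum l ip) (auto simp: Z_def)
 also have "... = int n * int M" by (simp add: M_def algebra_simps)
 finally have deg: "div_degree D1 <= int n * int M" .
 have le: "D R <= D1 R" for R proof (cases "R : T")
  case False
  thus ?thesis using d0 by (simp add: T_def D1_def)
 next
  case True
  hence P: "R : places F" using T by blast
  interpret curve_place F x n R by (rule curve_place[OF P])
  have "d R >= 1" proof -
   obtain t where t: "t : par" "t : m" by (rule par_ex)
   have o: "place_ord R t >= 1" using ord_pos[OF par_F[OF t(1)] par_nz[OF t(1)]] t(2) by simp
   show ?thesis proof (cases "t = inverse x")
    case True
    have "0 <= (SUM c:C. max 0 (place_ord R (l c)))" by (intro sum_nonneg) auto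
    thus ?thesis using o True by (simp add: d_def)
   next
    case False
    then obtain c where c: "t = l c" using t by (auto simp: par_def l_def)
    have "c : C" using t(2) c \<open>R : T\<close> by (auto simp: C_def)
    hence "max 0 (place_ord R (l c)) <= (SUM c:C. max 0 (place_ord R (l c)))" using finC by (intro member_le_sum) auto
    hence "1 <= (SUM c:C. max 0 (place_ord R (l c)))" using o unfolding c by linarith
    moreover have "0 <= max 0 (place_ord R (inverse x))" by simp
    ultimately show ?thesis unfolding d_def by linarith
   qed
  qed
  hence "int N * 1 <= int N * d R" by (intro mult_left_mono) auto
  moreover have "D R <= int N" proof -
   have "\<bar>D R\<bar> <= (SUM R:T. \<bar>D R\<bar>)" using True T by (intro member_le_sum) auto
   thus ?thesis by (simp add: N_def)
  qed
  ultimately show ?thesis using P by (simp add: D1_def)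
 qed
 define H where "H = (PROD c:C. l c ^ N)"
 have H: "H : F" "H ~= 0" unfolding H_def using l finC by (auto intro!: C_subfield_prod[OF F] C_subfield_closed(11)[OF F])
 obtain A where A: "finite A" "mero.independent A" "int n * int M + 1 - int g <= int (card A)"
   "ALL a:A. a : F & (ALL R:places F. (x : R --> a : R) & (x ~: R --> a / x ^ M : R))" using assms(1)[of M] by blast
 have memb: "a / H : RR_space F D1" if a: "a : A" for a proof -
  have "a ~= 0" using a A(2) mero.dependent_zero by blast
  have aF: "a : F" using a A(4) by blast
  have "- D1 R <= place_ord R (a / H)" if P: "R : places F" for R proof -
   interpret curve_place F x n R by (rule curve_place[OF P])
   have "ord H = (SUM c:C. ord (l c ^ N))" unfolding H_def using l finC by (intro ord_prod) (auto intro!: C_subfield_closed(11)[OF F])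
   hence oH: "ord H = int N * (SUM c:C. ord (l c))" by (simp add: ord_power l sum_distrib_left)
   have oa: "ord (a / H) = ord a - ord H"
    using ord_mult[of a "inverse H"] ord_inverse[OF H] aF \<open>a ~= 0\<close> H C_subfield_closed(8)[OF F H(1)]
    by (simp add: divide_inverse)
   have "- (int N * d R) <= ord (a / H)" proof (cases "x : R")
    case True
    have "ord (l c) = max 0 (ord (l c))" for c using ord_nonneg[OF l(2,3), of c] ring(2)[OF True const[of c]] by (simp add: l_def)
    hence "(SUM c:C. ord (l c)) = (SUM c:C. max 0 (ord (l c)))" by (rule sum.cong[OF refl])
    hence "(SUM c:C. ord (l c)) <= d R" by (simp add: d_def)
    hence "ord H <= int N * d R" unfolding oH by (intro mult_left_mono) auto
    moreover have "ord a >= 0" using A(4) a P True ord_nonneg[OF aF \<open>a ~= 0\<close>] by blast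
    ultimately show ?thesis unfolding oa by linarith
   next
    case False
    define k where "k = ord (inverse x)"
    have im: "inverse x : m" by (rule inverse_m[OF x False])
    have k: "k > 0" unfolding k_def using ord_pos[OF ip(2,3)] im by blast
    have ox: "ord x = - k" using ord_inverse[OF x x_nz] by (simp add: k_def)
    have "ord (l c) = - k" for c proof -
     define v where "v = 1 - mero_const c * inverse x"
     have cm: "mero_const c * inverse x : m" by (rule m_mult(2)[OF im const])
     have vR: "v : R" unfolding v_def by (rule ring(2)[OF ring(5)]) (use cm m_iff in blast)
     moreover have vm: "v ~: m" proof
      assume "v : m"
      hence "v + mero_const c * inverse x : m" by (rule m_add[OF _ cm])
      thus False using one_notin_m by (simp add: v_def)
     qed
     ultimately have "ord v = 0" by (rule ord_unit)
     moreover have "l c = x * v" using x_nz by (simp add: l_def v_def field_simps)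
     moreover have "v : F" "v ~= 0" using sub[OF vR] vm zero_m by auto
     ultimately show ?thesis using ord_mult[OF x x_nz, of v] ox by simp
    qed
    hence "ord H = - (int N * int (card C) * k)" unfolding oH by simp
    moreover have "ord a >= - (int M * k)" proof -
     have "a / x ^ M : R" using A(4) a P False by blast
     moreover have q: "a / x ^ M : F" "a / x ^ M ~= 0"
      using aF \<open>a ~= 0\<close> x_nz by (auto intro!: C_subfield_closed(10,11)[OF F] x)
     ultimately have "0 <= ord (a / x ^ M)" using ord_nonneg by blast
     moreover have "ord (a / x ^ M * x ^ M) = ord (a / x ^ M) + ord (x ^ M)"
      using q x_nz by (intro ord_mult C_subfield_closed(11)[OF F] x) auto
     ultimately show ?thesis using ord_power[OF x x_nz, of M] ox x_nz by simp
    qed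
    moreover have "int M * k = int N * int (card C) * k + int N * k" by (simp add: M_def algebra_simps)
    moreover have "int N * k <= int N * d R" proof (intro mult_left_mono)
     have "0 <= (SUM c:C. max 0 (place_ord R (l c)))" by (intro sum_nonneg) auto
     thus "k <= d R" by (simp add: d_def k_def)
    qed simp
    ultimately show ?thesis unfolding oa by linarith
   qed
   thus ?thesis using P by (simp add: D1_def)
  qed
  thus ?thesis using aF H by (auto simp: RR_space_def intro!: C_subfield_closed(10)[OF F])
 qed
 obtain B where B: "fbasis B (RR_space F D1)" "card B = RR_dim F D1" using RR_basis[OF D1] by blast
 \<comment> \<open>Multiplication by \<open>H\<close> is linear, so the independent set A lies in
   the span of the image of a basis.\<close>
 define HB where "HB = (%b. H * b) ` B"
 have "mero.span B <= {b. H * b : mero.span HB}" proof (rule mero.span_minimal)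
  show "B <= {b. H * b : mero.span HB}" by (auto simp: HB_def intro!: mero.span_base)
  show "mero.subspace {b. H * b : mero.span HB}" proof (rule mero.subspaceI)
   show "0 : {b. H * b : mero.span HB}" by (simp add: mero.span_zero)
   fix a b assume "a : {b. H * b : mero.span HB}" "b : {b. H * b : mero.span HB}"
   thus "a + b : {b. H * b : mero.span HB}" by (simp add: distrib_left mero.span_add)
  next
   fix c a assume "a : {b. H * b : mero.span HB}"
   hence "mero_scale c (H * a) : mero.span HB" by (simp add: mero.span_scale)
   thus "mero_scale c a : {b. H * b : mero.span HB}" by (simp add: mero_scale_def mult_ac)
  qed
 qed
 hence "H * (a / H) : mero.span HB" if "a : A" for a using memb[OF that] B(1) by (auto simp: fbasis_def)
 hence "A <= mero.span HB" using H by auto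
 hence "card A <= card HB" using mero.independent_span_bound[of HB A] A B(1) by (auto simp: fbasis_def HB_def)
 also have "... <= RR_dim F D1" unfolding B(2)[symmetric] HB_def using B(1) by (intro card_image_le) (auto simp: fbasis_def)
 finally have "int (card A) <= int (RR_dim F D1)" by simp
 thus ?thesis using RR_dim_mono[OF D D1 le] deg A(3) by linarith
qed

end

section \<open>A superelliptic curve\<close>

text \<open>Gaussian elimination without divisions, so that the coefficients stay in the
  domain.\<close>

lemma dependent_vectors:
 fixes V :: "'b => nat => 'a :: idom"
 assumes "finite I" "card I = Suc n"
 shows "EX c. (EX i:I. c i ~= 0) & (\<forall>j<n. (SUM i:I. c i * V i j) = 0)" using assms
proof (induction n arbitrary: I V)
 case 0
 then obtain i where "i : I" by (metis card.empty ex_in_conv nat.distinct(1))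
 thus ?case by (intro exI[of _ "%_. 1"]) auto
next
 case (Suc n)
 show ?case proof (cases "EX k:I. V k n ~= 0")
  case True
  then obtain k where k: "k : I" "V k n ~= 0" by blast
  have "finite (I - {k})" "card (I - {k}) = Suc n" using Suc.prems k by auto
  from Suc.IH[OF this, of "%i j. V k n * V i j - V i n * V k j"]
  obtain c where c: "EX i:I - {k}. c i ~= 0"
   "\<forall>j<n. (SUM i:I - {k}. c i * (V k n * V i j - V i n * V k j)) = 0" by blast
  define b where "b i = (if i = k then - (SUM i:I - {k}. c i * V i n) else c i * V k n)" for i
  have sum_b: "(SUM i:I. b i * V i j) = (SUM i:I - {k}. c i * (V k n * V i j - V i n * V k j))" for j proof -
   have "(SUM i:I. b i * V i j) = b k * V k j + (SUM i:I - {k}. b i * V i j)" using Suc.prems k by (intro sum.remove) auto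
   also have "(SUM i:I - {k}. b i * V i j) = (SUM i:I - {k}. c i * V k n * V i j)" by (rule sum.cong) (auto simp: b_def)
   also have "b k * V k j = - (SUM i:I - {k}. c i * V i n * V k j)" by (simp add: b_def sum_distrib_right)
   finally show ?thesis by (simp add: sum_subtractf algebra_simps)
  qed
  have "(SUM i:I. b i * V i j) = 0" if "j < Suc n" for j using that c(2) unfolding sum_b by (cases "j = n") (auto simp: mult_ac)
  moreover have "EX i:I. b i ~= 0" using c(1) k by (auto simp: b_def)
  ultimately show ?thesis by blast
 next
  case False
  obtain k where k: "k : I" using Suc.prems by (metis card.empty ex_in_conv nat.distinct(1))
  have "finite (I - {k})" "card (I - {k}) = Suc n" using Suc.prems k by auto
  from Suc.IH[OF this, of V] obtain c where c: "EX i:I - {k}. c i ~= 0"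
   "\<forall>j<n. (SUM i:I - {k}. c i * V i j) = 0" by blast
  define b where "b i = (if i = k then 0 else c i)" for i
  have "(SUM i:I. b i * V i j) = (SUM i:I - {k}. c i * V i j)" for j proof -
   have "(SUM i:I. b i * V i j) = b k * V k j + (SUM i:I - {k}. b i * V i j)" using Suc.prems k by (intro sum.remove) auto
   also have "(SUM i:I - {k}. b i * V i j) = (SUM i:I - {k}. c i * V i j)" by (rule sum.cong) (auto simp: b_def)
   finally show ?thesis by (simp add: b_def)
  qed
  moreover have "(SUM i:I - {k}. c i * V i n) = 0" using False by (intro sum.neutral) auto
  ultimately have "(SUM i:I. b i * V i j) = 0" if "j < Suc n" for j using that c(2) by (cases "j = n") auto
  moreover have "EX i:I. b i ~= 0" using c(1) by (auto simp: b_def)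
  ultimately show ?thesis by blast
 qed
qed

lemma independent_family:
 assumes I: "finite I" and c: "!!c. (SUM i:I. mero_const (c i) * h i) = 0 ==> (ALL i:I. c i = 0)"
 shows "inj_on h I" "mero.independent (h ` I)"
proof -
 show inj: "inj_on h I" proof (rule inj_onI, rule ccontr)
  fix i j assume ij: "i : I" "j : I" "h i = h j" "i ~= j"
  define u where "u k = (if k = i then 1 else if k = j then - 1 else 0 :: complex)" for k
  have "(SUM k:I. mero_const (u k) * h k) = (SUM k:{i, j}. mero_const (u k) * h k)"
   using I ij by (intro sum.mono_neutral_right) (auto simp: u_def mero_const_0)
  also have "... = 0" using ij by (simp add: u_def mero_const_1 mero_const_minus)
  finally have "u i = 0" using c ij by blast
  thus False by (simp add: u_def)
 qed
 show "mero.independent (h ` I)" proof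
  assume "mero.dependent (h ` I)"
  then obtain u where u: "EX v:h ` I. u v ~= 0" "(SUM v:h ` I. mero_scale (u v) v) = 0" using mero.dependent_finite[of "h ` I"] I by auto
  have "(SUM i:I. mero_const (u (h i)) * h i) = 0" using u(2) by (simp add: sum.reindex[OF inj] mero_scale_def)
  from c[OF this] show False using u(1) by auto
 qed
qed

context curve_place
begin

text \<open>After division by the leading power of x only the leading coefficient survives modulo 1
  / x.\<close>

lemma cpoly_at_infinity:
 assumes "x ~: R" "p ~= 0"
 shows "cpoly p x / x ^ degree p : R" "cpoly p x / x ^ degree p ~: m"
proof -
 define k where "k = degree p"
 have im: "inverse x : m" by (rule inverse_m[OF x assms(1)])
 hence iR: "inverse x : R" using m_iff by blast
 define B where "B = (\<Sum>i<k. mero_const (coeff p i) * inverse x ^ (k - i))"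
 have "cpoly p x / x ^ k = (SUM i<=k. mero_const (coeff p i) * inverse x ^ (k - i))"
  unfolding cpoly_altdef[of p k, unfolded k_def[symmetric], OF order_refl] sum_divide_distrib
  using x_nz by (intro sum.cong) (auto simp: power_diff field_simps power_inverse)
 also have "... = mero_const (coeff p k) + B" by (simp add: B_def lessThan_Suc_atMost[symmetric])
 finally have e: "cpoly p x / x ^ k = mero_const (coeff p k) + B" .
 have B: "B : m" unfolding B_def proof (intro m_sum m_mult(2) const)
  fix i assume "i : {..<k}"
  hence "inverse x ^ (k - i) = inverse x * inverse x ^ (k - i - 1)" by (simp add: power_eq_if)
  also have "... : m" by (intro m_mult(1) im power iR)
  finally show "inverse x ^ (k - i) : m" .
 qed
 show "cpoly p x / x ^ degree p : R" unfolding k_def[symmetric] e by (rule ring(1)[OF const]) (use B m_iff in blast)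
 show "cpoly p x / x ^ degree p ~: m" proof
  assume "cpoly p x / x ^ degree p : m"
  hence "mero_const (coeff p k) + B + - B : m" unfolding k_def[symmetric] e by (rule m_add[OF _ m_minus[OF B]])
  thus False using const_notin_m[of "coeff p k"] assms(2) by (simp add: k_def)
 qed
qed

lemma cpoly_F: "cpoly p x : F" by (induction p) (auto intro!: C_subfield_closed[OF F] x)

lemma cpoly_nz: "p ~= 0 ==> cpoly p x ~= 0" using cpoly_eq_0[OF trans] by blast

lemma ord_at_infinity:
 assumes "x ~: R" "p ~= 0"
 shows "ord (cpoly p x) = int (degree p) * ord x"
proof -
 have "ord (cpoly p x / x ^ degree p) = 0" using cpoly_at_infinity[OF assms] by (intro ord_unit)
 moreover have "ord (cpoly p x / x ^ degree p * x ^ degree p) = ord (cpoly p x / x ^ degree p) + ord (x ^ degree p)"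
  using cpoly_F cpoly_nz[OF assms(2)] x_nz by (intro ord_mult C_subfield_closed(10,11)[OF F] x) auto
 ultimately show ?thesis using x_nz ord_power[OF x x_nz] by simp
qed

text \<open>The cofactor of the full power of x - c is a unit, since a root of it that is congruent
  to x would have to be c.\<close>

lemma ord_at_point:
 assumes c: "x - mero_const c : m" and p: "p ~= 0"
 shows "ord (cpoly p x) = int (order c p) * ord (x - mero_const c)"
proof -
 define l where "l = x - mero_const c"
 have l: "l : F" "l ~= 0" using x trans by (auto simp: l_def intro!: C_subfield_closed[OF F])
 have "l + mero_const c : R" by (rule ring(1)[OF _ const]) (use c m_iff l_def in blast)
 hence xR: "x : R" by (simp add: l_def)
 obtain q where q: "p = [:- c, 1:] ^ order c p * q" "~ [:- c, 1:] dvd q" using order_decomp[OF p] by blast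
 have q0: "poly q c ~= 0" "q ~= 0" using q by (auto simp: poly_eq_0_iff_dvd)
 have "cpoly q x ~: m" proof
  assume "cpoly q x : m"
  then obtain d where d: "poly q d = 0" "x - mero_const d : m" using m_poly_root[OF xR q0(2)] by blast
  have "x - mero_const c + - (x - mero_const d) : m" by (intro m_add m_minus c d)
  hence "mero_const (d - c) : m" by (simp add: mero_const_diff)
  thus False using const_notin_m[of "d - c"] d(1) q0(1) by auto
 qed
 hence u: "ord (cpoly q x) = 0" using cpoly_mem[OF xR] by (intro ord_unit)
 have "cpoly p x = l ^ order c p * cpoly q x" by (subst q(1)) (simp add: cpoly_mult cpoly_power l_def mero_const_minus mero_const_1)
 moreover have "ord (l ^ order c p * cpoly q x) = ord (l ^ order c p) + ord (cpoly q x)"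
  using l cpoly_F cpoly_nz[OF q0(2)] by (intro ord_mult C_subfield_closed(11)[OF F]) auto
 ultimately show ?thesis using u ord_power[OF l] by (simp add: l_def)
qed

end

text \<open>The three equations are the multiplication table of 1, y, w. They amount to y^3 = f g^2
  with w = y^2 / g, and treat y and w symmetrically: w^3 = f^2 g.\<close>

locale superelliptic =
 fixes x y w :: mero and f g :: "complex poly"
 assumes trans: "x ~: range mero_const"
  and yy: "y ^ 2 = cpoly g x * w" and ww: "w ^ 2 = cpoly f x * y" and yw: "y * w = cpoly (f * g) x"
  and deg_f: "degree f = 3" and deg_g: "degree g = 2" and sqf: "rsquarefree (f * g)"
begin

abbreviation e where "e p \<equiv> cpoly p x"

definition rep where "rep a b c = e a + e b * y + e c * w"

definition K where "K = C_adjoin {x, y, w}"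

text \<open>The norm of a + b y + c w to C(x): the product over the three cube roots of
  unity.\<close>

definition nm where "nm a b c = a ^ 3 + b ^ 3 * f * g ^ 2 + c ^ 3 * f ^ 2 * g - 3 * a * b * c * f * g"

lemma fg_nz: "f ~= 0" "g ~= 0" using deg_f deg_g by auto

text \<open>The three pure terms have degrees congruent to 0, 1, 2 modulo 3, so one of them strictly
  dominates; the mixed term has the mean of the three degrees and cannot cancel it.\<close>

lemma norm_nz: assumes "a ~= 0 | b ~= 0 | c ~= 0" shows "nm a b c ~= 0"
proof -
 \<comment> \<open>The value -1 for the zero polynomial puts it below every actual degree.\<close>
 define al where "al = (if a = 0 then -1 else 3 * int (degree a))"
 define be where "be = (if b = 0 then -1 else 3 * int (degree b) + 7)"
 define ga where "ga = (if c = 0 then -1 else 3 * int (degree c) + 8)"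
 define A where "A = a ^ 3"
 define B where "B = b ^ 3 * f * g ^ 2"
 define C where "C = c ^ 3 * f ^ 2 * g"
 define E where "E = 3 * a * b * c * f * g"
 have dA: "a ~= 0 ==> int (degree A) = al" by (simp add: A_def al_def degree_power_eq)
 have dB: "b ~= 0 ==> int (degree B) = be" by (simp add: B_def be_def degree_mult_eq degree_power_eq fg_nz deg_f deg_g)
 have dC: "c ~= 0 ==> int (degree C) = ga" by (simp add: C_def ga_def degree_mult_eq degree_power_eq fg_nz deg_f deg_g)
 have d3: "degree (3 :: complex poly) = 0" by (simp add: numeral_poly)
 have dE: "3 * int (degree E) = al + be + ga" if "a ~= 0" "b ~= 0" "c ~= 0"
  using that by (simp add: E_def al_def be_def ga_def degree_mult_eq fg_nz deg_f deg_g d3)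
 have vanish: "coeff A (nat k) = 0" if "al < k" for k using that dA by (cases "a = 0") (auto simp: A_def intro!: coeff_eq_0)
 have vB: "coeff B (nat k) = 0" if "be < k" for k using that dB by (cases "b = 0") (auto simp: B_def intro!: coeff_eq_0)
 have vC: "coeff C (nat k) = 0" if "ga < k" for k using that dC by (cases "c = 0") (auto simp: C_def intro!: coeff_eq_0)
 have vE: "coeff E (nat k) = 0" if "al + be + ga < 3 * k" for k proof (cases "a ~= 0 & b ~= 0 & c ~= 0")
  case True
  hence "int (degree E) < k" using dE that by simp
  thus ?thesis by (intro coeff_eq_0) simp
 qed (auto simp: E_def)
 have "(be < al & ga < al & a ~= 0) | (al < be & ga < be & b ~= 0) | (al < ga & be < ga & c ~= 0)"
  using assms unfolding al_def be_def ga_def by (auto split: if_splits) presburger+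
 moreover have "nm a b c = A + B + C - E" by (simp add: nm_def A_def B_def C_def E_def)
 moreover have "coeff A (nat al) ~= 0" if "a ~= 0" using dA[OF that] that by (metis A_def leading_coeff_0_iff nat_int power_eq_0_iff)
 moreover have "coeff B (nat be) ~= 0" if "b ~= 0" proof -
  have "B ~= 0" using that fg_nz by (simp add: B_def)
  thus ?thesis using dB[OF that] by (metis leading_coeff_0_iff nat_int)
 qed
 moreover have "coeff C (nat ga) ~= 0" if "c ~= 0" proof -
  have "C ~= 0" using that fg_nz by (simp add: C_def)
  thus ?thesis using dC[OF that] by (metis leading_coeff_0_iff nat_int)
 qed
 ultimately show ?thesis proof (elim disjE conjE)
  assume h: "be < al" "ga < al" "a ~= 0" and k: "nm a b c = A + B + C - E" "a ~= 0 ==> coeff A (nat al) ~= 0"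
  have "coeff (nm a b c) (nat al) = coeff A (nat al)" unfolding k(1) using h by (simp add: vB vC vE)
  thus ?thesis using k(2) h by auto
 next
  assume h: "al < be" "ga < be" "b ~= 0" and k: "nm a b c = A + B + C - E" "b ~= 0 ==> coeff B (nat be) ~= 0"
  have "coeff (nm a b c) (nat be) = coeff B (nat be)" unfolding k(1) using h by (simp add: vanish vC vE)
  thus ?thesis using k(2) h by auto
 next
  assume h: "al < ga" "be < ga" "c ~= 0" and k: "nm a b c = A + B + C - E" "c ~= 0 ==> coeff C (nat ga) ~= 0"
  have "coeff (nm a b c) (nat ga) = coeff C (nat ga)" unfolding k(1) using h by (simp add: vanish vB vE)
  thus ?thesis using k(2) h by auto
 qed
qed

lemma rep_mult:
 "rep a b c * rep a' b' c' = rep (a * a' + (b * c' + c * b') * (f * g)) (a * b' + b * a' + c * c' * f) (a * c' + c * a' + b * b' * g)"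
proof -
 have "rep a b c * rep a' b' c' = e a * e a' + (e a * e b' + e b * e a') * y + (e a * e c' + e c * e a') * w
   + e b * e b' * y ^ 2 + e c * e c' * w ^ 2 + (e b * e c' + e c * e b') * (y * w)" by (simp add: rep_def algebra_simps power2_eq_square)
 thus ?thesis unfolding yy ww yw by (simp add: rep_def cpoly_simps algebra_simps)
qed

text \<open>The second factor is the product of the two other conjugates; it makes denominators
  polynomials in x.\<close>

lemma rep_conj: "rep a b c * rep (a ^ 2 - b * c * f * g) (c ^ 2 * f - a * b) (b ^ 2 * g - a * c) = e (nm a b c)"
proof -
 have "a * (a ^ 2 - b * c * f * g) + (b * (b ^ 2 * g - a * c) + c * (c ^ 2 * f - a * b)) * (f * g) = nm a b c"
  by (simp add: nm_def algebra_simps power2_eq_square power3_eq_cube)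
 moreover have "a * (c ^ 2 * f - a * b) + b * (a ^ 2 - b * c * f * g) + c * (b ^ 2 * g - a * c) * f = 0"
  "a * (b ^ 2 * g - a * c) + c * (a ^ 2 - b * c * f * g) + b * (c ^ 2 * f - a * b) * g = 0"
  by (simp_all add: algebra_simps power2_eq_square)
 ultimately show ?thesis unfolding rep_mult by (simp add: rep_def)
qed

lemma rep_lin: "rep a b c + rep a' b' c' = rep (a + a') (b + b') (c + c')"
 "e d * rep a b c = rep (d * a) (d * b) (d * c)" "- rep a b c = rep (- a) (- b) (- c)" by (simp_all add: rep_def cpoly_simps algebra_simps)

lemma e_eq_0_iff: "e p = 0 \<longleftrightarrow> p = 0" using cpoly_eq_0[OF trans, of p] by auto

lemma rep_eq_0: "rep a b c = 0 ==> a = 0 & b = 0 & c = 0" using rep_conj[of a b c] norm_nz[of a b c] e_eq_0_iff by auto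

lemma rep_eq: "rep a b c = rep a' b' c' ==> a = a' & b = b' & c = c'"
 using rep_eq_0[of "a - a'" "b - b'" "c - c'"] by (simp add: rep_def cpoly_simps algebra_simps)

lemma K_field: "C_subfield K" unfolding K_def by (rule C_subfield_hull)

lemma xyw_K: "x : K" "y : K" "w : K" using C_adjoin_subset[of "{x, y, w}"] by (auto simp: K_def)

lemma e_K: "e p : K" by (induction p) (auto intro!: C_subfield_closed[OF K_field] xyw_K)

lemma rep_K: "rep a b c : K" unfolding rep_def by (intro C_subfield_closed(5,6)[OF K_field] e_K xyw_K)

lemma K_rep: assumes "h : K" obtains a b c d where "d ~= 0" "h = rep a b c / e d"
proof -
 define L where "L = {rep a b c / e d | a b c d. d ~= 0}"
 have LI: "rep a b c / e d : L" if "d ~= 0" for a b c d using that unfolding L_def by blast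
 have L1: "rep a b c : L" for a b c using LI[of 1 a b c] by simp
 have "C_subfield L" unfolding C_subfield_def proof (intro conjI ballI subsetI)
  fix h assume "h : range mero_const"
  then obtain k where "h = mero_const k" by blast
  hence "h = rep [:k:] 0 0" by (simp add: rep_def)
  thus "h : L" using L1 by simp
 next
  fix h h' assume "h : L" "h' : L"
  then obtain a b c d a' b' c' d' where h: "h = rep a b c / e d" "d ~= 0" and h': "h' = rep a' b' c' / e d'" "d' ~= 0"
   unfolding L_def by blast
  have dd: "d * d' ~= 0" using h h' by simp
  have nz: "e d ~= 0" "e d' ~= 0" using h h' e_eq_0_iff by auto
  have "h + h' = (e d' * rep a b c + e d * rep a' b' c') / e (d * d')" using nz by (simp add: h(1) h'(1) cpoly_mult field_simps)
  also have "... : L" unfolding rep_lin by (rule LI[OF dd])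
  finally show "h + h' : L" .
  have "h * h' = (rep a b c * rep a' b' c') / e (d * d')" using nz by (simp add: h(1) h'(1) cpoly_mult field_simps)
  also have "... : L" unfolding rep_mult by (rule LI[OF dd])
  finally show "h * h' : L" .
 next
  fix h assume "h : L"
  then obtain a b c d where h: "h = rep a b c / e d" "d ~= 0" unfolding L_def by blast
  have "- h = (- rep a b c) / e d" by (simp add: h(1))
  also have "... : L" unfolding rep_lin by (rule LI[OF h(2)])
  finally show "- h : L" .
  show "inverse h : L" proof (cases "a = 0 & b = 0 & c = 0")
   case True
   hence "inverse h = rep 0 0 0" by (simp add: h(1) rep_def)
   thus ?thesis using L1 by simp
  next
   case False
   hence n: "nm a b c ~= 0" using norm_nz by blast
   have n': "e (nm a b c) ~= 0" using n e_eq_0_iff by blast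
   define r where "r = rep (a ^ 2 - b * c * f * g) (c ^ 2 * f - a * b) (b ^ 2 * g - a * c)"
   have rc: "rep a b c * r = e (nm a b c)" unfolding r_def by (rule rep_conj)
   have "rep a b c * r ~= 0" unfolding rc by (rule n')
   hence "r ~= 0" by simp
   hence "inverse h = e d * r / (rep a b c * r)" by (simp add: h(1))
   also have "... = e d * r / e (nm a b c)" by (simp only: rc)
   also have "... : L" unfolding r_def rep_lin by (rule LI[OF n])
   finally show ?thesis .
  qed
 qed
 moreover have "x = rep [:0, 1:] 0 0" "y = rep 0 1 0" "w = rep 0 0 1" by (simp_all add: rep_def mero_const_0 mero_const_1)
 hence "{x, y, w} <= L" using L1 by (metis empty_subsetI insert_subset)
 ultimately have "K <= L" unfolding K_def by (intro C_adjoin_minimal)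
 hence "h : L" using assms by blast
 thus ?thesis using that unfolding L_def by blast
qed

sublocale curve K x 3
proof
 \<comment> \<open>Four elements of K have numerators with three polynomial coordinates each, so
   they are dependent over C[x].\<close>
 fix h :: "nat => mero" assume h: "!!i. i <= 3 ==> h i : K"
 have "EX r. snd (snd (snd r)) ~= 0 & h i = rep (fst r) (fst (snd r)) (fst (snd (snd r))) / e (snd (snd (snd r)))"
  if i: "i : {..3}" for i proof -
  have "h i : K" using h i by simp
  then obtain a b c d where "d ~= 0" "h i = rep a b c / e d" by (rule K_rep)
  thus ?thesis by (intro exI[of _ "(a, b, c, d)"]) simp
 qed
 hence "ALL i:{..3}. EX r. snd (snd (snd r)) ~= 0 & h i = rep (fst r) (fst (snd r)) (fst (snd (snd r))) / e (snd (snd (snd r)))" by blast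
 from bchoice[OF this] obtain r where r: "ALL i:{..3}. snd (snd (snd (r i))) ~= 0 \<and>
   h i = rep (fst (r i)) (fst (snd (r i))) (fst (snd (snd (r i)))) / e (snd (snd (snd (r i))))" by blast
 define a b c d where "a i = fst (r i)" and "b i = fst (snd (r i))" and "c i = fst (snd (snd (r i)))"
  and "d i = snd (snd (snd (r i)))" for i
 have hr: "d i ~= 0" "h i = rep (a i) (b i) (c i) / e (d i)" if "i <= 3" for i
  using bspec[OF r, of i] that by (auto simp: a_def b_def c_def d_def)
 define V where "V i j = (if j = 0 then a i else if j = 1 then b i else c i)" for i j :: nat
 obtain k where k: "EX i:{..3}. k i ~= 0" "\<forall>j<3. (SUM i:{..3}. k i * V i j) = 0"
  using dependent_vectors[of "{..3::nat}" 3 V] by auto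
 have s: "(SUM i<=3. k i * a i) = 0" "(SUM i<=3. k i * b i) = 0" "(SUM i<=3. k i * c i) = 0"
  using k(2)[rule_format, of 0] k(2)[rule_format, of 1] k(2)[rule_format, of 2] by (simp_all add: V_def)
 have "(SUM i<=3. e (k i * d i) * h i) = (SUM i<=3. e (k i) * rep (a i) (b i) (c i))"
  using hr e_eq_0_iff by (intro sum.cong) (auto simp: cpoly_mult)
 also have "... = e (SUM i<=3. k i * a i) + e (SUM i<=3. k i * b i) * y + e (SUM i<=3. k i * c i) * w"
  by (simp add: rep_def cpoly_sum cpoly_mult sum.distrib sum_distrib_right distrib_left mult.assoc)
 also have "... = 0" by (simp add: s)
 finally have z: "(SUM i<=3. e (k i * d i) * h i) = 0" .
 obtain i where "i <= 3" "k i ~= 0" using k(1) by auto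
 hence "EX i<=3. k i * d i ~= 0" using hr(1) by auto
 thus "EX q. (EX i<=3. q i ~= 0) & (SUM i<=3. e (q i) * h i) = 0" using z by (intro exI[of _ "%i. k i * d i"]) simp
qed (rule K_field xyw_K trans)+

end

section \<open>The automorphism of order three\<close>

definition omega :: complex where
 "omega = (SOME z. z ^ 2 + z + 1 = 0)"

lemma omega: "omega ^ 2 + omega + 1 = 0"
proof -
 obtain z where "poly [:1, 1, 1 :: complex:] z = 0"
  using fundamental_theorem_of_algebra[of "[:1, 1, 1 :: complex:]"] by (auto simp: constant_degree)
 hence "\<exists>z::complex. z ^ 2 + z + 1 = 0" by (intro exI[of _ z]) (simp add: power2_eq_square algebra_simps)
 thus ?thesis unfolding omega_def by (rule someI_ex)
qed

lemma omega_sq: "omega ^ 2 = - 1 - omega" using omega by (simp add: eq_diff_eq eq_neg_iff_add_eq_0 add.assoc)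

lemma omega_mult: "omega * omega = - 1 - omega" using omega_sq by (simp add: power2_eq_square)

lemma omega_cube: "omega * omega ^ 2 = 1" "omega ^ 2 * omega = 1" "omega ^ 2 * omega ^ 2 = omega"
 unfolding omega_sq by (simp_all add: algebra_simps omega_mult)

lemma omega_powers: "omega ^ 3 = 1" "omega ^ 4 = omega" "omega ^ 6 = 1"
proof -
 show 3: "omega ^ 3 = 1" using omega_cube(1) by (simp add: eval_nat_numeral)
 have "omega ^ 4 = omega * omega ^ 3" "omega ^ 6 = omega ^ 3 * omega ^ 3" by (simp_all add: eval_nat_numeral mult_ac)
 thus "omega ^ 4 = omega" "omega ^ 6 = 1" unfolding 3 by simp_all
qed

context superelliptic
begin

text \<open>The automorphism over C(x) that multiplies y by omega and w by its square. Uniqueness of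
  the coordinates makes it independent of the fraction chosen.\<close>

definition sig :: "mero => mero" where
 "sig h = (THE s. EX a b c d. d ~= 0 & h = rep a b c / e d & s = rep a (smult omega b) (smult (omega ^ 2) c) / e d)"

lemma sig_eq: assumes d: "d ~= 0" shows "sig (rep a b c / e d) = rep a (smult omega b) (smult (omega ^ 2) c) / e d" unfolding sig_def
proof (rule the_equality)
 show "EX a' b' c' d'. d' ~= 0 & rep a b c / e d = rep a' b' c' / e d' \<and>
   rep a (smult omega b) (smult (omega ^ 2) c) / e d = rep a' (smult omega b') (smult (omega ^ 2) c') / e d'" using d by blast
next
 fix s assume "EX a' b' c' d'. d' ~= 0 & rep a b c / e d = rep a' b' c' / e d' & s = rep a' (smult omega b') (smult (omega ^ 2) c') / e d'"
 then obtain a' b' c' d' where s: "d' ~= 0" "rep a b c / e d = rep a' b' c' / e d'"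
  "s = rep a' (smult omega b') (smult (omega ^ 2) c') / e d'" by blast
 have nz: "e d ~= 0" "e d' ~= 0" using d s(1) e_eq_0_iff by auto
 have "e d' * rep a b c = e d * rep a' b' c'" using s(2) nz by (simp add: field_simps)
 hence "d' * a = d * a' & d' * b = d * b' & d' * c = d * c'" unfolding rep_lin by (rule rep_eq)
 hence "e d' * rep a (smult omega b) (smult (omega ^ 2) c) = e d * rep a' (smult omega b') (smult (omega ^ 2) c')"
  unfolding rep_lin by (metis mult_smult_right)
 thus "s = rep a (smult omega b) (smult (omega ^ 2) c) / e d" using nz by (simp add: s(3) field_simps)
qed

lemma sig_rep: "sig (rep a b c) = rep a (smult omega b) (smult (omega ^ 2) c)" using sig_eq[of 1 a b c] by simp

lemma sig_e: "sig (e p) = e p" using sig_rep[of p 0 0] by (simp add: rep_def)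

lemma sig_K: "h : K ==> sig h : K" by (elim K_rep) (auto simp: sig_eq intro!: C_subfield_closed(10)[OF K_field] rep_K e_K)

lemma sig_add: assumes "h : K" "h' : K" shows "sig (h + h') = sig h + sig h'"
proof -
 obtain a b c d where h: "d ~= 0" "h = rep a b c / e d" using assms(1) by (rule K_rep)
 obtain a' b' c' d' where h': "d' ~= 0" "h' = rep a' b' c' / e d'" using assms(2) by (rule K_rep)
 have nz: "e d ~= 0" "e d' ~= 0" "d * d' ~= 0" using h h' e_eq_0_iff by auto
 have add: "r / e d + r' / e d' = (e d' * r + e d * r') / e (d * d')" for r r' using nz by (simp add: cpoly_mult field_simps)
 show ?thesis unfolding h(2) h'(2) sig_eq[OF h(1)] sig_eq[OF h'(1)] add rep_lin sig_eq[OF nz(3)] by (simp add: smult_add_right)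
qed

lemma sig_mult: assumes "h : K" "h' : K" shows "sig (h * h') = sig h * sig h'"
proof -
 obtain a b c d where h: "d ~= 0" "h = rep a b c / e d" using assms(1) by (rule K_rep)
 obtain a' b' c' d' where h': "d' ~= 0" "h' = rep a' b' c' / e d'" using assms(2) by (rule K_rep)
 have nz: "d * d' ~= 0" using h h' by auto
 have mult: "r / e d * (r' / e d') = (r * r') / e (d * d')" for r r' by (simp add: cpoly_mult)
 have "omega * omega = omega ^ 2" by (simp add: power2_eq_square)
 thus ?thesis unfolding h(2) h'(2) sig_eq[OF h(1)] sig_eq[OF h'(1)] mult rep_mult sig_eq[OF nz]
  by (simp add: smult_add_right omega_cube omega_powers)
qed

lemma sig_const: "sig (mero_const c) = mero_const c" and sig_x: "sig x = x"
 using sig_e[of "[:c:]"] sig_e[of "[:0, 1:]"] by (simp_all add: mero_const_0 mero_const_1)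

lemma sig_0: "sig 0 = 0" and sig_1: "sig 1 = 1" using sig_const[of 0] sig_const[of 1] by (simp_all add: mero_const_0 mero_const_1)

lemma sig_inverse: assumes "h : K" shows "sig (inverse h) = inverse (sig h)"
proof (cases "h = 0")
 case False
 have "sig h * sig (inverse h) = 1" using sig_mult[OF assms C_subfield_closed(8)[OF K_field assms]] False by (simp add: sig_1)
 thus ?thesis by (simp add: inverse_unique)
qed (simp add: sig_0)

lemma sig_diff: assumes "h : K" "h' : K" shows "sig (h - h') = sig h - sig h'"
proof -
 have "sig (h - h' + h') = sig (h - h') + sig h'" using assms by (intro sig_add C_subfield_closed[OF K_field])
 thus ?thesis by simp
qed

lemma sig_sig_sig: assumes "h : K" shows "sig (sig (sig h)) = h"
proof -
 obtain a b c d where h: "d ~= 0" "h = rep a b c / e d" using assms(1) by (rule K_rep)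
 have "omega * (omega * omega) = 1" "omega ^ 2 * (omega ^ 2 * omega ^ 2) = 1"
  unfolding omega_cube(3) using omega_cube by (simp_all add: power2_eq_square)
 thus ?thesis unfolding h(2) sig_eq[OF h(1)] smult_smult by (simp only: smult_1_left)
qed

text \<open>The preimage of a valuation ring is one. It is proper because \<open>sig\<close> is
  invertible, and it is larger than the constants because x is fixed and x or 1 / x lies in
  it.\<close>

lemma sig_place: assumes R: "R : places K" shows "{h : K. sig h : R} : places K"
proof -
 interpret valuation_ring K R by (rule valuation_ring.intro[OF K_field R])
 define Q where "Q = {h : K. sig h : R}"
 have "range mero_const <= Q" using C_subfield_closed(1)[OF K_field] const by (auto simp: Q_def sig_const)
 moreover have "x : Q | inverse x : Q"
  using xyw_K(1) sig_inverse[OF xyw_K(1)] C_subfield_closed(8)[OF K_field xyw_K(1)] inverse_m[OF xyw_K(1)]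
  by (auto simp: Q_def sig_x m_iff)
 hence "range mero_const ~= Q" proof
  assume "inverse x : Q"
  moreover have "inverse x ~: range mero_const" proof
   assume "inverse x : range mero_const"
   then obtain c where "inverse x = mero_const c" by blast
   hence "x = mero_const (inverse c)" by (metis inverse_inverse_eq mero_const_inverse)
   thus False using trans by blast
  qed
  ultimately show ?thesis by blast
 qed (use trans in blast)
 moreover have "Q ~= K" proof
  assume Q: "Q = K"
  have "K <= R" proof
   fix h assume h: "h : K"
   hence "sig (sig h) : Q" using Q sig_K by blast
   thus "h : R" using sig_sig_sig[OF h] by (simp add: Q_def)
  qed
  thus False using R by (auto simp: places_def)
 qed
 moreover have "h + h' : Q & h - h' : Q & h * h' : Q" if "h : Q" "h' : Q" for h h'
  using that sig_add sig_diff sig_mult C_subfield_closed(5,6,9)[OF K_field] ring(1-3) by (simp add: Q_def)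
 moreover have "h : Q | inverse h : Q" if "h : K" for h
  using that sig_inverse[OF that] C_subfield_closed(8)[OF K_field that] inverse_m[OF sig_K[OF that]] by (auto simp: Q_def m_iff)
 moreover have "Q <= K" by (auto simp: Q_def)
 ultimately have "Q : places K" unfolding places_def by blast
 thus ?thesis by (simp add: Q_def)
qed

section \<open>Ramification and the functions with poles only at infinity\<close>

lemma cubes: "y ^ 3 = e (f * g ^ 2)" "w ^ 3 = e (f ^ 2 * g)"
proof -
 have "y ^ 3 = y ^ 2 * y" "w ^ 3 = w ^ 2 * w" by (simp_all add: power2_eq_square power3_eq_cube)
 hence "y ^ 3 = e g * (y * w)" "w ^ 3 = e f * (y * w)" unfolding yy ww by (simp_all add: mult_ac)
 thus "y ^ 3 = e (f * g ^ 2)" "w ^ 3 = e (f ^ 2 * g)" unfolding yw by (simp_all add: cpoly_simps power2_eq_square mult_ac)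
qed

lemma yw_nz: "y ~= 0" "w ~= 0" using yw e_eq_0_iff[of "f * g"] fg_nz by auto

lemma degrees: "degree (f * g ^ 2) = 7" "degree (f ^ 2 * g) = 8" using deg_f deg_g fg_nz by (simp_all add: degree_mult_eq degree_power_eq)

lemma orders: "order c (f * g ^ 2) <= 2" "order c (f ^ 2 * g) <= 2"
proof -
 have "order c (f * g) = 0 | order c (f * g) = 1" using sqf unfolding rsquarefree_def by blast
 hence "order c (f * g) <= 1" by linarith
 hence "order c f + order c g <= 1" using fg_nz by (simp add: order_mult)
 moreover have "order c (f * g ^ 2) = order c f + 2 * order c g" "order c (f ^ 2 * g) = 2 * order c f + order c g"
  using fg_nz by (simp_all add: order_mult power2_eq_square)
 ultimately show "order c (f * g ^ 2) <= 2" "order c (f ^ 2 * g) <= 2" by linarith+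
qed

text \<open>From 3 ord y = 7 ord x the order of x is divisible by 3, and the fundamental inequality
  bounds it by 3 in absolute value: infinity is totally ramified.\<close>

lemma ord_infinity:
 assumes R: "R : places K" "x ~: R"
 shows "place_ord R x = - 3" "place_ord R y = - 7" "place_ord R w = - 8"
proof -
 interpret R: curve_place K x 3 R by (rule curve_place[OF R(1)])
 have "R.ord x < 0" using R.ord_nonneg[OF xyw_K(1) x_nz] R(2) by linarith
 moreover have ip: "inverse x : par" by (simp add: par_def)
 have "(SUM R:{R}. place_ord R (inverse x)) <= int 3" by (rule fundamental_inequality[OF ip]) (use R R.inverse_m[OF xyw_K(1) R(2)] in auto)
 hence "- R.ord x <= 3" using R.ord_inverse[OF xyw_K(1) x_nz] by simp
 moreover have y: "3 * R.ord y = 7 * R.ord x"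
  using R.ord_power[OF xyw_K(2) yw_nz(1), of 3] R.ord_at_infinity[OF R(2), of "f * g ^ 2"] fg_nz unfolding cubes degrees by simp
 moreover have w: "3 * R.ord w = 8 * R.ord x"
  using R.ord_power[OF xyw_K(3) yw_nz(2), of 3] R.ord_at_infinity[OF R(2), of "f ^ 2 * g"] fg_nz unfolding cubes degrees by simp
 ultimately show "R.ord x = - 3" by presburger
 thus "R.ord y = - 7" "R.ord w = - 8" using y w by auto
qed

lemma infinity_unique: assumes "R : places K" "x ~: R" "R' : places K" "x ~: R'" shows "R = R'"
proof (rule ccontr)
 assume ne: "R ~= R'"
 interpret R: curve_place K x 3 R by (rule curve_place) fact
 interpret R': curve_place K x 3 R' by (rule curve_place) fact
 have ip: "inverse x : par" by (simp add: par_def)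
 have "(SUM R:{R, R'}. place_ord R (inverse x)) <= int 3" by (rule fundamental_inequality[OF ip])
   (use assms R.inverse_m[OF xyw_K(1)] R'.inverse_m[OF xyw_K(1)] in auto)
 thus False using ne R.ord_inverse[OF xyw_K(1) x_nz] R'.ord_inverse[OF xyw_K(1) x_nz]
  ord_infinity(1)[OF assms(1,2)] ord_infinity(1)[OF assms(3,4)] by simp
qed

text \<open>A root c of d that is not a root of q would be a pole: at a place over c the order of s
  is at most two thirds of that of x - c, while d vanishes at least to the order of x - c.\<close>

lemma polynomial_part:
 assumes "d ~= 0" and s: "s : K" "s ^ 3 = e p" "p ~= 0" "!!c. order c p <= 2"
  and "!!R. R : places K ==> x : R ==> e q / e d * s : R"
 shows "EX r. e q / e d = e r" using assms(1,6)
proof (induction "degree d" arbitrary: d q rule: less_induct)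
 case less
 note reg = less.prems(2)
 show ?case proof (cases "degree d = 0")
  case True
  then obtain k where k: "d = [:k:]" by (metis degree_eq_zeroE)
  have "e q / e d = e (smult (inverse k) q)" by (simp add: k cpoly_smult mero_const_inverse divide_inverse mult.commute)
  thus ?thesis by blast
 next
  case False
  then obtain c where c: "poly d c = 0" using fundamental_theorem_of_algebra[of d] by (auto simp: constant_degree)
  have lin: "x - mero_const c ~= 0" "x - mero_const c ~: range mero_const" proof -
   have *: "x - mero_const c ~= mero_const k" for k proof
    assume "x - mero_const c = mero_const k"
    hence "x = mero_const (k + c)" by (simp add: mero_const_add algebra_simps)
    thus False using trans by blast
   qed
   show "x - mero_const c ~: range mero_const" using * by blast
   show "x - mero_const c ~= 0" using *[of 0] by (simp add: mero_const_0)
  qed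
  show ?thesis proof (cases "poly q c = 0")
   case True
   obtain d' where d': "d = [:- c, 1:] * d'" using c by (auto simp: poly_eq_0_iff_dvd dvd_def)
   obtain q' where q': "q = [:- c, 1:] * q'" using True by (auto simp: poly_eq_0_iff_dvd dvd_def)
   have eq: "e q / e d = e q' / e d'" unfolding d' q' cpoly_linear_mult using lin(1) by simp
   have d0: "d' ~= 0" using less.prems(1) d' by auto
   hence "degree d' < degree d" unfolding d' by (subst degree_mult_eq) auto
   from less.hyps[OF this d0, of q'] show ?thesis using reg unfolding eq by blast
  next
   case qc: False
   have lK: "x - mero_const c : K" using xyw_K by (intro C_subfield_closed[OF K_field])
   obtain R where R: "R : places K" "x - mero_const c : max_ideal R" using place_over[OF K_field lK lin(2)] by blast
   interpret R: curve_place K x 3 R by (rule curve_place[OF R(1)])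
   define v where "v = R.ord (x - mero_const c)"
   have v: "v > 0" unfolding v_def using R.ord_pos[OF lK lin(1)] R(2) by blast
   have xR: "x : R" proof -
    have "x - mero_const c + mero_const c : R" by (rule R.ring(1)[OF _ R.const]) (use R(2) R.m_iff in blast)
    thus ?thesis by simp
   qed
   have q0: "q ~= 0" using qc by auto
   have "e p ~= 0" using s(3) by (simp add: e_eq_0_iff)
   hence "s ^ 3 ~= 0" by (simp only: s(2) not_False_eq_True)
   hence "s ~= 0" by (cases "s = 0") simp_all
   moreover have "e q ~= 0" "e d ~= 0" using q0 less.prems(1) by (simp_all add: e_eq_0_iff)
   ultimately have nz: "e q ~= 0" "e d ~= 0" "s ~= 0" by simp_all
   have T: "e q / e d * s : K" by (intro C_subfield_closed(6,10)[OF K_field] e_K s)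
   moreover have "e q / e d * s ~= 0" using nz by simp
   ultimately have T: "e q / e d * s : K" "e q / e d * s ~= 0" .
   have "0 <= R.ord (e q / e d * s)" using R.ord_nonneg[OF T] reg[OF R(1) xR] by blast
   moreover have "R.ord (e q / e d * s * e d) = R.ord (e q / e d * s) + R.ord (e d)" by (intro R.ord_mult e_K T nz)
   hence "R.ord (e q * s) = R.ord (e q / e d * s) + R.ord (e d)" using nz by simp
   moreover have "R.ord (e q * s) = R.ord (e q) + R.ord s" by (intro R.ord_mult e_K s nz)
   moreover have "R.ord (e q) = 0" using R.ord_at_point[OF R(2) q0] qc order_root[of q c] by simp
   moreover have "3 * R.ord s = int (order c p) * v"
    using R.ord_power[OF s(1) nz(3), of 3] R.ord_at_point[OF R(2) s(3)] unfolding s(2) v_def by simp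
   moreover have "int (order c p) * v <= 2 * v" using s(4)[of c] v by (intro mult_right_mono) auto
   moreover have "R.ord (e d) >= 1 * v" proof -
    have "order c d >= 1" using c less.prems(1) order_root[of d c] by simp
    hence "1 * v <= int (order c d) * v" using v by (intro mult_right_mono) auto
    thus ?thesis using R.ord_at_point[OF R(2) less.prems(1)] by (simp add: v_def)
   qed
   ultimately have False using v by linarith
   thus ?thesis ..
  qed
 qed
qed

lemma RR_six:
 assumes P: "P : places K" "x ~: P"
 shows "h : RR_space K (%R. if R = P then 6 else 0) \<longleftrightarrow>
  h : K & (ALL R:places K. R ~= P --> h : R) & h / x ^ 2 : P"
proof (cases "h : K & h ~= 0")
 case False
 have "0 : R" if "R : places K" for R using valuation_ring.ring(4)[OF valuation_ring.intro[OF K_field that]] .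
 thus ?thesis using False P(1) C_subfield_closed(2)[OF K_field] by (auto simp: RR_space_def)
next
 case True
 interpret P: curve_place K x 3 P by (rule curve_place[OF P(1)])
 have x2: "x ^ 2 : K" "x ^ 2 ~= 0" using x_nz by (auto intro: C_subfield_closed(11)[OF K_field] xyw_K)
 have q: "h / x ^ 2 : K" "h / x ^ 2 ~= 0" using True x2 by (auto intro: C_subfield_closed(10)[OF K_field])
 have "P.ord (h / x ^ 2 * x ^ 2) = P.ord (h / x ^ 2) + P.ord (x ^ 2)" by (intro P.ord_mult q x2)
 hence "P.ord h = P.ord (h / x ^ 2) - 6" using x_nz P.ord_power[OF xyw_K(1) x_nz, of 2] ord_infinity(1)[OF P] by simp
 hence "- 6 <= P.ord h \<longleftrightarrow> h / x ^ 2 : P" using P.ord_nonneg[OF q] by simp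
 moreover have "0 <= place_ord R h \<longleftrightarrow> h : R" if "R : places K" for R
  using curve_place.ord_nonneg[OF curve_place[OF that]] True by blast
 ultimately show ?thesis using True P(1) by (auto simp: RR_space_def)
qed

text \<open>There is only one place at infinity, so \<open>sig\<close> preserves the space and each
  of the components along 1, y, w lies in it. Their coefficients are polynomials, and the pole
  orders 7 and 8 of y and w exceed 6.\<close>

lemma RR_six_span:
 assumes P: "P : places K" "x ~: P" and h: "h : RR_space K (%R. if R = P then 6 else 0)"
 shows "h : mero.span {1, x, x ^ 2}"
proof -
 define V where "V = RR_space K (%R. if R = P then 6 else 0)"
 have VD: "k : K" "R : places K ==> R ~= P ==> k : R" "k / x ^ 2 : P" if k: "k : V" for k R
  using k RR_six[OF P, of k] unfolding V_def by simp_all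
 have VI: "k : V" if "k : K" "!!R. R : places K ==> R ~= P ==> k : R" "k / x ^ 2 : P" for k unfolding V_def RR_six[OF P] using that by simp
 have sub: "mero.subspace V" unfolding V_def by (rule RR_subspace)
 have x2: "x ^ 2 : K" using xyw_K by (intro C_subfield_closed(11)[OF K_field])
 interpret P: curve_place K x 3 P by (rule curve_place[OF P(1)])
 have sV: "sig k : V" if k: "k : V" for k proof -
  have kK: "k : K" by (rule VD(1)[OF k])
  have "sig k : R" if R: "R : places K" "R ~= P" for R proof -
   have "x : R" using infinity_unique[OF R(1) _ P] R(2) by blast
   hence "x : {h : K. sig h : R}" using xyw_K by (simp add: sig_x)
   hence "{h : K. sig h : R} ~= P" using P(2) by metis
   hence "k : {h : K. sig h : R}" by (rule VD(2)[OF k sig_place[OF R(1)]])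
   thus ?thesis by simp
  qed
  moreover have "sig k / x ^ 2 : P" proof -
   have "x ~: {h : K. sig h : P}" using P(2) by (simp add: sig_x)
   hence "{h : K. sig h : P} = P" using infinity_unique[OF sig_place[OF P(1)] _ P] by blast
   hence "k / x ^ 2 : {h : K. sig h : P}" using VD(3)[OF k] by simp
   hence "sig (k / x ^ 2) : P" by simp
   moreover have "sig (x ^ 2) = x ^ 2" using sig_e[of "[:0, 1:] ^ 2"] by (simp add: cpoly_simps mero_const_0 mero_const_1)
   ultimately show ?thesis using sig_mult[OF kK C_subfield_closed(8)[OF K_field x2]] sig_inverse[OF x2] by (simp add: divide_inverse)
  qed
  ultimately show ?thesis by (intro VI sig_K[OF kK])
 qed
 have hV: "h : V" using h by (simp add: V_def)
 have hK: "h : K" by (rule VD(1)[OF hV])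
 obtain a b c d where r: "d ~= 0" "h = rep a b c / e d" using hK by (rule K_rep)
 define A B C where "A = e a / e d" and "B = e b / e d * y" and "C = e c / e d * w"
 define z where "z = mero_const omega"
 have z: "z * z = - 1 - z" using arg_cong[OF omega_mult, of mero_const]
  by (simp add: z_def mero_const_mult mero_const_diff mero_const_minus mero_const_1)
 have z2: "mero_const (omega ^ 2) = - 1 - z"
  using arg_cong[OF omega_sq, of mero_const] by (simp add: z_def mero_const_diff mero_const_minus mero_const_1)
 have h1: "h = A + B + C" by (simp add: r(2) rep_def A_def B_def C_def add_divide_distrib)
 have s1: "sig h = A + z * B + (- 1 - z) * C" unfolding r(2) sig_eq[OF r(1)]
  by (simp add: rep_def A_def B_def C_def add_divide_distrib cpoly_smult z2 z_def mult.assoc)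
 have "smult omega (smult omega b) = smult (omega ^ 2) b" "smult (omega ^ 2) (smult (omega ^ 2) c) = smult omega c"
  by (simp add: power2_eq_square, simp only: smult_smult omega_cube)
 hence "sig (rep a (smult omega b) (smult (omega ^ 2) c) / e d) = rep a (smult (omega ^ 2) b) (smult omega c) / e d"
  unfolding sig_eq[OF r(1)] by (simp only:)
 also have "... = A + (- 1 - z) * B + z * C" by (simp add: rep_def A_def B_def C_def add_divide_distrib cpoly_smult z2 z_def mult.assoc)
 finally have "sig (rep a (smult omega b) (smult (omega ^ 2) c) / e d) = A + (- 1 - z) * B + z * C" .
 hence s2: "sig (sig h) = A + (- 1 - z) * B + z * C" unfolding r(2) sig_eq[OF r(1)] .
 have third: "k : V" if "3 * k : V" for k proof -
  have "mero_scale (1 / 3) (3 * k) : V" by (rule mero.subspace_scale[OF sub that])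
  moreover have "mero_scale (1 / 3) (3 * k) = k"
   by (simp add: mero_scale_def mult.assoc[symmetric] mero_const_numeral[symmetric] mero_const_mult[symmetric] mero_const_1)
  ultimately show ?thesis by simp
 qed
 have zV: "z * k : V" if "k : V" for k using mero.subspace_scale[OF sub that, of omega] by (simp add: mero_scale_def z_def)
 note cl = mero.subspace_add[OF sub] mero.subspace_neg[OF sub] mero.subspace_diff[OF sub] zV
 note hs = hV sV[OF hV] sV[OF sV[OF hV]]
 define h' h'' where "h' = sig h" and "h'' = sig (sig h)"
 note s1' = s1[folded h'_def(1)] and s2' = s2[folded h''_def(1)] and hs' = hs[folded h''_def h'_def]
 \<comment> \<open>The projections to the eigenspaces of \<open>sig\<close>, written as combinations
   of h and its two conjugates.\<close>
 have "3 * A = h + h' + h''" unfolding s1' s2' h1 by algebra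
 also have "... : V" by (intro cl hs')
 finally have AV: "A : V" by (rule third)
 have "3 * B = h + (- h' - z * h') + z * h''" unfolding s1' s2' h1 using z by algebra
 also have "... : V" by (intro cl hs')
 finally have BV: "B : V" by (rule third)
 have "3 * C = h + z * h' + (- h'' - z * h'')" unfolding s1' s2' h1 using z by algebra
 also have "... : V" by (intro cl hs')
 finally have CV: "C : V" by (rule third)
 have reg: "k : R" if "k : V" "R : places K" "x : R" for k R by (rule VD(2)[OF that(1,2)]) (use that(3) P(2) in metis)
 have "EX r. e a / e d = e r" proof (rule polynomial_part[OF r(1), of 1 1])
  show "order c 1 <= 2" for c :: complex by (simp add: order_1_eq_0)
 qed (use reg[OF AV] C_subfield_closed(3)[OF K_field] in \<open>auto simp: A_def\<close>)
 then obtain a' where a': "A = e a'" by (auto simp: A_def)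
 have "EX r. e b / e d = e r"
  by (rule polynomial_part[OF r(1) xyw_K(2) cubes(1) _ orders(1)]) (use reg[OF BV] fg_nz in \<open>auto simp: B_def\<close>)
 then obtain b' where "e b / e d = e b'" by blast
 hence b': "B = e b' * y" by (simp only: B_def)
 have "EX r. e c / e d = e r"
  by (rule polynomial_part[OF r(1) xyw_K(3) cubes(2) _ orders(2)]) (use reg[OF CV] fg_nz in \<open>auto simp: C_def\<close>)
 then obtain c' where "e c / e d = e c'" by blast
 hence c': "C = e c' * w" by (simp only: C_def)
 have bound: "- 6 <= P.ord k" if k: "k : V" "k ~= 0" for k using k P(1) by (auto simp: V_def RR_space_def split: if_splits)
 have "b' = 0" proof (rule ccontr)
  assume nz: "b' ~= 0"
  have "P.ord B = P.ord (e b') + P.ord y" unfolding b' using nz e_eq_0_iff yw_nz by (intro P.ord_mult e_K xyw_K) auto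
  hence "P.ord B <= - 7" using P.ord_at_infinity[OF P(2) nz] ord_infinity[OF P] by simp
  moreover have "B ~= 0" using nz yw_nz e_eq_0_iff by (simp add: b')
  ultimately show False using bound[OF BV] by simp
 qed
 moreover have "c' = 0" proof (rule ccontr)
  assume nz: "c' ~= 0"
  have "P.ord C = P.ord (e c') + P.ord w" unfolding c' using nz e_eq_0_iff yw_nz by (intro P.ord_mult e_K xyw_K) auto
  hence "P.ord C <= - 8" using P.ord_at_infinity[OF P(2) nz] ord_infinity[OF P] by simp
  moreover have "C ~= 0" using nz yw_nz e_eq_0_iff by (simp add: c')
  ultimately show False using bound[OF CV] by simp
 qed
 ultimately have "h = e a'" by (simp add: h1 a' b' c')
 also have "degree a' <= 2" proof (rule ccontr)
  assume "~ degree a' <= 2"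
  hence nz: "a' ~= 0" "degree a' >= 3" by auto
  have "P.ord A <= - 9" using P.ord_at_infinity[OF P(2) nz(1)] ord_infinity[OF P] nz(2) by (simp add: a')
  moreover have "A ~= 0" using nz e_eq_0_iff by (simp add: a')
  ultimately show False using bound[OF AV] by simp
 qed
 hence "e a' = mero_scale (coeff a' 0) 1 + mero_scale (coeff a' 1) x + mero_scale (coeff a' 2) (x ^ 2)"
  by (simp add: cpoly_altdef numeral_2_eq_2 mero_scale_def)
 also have "... : mero.span {1, x, x ^ 2}" by (intro mero.span_add mero.span_scale mero.span_base) auto
 finally show ?thesis .
qed

text \<open>The monomials x^i, x^i y, x^i w of pole order at most 3 M. Their regularity is tested on
  cubes, which are rational in x, since valuation rings are closed under roots.\<close>

lemma lower_bound:
 "EX A. finite A & mero.independent A & int 3 * int M + 1 - int 4 <= int (card A) \<and>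
   (ALL a:A. a : K & (ALL R:places K. (x : R --> a : R) & (x ~: R --> a / x ^ M : R)))"
proof -
 define bs where "bs k = (if k = 0 then 1 else if k = 1 then y else w)" for k :: nat
 define pl where "pl k = (if k = 0 then 1 else if k = 1 then f * g ^ 2 else f ^ 2 * g)" for k :: nat
 \<comment> \<open>As y and w have pole orders 7 and 8, both below 9, i may run up to M - 3. The
   count is M + 1 + 2 (M - 2) = 3 M + 1 - 4, and for small M the truncated subtraction only
   helps.\<close>
 define J where "J k = (if k = 0 then {..M} else {..<M - 2})" for k :: nat
 define I where "I = (SIGMA k:{0, 1, 2}. J k)"
 define h where "h = (%(k, i). x ^ i * bs k)"
 have finJ: "finite (J k)" for k by (simp add: J_def)
 have finI: "finite I" unfolding I_def using finJ by auto
 have bs: "bs k : K" "bs k ^ 3 = e (pl k)" "pl k ~= 0" for k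
  using xyw_K cubes fg_nz C_subfield_closed(3)[OF K_field] by (auto simp: bs_def pl_def)
 have ind: "ALL i:I. c i = 0" if z: "(SUM i:I. mero_const (c i) * h i) = 0" for c proof -
  define p where "p k = (SUM i:J k. monom (c (k, i)) i)" for k
  have "(SUM i:I. mero_const (c i) * h i) = (SUM k:{0, 1, 2}. SUM i:J k. mero_const (c (k, i)) * h (k, i))"
   unfolding I_def using finJ by (subst sum.Sigma) (auto intro!: sum.cong)
  also have "... = (SUM k:{0, 1, 2}. e (p k) * bs k)"
   by (intro sum.cong refl) (simp add: p_def h_def cpoly_sum cpoly_monom sum_distrib_right mult.assoc)
  also have "... = rep (p 0) (p 1) (p 2)" by (simp add: rep_def bs_def add.assoc)
  finally have "rep (p 0) (p 1) (p 2) = 0" using z by simp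
  from rep_eq_0[OF this] have p0: "p k = 0" if "k : {0, 1, 2}" for k using that by auto
  have "c (k, i) = 0" if "k : {0, 1, 2}" "i : J k" for k i proof -
   have "coeff (p k) i = c (k, i)" using that(2) finJ[of k] by (simp add: p_def coeff_sum)
   thus ?thesis using p0[OF that(1)] by simp
  qed
  thus ?thesis by (auto simp: I_def)
 qed
 have "card I = (SUM k:{0, 1, 2}. card (J k))" unfolding I_def using finJ by (subst card_SigmaI) auto
 also have "... = M + 1 + 2 * (M - 2)" by (simp add: J_def)
 finally have "int 3 * int M + 1 - int 4 <= int (card I)" by simp
 hence "int 3 * int M + 1 - int 4 <= int (card (h ` I))" using card_image[OF independent_family(1)[OF finI ind]] by simp
 moreover have "h (k, i) : K & (ALL R:places K. (x : R --> h (k, i) : R) & (x ~: R --> h (k, i) / x ^ M : R))"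
  if ki: "(k, i) : I" for k i proof (intro conjI ballI impI)
  show hK: "h (k, i) : K" using bs xyw_K by (simp add: h_def C_subfield_closed(6,11)[OF K_field])
  fix R assume R: "R : places K"
  interpret R: curve_place K x 3 R by (rule curve_place[OF R])
  {
   assume xR: "x : R"
   have "bs k : R" by (rule R.root_closed[of _ 3]) (use bs R.cpoly_mem[OF xR] in auto)
   thus "h (k, i) : R" using R.power[OF xR] by (simp add: h_def R.ring(3))
  next
   assume xR: "x ~: R"
   show "h (k, i) / x ^ M : R" proof (rule R.root_closed[of _ 3])
    show "h (k, i) / x ^ M : K" using hK xyw_K by (intro C_subfield_closed(10,11)[OF K_field])
    have dg: "3 * i + degree (pl k) <= 3 * M" using ki degrees by (auto simp: I_def J_def pl_def split: if_splits)
    have iR: "inverse x : R" using R.inverse_m[OF xyw_K(1) xR] R.m_iff by blast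
    have "(h (k, i) / x ^ M) ^ 3 = x ^ (3 * i) * e (pl k) / x ^ (3 * M)"
     by (simp add: h_def power_divide power_mult_distrib bs power_mult[symmetric] mult.commute)
    also have "... = e (pl k) / x ^ degree (pl k) * inverse x ^ (3 * M - 3 * i - degree (pl k))" proof -
     have "3 * M = 3 * i + degree (pl k) + (3 * M - 3 * i - degree (pl k))" using dg by simp
     hence "x ^ (3 * M) = x ^ (3 * i) * x ^ degree (pl k) * x ^ (3 * M - 3 * i - degree (pl k))" by (metis power_add)
     thus ?thesis using x_nz by (simp add: field_simps power_inverse)
    qed
    also have "... : R" by (intro R.ring(3) R.cpoly_at_infinity(1) xR bs R.power iR)
    finally show "(h (k, i) / x ^ M) ^ 3 : R" .
   qed simp
  }
 qed
 hence "ALL a:h ` I. a : K & (ALL R:places K. (x : R --> a : R) & (x ~: R --> a / x ^ M : R))" by force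
 ultimately show ?thesis using finI independent_family(2)[OF finI ind] by (intro exI[of _ "h ` I"]) auto
qed

text \<open>The divisor 6 P has degree 2 g - 2 for g = 4, and dimension at most 3 is what makes the
  bound sharp there.\<close>

theorem genus_four: "has_genus K 4"
proof -
 have bound: "div_degree D - int (RR_dim K D) + 1 <= int 4" if "D : divisors K" for D by (rule genus_bound[OF lower_bound that])
 have ixK: "inverse x : K" using xyw_K by (intro C_subfield_closed[OF K_field])
 have "inverse x ~: range mero_const" proof
  assume "inverse x : range mero_const"
  then obtain c where "inverse x = mero_const c" by blast
  hence "x = mero_const (inverse c)" by (metis inverse_inverse_eq mero_const_inverse)
  thus False using trans by blast
 qed
 then obtain P where P: "P : places K" "inverse x : max_ideal P" using place_over[OF K_field ixK] by blast
 interpret P: curve_place K x 3 P by (rule curve_place[OF P(1)])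
 have xP: "x ~: P" using P(2) x_nz P.m_iff by simp
 define D where "D = (%R. if R = P then 6 else 0 :: int)"
 have supp: "{R. D R ~= 0} = {P}" by (auto simp: D_def)
 have D: "D : divisors K" using P(1) by (simp add: divisors_def supp)
 have deg: "div_degree D = 6" unfolding div_degree_def supp by (simp add: D_def)
 obtain B where B: "fbasis B (RR_space K D)" "card B = RR_dim K D" using RR_basis[OF D] by blast
 have "B <= mero.span {1, x, x ^ 2}" using mero.span_superset[of B] B(1) RR_six_span[OF P(1) xP] by (auto simp: fbasis_def D_def)
 hence "card B <= card {1, x, x ^ 2}" using mero.independent_span_bound[of "{1, x, x ^ 2}" B] B(1) by (simp add: fbasis_def)
 also have "... <= 3" by (simp add: card_insert_if)
 finally have "div_degree D - int (RR_dim K D) + 1 >= 4" using B(2) deg by simp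
 hence "div_degree D - int (RR_dim K D) + 1 = int 4" using bound[OF D] by simp
 thus ?thesis using D bound unfolding has_genus_def by blast
qed

end

section \<open>The genus of the modular curve\<close>

lemma upsilon_not_const: "upsilon ~= mero_const c" using hauptmodul_upsilon hauptmodul.not_const[of "Gamma1 7" 7 upsilon _ c] by auto

text \<open>\<open>P1\<close> and \<open>P2\<close> are the resolvents of the three pairwise
  products of the roots. As the roots have sum -1, these products have elementary symmetric
  functions s, -t, t^2, which explains s^2 + 3 t and 2 s^3 + 9 s t + 27 t^2.\<close>

lemma resolvent_identity:
 fixes U P1 P2 G1 G2 z :: mero
 assumes z: "z * z = - 1 - z"
  and e3: "U * (G1 * G2 * (1 + G1 + G2)) = (U - 1) ^ 2"
  and e2: "U * (G1 * G2 - (G1 + G2) - (G1 + G2) ^ 2) = - (U ^ 2 - 1)"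
  and P1: "P1 = G1 * G2 + z * (G2 * (- 1 - G1 - G2)) + (- 1 - z) * ((- 1 - G1 - G2) * G1)"
  and P2: "P2 = G1 * G2 + (- 1 - z) * (G2 * (- 1 - G1 - G2)) + z * ((- 1 - G1 - G2) * G1)"
 shows "(U * P1) * (U * P2) = (U - 1) ^ 2 * (U ^ 2 - U + 1)"
  "(U * P1) ^ 3 + (U * P2) ^ 3 = (U - 1) ^ 3 * (- 2 * U ^ 3 + 30 * U ^ 2 - 24 * U - 2)"
proof -
 define s where "s = G1 * G2 - (G1 + G2) - (G1 + G2) ^ 2"
 define t where "t = - (G1 * G2 * (1 + G1 + G2))"
 have s: "U * s = - (U ^ 2 - 1)" and t: "U * t = - ((U - 1) ^ 2)" using e2 e3 by (simp_all add: s_def t_def)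
 have "P1 * P2 = s ^ 2 + 3 * t" unfolding P1 P2 s_def t_def using z by algebra
 moreover have "P1 ^ 3 + P2 ^ 3 = 2 * s ^ 3 + 9 * s * t + 27 * t ^ 2" proof -
  have "P1 + P2 = 3 * (G1 * G2) - s" unfolding P1 P2 s_def by algebra
  hence "P1 ^ 3 + P2 ^ 3 = (3 * (G1 * G2) - s) ^ 3 - 3 * (s ^ 2 + 3 * t) * (3 * (G1 * G2) - s)"
   using \<open>P1 * P2 = s ^ 2 + 3 * t\<close> by algebra
  also have "... = 2 * s ^ 3 + 9 * s * t + 27 * t ^ 2" unfolding s_def t_def by algebra
  finally show ?thesis .
 qed
 ultimately show "(U * P1) * (U * P2) = (U - 1) ^ 2 * (U ^ 2 - U + 1)"
  "(U * P1) ^ 3 + (U * P2) ^ 3 = (U - 1) ^ 3 * (- 2 * U ^ 3 + 30 * U ^ 2 - 24 * U - 2)" using s t by algebra+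
qed

lemma const_or_cube:
 assumes "v ^ 3 = mero_const k" shows "v : range mero_const"
proof (rule ccontr)
 assume "v ~: range mero_const"
 moreover have "cpoly [:- k, 0, 0, 1:] v = 0"
  using assms by (simp add: mero_const_0 mero_const_1 mero_const_minus power3_eq_cube mult.assoc)
 ultimately have "[:- k, 0, 0, 1:] = 0" by (rule cpoly_eq_0)
 thus False by simp
qed

text \<open>Up to the constant, f is (1 + c x)^3 - k0 x^3, and g is (1 + c x)^3 - c^3 x^3 divided
  through, its cubic term having cancelled. A multiple root, or a common one, would force 1 + c x
  and x to vanish together, or c^3 = k0, or c = 0; the condition k0 k3 = 28 excludes c^3 =
  k0.\<close>

lemma bicubic_squarefree:
 fixes c k0 k3 :: complex
 assumes "k3 * c ^ 3 = 1" "k0 * k3 = 28"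
 defines "f \<equiv> smult (k3 ^ 2) [:1, 3 * c, 3 * c ^ 2, c ^ 3 - k0:]" and "g \<equiv> [:1, 3 * c, 3 * c ^ 2:]"
 shows "degree f = 3" "degree g = 2" "rsquarefree (f * g)"
proof -
 have nz: "c ~= 0" "k3 ~= 0" "k0 ~= 0" using assms by auto
 have ck: "c ^ 3 ~= k0" proof
  assume "c ^ 3 = k0"
  hence "k0 * k3 = 1" using assms(1) by (simp add: mult.commute)
  thus False using assms(2) by simp
 qed
 show "degree f = 3" "degree g = 2" using nz ck by (simp_all add: f_def g_def)
 show "rsquarefree (f * g)" unfolding rsquarefree_roots proof (intro allI notI, elim conjE)
  fix a assume r: "poly (f * g) a = 0" "poly (pderiv (f * g)) a = 0"
  define F where "F = 1 + 3 * c * a + 3 * c ^ 2 * a ^ 2 + (c ^ 3 - k0) * a ^ 3"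
  define G where "G = 1 + 3 * c * a + 3 * c ^ 2 * a ^ 2"
  define F' where "F' = 3 * c + 6 * c ^ 2 * a + 3 * (c ^ 3 - k0) * a ^ 2"
  define G' where "G' = 3 * c + 6 * c ^ 2 * a"
  have pf: "poly f a = k3 ^ 2 * F" "poly g a = G" "poly (pderiv f) a = k3 ^ 2 * F'" "poly (pderiv g) a = G'"
   by (simp_all add: f_def g_def F_def G_def F'_def G'_def pderiv_pCons pderiv_smult algebra_simps power2_eq_square power3_eq_cube)
  have FG: "F * G = 0" using r(1) nz pf by simp
  have "k3 ^ 2 * (F * G' + G * F') = 0" using r(2) by (simp add: pderiv_mult pf algebra_simps)
  hence FG': "F * G' + G * F' = 0" using nz by simp
  have "F = 0 ==> G = 0 ==> False" proof -
   assume "F = 0" "G = 0"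
   hence "(c ^ 3 - k0) * a ^ 3 = 0" by (simp add: F_def G_def)
   hence "a = 0" using ck by simp
   thus False using \<open>G = 0\<close> by (simp add: G_def)
  qed
  moreover have "F = 0 ==> F' = 0 ==> False" proof -
   assume h: "F = 0" "F' = 0"
   have "a * F' - 3 * F = - 3 * (c * a + 1) ^ 2" unfolding F_def F'_def by algebra
   hence s: "c * a + 1 = 0" using h by simp
   have "F = (c * a + 1) ^ 3 - k0 * a ^ 3" unfolding F_def by algebra
   hence "a = 0" using h(1) s nz by simp
   thus False using s by simp
  qed
  moreover have "G = 0 ==> G' = 0 ==> False" proof -
   assume h: "G = 0" "G' = 0"
   have "4 * (c * G) = (1 + 2 * (c * a)) * G' + c" unfolding G_def G'_def by algebra
   thus False using h nz by simp
  qed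
  ultimately show False using FG FG' by auto
 qed
qed

theorem genus_function_field: "has_genus (C_adjoin {upsilon, g1, g2}) 4"
proof -
 define F where "F = C_adjoin {upsilon, g1, g2}"
 have F_field: "C_subfield F" unfolding F_def by (rule C_subfield_hull)
 have gen: "upsilon : F" "g1 : F" "g2 : F" using C_adjoin_subset[of "{upsilon, g1, g2}"] by (auto simp: F_def)
 define z where "z = mero_const omega"
 have z: "z * z = - 1 - z" using arg_cong[OF omega_mult, of mero_const]
  by (simp add: z_def mero_const_mult mero_const_diff mero_const_minus mero_const_1)
 define g3 where "g3 = - 1 - g1 - g2"
 define P1 where "P1 = g1 * g2 + z * (g2 * g3) + (- 1 - z) * (g3 * g1)"
 define P2 where "P2 = g1 * g2 + (- 1 - z) * (g2 * g3) + z * (g3 * g1)"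
 note res = resolvent_identity[OF z g_sym(2,3) P1_def[unfolded g3_def] P2_def[unfolded g3_def]]
 define a where "a = upsilon * P1 / (upsilon - 1)"
 define b where "b = upsilon * P2 / (upsilon - 1)"
 \<comment> \<open>\<open>A\<close> and \<open>B\<close> are the linear factors of upsilon^2 -
   upsilon + 1, the factor left in the product of the resolvents after division by (upsilon -
   1)^2.\<close>
 define A where "A = upsilon + z"
 define B where "B = upsilon - 1 - z"
 have nc: "upsilon - mero_const c ~= 0" for c using upsilon_not_const by simp
 have u1: "upsilon - 1 ~= 0" using nc[of 1] by (simp add: mero_const_1)
 have A0: "A ~= 0" using nc[of "- omega"] by (simp add: A_def z_def mero_const_minus)
 have B0: "B ~= 0" using nc[of "1 + omega"] by (simp add: B_def z_def mero_const_add mero_const_1 algebra_simps)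
 have AB: "A * B = upsilon ^ 2 - upsilon + 1" unfolding A_def B_def using z by algebra
 have ab: "a * b = A * B" proof -
  have "a * b = (upsilon * P1) * (upsilon * P2) / (upsilon - 1) ^ 2" by (simp add: a_def b_def power2_eq_square)
  thus ?thesis unfolding res AB using u1 by simp
 qed
 have a0: "a ~= 0" "b ~= 0" using ab A0 B0 by auto
 have cub: "a ^ 3 + b ^ 3 = - 2 * upsilon ^ 3 + 30 * upsilon ^ 2 - 24 * upsilon - 2" proof -
  have "a ^ 3 + b ^ 3 = ((upsilon * P1) ^ 3 + (upsilon * P2) ^ 3) / (upsilon - 1) ^ 3"
   by (simp add: a_def b_def power_divide add_divide_distrib)
  thus ?thesis unfolding res using u1 by simp
 qed
 \<comment> \<open>The cubic in \<open>cub\<close> is a combination of the cubes of \<open>A\<close>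
   and \<open>B\<close>; \<open>k0\<close> and \<open>k3\<close> are the coefficients.\<close>
 define k0 where "k0 = - 4 - 6 * omega"
 define k3 where "k3 = 2 + 6 * omega"
 have kk: "k0 * k3 = 28" unfolding k0_def k3_def using omega_mult by algebra
 define K0 where "K0 = mero_const k0"
 define K3 where "K3 = mero_const k3"
 have K: "K0 = - 4 - 6 * z" "K3 = 2 + 6 * z"
  by (simp_all add: K0_def K3_def k0_def k3_def z_def mero_const_diff mero_const_add mero_const_mult mero_const_minus mero_const_numeral)
 have cub': "a ^ 3 + b ^ 3 = K3 * B ^ 3 + K0 * A ^ 3" unfolding cub K A_def B_def using z by algebra
 \<comment> \<open>As a b = A B, also u = B / b and v = A / b. In these coordinates the relation for
   a^3 + b^3 becomes bilinear in u^3 and v^3.\<close>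
 define u where "u = a / A"
 define v where "v = a / B"
 have uA: "u * A = a" "v * B = a" using A0 B0 by (simp_all add: u_def v_def)
 have rel: "v ^ 3 * (u ^ 3 - K0) = K3 * u ^ 3 - 1" proof -
  have "b * a = A * B" using ab by (simp add: mult.commute)
  have "a ^ 3 * (a ^ 3 + b ^ 3) = a ^ 3 * a ^ 3 + (A * B) ^ 3" unfolding ab[symmetric] by algebra
  hence t: "a ^ 3 * (K3 * B ^ 3 + K0 * A ^ 3) = a ^ 3 * a ^ 3 + (A * B) ^ 3" unfolding cub' .
  have "(A * B) ^ 3 * (v ^ 3 * (u ^ 3 - K0)) = (A * B) ^ 3 * (K3 * u ^ 3 - 1)" proof -
   have "(A * B) ^ 3 * (v ^ 3 * (u ^ 3 - K0)) = (v * B) ^ 3 * ((u * A) ^ 3 - K0 * A ^ 3)" by algebra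
   also have "... = a ^ 3 * a ^ 3 - a ^ 3 * (K0 * A ^ 3)" unfolding uA by algebra
   also have "... = K3 * B ^ 3 * a ^ 3 - (A * B) ^ 3" using t by algebra
   also have "... = K3 * B ^ 3 * (u * A) ^ 3 - (A * B) ^ 3" unfolding uA ..
   also have "... = (A * B) ^ 3 * (K3 * u ^ 3 - 1)" by algebra
   finally show ?thesis .
  qed
  thus ?thesis using A0 B0 by simp
 qed
 have uv: "u - v ~= 0" proof
  assume "u - v = 0"
  hence uv: "u = v" by simp
  have "u * (A - B) = 0" using uA unfolding uv[symmetric] by (simp add: right_diff_distrib)
  moreover have "u ~= 0" using uA a0 by auto
  ultimately have "A - B = 0" by simp
  hence h: "1 + 2 * z = 0" unfolding A_def B_def by algebra
  have "(1 + 2 * z) * (1 + 2 * z) = - 3" using z by algebra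
  hence "(3 :: mero) = 0" unfolding h by simp
  thus False using mero_const_eq_0_iff[of 3] by (simp add: mero_const_numeral)
 qed
 \<comment> \<open>The equations u A = a = v B are linear in \<open>upsilon\<close>.\<close>
 have ups: "upsilon = - (v * (1 + z) + u * z) / (u - v)" proof -
  have "upsilon * (u - v) + (v * (1 + z) + u * z) = u * A - v * B" unfolding A_def B_def by (simp add: algebra_simps)
  hence "upsilon * (u - v) + (v * (1 + z) + u * z) = 0" unfolding uA by simp
  hence "upsilon * (u - v) = - (v * (1 + z) + u * z)" by (rule eq_neg_iff_add_eq_0[THEN iffD2])
  thus ?thesis using uv by (simp add: eq_divide_eq)
 qed
 have k3z: "k3 ~= 0" using kk by auto
 have not_root: "k3 * c ^ 3 ~= 1" if "c ^ 3 = k0" for c using that kk by (simp add: mult.commute)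
 \<comment> \<open>A constant u would make v^3 constant, hence v, and then \<open>upsilon\<close> as
   well.\<close>
 have u_nc: "u ~= mero_const k" for k proof
  assume k: "u = mero_const k"
  have e: "v ^ 3 * mero_const (k ^ 3 - k0) = mero_const (k3 * k ^ 3 - 1)"
   using rel unfolding k K0_def K3_def by (simp add: mero_const_diff mero_const_mult mero_const_power mero_const_1)
  have "k ^ 3 - k0 ~= 0" proof
   assume h: "k ^ 3 - k0 = 0"
   have "mero_const (k3 * k ^ 3 - 1) = v ^ 3 * mero_const (k ^ 3 - k0)" using e by (rule sym)
   also have "... = 0" unfolding h by (simp add: mero_const_0)
   finally have "k3 * k ^ 3 - 1 = 0" by (simp only: mero_const_eq_0_iff)
   thus False using not_root[of k] h by simp
  qed
  hence "v ^ 3 = mero_const ((k3 * k ^ 3 - 1) / (k ^ 3 - k0))" using e by (simp add: mero_const_divide eq_divide_eq mero_const_eq_0_iff)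
  then obtain l where l: "v = mero_const l" using const_or_cube by blast
  have "upsilon = mero_const (- (l * (1 + omega) + k * omega) / (k - l))"
   by (subst ups) (simp add: k l z_def mero_const_divide mero_const_minus mero_const_add mero_const_mult mero_const_diff mero_const_1)
  thus False using upsilon_not_const by blast
 qed
 obtain c where c: "k3 * c ^ 3 = 1" proof -
  have "EX c. poly [:- 1, 0, 0, k3:] c = 0" using k3z by (intro fundamental_theorem_of_algebra) (simp add: constant_degree)
  then obtain c where "poly [:- 1, 0, 0, k3:] c = 0" by blast
  moreover have "poly [:- 1, 0, 0, k3:] c = k3 * c ^ 3 - 1" by (simp add: power3_eq_cube)
  ultimately show ?thesis using that[of c] by simp
 qed
 \<comment> \<open>At u = c the numerator K3 u^3 - 1 of v^3 has a simple zero, so this point of the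
   u-line is totally ramified; x moves it to infinity.\<close>
 define x where "x = inverse (u - mero_const c)"
 have uc: "u - mero_const c ~= 0" using u_nc by simp
 have x0: "x ~= 0" using uc by (simp add: x_def)
 have ux: "u = mero_const c + inverse x" by (simp add: x_def)
 have x_nc: "x ~: range mero_const" proof
  assume "x : range mero_const"
  then obtain k where "x = mero_const k" by blast
  hence "u = mero_const (c + inverse k)" using ux by (simp add: mero_const_add mero_const_inverse)
  thus False using u_nc by blast
 qed
 define f0 where "f0 = [:1, 3 * c, 3 * c ^ 2, c ^ 3 - k0:]"
 define g where "g = [:1, 3 * c, 3 * c ^ 2:]"
 define C where "C = mero_const c"
 have KC: "K3 * C ^ 3 = 1" using arg_cong[OF c, of mero_const] by (simp add: K3_def C_def mero_const_mult mero_const_power mero_const_1)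
 have xu: "x * u = C * x + 1" using x0 by (simp add: ux C_def field_simps)
 have ef0: "cpoly f0 x = (C * x + 1) ^ 3 - K0 * x ^ 3"
  by (simp only: f0_def cpoly_pCons cpoly_0 C_def K0_def mero_const_diff mero_const_mult mero_const_power mero_const_1 mero_const_numeral)
   algebra
 have eg: "cpoly g x = (C * x + 1) ^ 3 - C ^ 3 * x ^ 3"
  by (simp only: g_def cpoly_pCons cpoly_0 C_def mero_const_mult mero_const_power mero_const_1 mero_const_numeral)
   algebra
 have key: "v ^ 3 * cpoly f0 x = K3 * cpoly g x" proof -
  have "v ^ 3 * cpoly f0 x = x ^ 3 * (v ^ 3 * (u ^ 3 - K0))" unfolding ef0 xu[symmetric] by algebra
  also have "... = K3 * (x * u) ^ 3 - x ^ 3" unfolding rel by algebra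
  also have "... = K3 * (x * u) ^ 3 - (K3 * C ^ 3) * x ^ 3" unfolding KC by simp
  also have "... = K3 * cpoly g x" unfolding eg xu by algebra
  finally show ?thesis .
 qed
 \<comment> \<open>The relation now reads v^3 = K3 g / f0. These multiples of v^2 and v have
   polynomial cubes f g^2 and f^2 g.\<close>
 define y where "y = cpoly f0 x * v ^ 2"
 define w where "w = K3 * cpoly f0 x * v"
 define f where "f = smult (k3 ^ 2) f0"
 have ef: "cpoly f x = K3 ^ 2 * cpoly f0 x" by (simp add: f_def cpoly_smult K3_def mero_const_power)
 note sq = bicubic_squarefree[OF c kk, folded f0_def g_def, folded f_def]
 interpret superelliptic x y w f g proof
  have "y ^ 2 = cpoly f0 x * v * (v ^ 3 * cpoly f0 x)" unfolding y_def by algebra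
  also have "... = cpoly g x * w" unfolding key w_def by algebra
  finally show "y ^ 2 = cpoly g x * w" .
  show "w ^ 2 = cpoly f x * y" unfolding ef y_def w_def by algebra
  have "y * w = K3 * cpoly f0 x * (v ^ 3 * cpoly f0 x)" unfolding y_def w_def by algebra
  also have "... = cpoly (f * g) x" unfolding key cpoly_mult ef by algebra
  finally show "y * w = cpoly (f * g) x" .
 qed (fact x_nc sq)+
 have "f0 ~= 0" by (simp add: f0_def)
 hence f0n: "cpoly f0 x ~= 0" using e_eq_0_iff by blast
 have K3n: "K3 ~= 0" using k3z by (simp add: K3_def mero_const_eq_0_iff)
 have zF: "z : F" "K3 : F" using C_subfield_closed(1)[OF F_field] by (auto simp: z_def K3_def)
 note cl = C_subfield_closed[OF F_field]
 have "K <= F" unfolding K_def proof (rule C_adjoin_minimal[OF _ F_field])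
  have aF: "a : F" unfolding a_def P1_def g3_def by (intro cl gen zF)
  have uF: "u : F" unfolding u_def A_def by (intro cl gen zF aF)
  have vF: "v : F" unfolding v_def B_def by (intro cl gen zF aF)
  have xF: "x : F" unfolding x_def by (intro cl uF)
  have pF: "cpoly p x : F" for p by (induction p) (auto intro!: cl xF)
  have "y : F" unfolding y_def by (intro cl pF vF)
  moreover have "w : F" unfolding w_def by (intro cl pF vF zF)
  ultimately show "{x, y, w} <= F" using xF by simp
 qed
 \<comment> \<open>Conversely u and v give \<open>upsilon\<close> and the resolvents; with the sum s
   they determine the pairwise products of the roots, and dividing the product t of all three by
   these gives back the roots.\<close>
 moreover have "F <= K" unfolding F_def proof (rule C_adjoin_minimal[OF _ K_field])
  note cl = C_subfield_closed[OF K_field]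
  have zK: "z : K" "K3 : K" "mero_const k : K" for k using cl(1) by (auto simp: z_def K3_def)
  have uK: "u : K" unfolding ux by (intro cl xyw_K)
  have "v = w / (K3 * cpoly f0 x)" using f0n K3n by (simp add: w_def)
  also have "... : K" by (intro cl xyw_K zK e_K)
  finally have vK: "v : K" .
  have upK: "upsilon : K" by (subst ups) (intro cl uK vK zK)
  have aK: "a : K" unfolding uA(1)[symmetric] A_def by (intro cl uK upK zK)
  have "b = (upsilon ^ 2 - upsilon + 1) / a" using ab a0 unfolding AB by (simp add: eq_divide_eq mult.commute)
  also have "... : K" by (intro cl upK aK)
  finally have bK: "b : K" .
  have "P1 = a * (upsilon - 1) / upsilon" "P2 = b * (upsilon - 1) / upsilon" using u1 nonzero_gens(1) by (simp_all add: a_def b_def)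
  moreover have "a * (upsilon - 1) / upsilon : K" "b * (upsilon - 1) / upsilon : K" by (intro cl aK bK upK)+
  ultimately have PK: "P1 : K" "P2 : K" by simp_all
  define s where "s = - (upsilon ^ 2 - 1) / upsilon"
  define t where "t = - ((upsilon - 1) ^ 2) / upsilon"
  have st: "s : K" "t : K" unfolding s_def t_def by (intro cl upK)+
  have s: "s = g1 * g2 + g2 * g3 + g3 * g1" proof -
   have "g1 * g2 + g2 * g3 + g3 * g1 = g1 * g2 - (g1 + g2) - (g1 + g2) ^ 2" unfolding g3_def by algebra
   hence "upsilon * (g1 * g2 + g2 * g3 + g3 * g1) = - (upsilon ^ 2 - 1)" using g_sym(3) by (simp only:)
   thus ?thesis unfolding s_def using nonzero_gens(1) by (metis nonzero_mult_div_cancel_left)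
  qed
  have t: "t = g1 * g2 * g3" proof -
   have "upsilon * (g1 * g2 * g3) = - (upsilon * (g1 * g2 * (1 + g1 + g2)))" unfolding g3_def by algebra
   hence "upsilon * (g1 * g2 * g3) = - ((upsilon - 1) ^ 2)" unfolding g_sym(2) .
   thus ?thesis unfolding t_def using nonzero_gens(1) by (metis nonzero_mult_div_cancel_left)
  qed
  have "upsilon * t ~= 0" using u1 nonzero_gens(1) by (simp add: t_def)
  hence gn: "g1 ~= 0" "g2 ~= 0" "g3 ~= 0" unfolding t by auto
  have three: "(3 :: mero) ~= 0" using mero_const_eq_0_iff[of 3] by (simp add: mero_const_numeral)
  have "3 * (g2 * g3) = s + (- 1 - z) * P1 + z * P2" unfolding s P1_def P2_def using z by algebra
  hence q: "g2 * g3 = (s + (- 1 - z) * P1 + z * P2) / 3" using three by (simp add: eq_divide_eq mult.commute)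
  have "3 * (g3 * g1) = s + z * P1 + (- 1 - z) * P2" unfolding s P1_def P2_def using z by algebra
  hence r: "g3 * g1 = (s + z * P1 + (- 1 - z) * P2) / 3" using three by (simp add: eq_divide_eq mult.commute)
  have "t / (g2 * g3) : K" "t / (g3 * g1) : K" unfolding q r by (intro cl st PK zK)+
  moreover have "t / (g2 * g3) = g1" "t / (g3 * g1) = g2" using gn by (simp_all add: t)
  ultimately show "{upsilon, g1, g2} <= K" using upK by simp
 qed
 ultimately have "F = K" by blast
 thus ?thesis using genus_four unfolding F_def by simp
qed

section \<open>The plane model\<close>

lemma eval2_pCons [simp]: "eval2 (pCons a p) s t = cpoly a s + t * eval2 p s t" by (simp add: eval2_def map_poly_pCons flip: cpoly_def)

lemma eval2_0 [simp]: "eval2 0 s t = 0" by (simp add: eval2_def)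

lemma eval2_add: "eval2 (p + q) s t = eval2 p s t + eval2 q s t"
proof -
 have "map_poly (%r. cpoly r s) (p + q) = map_poly (%r. cpoly r s) p + map_poly (%r. cpoly r s) q"
  by (rule poly_eqI) (simp add: coeff_map_poly cpoly_add)
 thus ?thesis by (simp add: eval2_def flip: cpoly_def)
qed

lemma eval2_smult: "eval2 (smult a p) s t = cpoly a s * eval2 p s t" by (induction p) (simp_all add: cpoly_mult algebra_simps)

lemma eval2_mult: "eval2 (p * q) s t = eval2 p s t * eval2 q s t" by (induction p) (simp_all add: eval2_add eval2_smult algebra_simps)

lemma eval2_minus: "eval2 (- p) s t = - eval2 p s t" by (induction p) (simp_all add: cpoly_minus)

lemma eval2_diff: "eval2 (p - q) s t = eval2 p s t - eval2 q s t" using eval2_add[of p "- q" s t] by (simp add: eval2_minus)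

lemma eval2_base: "eval2 Z1 s t = s" "eval2 Z2 s t = t" "eval2 1 s t = 1" "eval2 (numeral k) s t = numeral k"
 by (simp_all add: Z1_def Z2_def one_pCons numeral_poly mero_const_0 mero_const_1 mero_const_numeral)

abbreviation model :: "complex poly poly" where
 "model \<equiv> (Z1 + Z2) * (Z1 + Z2 + 2) * Z1\<^sup>2 * Z2\<^sup>2
    + 2 * (Z1 + Z2 + 1) * (Z1 + Z2 + 2) * Z1 * Z2
    - (Z1 + Z2)\<^sup>2 * (Z1 + Z2 + 1)\<^sup>2"

lemma eval2_model: "eval2 model g1 g2 = 0" using plane_equation by (simp add: eval2_add eval2_diff eval2_mult eval2_base power2_eq_square)

text \<open>The polynomial by powers of \<open>Z2\<close>, with coefficients in \<open>Z1\<close>,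
  so that degrees and specialisations can be computed.\<close>

lemma model_expand:
 "model = [:[:0, 0, -1, -2, -1:], [:0, 2, 0, -2:], [:-1, 0, -2, 2, 1:], [:-2, -2, 2, 2:], [:-1, 0, 1:]:]"
 by (simp add: Z1_def Z2_def power2_eq_square numeral_poly one_pCons)

definition spec :: "complex => complex poly poly => complex poly" where
 "spec c p = map_poly (%r. poly r c) p"

lemma coeff_spec: "coeff (spec c p) k = poly (coeff p k) c" by (simp add: spec_def coeff_map_poly)

lemma spec_mult: "spec c (p * q) = spec c p * spec c q" by (rule poly_eqI) (simp add: coeff_spec coeff_mult poly_sum)

text \<open>
  At \<open>Z1 = 1\<close> the polynomial becomes the constant \<open>-4\<close> while its leading coefficient \<open>Z1\<^sup>2 - 1\<close> has a
  simple zero there: Eisenstein's criterion for the reciprocal polynomial.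
\<close>
lemma model_irreducible: "irreducible model"
proof (rule irreducibleI)
 define p where "p = model"
 have p_eq: "p = [:[:0, 0, -1, -2, -1:], [:0, 2, 0, -2:], [:-1, 0, -2, 2, 1:], [:-2, -2, 2, 2:], [:-1, 0, 1:]:]"
  unfolding p_def by (rule model_expand)
 have cf: "coeff p 0 = [:0, 0, -1, -2, -1:]" "coeff p 2 = [:-1, 0, -2, 2, 1:]" "coeff p 4 = [:-1, 0, 1:]"
  by (simp_all add: p_eq numeral_eq_Suc)
 have deg: "degree p = 4" by (simp add: p_eq)
 have p0: "p ~= 0" using deg by auto
 thus "model ~= 0" unfolding p_def .
 show "~ model dvd 1" proof
  assume "model dvd 1"
  then obtain q where q: "1 = p * q" unfolding p_def[symmetric] by (rule dvdE)
  hence "q ~= 0" by auto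
  hence "degree (p * q) = 4 + degree q" using p0 deg by (simp add: degree_mult_eq)
  thus False unfolding q[symmetric] by simp
 qed
 \<comment> \<open>A factor of degree 0 in \<open>Z2\<close> divides all coefficients. A root of it
   would be 1 or -1 by the leading coefficient, but the constant coefficient does not vanish at 1,
   nor that of \<open>Z2\<close> squared at -1.\<close>
 have unit: "a dvd 1" if ab: "p = a * b" and da: "degree a = 0" for a b proof -
  obtain r where r: "a = [:r:]" using da by (metis degree_eq_zeroE)
  have cr: "coeff p k = r * coeff b k" for k by (simp add: ab r)
  have "degree r = 0" proof (rule ccontr)
   assume "degree r ~= 0"
   then obtain c where c: "poly r c = 0" using fundamental_theorem_of_algebra[of r] by (auto simp: constant_degree)
   have z: "poly (coeff p k) c = 0" for k using c by (simp add: cr)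
   have "c * c = 1" using z[of 4] by (simp add: cf)
   hence "c = 1 | c = - 1" using square_eq_1_iff[of c] by (simp add: power2_eq_square)
   thus False using z[of 0] z[of 2] by (auto simp: cf)
  qed
  then obtain k where k: "r = [:k:]" by (metis degree_eq_zeroE)
  have "k ~= 0" using p0 ab r k by auto
  hence "a * [:[:1 / k:]:] = 1" by (simp add: r k one_pCons)
  thus ?thesis by (metis dvdI)
 qed
 fix a b assume "model = a * b"
 hence ab: "p = a * b" by (simp only: p_def)
 hence ab0: "a ~= 0" "b ~= 0" using p0 by auto
 show "a dvd 1 | b dvd 1" proof (cases "degree a = 0 | degree b = 0")
  case True
  thus ?thesis using unit[OF ab] unit[of b a] ab by (auto simp: mult.commute)
 next
  case False
  have "spec 1 a * spec 1 b = [:-4:]" unfolding spec_mult[symmetric] ab[symmetric] by (simp add: p_eq spec_def map_poly_pCons)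
  moreover from this have "spec 1 a ~= 0" "spec 1 b ~= 0" by auto
  ultimately have "degree (spec 1 a) + degree (spec 1 b) = 0" by (metis degree_mult_eq degree_pCons_0)
  hence "coeff (spec 1 a) (degree a) = 0" "coeff (spec 1 b) (degree b) = 0" using False by (auto intro!: coeff_eq_0)
  hence l: "poly (lead_coeff a) 1 = 0" "poly (lead_coeff b) 1 = 0" by (simp_all add: coeff_spec)
  \<comment> \<open>Both leading coefficients vanish at 1, so their product would have a double zero
    there, but its derivative at 1 is 2.\<close>
  have "lead_coeff a * lead_coeff b = [:-1, 0, 1:]" using lead_coeff_mult[of a b] cf(3) deg unfolding ab[symmetric] by simp
  hence "poly (pderiv (lead_coeff a * lead_coeff b)) 1 = 2" by (simp add: pderiv_pCons)
  thus ?thesis using l by (simp add: pderiv_mult)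
 qed
qed

theorem proposition6p5:
  shows "A0 (Gamma_principal 2 \<inter> Gamma1 7) = C_adjoin {upsilon, g1, g2} \<and>
    C_adjoin {upsilon, g1, g2} = C_adjoin {g1, g2} \<and>
    plane_model (A0 (Gamma_principal 2 \<inter> Gamma1 7)) g1 g2
      ((Z1 + Z2) * (Z1 + Z2 + 2) * Z1\<^sup>2 * Z2\<^sup>2
        + 2 * (Z1 + Z2 + 1) * (Z1 + Z2 + 2) * Z1 * Z2
        - (Z1 + Z2)\<^sup>2 * (Z1 + Z2 + 1)\<^sup>2) \<and>
    has_genus (A0 (Gamma_principal 2 \<inter> Gamma1 7)) 4"
proof (intro conjI)
  show "A0 G14 = C_adjoin {upsilon, g1, g2}" "C_adjoin {upsilon, g1, g2} = C_adjoin {g1, g2}"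
    by (rule function_field)+
  show "plane_model (A0 G14) g1 g2 model"
    unfolding plane_model_def
    by (intro conjI model_irreducible eval2_model) (simp only: function_field)
  show "has_genus (A0 G14) 4"
    unfolding function_field(1) by (rule genus_function_field)
qed

end
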